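(* Let $\Omega$ be a bounded convex Reinhardt domain in $\mathbb{C}^2$ and $\phi\in C(\overline{\Omega})$. Then the following are equivalent: (i) $T_{\phi}$ is compact. (ii) $T^*_{\phi}T_{\phi}$ is compact. (iii) $\widetilde{T^*_{\phi}T_{\phi}}(z)=\|T_{\phi}k_z\|^2\to 0$ as $z\to b\Omega$. (iv) $\widetilde{T_{\phi}}(z)\to 0$ as $z\to b\Omega$. (v) $\phi=0$ on $b\Omega$.
   Context: $b\Omega$ denotes the boundary of $\Omega$. A domain $\Omega\subseteq\mathbb{C}^n$ is Reinhardt if $(\xi_1z_1,\ldots,\xi_nz_n)\in\Omega$ whenever $z\in\Omega$ and $|\xi_1|=\cdots=|\xi_n|=1$. $A^2(\Omega)$ is the Bergman space of holomorphic functions on $\Omega$ that are square integrable with respect to Lebesgue measure $dV$; $P:L^2(\Omega)\to A^2(\Omega)$ is the orthogonal (Bergman) projection; $K$ is the Bergman kernel of $\Omega$. For bounded $\phi$, the Toeplitz operator is $T_\phi:A^2(\Omega)\to A^2(\Omega)$, $T_\phi f=P(\phi f)$. The normalized Bergman kernel is $k_z(w)=K(w,z)/\sqrt{K(z,z)}$ for $z,w\in\Omega$. The Berezin transform of a bounded linear operator $T$ on $A^2(\Omega)$ is $\widetilde{T}(z)=\langle Tk_z,k_z\rangle$, $z\in\Omega$. $\|\cdot\|$ is the $L^2(\Omega)$-norm. "$z\to b\Omega$" means that the distance from $z\in\Omega$ to $b\Omega$ tends to $0$. *)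

theory Defs
  imports "HOL-Analysis.Analysis"
begin

definition reinhardt_domain :: "(complex ^ 'n) set \<Rightarrow> bool" where
  "reinhardt_domain \<Omega> \<longleftrightarrow> open \<Omega> \<and> connected \<Omega> \<and> \<Omega> \<noteq> {} \<and>
     (\<forall>z\<in>\<Omega>. \<forall>\<xi>. (\<forall>j. norm (\<xi> $ j) = 1) \<longrightarrow> (\<chi> j. \<xi> $ j * z $ j) \<in> \<Omega>)"

text \<open>Holomorphy in several variables: real Frechet differentiability with complex-linear
  derivative.\<close>

definition holo_on :: "(complex ^ 'n \<Rightarrow> complex) \<Rightarrow> (complex ^ 'n) set \<Rightarrow> bool" where
  "holo_on f \<Omega> \<longleftrightarrow>
     (\<forall>z\<in>\<Omega>. \<exists>D. (f has_derivative D) (at z) \<and> (\<forall>c v. D (c *s v) = c * D v))"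

text \<open>Elements of the Lebesgue space are functions rather than equivalence classes; values
  off \<open>\<Omega>\<close> are irrelevant.\<close>

definition L2 :: "(complex ^ 'n) set \<Rightarrow> (complex ^ 'n \<Rightarrow> complex) set" where
  "L2 \<Omega> = {f. set_borel_measurable lebesgue \<Omega> f \<and>
              set_integrable lebesgue \<Omega> (\<lambda>z. (norm (f z))\<^sup>2)}"

definition L2_inner ::
    "(complex ^ 'n) set \<Rightarrow> (complex ^ 'n \<Rightarrow> complex) \<Rightarrow> (complex ^ 'n \<Rightarrow> complex) \<Rightarrow> complex" where
  "L2_inner \<Omega> f g = (LINT z:\<Omega>|lebesgue. f z * cnj (g z))"

definition L2_norm :: "(complex ^ 'n) set \<Rightarrow> (complex ^ 'n \<Rightarrow> complex) \<Rightarrow> real" where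
  "L2_norm \<Omega> f = sqrt (LINT z:\<Omega>|lebesgue. (norm (f z))\<^sup>2)"

text \<open>Holomorphic functions on \<open>\<Omega>\<close> are represented by their extension by zero. This makes the
  representative unique (two continuous functions that agree almost everywhere on the open set
  \<open>\<Omega>\<close> agree on \<open>\<Omega>\<close>), so that the definite descriptions below denote.\<close>

definition bergman_space :: "(complex ^ 'n) set \<Rightarrow> (complex ^ 'n \<Rightarrow> complex) set" where
  "bergman_space \<Omega> = {f \<in> L2 \<Omega>. holo_on f \<Omega> \<and> (\<forall>z. z \<notin> \<Omega> \<longrightarrow> f z = 0)}"

definition bergman_projection ::
    "(complex ^ 'n) set \<Rightarrow> (complex ^ 'n \<Rightarrow> complex) \<Rightarrow> (complex ^ 'n \<Rightarrow> complex)" where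
  "bergman_projection \<Omega> g =
     (THE f. f \<in> bergman_space \<Omega> \<and>
             (\<forall>h\<in>bergman_space \<Omega>. L2_inner \<Omega> (\<lambda>z. g z - f z) h = 0))"

text \<open>\<open>bergman_kernel \<Omega> w z\<close> is $K(w,z)$; the function $K(\cdot,z)$ is the element of the Bergman
  space that represents evaluation at \<open>z\<close>.\<close>

definition bergman_kernel :: "(complex ^ 'n) set \<Rightarrow> complex ^ 'n \<Rightarrow> complex ^ 'n \<Rightarrow> complex" where
  "bergman_kernel \<Omega> w z =
     (THE k. k \<in> bergman_space \<Omega> \<and> (\<forall>f\<in>bergman_space \<Omega>. f z = L2_inner \<Omega> f k)) w"

definition normalized_kernel :: "(complex ^ 'n) set \<Rightarrow> complex ^ 'n \<Rightarrow> complex ^ 'n \<Rightarrow> complex" where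
  "normalized_kernel \<Omega> z = (\<lambda>w. bergman_kernel \<Omega> w z / csqrt (bergman_kernel \<Omega> z z))"

definition toeplitz ::
    "(complex ^ 'n) set \<Rightarrow> (complex ^ 'n \<Rightarrow> complex) \<Rightarrow>
     (complex ^ 'n \<Rightarrow> complex) \<Rightarrow> (complex ^ 'n \<Rightarrow> complex)" where
  "toeplitz \<Omega> \<phi> f = bergman_projection \<Omega> (\<lambda>z. \<phi> z * f z)"

text \<open>Operators on the Bergman space are functions on \<^typ>\<open>complex ^ 'n \<Rightarrow> complex\<close>, of which only
  the values on \<^const>\<open>bergman_space\<close> matter.\<close>

definition bergman_adjoint ::
    "(complex ^ 'n) set \<Rightarrow> ((complex ^ 'n \<Rightarrow> complex) \<Rightarrow> (complex ^ 'n \<Rightarrow> complex)) \<Rightarrow>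
     (complex ^ 'n \<Rightarrow> complex) \<Rightarrow> (complex ^ 'n \<Rightarrow> complex)" where
  "bergman_adjoint \<Omega> T g =
     (THE h. h \<in> bergman_space \<Omega> \<and>
             (\<forall>f\<in>bergman_space \<Omega>. L2_inner \<Omega> (T f) g = L2_inner \<Omega> f h))"

definition compact_operator ::
    "(complex ^ 'n) set \<Rightarrow> ((complex ^ 'n \<Rightarrow> complex) \<Rightarrow> (complex ^ 'n \<Rightarrow> complex)) \<Rightarrow> bool" where
  "compact_operator \<Omega> T \<longleftrightarrow>
     (\<forall>f :: nat \<Rightarrow> complex ^ 'n \<Rightarrow> complex.
        (\<forall>n. f n \<in> bergman_space \<Omega>) \<and> (\<exists>M. \<forall>n. L2_norm \<Omega> (f n) \<le> M) \<longrightarrow>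
        (\<exists>g\<in>bergman_space \<Omega>. \<exists>r. strict_mono r \<and>
           (\<lambda>n. L2_norm \<Omega> (\<lambda>z. T (f (r n)) z - g z)) \<longlonglongrightarrow> 0))"

definition berezin ::
    "(complex ^ 'n) set \<Rightarrow> ((complex ^ 'n \<Rightarrow> complex) \<Rightarrow> (complex ^ 'n \<Rightarrow> complex)) \<Rightarrow>
     complex ^ 'n \<Rightarrow> complex" where
  "berezin \<Omega> T z = L2_inner \<Omega> (T (normalized_kernel \<Omega> z)) (normalized_kernel \<Omega> z)"

text \<open>The filter of points of \<open>\<Omega>\<close> whose distance to the boundary tends to zero.\<close>

definition to_boundary :: "(complex ^ 'n) set \<Rightarrow> (complex ^ 'n) filter" where
  "to_boundary \<Omega> =
     inf (filtercomap (\<lambda>z. infdist z (frontier \<Omega>)) (nhds 0)) (principal \<Omega>)"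

end

theory Submission
  imports Defs "HOL-Complex_Analysis.Great_Picard"
begin

text \<open>
  The implications that see little of the boundary are soft. If \<open>\<phi>\<close> vanishes on the boundary and
  \<open>f\<^sub>n\<close> is bounded in the Bergman space, a subsequence converges pointwise by Montel's theorem; off a
  compact set \<open>\<phi>\<close> is small and on the compact set dominated convergence applies, so that \<open>T\<close> is compact
  (\<open>compact_of_vanishing_boundary\<close>). Compactness of \<open>T\<close> and of \<open>T\<^sup>*T\<close> are equivalent because
  \<open>\<parallel>T f\<parallel>\<^sup>2 = \<langle>f, T\<^sup>*T f\<rangle>\<close>. For the rest everything is read off the probability measures
  \<open>|k\<^sub>z|\<^sup>2 dV\<close>, through one identity (\<open>nk_self_inner\<close>): \<open>\<integral> q |k\<^sub>z|\<^sup>2 dV = q z\<close> for bounded holomorphic \<open>q\<close>.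
  If \<open>p\<close> is a boundary point and \<open>1 - h\<close> is the affine function of a supporting hyperplane at \<open>p\<close>,
  then \<open>\<integral> Re (1 - h) |k\<^sub>z|\<^sup>2 dV = Re (1 - h z)\<close> tends to \<open>0\<close> as \<open>z\<close> tends to \<open>p\<close>, so the mass leaves every compact subset,
  \<open>k\<^sub>z\<close> tends weakly to \<open>0\<close> (\<open>nk_weakly_null\<close>), and a compact \<open>T\<close> sends it to \<open>0\<close> in norm.
  By the Cauchy-Schwarz inequality the Berezin transform of \<open>T\<close> then tends to \<open>0\<close> as well.

  The remaining implication recovers the boundary values of \<open>\<phi>\<close> from the Berezin transform. By
  convexity and rotation invariance a boundary point \<open>p\<close> has a supporting functional \<open>\<alpha>\<close>
  with \<open>|\<alpha>\<^sub>1 y\<^sub>1| + |\<alpha>\<^sub>2 y\<^sub>2| \<le> c\<close> on the closure and with \<open>\<alpha>\<^sub>1 p\<^sub>1, \<alpha>\<^sub>2 p\<^sub>2 \<ge> 0\<close> adding up to \<open>c\<close>.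
  If both coefficients are nonzero, the functional exposes only a real segment, and adding the square of one
  coordinate turns it into a polynomial peaking at \<open>p\<close> alone; hence \<open>|k\<^sub>z|\<^sup>2 dV\<close> concentrates at
  \<open>p\<close> and the Berezin transform tends to \<open>\<phi> p\<close> (\<open>symbol_zero_of_generic_support\<close>). Otherwise
  \<open>|y\<^sub>i| \<le> |p\<^sub>i|\<close> on the closure, and the face over \<open>p\<^sub>i\<close> is a point, which is a peak point again, or a
  disc of radius \<open>s > 0\<close>.

  On a disc face the measures do not concentrate at a point; they look like \<open>|k|\<^sup>2\<close> for the kernel
  of the disc, and what is needed is a version of the injectivity of the Berezin transform. Put
  \<open>a\<^sub>t = (t p\<^sub>i, 0)\<close> and let \<open>P\<^sub>k\<close> represent the functional that takes \<open>f\<close> to the \<open>k\<close>-th Taylor coefficient of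
  \<open>f (t p\<^sub>i, \<cdot>)\<close> at \<open>0\<close>. The kernel at \<open>(t p\<^sub>i, z)\<close> is \<open>\<Sum>\<^sub>k (cnj z)\<^sup>k P\<^sub>k\<close>,
  with bounds that are uniform in \<open>t\<close> after division by the norm of the kernel at \<open>a\<^sub>t\<close>. So the
  Berezin transform near the face is a sesquianalytic function of \<open>z\<close> whose coefficients are the normalized
  numbers \<open>\<langle>\<phi> P\<^sub>k, P\<^sub>l\<rangle>\<close>, and since it tends to \<open>0\<close>, so does every coefficient
  (\<open>toeplitz_coefficients_null\<close>). By rotation invariance \<open>P\<^sub>k\<close> has the form \<open>G\<^sub>k(u\<^sub>i) u\<^sub>j\<^sup>k\<close>, and its mass
  concentrates at \<open>u\<^sub>i = p\<^sub>i\<close>. Integrating over the slices of the domain first therefore compares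
  \<open>\<langle>\<phi> P\<^sub>k, P\<^sub>l\<rangle>\<close> with the moment \<open>\<integral> \<phi>(p\<^sub>i, b) b\<^sup>k (cnj b)\<^sup>l db\<close> over the disc
  (\<open>face_form_estimate\<close>). All these moments vanish, so \<open>\<phi>\<close> vanishes on the open disc by the
  Stone-Weierstrass theorem (\<open>symbol_zero_on_open_face\<close>), and on the closed one by continuity.
\<close>

(* The infix dollar is reserved for the components of a vector. *)
no_notation fps_nth (infixl "$" 75)

section \<open>Coordinates and Lebesgue measure on \<open>\<complex>\<^sup>2\<close>\<close>

text \<open>
  Two-dimensional vectors are built from a distinguished coordinate \<open>i\<close>, so that
  both coordinates can play the role of the flat direction without a separate symmetry argument.
\<close>

definition vec2 :: "2 \<Rightarrow> complex \<Rightarrow> complex \<Rightarrow> complex ^ 2" where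
  "vec2 i a b = (\<chi> k. if k = i then a else b)"

lemma two_indices:
  fixes i j k :: 2
  assumes "i \<noteq> j"
  shows "k = i \<or> k = j"
  using assms exhaust_2[of i] exhaust_2[of j] exhaust_2[of k] by auto

lemma UNIV_2_eq: "i \<noteq> j \<Longrightarrow> (UNIV :: 2 set) = {i, j}"
  using two_indices by auto

lemma vec2_nth [simp]: "vec2 i a b $ i = a" "i \<noteq> j \<Longrightarrow> vec2 i a b $ j = b"
  by (auto simp: vec2_def)

lemma vec2_nth': "j \<noteq> i \<Longrightarrow> vec2 i a b $ j = b"
  by (auto simp: vec2_def)

lemma vec2_eta: "i \<noteq> j \<Longrightarrow> vec2 i (u $ i) (u $ j) = u"
  by (auto simp: vec2_def vec_eq_iff) (metis two_indices)

lemma vec2_eqI: "i \<noteq> j \<Longrightarrow> u $ i = v $ i \<Longrightarrow> u $ j = v $ j \<Longrightarrow> u = (v :: complex ^ 2)"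
  by (metis vec2_eta)

lemma continuous_vec2 [continuous_intros]:
  assumes "continuous_on S f" "continuous_on S g"
  shows "continuous_on S (\<lambda>x. vec2 i (f x) (g x))"
  unfolding vec2_def
proof (rule continuous_on_vec_lambda)
  show "continuous_on S (\<lambda>x. if k = i then f x else g x)" for k
    using assms by (cases "k = i") auto
qed

lemma tendsto_vec2 [tendsto_intros]:
  assumes "(f \<longlongrightarrow> a) F" "(g \<longlongrightarrow> b) F"
  shows "((\<lambda>x. vec2 i (f x) (g x)) \<longlongrightarrow> vec2 i a b) F"
  unfolding vec2_def by (intro vec_tendstoI) (auto intro: assms)

lemma measurable_vec2: "(\<lambda>(a, b). vec2 i a b) \<in> borel_measurable borel"
  by (rule borel_measurable_continuous_onI) (auto simp: split_beta intro!: continuous_intros)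

lemma complex2_Basis:
  assumes "i \<noteq> j"
  shows "(Basis :: (complex ^ 2) set) = axis i ` Basis \<union> axis j ` Basis"
  using UNIV_2_eq[OF assms] by (auto simp: Basis_vec_def)

text \<open>
  Boxes factor, and a measure on Borel sets is determined by its values on boxes.
\<close>

lemma lborel_complex2:
  assumes "i \<noteq> j"
  shows "(lborel :: (complex ^ 2) measure) =
         distr (lborel \<Otimes>\<^sub>M lborel) borel (\<lambda>(a, b). vec2 i a b)"
proof (rule lborel_eqI)
  have meas: "(\<lambda>(a, b). vec2 i a b) \<in> (lborel \<Otimes>\<^sub>M lborel) \<rightarrow>\<^sub>M borel"
    using measurable_vec2[of i] by (simp add: lborel_prod)
  have mem: "vec2 i a b \<in> box l u \<longleftrightarrow> a \<in> box (l $ i) (u $ i) \<and> b \<in> box (l $ j) (u $ j)" for a b l u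
    using assms by (auto simp: mem_box complex2_Basis[OF assms] inner_axis ball_Un)
  fix l u :: "complex ^ 2"
  assume le: "\<And>b. b \<in> Basis \<Longrightarrow> l \<bullet> b \<le> u \<bullet> b"
  have le1: "b \<in> Basis \<Longrightarrow> l $ i \<bullet> b \<le> u $ i \<bullet> b" "b \<in> Basis \<Longrightarrow> l $ j \<bullet> b \<le> u $ j \<bullet> b" for b
    using le[of "axis i b"] le[of "axis j b"] by (auto simp: complex2_Basis[OF assms] inner_axis)
  have "emeasure (distr (lborel \<Otimes>\<^sub>M lborel) borel (\<lambda>(a, b). vec2 i a b)) (box l u)
      = emeasure (lborel \<Otimes>\<^sub>M lborel) (box (l $ i) (u $ i) \<times> box (l $ j) (u $ j))"
    using mem by (subst emeasure_distr[OF meas]) (auto intro!: arg_cong2[where f = emeasure]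
        simp: space_pair_measure)
  also have "\<dots> = emeasure lborel (box (l $ i) (u $ i)) * emeasure lborel (box (l $ j) (u $ j))"
    by (intro lborel.emeasure_pair_measure_Times) auto
  also have "\<dots> = (\<Prod>b\<in>Basis. (u $ i - l $ i) \<bullet> b) * (\<Prod>b\<in>Basis. (u $ j - l $ j) \<bullet> b)"
    by (subst (1 2) emeasure_lborel_box) (auto simp: le1 ennreal_mult prod_nonneg inner_diff_left)
  also have "(\<Prod>b\<in>Basis. (u $ i - l $ i) \<bullet> b) * (\<Prod>b\<in>Basis. (u $ j - l $ j) \<bullet> b)
      = (\<Prod>b\<in>Basis. (u - l) \<bullet> b)"
    unfolding complex2_Basis[OF assms]
  proof (subst prod.union_disjoint)
    show "axis i ` Basis \<inter> axis j ` (Basis :: complex set) = {}"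
      using assms by (auto simp: axis_eq_axis)
    have inj: "inj_on (axis k) S" for k :: 2 and S :: "complex set"
      by (auto simp: inj_on_def axis_eq_axis)
    show "(\<Prod>b\<in>Basis. (u $ i - l $ i) \<bullet> b) * (\<Prod>b\<in>Basis. (u $ j - l $ j) \<bullet> b) =
      (\<Prod>b\<in>axis i ` Basis. (u - l) \<bullet> b) * (\<Prod>b\<in>axis j ` Basis. (u - l) \<bullet> b)"
      by (subst (1 2) prod.reindex[OF inj]) (auto simp: inner_axis)
  qed auto
  finally show "emeasure (distr (lborel \<Otimes>\<^sub>M lborel) borel (\<lambda>(a, b). vec2 i a b)) (box l u)
      = ennreal (\<Prod>b\<in>Basis. (u - l) \<bullet> b)" .
qed auto

lemma vec2_measurable_pair [measurable]:
  "(\<lambda>(a, b). vec2 i a b) \<in> (lborel \<Otimes>\<^sub>M lborel) \<rightarrow>\<^sub>M borel"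
  using measurable_vec2[of i] by (simp add: lborel_prod)

lemma vec2_measurable_snd [measurable]: "vec2 i a \<in> borel_measurable borel"
  by (rule borel_measurable_continuous_onI) (intro continuous_intros)

lemma nn_integral_slices:
  assumes "i \<noteq> j" and [measurable]: "f \<in> borel_measurable (borel :: (complex ^ 2) measure)"
  shows "(\<integral>\<^sup>+u. f u \<partial>lborel) = (\<integral>\<^sup>+a. (\<integral>\<^sup>+b. f (vec2 i a b) \<partial>lborel) \<partial>lborel)"
proof -
  have "(\<lambda>x. f (case x of (a, b) \<Rightarrow> vec2 i a b)) \<in> borel_measurable (lborel \<Otimes>\<^sub>M lborel)"
    by (rule measurable_compose[OF vec2_measurable_pair assms(2)])
  from lborel.nn_integral_fst[OF this]
  show ?thesis
    by (subst lborel_complex2[OF assms(1)], subst nn_integral_distr) simp_all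
qed

lemma
  fixes f :: "complex ^ 2 \<Rightarrow> complex"
  assumes "i \<noteq> j" and [measurable]: "f \<in> borel_measurable borel" and int: "integrable lborel f"
  shows integrable_slices: "integrable lborel (\<lambda>a. LINT b|lborel. f (vec2 i a b))"
    and integral_slices: "(LINT u|lborel. f u) = (LINT a|lborel. LINT b|lborel. f (vec2 i a b))"
proof -
  have "integrable (distr (lborel \<Otimes>\<^sub>M lborel) borel (\<lambda>(a, b). vec2 i a b)) f"
    using int lborel_complex2[OF assms(1)] by simp
  hence int': "integrable (lborel \<Otimes>\<^sub>M lborel) (\<lambda>(a, b). f (vec2 i a b))"
    by (subst (asm) integrable_distr_eq) (auto simp: split_beta')
  show "integrable lborel (\<lambda>a. LINT b|lborel. f (vec2 i a b))"
    using lborel_pair.integrable_fst'[OF int'] by simp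
  show "(LINT u|lborel. f u) = (LINT a|lborel. LINT b|lborel. f (vec2 i a b))"
    using lborel_pair.integral_fst'[OF int']
    by (subst lborel_complex2[OF assms(1)], subst integral_distr) (simp_all add: split_beta')
qed

lemma lborel_complex_eq_distr:
  "(lborel :: complex measure) = distr lborel borel (\<lambda>v :: real ^ 2. Complex (v $ 1) (v $ 2))"
proof (rule lborel_eqI)
  have meas: "(\<lambda>v :: real ^ 2. Complex (v $ 1) (v $ 2)) \<in> borel_measurable borel"
    by (rule borel_measurable_continuous_onI) (auto simp: Complex_eq intro!: continuous_intros)
  fix l u :: complex
  assume le: "\<And>b. b \<in> Basis \<Longrightarrow> l \<bullet> b \<le> u \<bullet> b"
  let ?l = "(\<chi> k. if k = 1 then Re l else Im l) :: real ^ 2"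
  let ?u = "(\<chi> k. if k = 1 then Re u else Im u) :: real ^ 2"
  have B: "(Basis :: (real ^ 2) set) = {axis 1 1, axis 2 1}"
    by (auto simp: Basis_vec_def UNIV_2)
  have ne: "axis 1 1 \<noteq> (axis 2 1 :: real ^ 2)"
    by (auto simp: axis_eq_axis)
  have "(\<lambda>v :: real ^ 2. Complex (v $ 1) (v $ 2)) -` box l u = box ?l ?u"
    by (auto simp: mem_box B Basis_complex_def inner_axis)
  hence "emeasure (distr lborel borel (\<lambda>v :: real ^ 2. Complex (v $ 1) (v $ 2))) (box l u)
      = emeasure lborel (box ?l ?u)"
    using meas by (subst emeasure_distr) auto
  also have "\<dots> = (\<Prod>b\<in>Basis. (?u - ?l) \<bullet> b)"
    using le[of 1] le[of \<i>] by (subst emeasure_lborel_box) (auto simp: B Basis_complex_def inner_axis)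
  also have "\<dots> = (\<Prod>b\<in>Basis. (u - l) \<bullet> b)"
    using ne by (auto simp: B Basis_complex_def inner_axis)
  finally show "emeasure (distr lborel borel (\<lambda>v :: real ^ 2. Complex (v $ 1) (v $ 2))) (box l u)
      = ennreal (\<Prod>b\<in>Basis. (u - l) \<bullet> b)" .
qed auto

text \<open>
  Multiplication by a unimodular number is an orthogonal map of the real plane, and those
  preserve Lebesgue measure; \<open>lborel_complex_eq_distr\<close> carries this over to
  \<open>\<complex>\<close>.
\<close>

lemma lborel_complex_rotation:
  assumes "norm \<xi> = 1"
  shows "distr lborel borel ((*) \<xi>) = (lborel :: complex measure)"
proof (rule lborel_eqI[symmetric])
  let ?J = "\<lambda>v :: real ^ 2. Complex (v $ 1) (v $ 2)"
  let ?R = "\<lambda>v :: real ^ 2. (\<chi> k. if k = 1 then Re \<xi> * v $ 1 + Im \<xi> * v $ 2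
        else Re \<xi> * v $ 2 - Im \<xi> * v $ 1) :: real ^ 2"
  have sq: "(Re \<xi>)\<^sup>2 + (Im \<xi>)\<^sup>2 = 1"
    using assms by (simp add: cmod_def)
  have measJ: "?J \<in> borel_measurable borel"
    by (rule borel_measurable_continuous_onI) (auto simp: Complex_eq intro!: continuous_intros)
  have R: "orthogonal_transformation ?R"
  proof -
    have "linear ?R"
      by (rule linearI) (auto simp: vec_eq_iff algebra_simps)
    moreover have "norm (?R v) = norm v" for v
    proof -
      have "(Re \<xi> * v $ 1 + Im \<xi> * v $ 2)\<^sup>2 + (Re \<xi> * v $ 2 - Im \<xi> * v $ 1)\<^sup>2
          = ((Re \<xi>)\<^sup>2 + (Im \<xi>)\<^sup>2) * ((v $ 1)\<^sup>2 + (v $ 2)\<^sup>2)"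
        by (simp add: power2_eq_square algebra_simps)
      thus ?thesis
        unfolding sq by (simp add: norm_vec_def L2_set_def UNIV_2)
    qed
    ultimately show ?thesis
      by (simp add: orthogonal_transformation)
  qed
  fix l u :: complex
  assume le: "\<And>b. b \<in> Basis \<Longrightarrow> l \<bullet> b \<le> u \<bullet> b"
  define A where "A = ?J -` box l u"
  have oJ: "open A"
    unfolding A_def by (rule open_vimage) (auto simp: Complex_eq intro!: continuous_intros)
  have A_lm: "A \<in> lmeasurable"
  proof -
    have "emeasure lborel A = emeasure (distr lborel borel ?J) (box l u)"
      using measJ by (subst emeasure_distr) (auto simp: A_def)
    also have "\<dots> < \<infinity>"
      unfolding lborel_complex_eq_distr[symmetric] using emeasure_lborel_box_finite by auto
    finally show ?thesis
      using oJ by (auto simp: fmeasurable_def)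
  qed
  have J: "?J (?R v) = cnj \<xi> * ?J v" for v
    by (simp add: complex_eq_iff)
  have xc: "\<xi> * (cnj \<xi> * z) = z" for z
  proof -
    have "\<xi> * cnj \<xi> = 1" using assms complex_norm_square[of \<xi>] by simp
    thus ?thesis by (metis mult.assoc mult.left_neutral)
  qed
  have bij: "bij ?R"
    using R orthogonal_transformation_bij by blast
  have img: "?R ` A = ?J -` ((*) \<xi> -` box l u)"
  proof (intro set_eqI iffI)
    fix w assume "w \<in> ?R ` A"
    then obtain v where v: "w = ?R v" "?J v \<in> box l u" by (auto simp: A_def)
    show "w \<in> ?J -` ((*) \<xi> -` box l u)"
      unfolding v(1) vimage_eq J xc using v(2) .
  next
    fix w assume w: "w \<in> ?J -` ((*) \<xi> -` box l u)"
    obtain v where v: "w = ?R v"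
      using bij by (meson bij_pointE)
    have "?J v \<in> box l u"
      using w unfolding v vimage_eq J xc .
    thus "w \<in> ?R ` A"
      unfolding v by (auto simp: A_def)
  qed
  have mx: "(*) \<xi> \<in> borel_measurable borel"
    by simp
  have B: "(*) \<xi> -` box l u \<in> sets borel"
    using measurable_sets[OF mx, of "box l u"] by simp
  have sV: "?J -` S \<in> sets borel" if "S \<in> sets borel" for S
    using measurable_sets[OF measJ that] by simp
  have "emeasure (distr lborel borel ((*) \<xi>)) (box l u) = emeasure lborel ((*) \<xi> -` box l u)"
    using mx by (subst emeasure_distr) auto
  also have "\<dots> = emeasure (distr lborel borel ?J) ((*) \<xi> -` box l u)"
    by (subst lborel_complex_eq_distr) simp
  also have "\<dots> = emeasure lborel (?R ` A)"
    using measJ B unfolding img by (subst emeasure_distr) auto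
  also have "\<dots> = emeasure lebesgue (?R ` A)"
    using sV[OF B] unfolding img by simp
  also have "\<dots> = emeasure lebesgue A"
    using measure_orthogonal_image[OF R A_lm] measurable_orthogonal_image[OF R A_lm] A_lm
    by (simp add: emeasure_eq_measure2)
  also have "\<dots> = emeasure lborel A"
    using oJ by auto
  also have "\<dots> = emeasure (distr lborel borel ?J) (box l u)"
    using measJ by (subst emeasure_distr) (auto simp: A_def)
  also have "\<dots> = (\<Prod>b\<in>Basis. (u - l) \<bullet> b)"
    unfolding lborel_complex_eq_distr[symmetric] using le by (rule emeasure_lborel_box)
  finally show "emeasure (distr lborel borel ((*) \<xi>)) (box l u) = ennreal (\<Prod>b\<in>Basis. (u - l) \<bullet> b)" .
qed auto

lemma nn_integral_complex_rotation:
  assumes "norm \<xi> = 1" and [measurable]: "f \<in> borel_measurable (borel :: complex measure)"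
  shows "(\<integral>\<^sup>+z. f (\<xi> * z) \<partial>lborel) = (\<integral>\<^sup>+z. f z \<partial>lborel)"
  by (subst lborel_complex_rotation[OF assms(1), symmetric], subst nn_integral_distr) auto

lemma nn_integral_torus_rotation:
  fixes f :: "complex ^ 2 \<Rightarrow> ennreal"
  assumes \<xi>: "\<And>k. norm (\<xi> $ k) = 1" and [measurable]: "f \<in> borel_measurable borel"
  shows "(\<integral>\<^sup>+u. f (\<chi> k. \<xi> $ k * u $ k) \<partial>lborel) = (\<integral>\<^sup>+u. f u \<partial>lborel)"
proof -
  have ij: "(1::2) \<noteq> 2" by simp
  have [measurable]: "(\<lambda>u :: complex ^ 2. \<chi> k. \<xi> $ k * u $ k) \<in> borel_measurable borel"
    by (rule borel_measurable_continuous_onI) (intro continuous_intros)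
  have rot: "(\<chi> k. \<xi> $ k * vec2 1 a b $ k) = vec2 1 (\<xi> $ 1 * a) (\<xi> $ 2 * b)" for a b
    by (intro vec2_eqI[OF ij]) (simp_all add: vec2_nth')
  have [measurable]: "(\<lambda>a. \<integral>\<^sup>+b. f (vec2 1 a b) \<partial>lborel) \<in> borel_measurable borel"
  proof -
    have "(\<lambda>x. f (case x of (a, b) \<Rightarrow> vec2 1 a b)) \<in> borel_measurable (lborel \<Otimes>\<^sub>M lborel)"
      by (rule measurable_compose[OF vec2_measurable_pair assms(2)])
    from lborel.borel_measurable_nn_integral_fst[OF this] show ?thesis by simp
  qed
  have "(\<integral>\<^sup>+u. f (\<chi> k. \<xi> $ k * u $ k) \<partial>lborel)
      = (\<integral>\<^sup>+a. (\<integral>\<^sup>+b. f (vec2 1 (\<xi> $ 1 * a) (\<xi> $ 2 * b)) \<partial>lborel) \<partial>lborel)"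
    by (subst nn_integral_slices[OF ij]) (simp_all add: rot)
  also have "\<dots> = (\<integral>\<^sup>+a. (\<integral>\<^sup>+b. f (vec2 1 (\<xi> $ 1 * a) b) \<partial>lborel) \<partial>lborel)"
  proof (rule nn_integral_cong)
    show "(\<integral>\<^sup>+b. f (vec2 1 (\<xi> $ 1 * a) (\<xi> $ 2 * b)) \<partial>lborel)
        = (\<integral>\<^sup>+b. f (vec2 1 (\<xi> $ 1 * a) b) \<partial>lborel)" for a
      by (rule nn_integral_complex_rotation[OF \<xi>]) measurable
  qed
  also have "\<dots> = (\<integral>\<^sup>+a. (\<integral>\<^sup>+b. f (vec2 1 a b) \<partial>lborel) \<partial>lborel)"
    by (rule nn_integral_complex_rotation[OF \<xi>]) measurable
  also have "\<dots> = (\<integral>\<^sup>+u. f u \<partial>lborel)"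
    by (subst nn_integral_slices[OF ij]) simp_all
  finally show ?thesis .
qed

section \<open>Square integrable functions\<close>

lemma borel_measurable_cnj [measurable (raw)]:
  "f \<in> borel_measurable M \<Longrightarrow> (\<lambda>x. cnj (f x)) \<in> borel_measurable M"
  by (rule borel_measurable_continuous_on[where f = cnj]) (auto intro!: continuous_intros)

locale bergman_domain =
  fixes \<Omega> :: "(complex ^ 2) set"
  assumes open_dom: "open \<Omega>" and bounded_dom: "bounded \<Omega>"
begin

abbreviation dM :: "(complex ^ 2) measure" where "dM \<equiv> lebesgue_on \<Omega>"

abbreviation inn ("\<langle>_, _\<rangle>") where "\<langle>f, g\<rangle> \<equiv> L2_inner \<Omega> f g"
abbreviation nrm ("\<parallel>_\<parallel>") where "\<parallel>f\<parallel> \<equiv> L2_norm \<Omega> f"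
abbreviation A2 where "A2 \<equiv> bergman_space \<Omega>"

lemma dom_sets [measurable, simp]: "\<Omega> \<in> sets borel" "\<Omega> \<in> sets lebesgue"
  using open_dom by auto

lemma space_dM [simp]: "space dM = \<Omega>"
  by simp

lemma finite_dM: "finite_measure dM"
  using bounded_dom open_dom
  by (metis bounded_set_imp_lmeasurable dom_sets(2) finite_measure_lebesgue_on)

lemma L2_iff: "f \<in> L2 \<Omega> \<longleftrightarrow> f \<in> borel_measurable dM \<and> integrable dM (\<lambda>z. (norm (f z))\<^sup>2)"
  unfolding L2_def set_borel_measurable_def set_integrable_def
  by (simp add: borel_measurable_restrict_space_iff integrable_restrict_space)

lemma L2_inner_eq: "\<langle>f, g\<rangle> = (LINT z|dM. f z * cnj (g z))"
  unfolding L2_inner_def set_lebesgue_integral_def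
  by (simp add: integral_restrict_space)

lemma L2_norm_eq: "\<parallel>f\<parallel> = sqrt (LINT z|dM. (norm (f z))\<^sup>2)"
  unfolding L2_norm_def set_lebesgue_integral_def
  by (simp add: integral_restrict_space)

lemma L2_norm_nonneg [simp]: "\<parallel>f\<parallel> \<ge> 0"
  unfolding L2_norm_eq by (simp add: integral_nonneg_AE)

lemma L2_norm_sq: "\<parallel>f\<parallel>\<^sup>2 = (LINT z|dM. (norm (f z))\<^sup>2)"
  unfolding L2_norm_eq by (simp add: integral_nonneg_AE)

lemma L2_norm_cong: "(\<And>z. z \<in> \<Omega> \<Longrightarrow> norm (f z) = norm (g z)) \<Longrightarrow> \<parallel>f\<parallel> = \<parallel>g\<parallel>"
  unfolding L2_norm_eq by (intro arg_cong[where f = sqrt] Bochner_Integration.integral_cong) auto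

lemma L2_inner_cong:
  "(\<And>z. z \<in> \<Omega> \<Longrightarrow> f z = f' z) \<Longrightarrow> (\<And>z. z \<in> \<Omega> \<Longrightarrow> g z = g' z) \<Longrightarrow> \<langle>f, g\<rangle> = \<langle>f', g'\<rangle>"
  unfolding L2_inner_eq by (intro Bochner_Integration.integral_cong) auto

lemma L2_prod_integrable:
  assumes "f \<in> L2 \<Omega>" "g \<in> L2 \<Omega>"
  shows "integrable dM (\<lambda>z. f z * cnj (g z))"
proof (rule Bochner_Integration.integrable_bound)
  show "integrable dM (\<lambda>z. (norm (f z))\<^sup>2 + (norm (g z))\<^sup>2)"
    using assms by (simp add: L2_iff)
  show "(\<lambda>z. f z * cnj (g z)) \<in> borel_measurable dM"
    using assms by (auto simp: L2_iff intro!: borel_measurable_times borel_measurable_cnj)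
  show "AE z in dM. norm (f z * cnj (g z)) \<le> norm ((norm (f z))\<^sup>2 + (norm (g z))\<^sup>2)"
  proof (rule AE_I2)
    fix z
    have "0 \<le> (norm (f z) - norm (g z))\<^sup>2 + (norm (f z))\<^sup>2 + (norm (g z))\<^sup>2" by simp
    hence "norm (f z) * norm (g z) \<le> (norm (f z))\<^sup>2 + (norm (g z))\<^sup>2"
      by (simp add: power2_eq_square algebra_simps)
    thus "norm (f z * cnj (g z)) \<le> norm ((norm (f z))\<^sup>2 + (norm (g z))\<^sup>2)"
      by (simp add: norm_mult)
  qed
qed

lemma L2_mult_bounded:
  assumes "f \<in> L2 \<Omega>" and [measurable]: "h \<in> borel_measurable dM"
    and B: "\<And>z. z \<in> \<Omega> \<Longrightarrow> norm (h z) \<le> B"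
  shows "(\<lambda>z. h z * f z) \<in> L2 \<Omega>"
proof -
  have [measurable]: "f \<in> borel_measurable dM" using assms(1) by (simp add: L2_iff)
  have "integrable dM (\<lambda>z. (norm (h z * f z))\<^sup>2)"
  proof (rule Bochner_Integration.integrable_bound)
    show "integrable dM (\<lambda>z. B\<^sup>2 * (norm (f z))\<^sup>2)"
      using assms by (simp add: L2_iff)
    show "AE z in dM. norm ((norm (h z * f z))\<^sup>2) \<le> norm (B\<^sup>2 * (norm (f z))\<^sup>2)"
      using B by (intro AE_I2) (auto simp: norm_mult power_mult_distrib intro!: mult_right_mono power_mono)
  qed simp
  thus ?thesis by (simp add: L2_iff)
qed

lemma L2_norm_mult_bounded:
  assumes "f \<in> L2 \<Omega>" and h: "h \<in> borel_measurable dM"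
    and B: "\<And>z. z \<in> \<Omega> \<Longrightarrow> norm (h z) \<le> B" and "B \<ge> 0"
  shows "\<parallel>\<lambda>z. h z * f z\<parallel> \<le> B * \<parallel>f\<parallel>"
proof -
  have "\<parallel>\<lambda>z. h z * f z\<parallel>\<^sup>2 \<le> (LINT z|dM. B\<^sup>2 * (norm (f z))\<^sup>2)"
    unfolding L2_norm_sq
  proof (rule integral_mono)
    show "integrable dM (\<lambda>z. (norm (h z * f z))\<^sup>2)"
      using L2_mult_bounded[OF assms(1-3)] by (simp add: L2_iff)
  qed (use assms in \<open>auto simp: L2_iff norm_mult power_mult_distrib intro!: mult_right_mono power_mono\<close>)
  also have "\<dots> = (B * \<parallel>f\<parallel>)\<^sup>2"
    by (simp add: L2_norm_sq power_mult_distrib)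
  finally show ?thesis
    using assms(4) by (simp add: power2_le_iff_abs_le)
qed

lemma L2_scale: "f \<in> L2 \<Omega> \<Longrightarrow> (\<lambda>z. c * f z) \<in> L2 \<Omega>"
  by (rule L2_mult_bounded) auto

lemma L2_add:
  assumes "f \<in> L2 \<Omega>" "g \<in> L2 \<Omega>"
  shows "(\<lambda>z. f z + g z) \<in> L2 \<Omega>"
proof -
  have [measurable]: "f \<in> borel_measurable dM" "g \<in> borel_measurable dM"
    using assms by (simp_all add: L2_iff)
  have "integrable dM (\<lambda>z. (norm (f z + g z))\<^sup>2)"
  proof (rule Bochner_Integration.integrable_bound)
    show "integrable dM (\<lambda>z. 2 * (norm (f z))\<^sup>2 + 2 * (norm (g z))\<^sup>2)"
      using assms by (simp add: L2_iff)
    show "AE z in dM. norm ((norm (f z + g z))\<^sup>2) \<le> norm (2 * (norm (f z))\<^sup>2 + 2 * (norm (g z))\<^sup>2)"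
    proof (rule AE_I2)
      fix z
      have "(norm (f z + g z))\<^sup>2 \<le> (norm (f z) + norm (g z))\<^sup>2"
        by (intro power_mono norm_triangle_ineq) auto
      also have "\<dots> \<le> (norm (f z) + norm (g z))\<^sup>2 + (norm (f z) - norm (g z))\<^sup>2" by simp
      also have "\<dots> = 2 * (norm (f z))\<^sup>2 + 2 * (norm (g z))\<^sup>2"
        by (simp add: power2_eq_square algebra_simps)
      finally show "norm ((norm (f z + g z))\<^sup>2) \<le> norm (2 * (norm (f z))\<^sup>2 + 2 * (norm (g z))\<^sup>2)"
        by simp
    qed
  qed simp
  thus ?thesis by (simp add: L2_iff)
qed

lemma L2_diff: "f \<in> L2 \<Omega> \<Longrightarrow> g \<in> L2 \<Omega> \<Longrightarrow> (\<lambda>z. f z - g z) \<in> L2 \<Omega>"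
  using L2_add[of f "\<lambda>z. (-1) * g z"] L2_scale[of g "-1"] by simp

lemma L2_zero: "(\<lambda>z. 0) \<in> L2 \<Omega>"
  by (simp add: L2_iff)

lemma L2_sum: "(\<And>k. k \<in> K \<Longrightarrow> f k \<in> L2 \<Omega>) \<Longrightarrow> (\<lambda>z. \<Sum>k\<in>K. f k z) \<in> L2 \<Omega>"
  by (induction K rule: infinite_finite_induct) (auto simp: L2_zero L2_add)

lemma L2_bounded:
  assumes "h \<in> borel_measurable dM" "\<And>z. z \<in> \<Omega> \<Longrightarrow> norm (h z) \<le> B"
  shows "h \<in> L2 \<Omega>"
proof -
  interpret finite_measure dM by (rule finite_dM)
  have "(\<lambda>z. 1 :: complex) \<in> L2 \<Omega>" by (simp add: L2_iff)
  from L2_mult_bounded[OF this assms] show ?thesis by simp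
qed

lemma inner_add_left:
  "f \<in> L2 \<Omega> \<Longrightarrow> g \<in> L2 \<Omega> \<Longrightarrow> h \<in> L2 \<Omega> \<Longrightarrow> \<langle>\<lambda>z. f z + g z, h\<rangle> = \<langle>f, h\<rangle> + \<langle>g, h\<rangle>"
  unfolding L2_inner_eq by (simp add: ring_distribs L2_prod_integrable)

lemma inner_diff_left:
  "f \<in> L2 \<Omega> \<Longrightarrow> g \<in> L2 \<Omega> \<Longrightarrow> h \<in> L2 \<Omega> \<Longrightarrow> \<langle>\<lambda>z. f z - g z, h\<rangle> = \<langle>f, h\<rangle> - \<langle>g, h\<rangle>"
  unfolding L2_inner_eq by (simp add: ring_distribs L2_prod_integrable)

lemma inner_scale_left: "\<langle>\<lambda>z. c * f z, h\<rangle> = c * \<langle>f, h\<rangle>"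
  unfolding L2_inner_eq by (simp add: mult.assoc)

lemma inner_cnj: "\<langle>g, f\<rangle> = cnj \<langle>f, g\<rangle>"
  unfolding L2_inner_eq Bochner_Integration.integral_cnj[symmetric] by (simp add: mult.commute)

lemma inner_add_right:
  "f \<in> L2 \<Omega> \<Longrightarrow> g \<in> L2 \<Omega> \<Longrightarrow> h \<in> L2 \<Omega> \<Longrightarrow> \<langle>h, \<lambda>z. f z + g z\<rangle> = \<langle>h, f\<rangle> + \<langle>h, g\<rangle>"
  unfolding inner_cnj[of h "\<lambda>z. f z + g z"] inner_cnj[of h f] inner_cnj[of h g]
  by (simp add: inner_add_left)

lemma inner_diff_right:
  "f \<in> L2 \<Omega> \<Longrightarrow> g \<in> L2 \<Omega> \<Longrightarrow> h \<in> L2 \<Omega> \<Longrightarrow> \<langle>h, \<lambda>z. f z - g z\<rangle> = \<langle>h, f\<rangle> - \<langle>h, g\<rangle>"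
  unfolding inner_cnj[of h "\<lambda>z. f z - g z"] inner_cnj[of h f] inner_cnj[of h g]
  by (simp add: inner_diff_left)

lemma inner_scale_right: "\<langle>h, \<lambda>z. c * f z\<rangle> = cnj c * \<langle>h, f\<rangle>"
  unfolding inner_cnj[of h "\<lambda>z. c * f z"] inner_cnj[of h f]
  by (simp add: inner_scale_left)

lemma inner_sum_left:
  assumes "\<And>k. k \<in> K \<Longrightarrow> f k \<in> L2 \<Omega>" "h \<in> L2 \<Omega>"
  shows "\<langle>\<lambda>z. \<Sum>k\<in>K. f k z, h\<rangle> = (\<Sum>k\<in>K. \<langle>f k, h\<rangle>)"
  unfolding L2_inner_eq using assms
  by (subst Bochner_Integration.integral_sum[symmetric])
     (auto simp: L2_prod_integrable sum_distrib_right)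

lemma inner_sum_right:
  assumes "\<And>k. k \<in> K \<Longrightarrow> f k \<in> L2 \<Omega>" "h \<in> L2 \<Omega>"
  shows "\<langle>h, \<lambda>z. \<Sum>k\<in>K. f k z\<rangle> = (\<Sum>k\<in>K. \<langle>h, f k\<rangle>)"
proof -
  have "\<langle>\<lambda>z. \<Sum>k\<in>K. f k z, h\<rangle> = (\<Sum>k\<in>K. \<langle>f k, h\<rangle>)"
    by (rule inner_sum_left) (use assms in auto)
  hence "\<langle>h, \<lambda>z. \<Sum>k\<in>K. f k z\<rangle> = cnj (\<Sum>k\<in>K. \<langle>f k, h\<rangle>)"
    by (simp only: inner_cnj[of h "\<lambda>z. \<Sum>k\<in>K. f k z"])
  also have "\<dots> = (\<Sum>k\<in>K. \<langle>h, f k\<rangle>)"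
    unfolding cnj_sum by (intro sum.cong refl inner_cnj[symmetric])
  finally show ?thesis .
qed

lemma inner_self: "\<langle>f, f\<rangle> = of_real (\<parallel>f\<parallel>\<^sup>2)"
  unfolding L2_inner_eq L2_norm_sq
  by (subst integral_complex_of_real[symmetric]) (simp add: complex_norm_square del: of_real_power)

lemma inner_mult_move: "\<langle>\<lambda>z. h z * f z, g\<rangle> = \<langle>f, \<lambda>z. cnj (h z) * g z\<rangle>"
  unfolding L2_inner_eq by (simp add: mult_ac)

lemma norm_add_sq:
  assumes "f \<in> L2 \<Omega>" "g \<in> L2 \<Omega>"
  shows "\<parallel>\<lambda>z. f z + g z\<parallel>\<^sup>2 = \<parallel>f\<parallel>\<^sup>2 + 2 * Re \<langle>f, g\<rangle> + \<parallel>g\<parallel>\<^sup>2"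
proof -
  have "complex_of_real (\<parallel>\<lambda>z. f z + g z\<parallel>\<^sup>2) = \<langle>f, f\<rangle> + \<langle>f, g\<rangle> + (\<langle>g, f\<rangle> + \<langle>g, g\<rangle>)"
    using assms by (simp add: inner_self[symmetric] inner_add_left inner_add_right L2_add del: of_real_power)
  also have "Re \<dots> = \<parallel>f\<parallel>\<^sup>2 + 2 * Re \<langle>f, g\<rangle> + \<parallel>g\<parallel>\<^sup>2"
    using inner_cnj[of g f] by (simp add: inner_self)
  finally show ?thesis by (metis Re_complex_of_real)
qed

lemma norm_scale: "\<parallel>\<lambda>z. c * f z\<parallel> = norm c * \<parallel>f\<parallel>"
  unfolding L2_norm_eq by (simp add: norm_mult power_mult_distrib real_sqrt_mult)

lemma norm_diff_sq:
  assumes "f \<in> L2 \<Omega>" "g \<in> L2 \<Omega>"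
  shows "\<parallel>\<lambda>z. f z - g z\<parallel>\<^sup>2 = \<parallel>f\<parallel>\<^sup>2 - 2 * Re \<langle>f, g\<rangle> + \<parallel>g\<parallel>\<^sup>2"
  using norm_add_sq[OF assms(1) L2_scale[OF assms(2)], of "-1"] norm_scale[of "-1" g]
    inner_scale_right[of f "-1" g] by simp

lemma norm_minus_commute_L2: "\<parallel>\<lambda>z. f z - g z\<parallel> = \<parallel>\<lambda>z. g z - f z\<parallel>"
  by (rule L2_norm_cong) (simp add: norm_minus_commute)

text \<open>
  Expand the square of the norm of \<open>\<parallel>g\<parallel> f - \<parallel>f\<parallel>
  g\<close>.
\<close>

lemma Re_inner_le:
  assumes "f \<in> L2 \<Omega>" "g \<in> L2 \<Omega>"
  shows "Re \<langle>f, g\<rangle> \<le> \<parallel>f\<parallel> * \<parallel>g\<parallel>"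
proof -
  have sc: "norm (complex_of_real \<parallel>h\<parallel>) = \<parallel>h\<parallel>" for h by simp
  have in1: "(\<lambda>z. of_real \<parallel>g\<parallel> * f z) \<in> L2 \<Omega>" "(\<lambda>z. of_real \<parallel>f\<parallel> * g z) \<in> L2 \<Omega>"
    using assms L2_scale by auto
  have "0 \<le> \<parallel>\<lambda>z. of_real \<parallel>g\<parallel> * f z - of_real \<parallel>f\<parallel> * g z\<parallel>\<^sup>2" by simp
  also have "\<dots> = 2 * (\<parallel>f\<parallel> * \<parallel>g\<parallel>) * (\<parallel>f\<parallel> * \<parallel>g\<parallel> - Re \<langle>f, g\<rangle>)"
    unfolding norm_diff_sq[OF in1] norm_scale inner_scale_left inner_scale_right
    by (simp add: power2_eq_square algebra_simps)
  finally have *: "0 \<le> (\<parallel>f\<parallel> * \<parallel>g\<parallel>) * (\<parallel>f\<parallel> * \<parallel>g\<parallel> - Re \<langle>f, g\<rangle>)" by simp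
  show ?thesis
  proof (cases "\<parallel>f\<parallel> * \<parallel>g\<parallel> = 0")
    case False
    hence "\<parallel>f\<parallel> * \<parallel>g\<parallel> > 0" by (simp add: order_less_le)
    with * show ?thesis by (simp add: zero_le_mult_iff)
  next
    case True
    \<comment> \<open>one of the norms vanishes; scaling by a large real then forces the inner product down to \<open>0\<close>\<close>
    have ex: "Re \<langle>f, g\<rangle> \<le> 0" if "f \<in> L2 \<Omega>" "g \<in> L2 \<Omega>" "\<parallel>f\<parallel> = 0" for f g
    proof (rule ccontr)
      assume "\<not> Re \<langle>f, g\<rangle> \<le> 0"
      hence pos: "Re \<langle>f, g\<rangle> > 0" by simp
      define t where "t = (\<parallel>g\<parallel>\<^sup>2 + 1) / (2 * Re \<langle>f, g\<rangle>)"
      have "0 \<le> \<parallel>\<lambda>z. of_real t * f z - g z\<parallel>\<^sup>2" by simp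
      also have "\<dots> = \<parallel>g\<parallel>\<^sup>2 - 2 * t * Re \<langle>f, g\<rangle>"
        unfolding norm_diff_sq[OF L2_scale[OF that(1)] that(2)] norm_scale inner_scale_left
        using that(3) by simp
      also have "\<dots> = -1" using pos by (simp add: t_def field_simps)
      finally show False by simp
    qed
    from True consider "\<parallel>f\<parallel> = 0" | "\<parallel>g\<parallel> = 0" by auto
    hence "Re \<langle>f, g\<rangle> \<le> 0"
      using ex[OF assms] ex[OF assms(2,1)] inner_cnj[of f g] by cases auto
    thus ?thesis unfolding True .
  qed
qed

lemma cauchy_schwarz:
  assumes "f \<in> L2 \<Omega>" "g \<in> L2 \<Omega>"
  shows "norm \<langle>f, g\<rangle> \<le> \<parallel>f\<parallel> * \<parallel>g\<parallel>"
proof (cases "\<langle>f, g\<rangle> = 0")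
  case False
  define c where "c = cnj (sgn \<langle>f, g\<rangle>)"
  have c: "norm c = 1" using False by (simp add: c_def norm_sgn)
  have "c * \<langle>f, g\<rangle> = of_real (norm \<langle>f, g\<rangle>)"
    using False complex_norm_square[of "\<langle>f, g\<rangle>"] unfolding c_def
    by (simp add: sgn_eq divide_simps power2_eq_square mult.commute)
  hence "norm \<langle>f, g\<rangle> = Re \<langle>\<lambda>z. c * f z, g\<rangle>"
    by (simp add: inner_scale_left)
  also have "\<dots> \<le> \<parallel>\<lambda>z. c * f z\<parallel> * \<parallel>g\<parallel>"
    by (rule Re_inner_le[OF L2_scale[OF assms(1)] assms(2)])
  finally show ?thesis using c by (simp add: norm_scale)
qed simp

lemma norm_triangle_L2:
  assumes "f \<in> L2 \<Omega>" "g \<in> L2 \<Omega>"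
  shows "\<parallel>\<lambda>z. f z + g z\<parallel> \<le> \<parallel>f\<parallel> + \<parallel>g\<parallel>"
proof -
  have "\<parallel>\<lambda>z. f z + g z\<parallel>\<^sup>2 \<le> (\<parallel>f\<parallel> + \<parallel>g\<parallel>)\<^sup>2"
    unfolding norm_add_sq[OF assms] using Re_inner_le[OF assms]
    by (simp add: power2_eq_square algebra_simps)
  thus ?thesis by (simp add: power2_le_iff_abs_le)
qed

lemma norm_diff_triangle_L2:
  assumes "f \<in> L2 \<Omega>" "g \<in> L2 \<Omega>" "h \<in> L2 \<Omega>"
  shows "\<parallel>\<lambda>z. f z - h z\<parallel> \<le> \<parallel>\<lambda>z. f z - g z\<parallel> + \<parallel>\<lambda>z. g z - h z\<parallel>"
  using norm_triangle_L2[OF L2_diff[OF assms(1,2)] L2_diff[OF assms(2,3)]] by simp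

lemma norm_le_add_diff_L2:
  assumes "f \<in> L2 \<Omega>" "g \<in> L2 \<Omega>"
  shows "\<parallel>f\<parallel> \<le> \<parallel>g\<parallel> + \<parallel>\<lambda>z. f z - g z\<parallel>"
  using norm_triangle_L2[OF assms(2) L2_diff[OF assms]] by simp

lemma norm_sq_nn:
  assumes "f \<in> L2 \<Omega>"
  shows "ennreal (\<parallel>f\<parallel>\<^sup>2) = (\<integral>\<^sup>+z. ennreal ((norm (f z))\<^sup>2) \<partial>dM)"
  unfolding L2_norm_sq using assms by (subst nn_integral_eq_integral) (auto simp: L2_iff)

lemma L2_of_nn_bound:
  assumes "f \<in> borel_measurable dM" "(\<integral>\<^sup>+z. ennreal ((norm (f z))\<^sup>2) \<partial>dM) \<le> ennreal (B\<^sup>2)" "B \<ge> 0"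
  shows "f \<in> L2 \<Omega>" "\<parallel>f\<parallel> \<le> B"
proof -
  have "integrable dM (\<lambda>z. (norm (f z))\<^sup>2)"
    using assms by (intro integrableI_nonneg) (auto simp: order_le_less_trans)
  thus "f \<in> L2 \<Omega>" using assms by (simp add: L2_iff)
  from norm_sq_nn[OF this] assms(2) have "\<parallel>f\<parallel>\<^sup>2 \<le> B\<^sup>2"
    by (metis ennreal_le_iff zero_le_power2)
  thus "\<parallel>f\<parallel> \<le> B" using assms(3) by (simp add: power2_le_iff_abs_le)
qed

lemma nn_integral_dM:
  assumes "f \<in> borel_measurable borel"
  shows "(\<integral>\<^sup>+z. f z \<partial>dM) = (\<integral>\<^sup>+z. f z * indicator \<Omega> z \<partial>lborel)"
  using assms by (subst nn_integral_restrict_space) (auto simp: nn_integral_completion)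

end

section \<open>Discrete Cauchy formulas and circle averages\<close>

definition unit_root :: "nat \<Rightarrow> nat \<Rightarrow> complex" where
  "unit_root N m = cis (2 * pi * real m / real N)"

lemma norm_root1 [simp]: "norm (unit_root N m) = 1"
  by (simp add: unit_root_def)

lemma unit_root_power_commute: "unit_root N m ^ j = unit_root N j ^ m"
  by (simp add: unit_root_def Complex.DeMoivre mult_ac)

lemma unit_root_power_N: "N > 0 \<Longrightarrow> unit_root N m ^ N = 1"
  by (simp add: unit_root_def Complex.DeMoivre)

lemma unit_root_inj: "j < N \<Longrightarrow> k < N \<Longrightarrow> unit_root N j = unit_root N k \<longleftrightarrow> j = k"
  unfolding unit_root_def
  using inj_on_eq_iff[OF bij_betw_imp_inj_on[OF Complex.bij_betw_roots_unity[of N]], of j k] by simp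

text \<open>
  The characters of a finite cyclic group are orthogonal: the sum is geometric with a ratio that
  is an \<open>N\<close>-th root of unity.
\<close>

lemma unit_root_orthogonality:
  assumes "j < N" "k < N"
  shows "(\<Sum>m<N. cnj (unit_root N m) ^ k * unit_root N m ^ j) = (if j = k then of_nat N else 0)"
proof -
  \<comment> \<open>the ratio of the geometric sum\<close>
  define w where "w = cnj (unit_root N k) * unit_root N j"
  have cu: "cnj (unit_root N k) * unit_root N k = 1"
    using complex_norm_square[of "unit_root N k"] by (simp add: mult.commute)
  have eq: "(\<Sum>m<N. cnj (unit_root N m) ^ k * unit_root N m ^ j) = (\<Sum>m<N. w ^ m)"
    unfolding w_def by (intro sum.cong refl)
      (simp add: power_mult_distrib unit_root_power_commute[of N _ j] unit_root_power_commute[of N _ k]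
        flip: complex_cnj_power)
  show ?thesis
  proof (cases "j = k")
    case True
    with cu show ?thesis unfolding eq by (simp add: w_def)
  next
    case False
    have "w \<noteq> 1"
    proof
      assume "w = 1"
      have "unit_root N k * w = (cnj (unit_root N k) * unit_root N k) * unit_root N j"
        by (simp add: w_def mult_ac)
      hence "unit_root N j = unit_root N k" using cu \<open>w = 1\<close> by simp
      with False show False using unit_root_inj[OF assms] by simp
    qed
    moreover have "w ^ N = 1"
      using assms unit_root_power_N[of N k] unit_root_power_N[of N j]
      by (simp add: w_def power_mult_distrib flip: complex_cnj_power)
    ultimately show ?thesis unfolding eq using False by (simp add: geometric_sum)
  qed
qed

definition taylor_coeff :: "(complex \<Rightarrow> complex) \<Rightarrow> nat \<Rightarrow> complex" where
  "taylor_coeff g k = (deriv ^^ k) g 0 / fact k"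

lemma taylor_coeff_sums:
  assumes "g holomorphic_on ball 0 R" "norm z < R"
  shows "(\<lambda>k. taylor_coeff g k * z ^ k) sums g z"
  using holomorphic_power_series[OF assms(1), of z] assms(2) by (simp add: taylor_coeff_def)

lemma taylor_coeff_bound:
  assumes "g holomorphic_on ball 0 R" "0 < r" "r < R" "\<And>z. norm z \<le> r \<Longrightarrow> norm (g z) \<le> B"
  shows "norm (taylor_coeff g k) \<le> B / r ^ k"
proof -
  have "norm ((deriv ^^ k) g 0) \<le> fact k * B / r ^ k"
  proof (rule Cauchy_inequality)
    show "g holomorphic_on ball 0 r"
      using assms by (auto intro: holomorphic_on_subset)
    show "continuous_on (cball 0 r) g"
      using assms by (auto intro!: holomorphic_on_imp_continuous_on intro: holomorphic_on_subset)
  qed (use assms in auto)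
  hence "norm ((deriv ^^ k) g 0) / fact k \<le> (fact k * B / r ^ k) / fact k"
    by (intro divide_right_mono) auto
  thus ?thesis
    by (simp add: taylor_coeff_def norm_divide)
qed

text \<open>
  Averaging against a character over the \<open>N\<close>-th roots of unity reads off a Taylor
  coefficient exactly for polynomials of degree below \<open>N\<close>; the error is the tail of
  the series, which Cauchy's estimates make geometrically small. This replaces the Cauchy
  integral: finite sums pass through holomorphy and through the triangle inequality in
  \<open>L\<^sup>2\<close> at once.
\<close>

lemma discrete_cauchy:
  assumes g: "g holomorphic_on ball 0 R" and r: "r < R" and t: "0 < t" "t < r"
    and B: "\<And>z. norm z \<le> r \<Longrightarrow> norm (g z) \<le> B" and k: "k < N"
  shows "norm ((\<Sum>m<N. cnj (unit_root N m) ^ k * g (of_real t * unit_root N m)) / of_nat N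
            - taylor_coeff g k * of_real t ^ k) \<le> B * (t / r) ^ N / (1 - t / r)"
proof -
  have r0: "r > 0" using t by simp
  have B0: "B \<ge> 0" using B[of 0] r0 norm_ge_zero[of "g 0"] by (simp del: norm_ge_zero)
  define a where "a = taylor_coeff g"
  define tail where "tail z = g z - (\<Sum>j<N. a j * z ^ j)" for z
  have q: "norm (t / r) < 1" using t r0 by simp
  have tail: "norm (tail z) \<le> B * (t / r) ^ N / (1 - t / r)" if "norm z = t" for z
  proof -
    have "(\<lambda>j. a j * z ^ j) sums g z"
      unfolding a_def by (rule taylor_coeff_sums[OF g]) (use that t r in simp)
    hence s: "(\<lambda>j. a (j + N) * z ^ (j + N)) sums tail z"
      unfolding tail_def by (rule sums_split_initial_segment)
    have gs: "(\<lambda>j. B * (t / r) ^ N * (t / r) ^ j) sums (B * (t / r) ^ N * (1 / (1 - t / r)))"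
      by (intro sums_mult geometric_sums q)
    have bd: "norm (a (j + N) * z ^ (j + N)) \<le> B * (t / r) ^ N * (t / r) ^ j" for j
    proof -
      have "norm (a (j + N)) * t ^ (j + N) \<le> B / r ^ (j + N) * t ^ (j + N)"
        unfolding a_def using t r0
        by (intro mult_right_mono taylor_coeff_bound[OF g r0 r B]) auto
      also have "\<dots> = B * (t / r) ^ N * (t / r) ^ j"
        by (simp add: power_add power_divide mult_ac)
      finally show ?thesis by (simp add: norm_mult norm_power that)
    qed
    have "norm (tail z) \<le> (\<Sum>j. norm (a (j + N) * z ^ (j + N)))"
      unfolding sums_unique[OF s]
      by (intro summable_norm summable_comparison_test'[OF sums_summable[OF gs], of 0])
         (use bd in auto)
    also have "\<dots> \<le> (\<Sum>j. B * (t / r) ^ N * (t / r) ^ j)"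
      using bd by (intro suminf_le sums_summable[OF gs]
          summable_comparison_test'[OF sums_summable[OF gs], of 0]) auto
    also have "\<dots> = B * (t / r) ^ N / (1 - t / r)"
      using sums_unique[OF gs] by simp
    finally show ?thesis .
  qed
  have N: "N > 0" using k by simp
  have "(\<Sum>m<N. cnj (unit_root N m) ^ k * g (of_real t * unit_root N m))
      = (\<Sum>m<N. (\<Sum>j<N. a j * of_real t ^ j * (cnj (unit_root N m) ^ k * unit_root N m ^ j))
          + cnj (unit_root N m) ^ k * tail (of_real t * unit_root N m))"
    by (intro sum.cong refl)
       (simp add: tail_def algebra_simps sum_distrib_left power_mult_distrib)
  also have "\<dots> = (\<Sum>j<N. a j * of_real t ^ j * (\<Sum>m<N. cnj (unit_root N m) ^ k * unit_root N m ^ j))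
          + (\<Sum>m<N. cnj (unit_root N m) ^ k * tail (of_real t * unit_root N m))"
    unfolding sum.distrib by (subst sum.swap) (simp add: sum_distrib_left)
  also have "(\<Sum>j<N. a j * of_real t ^ j * (\<Sum>m<N. cnj (unit_root N m) ^ k * unit_root N m ^ j))
      = (\<Sum>j<N. if j = k then a j * of_real t ^ j * of_nat N else 0)"
    using k by (intro sum.cong refl) (simp add: unit_root_orthogonality)
  also have "\<dots> = a k * of_real t ^ k * of_nat N"
    using k by simp
  finally have "(\<Sum>m<N. cnj (unit_root N m) ^ k * g (of_real t * unit_root N m)) / of_nat N
        - a k * of_real t ^ k = (\<Sum>m<N. cnj (unit_root N m) ^ k * tail (of_real t * unit_root N m)) / of_nat N"
    using N by (simp add: field_simps)
  also have "norm \<dots> \<le> (\<Sum>m<N. B * (t / r) ^ N / (1 - t / r)) / of_nat N"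
    unfolding norm_divide norm_of_nat
  proof (intro divide_right_mono order_trans[OF norm_sum] sum_mono)
    fix m
    have "norm (tail (of_real t * unit_root N m)) \<le> B * (t / r) ^ N / (1 - t / r)"
      using t by (intro tail) (simp add: norm_mult)
    thus "norm (cnj (unit_root N m) ^ k * tail (of_real t * unit_root N m)) \<le> B * (t / r) ^ N / (1 - t / r)"
      by (simp add: norm_mult norm_power)
  qed simp
  also have "\<dots> = B * (t / r) ^ N / (1 - t / r)" using N by simp
  finally show ?thesis unfolding a_def .
qed

lemma discrete_cauchy_tendsto:
  assumes g: "g holomorphic_on ball 0 R" and t: "0 < t" "t < R"
  shows "(\<lambda>N. (\<Sum>m<N. cnj (unit_root N m) ^ k * g (of_real t * unit_root N m)) / of_nat N)
           \<longlonglongrightarrow> taylor_coeff g k * of_real t ^ k"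
proof -
  define r where "r = (t + R) / 2"
  have r: "t < r" "r < R" "0 < r" using t by (auto simp: r_def)
  have "bounded (g ` cball 0 r)"
    using r by (intro compact_imp_bounded compact_continuous_image
        holomorphic_on_imp_continuous_on holomorphic_on_subset[OF g]) auto
  then obtain B where B: "\<And>z. norm z \<le> r \<Longrightarrow> norm (g z) \<le> B"
    by (force simp: bounded_iff)
  have "(\<lambda>N. B * (t / r) ^ N / (1 - t / r)) \<longlonglongrightarrow> B * 0 / (1 - t / r)"
    using r t by (intro tendsto_intros LIMSEQ_realpow_zero) auto
  hence "(\<lambda>N. B * (t / r) ^ N / (1 - t / r)) \<longlonglongrightarrow> 0" by simp
  hence "(\<lambda>N. (\<Sum>m<N. cnj (unit_root N m) ^ k * g (of_real t * unit_root N m)) / of_nat N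
            - taylor_coeff g k * of_real t ^ k) \<longlonglongrightarrow> 0"
    by (rule Lim_null_comparison[rotated])
       (use discrete_cauchy[OF g r(2) t(1) r(1) B, of k] in
         \<open>auto intro!: eventually_sequentiallyI[of "Suc k"]\<close>)
  thus ?thesis by (simp add: LIM_zero_iff)
qed

text \<open>
  Averages over rotated copies of \<open>F\<close> have at most the
  \<open>L\<^sup>2\<close>-norm of \<open>F\<close>, since rotations preserve the measure and
  squaring is convex; Fatou's lemma passes to the limit. It yields the mean value inequality and
  the contractivity of the projection onto homogeneous parts.
\<close>

lemma nn_integral_circle_average:
  fixes F :: "complex ^ 2 \<Rightarrow> complex" and \<xi> :: "nat \<Rightarrow> nat \<Rightarrow> complex ^ 2"
  assumes F [measurable]: "F \<in> borel_measurable borel"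
    and \<xi>: "\<And>N m k. norm (\<xi> N m $ k) = 1" and c: "\<And>N m. norm (c N m) = 1"
    and lim: "\<And>u. (\<lambda>N. (\<Sum>m<N. c N m * F (\<chi> k. \<xi> N m $ k * u $ k)) / of_nat N) \<longlonglongrightarrow> h u"
  shows "(\<integral>\<^sup>+u. ennreal ((norm (h u))\<^sup>2) \<partial>lborel) \<le> (\<integral>\<^sup>+u. ennreal ((norm (F u))\<^sup>2) \<partial>lborel)"
proof -
  define A where "A N u = (\<Sum>m<N. c N m * F (\<chi> k. \<xi> N m $ k * u $ k)) / of_nat N" for N u
  have [measurable]: "(\<lambda>u :: complex ^ 2. \<chi> k. \<xi> N m $ k * u $ k) \<in> borel_measurable borel" for N m
    by (rule borel_measurable_continuous_onI) (intro continuous_intros)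
  have [measurable]: "A N \<in> borel_measurable borel" for N
    unfolding A_def by measurable
  have A: "(\<integral>\<^sup>+u. ennreal ((norm (A N u))\<^sup>2) \<partial>lborel) \<le> (\<integral>\<^sup>+u. ennreal ((norm (F u))\<^sup>2) \<partial>lborel)" for N
  proof (cases "N = 0")
    case False
    have pt: "(norm (A N u))\<^sup>2 \<le> (\<Sum>m<N. (norm (F (\<chi> k. \<xi> N m $ k * u $ k)))\<^sup>2 / real N)" for u
    proof -
      have "norm (A N u) \<le> (\<Sum>m<N. norm (F (\<chi> k. \<xi> N m $ k * u $ k))) / real N"
        unfolding A_def norm_divide norm_of_nat
        by (intro divide_right_mono order_trans[OF norm_sum]) (auto simp: norm_mult c)
      hence "(norm (A N u))\<^sup>2 \<le> ((\<Sum>m<N. norm (F (\<chi> k. \<xi> N m $ k * u $ k))) / real N)\<^sup>2"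
        by (intro power_mono) auto
      also have "\<dots> \<le> ((\<Sum>m<N. (norm (F (\<chi> k. \<xi> N m $ k * u $ k)))\<^sup>2) * real N) / (real N)\<^sup>2"
        unfolding power_divide
        using sum_squared_le_sum_of_squares[of "\<lambda>m. norm (F (\<chi> k. \<xi> N m $ k * u $ k))" "{..<N}"]
        by (intro divide_right_mono) auto
      also have "\<dots> = (\<Sum>m<N. (norm (F (\<chi> k. \<xi> N m $ k * u $ k)))\<^sup>2 / real N)"
        using False by (simp add: power2_eq_square sum_divide_distrib)
      finally show ?thesis .
    qed
    have "(\<integral>\<^sup>+u. ennreal ((norm (A N u))\<^sup>2) \<partial>lborel)
        \<le> (\<integral>\<^sup>+u. (\<Sum>m<N. ennreal ((norm (F (\<chi> k. \<xi> N m $ k * u $ k)))\<^sup>2 / real N)) \<partial>lborel)"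
      using pt by (intro nn_integral_mono) (auto simp: sum_ennreal intro!: ennreal_leI)
    also have "\<dots> = (\<Sum>m<N. \<integral>\<^sup>+u. ennreal ((norm (F (\<chi> k. \<xi> N m $ k * u $ k)))\<^sup>2 / real N) \<partial>lborel)"
      by (rule nn_integral_sum) measurable
    also have "\<dots> = (\<Sum>m<N. \<integral>\<^sup>+u. ennreal ((norm (F u))\<^sup>2 / real N) \<partial>lborel)"
    proof (rule sum.cong[OF refl])
      fix m
      show "(\<integral>\<^sup>+u. ennreal ((norm (F (\<chi> k. \<xi> N m $ k * u $ k)))\<^sup>2 / real N) \<partial>lborel)
        = (\<integral>\<^sup>+u. ennreal ((norm (F u))\<^sup>2 / real N) \<partial>lborel)"
        by (rule nn_integral_torus_rotation[OF \<xi>, where f = "\<lambda>u. ennreal ((norm (F u))\<^sup>2 / real N)"])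
           measurable
    qed
    also have "\<dots> = (\<integral>\<^sup>+u. (\<Sum>m<N. ennreal ((norm (F u))\<^sup>2 / real N)) \<partial>lborel)"
      by (rule nn_integral_sum[symmetric]) measurable
    also have "\<dots> = (\<integral>\<^sup>+u. ennreal ((norm (F u))\<^sup>2) \<partial>lborel)"
      using False by (intro nn_integral_cong, subst sum_ennreal) auto
    finally show ?thesis .
  qed (simp add: A_def)
  have "(\<integral>\<^sup>+u. ennreal ((norm (h u))\<^sup>2) \<partial>lborel)
      = (\<integral>\<^sup>+u. liminf (\<lambda>N. ennreal ((norm (A N u))\<^sup>2)) \<partial>lborel)"
  proof (rule nn_integral_cong)
    fix u
    have "(\<lambda>N. ennreal ((norm (A N u))\<^sup>2)) \<longlonglongrightarrow> ennreal ((norm (h u))\<^sup>2)"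
      using lim[of u] unfolding A_def by (intro tendsto_ennrealI tendsto_intros)
    from lim_imp_Liminf[OF sequentially_bot this]
    show "ennreal ((norm (h u))\<^sup>2) = liminf (\<lambda>N. ennreal ((norm (A N u))\<^sup>2))"
      by simp
  qed
  also have "\<dots> \<le> liminf (\<lambda>N. \<integral>\<^sup>+u. ennreal ((norm (A N u))\<^sup>2) \<partial>lborel)"
    by (rule nn_integral_liminf) measurable
  also have "\<dots> \<le> limsup (\<lambda>N. \<integral>\<^sup>+u. ennreal ((norm (A N u))\<^sup>2) \<partial>lborel)"
    by (rule Liminf_le_Limsup) simp
  also have "\<dots> \<le> (\<integral>\<^sup>+u. ennreal ((norm (F u))\<^sup>2) \<partial>lborel)"
    using A by (intro Limsup_bounded) auto
  finally show ?thesis .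
qed

section \<open>Holomorphic functions of several variables\<close>

lemma norm_smult_complex: "norm (c *s (v :: complex ^ 'n)) = norm c * norm v"
  by (simp add: norm_vec_def norm_mult L2_set_right_distrib)

lemma bounded_linear_smult_left: "bounded_linear (\<lambda>c. c *s (v :: complex ^ 'n))"
proof (rule bounded_linear_intro[where K = "norm v"])
  show "(b + c) *s v = b *s v + c *s v" for b c by (simp add: vec_eq_iff algebra_simps)
  show "(r *\<^sub>R b) *s v = r *\<^sub>R (b *s v)" for r b by (simp add: vec_eq_iff scaleR_conv_of_real[where 'a = complex])
  show "norm (b *s v) \<le> norm b * norm v" for b by (simp add: norm_smult_complex)
qed

lemma holo_on_derivE:
  assumes "holo_on f U" "z \<in> U"
  obtains D where "(f has_derivative D) (at z)" "\<And>c v. D (c *s v) = c * D v"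
  using assms unfolding holo_on_def by blast

lemma holo_on_continuous: "holo_on f U \<Longrightarrow> continuous_on U f"
  unfolding holo_on_def
  by (meson continuous_at_imp_continuous_on has_derivative_continuous)

lemma holo_on_cong:
  assumes "holo_on f U" "open U" "\<And>z. z \<in> U \<Longrightarrow> f z = g z"
  shows "holo_on g U"
  unfolding holo_on_def
proof
  fix z assume z: "z \<in> U"
  then obtain D where D: "(f has_derivative D) (at z)" "\<And>c v. D (c *s v) = c * D v"
    using holo_on_derivE[OF assms(1) z] by blast
  have "(g has_derivative D) (at z)"
    by (rule has_derivative_transform_within_open[OF D(1) assms(2) z assms(3)])
  thus "\<exists>D. (g has_derivative D) (at z) \<and> (\<forall>c v. D (c *s v) = c * D v)"
    using D(2) by blast
qed

lemma holo_on_const: "holo_on (\<lambda>z. c) U"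
  unfolding holo_on_def by (intro ballI exI[of _ "\<lambda>v. 0"]) auto

lemma holo_on_coord: "holo_on (\<lambda>z. z $ i) U"
  unfolding holo_on_def
  by (intro ballI exI[of _ "\<lambda>v. v $ i"])
     (auto intro!: bounded_linear_imp_has_derivative bounded_linear_vec_nth)

lemma holo_on_add:
  assumes "holo_on f U" "holo_on g U"
  shows "holo_on (\<lambda>z. f z + g z) U"
  unfolding holo_on_def
proof
  fix z assume z: "z \<in> U"
  obtain D where D: "(f has_derivative D) (at z)" "\<And>c v. D (c *s v) = c * D v"
    using holo_on_derivE[OF assms(1) z] by blast
  obtain E where E: "(g has_derivative E) (at z)" "\<And>c v. E (c *s v) = c * E v"
    using holo_on_derivE[OF assms(2) z] by blast
  show "\<exists>D. ((\<lambda>z. f z + g z) has_derivative D) (at z) \<and> (\<forall>c v. D (c *s v) = c * D v)"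
    by (intro exI[of _ "\<lambda>v. D v + E v"] conjI has_derivative_add D E)
       (simp add: D E algebra_simps)
qed

lemma holo_on_mult:
  assumes "holo_on f U" "holo_on g U"
  shows "holo_on (\<lambda>z. f z * g z) U"
  unfolding holo_on_def
proof
  fix z assume z: "z \<in> U"
  obtain D where D: "(f has_derivative D) (at z)" "\<And>c v. D (c *s v) = c * D v"
    using holo_on_derivE[OF assms(1) z] by blast
  obtain E where E: "(g has_derivative E) (at z)" "\<And>c v. E (c *s v) = c * E v"
    using holo_on_derivE[OF assms(2) z] by blast
  show "\<exists>D. ((\<lambda>z. f z * g z) has_derivative D) (at z) \<and> (\<forall>c v. D (c *s v) = c * D v)"
    by (intro exI[of _ "\<lambda>v. f z * E v + D v * g z"] conjI has_derivative_mult D E)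
       (simp add: D E algebra_simps)
qed

lemma holo_on_scale: "holo_on f U \<Longrightarrow> holo_on (\<lambda>z. c * f z) U"
  by (intro holo_on_mult holo_on_const)

lemma holo_on_diff: "holo_on f U \<Longrightarrow> holo_on g U \<Longrightarrow> holo_on (\<lambda>z. f z - g z) U"
  using holo_on_add[of f U "\<lambda>z. (-1) * g z"] holo_on_scale[of g U "-1"] by simp

lemma holo_on_sum: "(\<And>k. k \<in> K \<Longrightarrow> holo_on (f k) U) \<Longrightarrow> holo_on (\<lambda>z. \<Sum>k\<in>K. f k z) U"
  by (induction K rule: infinite_finite_induct) (auto intro: holo_on_const holo_on_add)

lemma holo_on_power: "holo_on f U \<Longrightarrow> holo_on (\<lambda>z. f z ^ n) U"
  by (induction n) (auto intro: holo_on_const holo_on_mult)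

lemma holo_on_compose_affine:
  assumes f: "holo_on f U" and L: "bounded_linear L" "\<And>c v. L (c *s v) = c *s L v"
    and V: "\<And>z. z \<in> V \<Longrightarrow> a + L z \<in> U"
  shows "holo_on (\<lambda>z. f (a + L z)) V"
  unfolding holo_on_def
proof
  fix z assume z: "z \<in> V"
  obtain D where D: "(f has_derivative D) (at (a + L z))" "\<And>c v. D (c *s v) = c * D v"
    using holo_on_derivE[OF f V[OF z]] by blast
  have "((\<lambda>z. a + L z) has_derivative L) (at z)"
    using has_derivative_add[OF has_derivative_const bounded_linear_imp_has_derivative[OF L(1)],
        of a "at z"]
    by simp
  from has_derivative_compose[OF this D(1)]
  show "\<exists>D. ((\<lambda>z. f (a + L z)) has_derivative D) (at z) \<and> (\<forall>c v. D (c *s v) = c * D v)"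
    by (intro exI[of _ "\<lambda>v. D (L v)"]) (simp add: D L)
qed

lemma holo_on_line_deriv:
  fixes f :: "complex ^ 'n \<Rightarrow> complex"
  assumes "(f has_derivative D) (at (a + \<zeta> *s v))" "\<And>c v. D (c *s v) = c * D v"
  shows "((\<lambda>\<zeta>. f (a + \<zeta> *s v)) has_field_derivative D v) (at \<zeta>)"
proof -
  have "((\<lambda>\<zeta>. \<zeta> *s v) has_derivative (\<lambda>\<zeta>. \<zeta> *s v)) (at \<zeta>)"
    by (rule bounded_linear_imp_has_derivative[OF bounded_linear_smult_left])
  from has_derivative_add[OF has_derivative_const this, of a]
  have "((\<lambda>\<zeta>. a + \<zeta> *s v) has_derivative (\<lambda>\<zeta>. \<zeta> *s v)) (at \<zeta>)"
    by simp
  from has_derivative_compose[OF this assms(1)]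
  show ?thesis
    by (simp add: has_field_derivative_def assms(2) mult.commute[of _ "D v"])
qed

lemma holo_on_line:
  assumes "holo_on f U" "\<And>\<zeta>. \<zeta> \<in> S \<Longrightarrow> a + \<zeta> *s v \<in> U"
  shows "(\<lambda>\<zeta>. f (a + \<zeta> *s v)) holomorphic_on S"
proof (rule holomorphic_onI)
  fix \<zeta> assume "\<zeta> \<in> S"
  then obtain D where "(f has_derivative D) (at (a + \<zeta> *s v))" "\<And>c v. D (c *s v) = c * D v"
    using holo_on_derivE[OF assms(1) assms(2)] by metis
  from holo_on_line_deriv[OF this]
  show "(\<lambda>\<zeta>. f (a + \<zeta> *s v)) field_differentiable at \<zeta> within S"
    using field_differentiable_at_within field_differentiable_def by blast
qed

text \<open>
  Cauchy's estimate on the complex line through \<open>x\<close> in the direction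
  \<open>v\<close>.
\<close>

lemma holo_deriv_bound:
  fixes f :: "complex ^ 'n \<Rightarrow> complex"
  assumes f: "holo_on f U" and \<rho>: "\<rho> > 0" "ball x \<rho> \<subseteq> U"
    and B: "\<And>y. y \<in> ball x \<rho> \<Longrightarrow> norm (f y) \<le> B"
    and D: "(f has_derivative D) (at x)" "\<And>c v. D (c *s v) = c * D v"
  shows "norm (D v) \<le> 2 * B / \<rho> * norm v"
proof (cases "v = 0")
  case True
  have "D (0 *s v) = 0" by (subst D(2)) simp
  thus ?thesis using True by simp
next
  case False
  define R where "R = \<rho> / (2 * norm v)"
  have R: "R > 0" using False \<rho> by (simp add: R_def)
  have in_ball: "x + \<zeta> *s v \<in> ball x \<rho>" if "norm \<zeta> \<le> R" for \<zeta>
  proof -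
    have "norm \<zeta> * norm v \<le> R * norm v" using that by (intro mult_right_mono) auto
    also have "\<dots> < \<rho>" using False \<rho> by (simp add: R_def)
    finally show ?thesis by (simp add: dist_norm norm_smult_complex)
  qed
  define g where "g \<zeta> = f (x + \<zeta> *s v)" for \<zeta>
  have hol: "g holomorphic_on cball 0 R"
    unfolding g_def using in_ball \<rho>(2) by (intro holo_on_line[OF f]) auto
  have "norm ((deriv ^^ 1) g 0) \<le> fact 1 * B / R ^ 1"
  proof (rule Cauchy_inequality)
    show "g holomorphic_on ball 0 R"
      using hol by (rule holomorphic_on_subset) auto
    show "continuous_on (cball 0 R) g"
      using hol by (rule holomorphic_on_imp_continuous_on)
    show "norm (g z) \<le> B" if "norm (0 - z) = R" for z
      unfolding g_def using that by (intro B in_ball) auto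
  qed (rule R)
  moreover have "deriv g 0 = D v"
    unfolding g_def by (rule DERIV_imp_deriv, rule holo_on_line_deriv) (use D in auto)
  ultimately show ?thesis using False by (simp add: R_def field_simps)
qed

text \<open>
  By \<open>holo_deriv_bound\<close> uniform convergence of the functions forces uniform
  convergence of the derivatives on a smaller ball, so the derivatives may be interchanged with
  the limit, and complex linearity survives.
\<close>

lemma holo_on_uniform_limit:
  fixes f :: "nat \<Rightarrow> complex ^ 'n \<Rightarrow> complex"
  assumes f: "\<And>n. holo_on (f n) U"
    and lim: "\<And>z. z \<in> U \<Longrightarrow> \<exists>r>0. ball z r \<subseteq> U \<and> uniform_limit (ball z r) f g sequentially"
  shows "holo_on g U"
  unfolding holo_on_def
proof
  fix z assume z: "z \<in> U"
  obtain r where r: "r > 0" "ball z r \<subseteq> U" "uniform_limit (ball z r) f g sequentially"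
    using lim[OF z] by blast
  have "\<exists>D. \<forall>n. \<forall>x\<in>U. (f n has_derivative D n x) (at x) \<and> (\<forall>c v. D n x (c *s v) = c * D n x v)"
    using f unfolding holo_on_def by metis
  then obtain D where D: "\<And>n x. x \<in> U \<Longrightarrow> (f n has_derivative D n x) (at x)"
      "\<And>n x c v. x \<in> U \<Longrightarrow> D n x (c *s v) = c * D n x v"
    by blast
  let ?S = "ball z (r / 2)"
  have SU: "?S \<subseteq> U" "?S \<subseteq> ball z r" using r by auto
  have sub: "ball x (r / 2) \<subseteq> ball z r" if "x \<in> ?S" for x
  proof
    fix y assume "y \<in> ball x (r / 2)"
    thus "y \<in> ball z r" using that dist_triangle[of z y x] by simp
  qed
  have cau: "\<exists>N. \<forall>m\<ge>N. \<forall>n\<ge>N. \<forall>x\<in>?S. \<forall>h. norm (D m x h - D n x h) \<le> e * norm h" if e: "e > 0" for e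
  proof -
    have "e * r / 8 > 0" using e r by simp
    then obtain N where N: "\<And>n y. n \<ge> N \<Longrightarrow> y \<in> ball z r \<Longrightarrow> dist (f n y) (g y) < e * r / 8"
      using r(3) unfolding uniform_limit_sequentially_iff by blast
    show ?thesis
    proof (intro exI allI impI ballI)
      fix m n x h assume mn: "m \<ge> N" "n \<ge> N" and x: "x \<in> ?S"
      have xU: "x \<in> U" using x SU by blast
      have "norm (D m x h - D n x h) \<le> 2 * (e * r / 4) / (r / 2) * norm h"
      proof (rule holo_deriv_bound[where f = "\<lambda>y. f m y - f n y" and U = U and x = x])
        show "holo_on (\<lambda>y. f m y - f n y) U" by (intro holo_on_diff f)
        show "ball x (r / 2) \<subseteq> U" using sub[OF x] r(2) by blast
        show "norm (f m y - f n y) \<le> e * r / 4" if "y \<in> ball x (r / 2)" for y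
        proof -
          have y: "y \<in> ball z r" using that sub[OF x] by blast
          have "norm (f m y - f n y) \<le> dist (f m y) (g y) + dist (f n y) (g y)"
            unfolding dist_norm[symmetric] by (rule dist_triangle2)
          thus ?thesis using N[OF mn(1) y] N[OF mn(2) y] by simp
        qed
        show "((\<lambda>y. f m y - f n y) has_derivative (\<lambda>h. D m x h - D n x h)) (at x)"
          by (intro has_derivative_diff D xU)
      qed (use r D(2)[OF xU] in \<open>auto simp: right_diff_distrib\<close>)
      also have "\<dots> = e * norm h" using r by simp
      finally show "norm (D m x h - D n x h) \<le> e * norm h" .
    qed
  qed
  define D' where "D' x h = lim (\<lambda>n. D n x h)" for x h
  have conv: "(\<lambda>n. D n x h) \<longlonglongrightarrow> D' x h" if x: "x \<in> ?S" for x h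
  proof -
    have "Cauchy (\<lambda>n. D n x h)"
    proof (rule metric_CauchyI)
      fix e :: real assume e: "e > 0"
      have "e / (norm h + 1) > 0" using e by (simp add: add_nonneg_pos)
      from cau[OF this] obtain N where N: "\<And>m n. m \<ge> N \<Longrightarrow> n \<ge> N \<Longrightarrow>
          norm (D m x h - D n x h) \<le> e / (norm h + 1) * norm h"
        using x by blast
      have "e / (norm h + 1) * norm h < e"
        using e by (simp add: divide_simps add_nonneg_pos)
      thus "\<exists>M. \<forall>m\<ge>M. \<forall>n\<ge>M. dist (D m x h) (D n x h) < e"
        using N unfolding dist_norm by (meson order_le_less_trans)
    qed
    thus ?thesis unfolding D'_def by (simp add: Cauchy_convergent_iff convergent_LIMSEQ_iff)
  qed
  have "\<exists>g0. \<forall>x\<in>?S. (\<lambda>n. f n x) \<longlonglongrightarrow> g0 x \<and> (g0 has_derivative D' x) (at x within ?S)"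
  proof (rule has_derivative_sequence)
    show "(f n has_derivative D n x) (at x within ?S)" if "x \<in> ?S" for n x
      using D(1) that SU by (meson has_derivative_at_withinI subsetD)
    show "\<forall>\<^sub>F n in sequentially. \<forall>x\<in>?S. \<forall>h. norm (D n x h - D' x h) \<le> e * norm h" if e: "e > 0" for e
    proof -
      obtain N where N: "\<And>m n x h. m \<ge> N \<Longrightarrow> n \<ge> N \<Longrightarrow> x \<in> ?S \<Longrightarrow> norm (D m x h - D n x h) \<le> e * norm h"
        using cau[OF e] by blast
      show ?thesis
      proof (rule eventually_sequentiallyI[of N], intro ballI allI)
        fix n x h assume n: "n \<ge> N" and x: "x \<in> ?S"
        have "(\<lambda>m. norm (D n x h - D m x h)) \<longlonglongrightarrow> norm (D n x h - D' x h)"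
          by (intro tendsto_intros conv x)
        thus "norm (D n x h - D' x h) \<le> e * norm h"
          by (rule LIMSEQ_le_const2) (use N n x in blast)
      qed
    qed
    show "z \<in> ?S" using r(1) by simp
    show "(\<lambda>n. f n z) \<longlonglongrightarrow> g z"
      using tendsto_uniform_limitI[OF r(3), of z] r by simp
  qed simp
  then obtain g0 where g0: "\<And>x. x \<in> ?S \<Longrightarrow> (\<lambda>n. f n x) \<longlonglongrightarrow> g0 x"
      "\<And>x. x \<in> ?S \<Longrightarrow> (g0 has_derivative D' x) (at x within ?S)"
    by blast
  have gg0: "g0 x = g x" if x: "x \<in> ?S" for x
    by (rule LIMSEQ_unique[OF g0(1)[OF x] tendsto_uniform_limitI[OF r(3)]]) (use x SU(2) in blast)
  have zS: "z \<in> ?S" using r(1) by simp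
  have "(g0 has_derivative D' z) (at z)"
    using g0(2)[OF zS] unfolding at_within_open[OF zS open_ball] .
  hence "(g has_derivative D' z) (at z)"
    by (rule has_derivative_transform_within_open[OF _ open_ball zS gg0])
  moreover have "D' z (c *s v) = c * D' z v" for c v
  proof (rule LIMSEQ_unique)
    show "(\<lambda>n. D n z (c *s v)) \<longlonglongrightarrow> D' z (c *s v)" by (rule conv[OF zS])
    show "(\<lambda>n. D n z (c *s v)) \<longlonglongrightarrow> c * D' z v"
      unfolding D(2)[OF z] by (intro tendsto_intros conv[OF zS])
  qed
  ultimately show "\<exists>D. (g has_derivative D) (at z) \<and> (\<forall>c v. D (c *s v) = c * D v)"
    by blast
qed

text \<open>
  The derivative bound, integrated along a segment; this is the equicontinuity behind Montel's
  theorem.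
\<close>

lemma holo_lipschitz:
  fixes f :: "complex ^ 'n \<Rightarrow> complex"
  assumes f: "holo_on f U" and r: "r > 0" "ball a r \<subseteq> U"
    and B: "\<And>y. y \<in> ball a r \<Longrightarrow> norm (f y) \<le> B" and y: "y \<in> ball a (r / 2)"
  shows "norm (f a - f y) \<le> 4 * B / r * norm (a - y)"
proof -
  have "\<exists>D. \<forall>x\<in>U. (f has_derivative D x) (at x) \<and> (\<forall>c v. D x (c *s v) = c * D x v)"
    using f unfolding holo_on_def by metis
  then obtain D where D: "\<And>x. x \<in> U \<Longrightarrow> (f has_derivative D x) (at x)"
      "\<And>x c v. x \<in> U \<Longrightarrow> D x (c *s v) = c * D x v"
    by blast
  have sub: "ball x (r / 2) \<subseteq> ball a r" if "x \<in> ball a (r / 2)" for x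
  proof
    fix y assume "y \<in> ball x (r / 2)"
    thus "y \<in> ball a r" using that dist_triangle[of a y x] by simp
  qed
  have xU: "x \<in> U" if "x \<in> ball a (r / 2)" for x
    using that r by auto
  have "norm (f a - f y) \<le> (2 * B / (r / 2)) * norm (a - y)"
  proof (rule differentiable_bound[where S = "ball a (r / 2)" and f' = D])
    show "(f has_derivative D x) (at x within ball a (r / 2))" if "x \<in> ball a (r / 2)" for x
      using D(1)[OF xU[OF that]] by (rule has_derivative_at_withinI)
    show "onorm (D x) \<le> 2 * B / (r / 2)" if x: "x \<in> ball a (r / 2)" for x
    proof (rule onorm_le)
      show "norm (D x v) \<le> 2 * B / (r / 2) * norm v" for v
      proof (rule holo_deriv_bound[OF f _ _ _ D(1) D(2)])
        show "ball x (r / 2) \<subseteq> U" using sub[OF x] r(2) by blast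
        show "norm (f y) \<le> B" if "y \<in> ball x (r / 2)" for y
          using sub[OF x] that by (intro B) blast
      qed (use r xU[OF x] in auto)
    qed
  qed (use r y in auto)
  thus ?thesis by simp
qed

text \<open>
  Local boundedness gives equicontinuity, so the Arzela-Ascoli theorem applies on each set of a
  compact exhaustion, and a diagonal subsequence works for all of them.
\<close>

theorem montel_several:
  fixes F :: "nat \<Rightarrow> complex ^ 'n \<Rightarrow> complex"
  assumes "open U" and F: "\<And>n. holo_on (F n) U"
    and bdd: "\<And>K. compact K \<Longrightarrow> K \<subseteq> U \<Longrightarrow> \<exists>B. \<forall>n. \<forall>z\<in>K. norm (F n z) \<le> B"
  obtains g r where "holo_on g U" "strict_mono (r :: nat \<Rightarrow> nat)"
    "\<And>z. z \<in> U \<Longrightarrow> (\<lambda>n. F (r n) z) \<longlonglongrightarrow> g z"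
proof -
  obtain K where comK: "\<And>n. compact (K n)" and KU: "\<And>n::nat. K n \<subseteq> U"
             and subK: "\<And>X. \<lbrakk>compact X; X \<subseteq> U\<rbrakk> \<Longrightarrow> \<exists>N. \<forall>n\<ge>N. X \<subseteq> K n"
    using open_Union_compact_subsets [OF \<open>open U\<close>] by metis
  have "\<exists>B. \<forall>i n. \<forall>z\<in>K i. norm (F n z) \<le> B i"
    using bdd[OF comK KU] by metis
  then obtain B where B: "\<And>i n z. z \<in> K i \<Longrightarrow> norm (F n z) \<le> B i" by blast
  define conv where "conv i G \<longleftrightarrow> (\<exists>g. \<forall>e>0. \<exists>N. \<forall>n\<ge>N. \<forall>x\<in>K i. norm (G n x - g x) < e)"
    for i and G :: "nat \<Rightarrow> complex ^ 'n \<Rightarrow> complex"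
  have sub: "\<exists>k. strict_mono (k :: nat \<Rightarrow> nat) \<and> conv i (F \<circ> (s \<circ> k))" for i and s :: "nat \<Rightarrow> nat"
  proof -
    obtain g k where "continuous_on (K i) g" "strict_mono (k::nat\<Rightarrow>nat)"
          "\<And>e. 0 < e \<Longrightarrow> \<exists>N. \<forall>n x. n \<ge> N \<and> x \<in> K i \<longrightarrow> norm ((F \<circ> s) (k n) x - g x) < e"
    proof (rule Arzela_Ascoli[of "K i" "F \<circ> s" "B i"])
      fix z e assume z: "z \<in> K i" and e: "(0::real) < e"
      obtain r where r: "r > 0" "cball z r \<subseteq> U"
        using z KU[of i] \<open>open U\<close> open_contains_cball by blast
      obtain N where "\<forall>n\<ge>N. cball z r \<subseteq> K n"
        using subK[OF compact_cball r(2)] by blast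
      hence BN: "norm (F n y) \<le> max 1 (B N)" if "y \<in> ball z r" for n y
        using B[of y N n] that by (meson ball_subset_cball le_max_iff_disj order_refl subsetD)
      define M where "M = max 1 (B N)"
      have M: "M > 0" by (simp add: M_def)
      define d where "d = min (r / 2) (e * r / (4 * M))"
      show "\<exists>d>0. \<forall>n y. y \<in> K i \<and> norm (z - y) < d \<longrightarrow> norm ((F \<circ> s) n z - (F \<circ> s) n y) < e"
      proof (intro exI[of _ d] conjI allI impI; (elim conjE)?)
        show "d > 0" using r e M by (simp add: d_def)
        fix n y assume y: "norm (z - y) < d"
        have "norm (F (s n) z - F (s n) y) \<le> 4 * M / r * norm (z - y)"
          by (rule holo_lipschitz[OF F r(1)])
             (use r y BN in \<open>auto simp: d_def dist_norm M_def\<close>)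
        also have "\<dots> < 4 * M / r * (e * r / (4 * M))"
          using y r M by (intro mult_strict_left_mono) (auto simp: d_def)
        also have "\<dots> = e" using r M by simp
        finally show "norm ((F \<circ> s) n z - (F \<circ> s) n y) < e" by simp
      qed
    qed (use comK B in auto)
    thus ?thesis unfolding conv_def by (intro exI[of _ k]) (auto simp: o_def, metis)
  qed
  obtain k where k: "strict_mono (k :: nat \<Rightarrow> nat)" "\<And>i. conv i (F \<circ> (id \<circ> k))"
  proof (rule subsequence_diagonalization_lemma[where P = "\<lambda>i s. conv i (F \<circ> s)" and r = id])
    show "\<exists>k. strict_mono (k :: nat \<Rightarrow> nat) \<and> conv i (F \<circ> (s \<circ> k))" for i and s :: "nat \<Rightarrow> nat"
      by (rule sub)
    fix i N and s k1 k2 :: "nat \<Rightarrow> nat"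
    assume c: "conv i (F \<circ> (s \<circ> k1))" and k2: "\<And>j. N \<le> j \<Longrightarrow> \<exists>j'\<ge>j. k2 j = k1 j'"
    obtain g where g: "\<And>e. e > 0 \<Longrightarrow> \<exists>N. \<forall>n\<ge>N. \<forall>x\<in>K i. norm ((F \<circ> (s \<circ> k1)) n x - g x) < e"
      using c unfolding conv_def by blast
    show "conv i (F \<circ> (s \<circ> k2))"
      unfolding conv_def
    proof (intro exI[of _ g] allI impI)
      fix e :: real assume "e > 0"
      then obtain M where M: "\<And>n x. n \<ge> M \<Longrightarrow> x \<in> K i \<Longrightarrow> norm ((F \<circ> (s \<circ> k1)) n x - g x) < e"
        using g by blast
      show "\<exists>N. \<forall>n\<ge>N. \<forall>x\<in>K i. norm ((F \<circ> (s \<circ> k2)) n x - g x) < e"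
      proof (intro exI[of _ "max M N"] allI impI ballI)
        fix n x assume n: "n \<ge> max M N" and x: "x \<in> K i"
        obtain j' where j': "j' \<ge> n" "k2 n = k1 j'" using k2[of n] n by auto
        have "norm ((F \<circ> (s \<circ> k1)) j' x - g x) < e" using M[of j' x] j' n x by simp
        thus "norm ((F \<circ> (s \<circ> k2)) n x - g x) < e" using j' by simp
      qed
    qed
  qed (use that in auto)
  have "\<forall>i. \<exists>g. \<forall>e>0. \<exists>N. \<forall>n\<ge>N. \<forall>x\<in>K i. norm (F (k n) x - g x) < e"
    using k(2) unfolding conv_def by simp
  from choice[OF this] obtain g where g: "\<And>i e. e > 0 \<Longrightarrow> \<exists>N. \<forall>n\<ge>N. \<forall>x\<in>K i. norm (F (k n) x - g i x) < e"
    by blast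
  define G where "G x = lim (\<lambda>n. F (k n) x)" for x
  have gi: "(\<lambda>n. F (k n) x) \<longlonglongrightarrow> g i x" if "x \<in> K i" for i x
    unfolding LIMSEQ_def dist_norm using g that by meson
  have G: "G x = g i x" if "x \<in> K i" for i x
    unfolding G_def by (rule limI[OF gi[OF that]])
  have unif: "\<exists>r>0. ball z r \<subseteq> U \<and> uniform_limit (ball z r) (\<lambda>n. F (k n)) G sequentially"
    if z: "z \<in> U" for z
  proof -
    obtain r where r: "r > 0" "cball z r \<subseteq> U"
      using z \<open>open U\<close> open_contains_cball by blast
    obtain N where N: "\<forall>n\<ge>N. cball z r \<subseteq> K n"
      using subK[OF compact_cball r(2)] by blast
    hence bK: "ball z r \<subseteq> K N" using ball_subset_cball by blast
    have "uniform_limit (ball z r) (\<lambda>n. F (k n)) G sequentially"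
      unfolding uniform_limit_sequentially_iff
    proof (intro allI impI)
      fix e :: real assume "e > 0"
      then obtain M where "\<forall>n\<ge>M. \<forall>x\<in>K N. norm (F (k n) x - g N x) < e" using g by blast
      thus "\<exists>M. \<forall>n\<ge>M. \<forall>x\<in>ball z r. dist (F (k n) x) (G x) < e"
        using bK G by (intro exI[of _ M]) (auto simp: dist_norm)
    qed
    thus ?thesis using r ball_subset_cball by blast
  qed
  show thesis
  proof (rule that)
    show "holo_on G U"
      by (rule holo_on_uniform_limit[OF F unif])
    show "(\<lambda>n. F (k n) z) \<longlonglongrightarrow> G z" if z: "z \<in> U" for z
    proof -
      obtain r where "r > 0" "uniform_limit (ball z r) (\<lambda>n. F (k n)) G sequentially"
        using unif[OF z] by blast
      from tendsto_uniform_limitI[OF this(2), of z] this(1) show ?thesis by simp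
    qed
  qed (rule k(1))
qed

lemma nn_integral_lborel_translate:
  fixes f :: "'a :: euclidean_space \<Rightarrow> ennreal"
  assumes [measurable]: "f \<in> borel_measurable borel"
  shows "(\<integral>\<^sup>+u. f (a + u) \<partial>lborel) = (\<integral>\<^sup>+u. f u \<partial>lborel)"
proof -
  have "(\<integral>\<^sup>+u. f u \<partial>lborel) = (\<integral>\<^sup>+u. f u \<partial>distr lborel borel ((+) a))"
    by (simp only: lborel_distr_plus)
  also have "\<dots> = (\<integral>\<^sup>+u. f (a + u) \<partial>lborel)"
    by (rule nn_integral_distr) measurable
  finally show ?thesis ..
qed

text \<open>
  On each complex line through \<open>a\<close>, the average of \<open>f\<close> over a circle
  is \<open>f a\<close>; thus the constant \<open>f a\<close> on the ball is a limit of circle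
  averages of \<open>f\<close>.
\<close>

lemma holo_mean_value_bound:
  fixes f :: "complex ^ 2 \<Rightarrow> complex"
  assumes f: "holo_on f U" and r: "r > 0" and U: "ball a r \<subseteq> U"
  shows "ennreal ((norm (f a))\<^sup>2) * emeasure lborel (ball (0 :: complex ^ 2) r)
      \<le> (\<integral>\<^sup>+u. ennreal ((norm (f u))\<^sup>2) * indicator (ball a r) u \<partial>lborel)"
proof -
  define F where "F u = indicator (ball 0 r) u *\<^sub>R f (a + u)" for u
  define h where "h u = indicator (ball (0 :: complex ^ 2) r) u *\<^sub>R f a" for u
  have cont: "continuous_on (ball a r) f"
    using holo_on_continuous[OF f] U continuous_on_subset by blast
  have mf: "(\<lambda>u. indicator (ball a r) u *\<^sub>R f u) \<in> borel_measurable borel"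
    by (rule borel_measurable_continuous_on_indicator) (use cont in auto)
  have mF: "F \<in> borel_measurable borel"
    unfolding F_def
  proof (rule borel_measurable_continuous_on_indicator)
    show "continuous_on (ball 0 r) (\<lambda>u. f (a + u))"
      by (rule continuous_on_compose2[OF cont]) (auto intro!: continuous_intros simp: dist_norm)
  qed simp
  have "(\<integral>\<^sup>+u. ennreal ((norm (h u))\<^sup>2) \<partial>lborel) \<le> (\<integral>\<^sup>+u. ennreal ((norm (F u))\<^sup>2) \<partial>lborel)"
  proof (rule nn_integral_circle_average[OF mF, where \<xi> = "\<lambda>N m. \<chi> k. unit_root N m" and c = "\<lambda>N m. 1"])
    fix u :: "complex ^ 2"
    have sm: "(\<chi> k. (\<chi> k. unit_root N m) $ k * u $ k) = unit_root N m *s u" for N m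
      by (simp add: vec_eq_iff)
    have sm': "(\<chi> k. unit_root N m * u $ k) = unit_root N m *s u" for N m
      by (simp add: vec_eq_iff)
    show "(\<lambda>N. (\<Sum>m<N. 1 * F (\<chi> k. (\<chi> k. unit_root N m) $ k * u $ k)) / of_nat N) \<longlonglongrightarrow> h u"
    proof (cases "u \<in> ball 0 r")
      case False
      thus ?thesis by (simp add: sm' F_def h_def norm_smult_complex)
    next
      case True
      define R where "R = (if u = 0 then 2 else r / norm u)"
      have R: "R > 1" using True by (auto simp: R_def)
      define g where "g \<zeta> = f (a + \<zeta> *s u)" for \<zeta>
      have "norm (\<zeta> *s u) < r" if "norm \<zeta> < R" for \<zeta>
        using that r by (auto simp: norm_smult_complex R_def field_simps split: if_splits)
      hence "g holomorphic_on ball 0 R"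
        unfolding g_def using U by (intro holo_on_line[OF f]) (auto simp: dist_norm)
      from discrete_cauchy_tendsto[OF this _ R, of 0]
      have "(\<lambda>N. (\<Sum>m<N. g (unit_root N m)) / of_nat N) \<longlonglongrightarrow> g 0"
        by (simp add: taylor_coeff_def)
      moreover have "F (unit_root N m *s u) = g (unit_root N m)" for N m
        using True by (simp add: F_def g_def norm_smult_complex)
      ultimately show ?thesis using True by (simp add: sm' h_def g_def)
    qed
  qed auto
  moreover have "(\<integral>\<^sup>+u. ennreal ((norm (h u))\<^sup>2) \<partial>lborel)
      = (\<integral>\<^sup>+u. ennreal ((norm (f a))\<^sup>2) * indicator (ball (0 :: complex ^ 2) r) u \<partial>lborel)"
    by (intro nn_integral_cong) (auto simp: h_def indicator_def)
  moreover have "\<dots> = ennreal ((norm (f a))\<^sup>2) * emeasure lborel (ball (0 :: complex ^ 2) r)"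
    by (rule nn_integral_cmult_indicator) simp
  moreover have "(\<integral>\<^sup>+u. ennreal ((norm (F u))\<^sup>2) \<partial>lborel)
      = (\<integral>\<^sup>+u. ennreal ((norm (indicator (ball a r) (a + u) *\<^sub>R f (a + u)))\<^sup>2) \<partial>lborel)"
    by (intro nn_integral_cong) (auto simp: F_def indicator_def dist_norm)
  moreover have "\<dots> = (\<integral>\<^sup>+u. ennreal ((norm (indicator (ball a r) u *\<^sub>R f u))\<^sup>2) \<partial>lborel)"
    by (rule nn_integral_lborel_translate) (use mf in measurable)
  moreover have "\<dots> = (\<integral>\<^sup>+u. ennreal ((norm (f u))\<^sup>2) * indicator (ball a r) u \<partial>lborel)"
    by (intro nn_integral_cong) (auto simp: indicator_def)
  ultimately show ?thesis by simp
qed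

section \<open>The Bergman space and its kernel\<close>

context bergman_domain
begin

text \<open>
  Elements of the Bergman space vanish off the domain, whereas polynomials and limits of
  holomorphic functions come without such a normalization.
\<close>

definition ext0 :: "(complex ^ 2 \<Rightarrow> complex) \<Rightarrow> complex ^ 2 \<Rightarrow> complex" where
  "ext0 h z = (if z \<in> \<Omega> then h z else 0)"

lemma ext0_in [simp]: "z \<in> \<Omega> \<Longrightarrow> ext0 h z = h z"
  by (simp add: ext0_def)

lemma A2D:
  assumes "f \<in> A2"
  shows "f \<in> L2 \<Omega>" "holo_on f \<Omega>" "z \<notin> \<Omega> \<Longrightarrow> f z = 0"
  using assms by (auto simp: bergman_space_def)

lemma measurable_of_continuous: "continuous_on \<Omega> f \<Longrightarrow> f \<in> borel_measurable dM"
  for f :: "complex ^ 2 \<Rightarrow> 'b :: real_normed_vector"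
  by (rule continuous_imp_measurable_on_sets_lebesgue) auto

lemma measurable_of_holo: "holo_on f \<Omega> \<Longrightarrow> f \<in> borel_measurable dM"
  by (intro measurable_of_continuous holo_on_continuous)

lemma L2_cong: "f \<in> L2 \<Omega> \<Longrightarrow> (\<And>z. z \<in> \<Omega> \<Longrightarrow> f z = g z) \<Longrightarrow> g \<in> L2 \<Omega>"
  unfolding L2_iff
  by (metis (mono_tags, lifting) Bochner_Integration.integrable_cong measurable_cong space_dM)

lemma ext0_A2:
  assumes "holo_on h \<Omega>" "h \<in> L2 \<Omega>"
  shows "ext0 h \<in> A2"
  unfolding bergman_space_def
  using L2_cong[OF assms(2), of "ext0 h"] holo_on_cong[OF assms(1) open_dom, of "ext0 h"]
  by (simp add: ext0_def)

lemma ext0_bounded_A2: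
  assumes "holo_on h \<Omega>" "\<And>z. z \<in> \<Omega> \<Longrightarrow> norm (h z) \<le> B"
  shows "ext0 h \<in> A2"
  using assms by (intro ext0_A2 L2_bounded measurable_of_holo)

lemma A2_add: "f \<in> A2 \<Longrightarrow> g \<in> A2 \<Longrightarrow> (\<lambda>z. f z + g z) \<in> A2"
  by (simp add: bergman_space_def L2_add holo_on_add)

lemma A2_diff: "f \<in> A2 \<Longrightarrow> g \<in> A2 \<Longrightarrow> (\<lambda>z. f z - g z) \<in> A2"
  by (simp add: bergman_space_def L2_diff holo_on_diff)

lemma A2_scale: "f \<in> A2 \<Longrightarrow> (\<lambda>z. c * f z) \<in> A2"
  by (simp add: bergman_space_def L2_scale holo_on_scale)

lemma A2_zero: "(\<lambda>z. 0) \<in> A2"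
  by (simp add: bergman_space_def L2_zero holo_on_const)

lemma A2_sum: "(\<And>k. k \<in> K \<Longrightarrow> f k \<in> A2) \<Longrightarrow> (\<lambda>z. \<Sum>k\<in>K. f k z) \<in> A2"
  by (simp add: bergman_space_def L2_sum holo_on_sum)

lemma A2_mult_bounded:
  assumes "f \<in> A2" "holo_on h \<Omega>" "\<And>z. z \<in> \<Omega> \<Longrightarrow> norm (h z) \<le> B"
  shows "(\<lambda>z. h z * f z) \<in> A2"
  using assms L2_mult_bounded[OF _ measurable_of_holo, of f h B]
  by (simp add: bergman_space_def holo_on_mult)

text \<open>
  A compact subset admits a common radius \<open>r\<close> such that the balls around its points
  stay in the domain; the mean value inequality on these balls gives one constant.
\<close>

lemma A2_pointwise_bound:
  assumes "compact K" "K \<subseteq> \<Omega>"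
  shows "\<exists>C>0. \<forall>f\<in>A2. \<forall>z\<in>K. norm (f z) \<le> C * \<parallel>f\<parallel>"
proof -
  obtain r where r: "r > 0" "(\<Union>x\<in>K. ball x r) \<subseteq> \<Omega>"
    using compact_subset_open_imp_ball_epsilon_subset[OF assms(1) open_dom assms(2)] by blast
  define V where "V = measure lborel (ball (0 :: complex ^ 2) r)"
  have V: "emeasure lborel (ball (0 :: complex ^ 2) r) = ennreal V"
    unfolding V_def
    by (rule emeasure_eq_ennreal_measure) (use emeasure_lborel_ball_finite[of "0 :: complex ^ 2" r] in auto)
  have V0: "V > 0"
  proof -
    have "measure lebesgue (ball (0 :: complex ^ 2) r) > 0"
      using r by (simp add: content_ball_pos)
    thus ?thesis by (simp add: V_def)
  qed
  have "norm (f z) \<le> (1 / sqrt V) * \<parallel>f\<parallel>" if f: "f \<in> A2" and z: "z \<in> K" for f z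
  proof -
    have sub: "ball z r \<subseteq> \<Omega>" using r z by blast
    have "ennreal ((norm (f z))\<^sup>2 * V) = ennreal ((norm (f z))\<^sup>2) * emeasure lborel (ball (0 :: complex ^ 2) r)"
      unfolding V using V0 by (intro ennreal_mult) auto
    also have "\<dots> \<le> (\<integral>\<^sup>+u. ennreal ((norm (f u))\<^sup>2) * indicator (ball z r) u \<partial>lborel)"
      by (rule holo_mean_value_bound[OF A2D(2)[OF f] r(1) sub])
    also have "\<dots> \<le> (\<integral>\<^sup>+u. ennreal ((norm (f u))\<^sup>2) * indicator \<Omega> u \<partial>lborel)"
      using sub by (intro nn_integral_mono) (auto simp: indicator_def)
    also have "\<dots> = (\<integral>\<^sup>+u. ennreal ((norm (f u))\<^sup>2) \<partial>dM)"
    proof (rule nn_integral_dM[symmetric])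
      have "(\<lambda>u. indicator \<Omega> u *\<^sub>R f u) \<in> borel_measurable borel"
        by (intro borel_measurable_continuous_on_indicator holo_on_continuous A2D(2)[OF f] dom_sets)
      moreover have "(\<lambda>u. indicator \<Omega> u *\<^sub>R f u) = f"
        using A2D(3)[OF f] by (auto simp: indicator_def)
      ultimately have "f \<in> borel_measurable borel" by simp
      thus "(\<lambda>u. ennreal ((norm (f u))\<^sup>2)) \<in> borel_measurable borel" by measurable
    qed
    also have "\<dots> = ennreal (\<parallel>f\<parallel>\<^sup>2)"
      by (rule norm_sq_nn[OF A2D(1)[OF f], symmetric])
    finally have "(norm (f z))\<^sup>2 * V \<le> \<parallel>f\<parallel>\<^sup>2"
      by (subst (asm) ennreal_le_iff) auto
    hence "(norm (f z))\<^sup>2 \<le> ((1 / sqrt V) * \<parallel>f\<parallel>)\<^sup>2"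
      using V0 by (simp add: field_simps power_mult_distrib power_divide)
    thus ?thesis using V0 by (simp add: power2_le_iff_abs_le)
  qed
  thus ?thesis using V0 by (intro exI[of _ "1 / sqrt V"]) auto
qed

lemma A2_norm_zero:
  assumes "f \<in> A2" "\<parallel>f\<parallel> = 0"
  shows "f = (\<lambda>z. 0)"
proof
  fix z
  show "f z = 0"
  proof (cases "z \<in> \<Omega>")
    case True
    then obtain C where "\<forall>f\<in>A2. \<forall>z\<in>{z}. norm (f z) \<le> C * \<parallel>f\<parallel>"
      using A2_pointwise_bound[of "{z}"] by auto
    thus ?thesis using assms by auto
  qed (use A2D(3) assms in auto)
qed

text \<open>
  Fatou's lemma, in the form in which pointwise limits inherit norm bounds.
\<close>

lemma L2_fatou:
  assumes f: "\<And>n. f n \<in> L2 \<Omega>" and g: "g \<in> borel_measurable dM"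
    and lim: "\<And>z. z \<in> \<Omega> \<Longrightarrow> (\<lambda>n. f n z) \<longlonglongrightarrow> g z"
    and B: "\<forall>\<^sub>F n in sequentially. \<parallel>f n\<parallel> \<le> B" and B0: "B \<ge> 0"
  shows "g \<in> L2 \<Omega>" "\<parallel>g\<parallel> \<le> B"
proof -
  have [measurable]: "f n \<in> borel_measurable dM" for n using f by (simp add: L2_iff)
  have "(\<integral>\<^sup>+z. ennreal ((norm (g z))\<^sup>2) \<partial>dM)
      = (\<integral>\<^sup>+z. liminf (\<lambda>n. ennreal ((norm (f n z))\<^sup>2)) \<partial>dM)"
  proof (rule nn_integral_cong)
    fix z assume "z \<in> space dM"
    hence "(\<lambda>n. ennreal ((norm (f n z))\<^sup>2)) \<longlonglongrightarrow> ennreal ((norm (g z))\<^sup>2)"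
      by (intro tendsto_ennrealI tendsto_intros lim) simp
    from lim_imp_Liminf[OF sequentially_bot this]
    show "ennreal ((norm (g z))\<^sup>2) = liminf (\<lambda>n. ennreal ((norm (f n z))\<^sup>2))" by simp
  qed
  also have "\<dots> \<le> liminf (\<lambda>n. \<integral>\<^sup>+z. ennreal ((norm (f n z))\<^sup>2) \<partial>dM)"
    by (rule nn_integral_liminf) measurable
  also have "\<dots> \<le> limsup (\<lambda>n. \<integral>\<^sup>+z. ennreal ((norm (f n z))\<^sup>2) \<partial>dM)"
    by (rule Liminf_le_Limsup) simp
  also have "\<dots> \<le> ennreal (B\<^sup>2)"
    unfolding norm_sq_nn[OF f, symmetric]
    by (rule Limsup_bounded, rule eventually_mono[OF B])
       (auto intro!: ennreal_leI power_mono)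
  finally show "g \<in> L2 \<Omega>" "\<parallel>g\<parallel> \<le> B"
    using L2_of_nn_bound[OF g _ B0] by auto
qed

text \<open>
  A Cauchy sequence converges locally uniformly by the pointwise bound; the limit is
  holomorphic, and Fatou's lemma turns the Cauchy condition into convergence in norm.
\<close>

lemma A2_complete:
  assumes f: "\<And>n. f n \<in> A2"
    and cau: "\<And>e. e > 0 \<Longrightarrow> \<exists>N. \<forall>m\<ge>N. \<forall>n\<ge>N. \<parallel>\<lambda>z. f m z - f n z\<parallel> \<le> e"
  obtains g where "g \<in> A2" "(\<lambda>n. \<parallel>\<lambda>z. f n z - g z\<parallel>) \<longlonglongrightarrow> 0"
proof -
  have ucau: "\<exists>N. \<forall>m\<ge>N. \<forall>n\<ge>N. \<forall>z\<in>K. norm (f m z - f n z) \<le> e"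
    if K: "compact K" "K \<subseteq> \<Omega>" and e: "e > 0" for K e
  proof -
    obtain C where C: "C > 0" "\<And>f z. f \<in> A2 \<Longrightarrow> z \<in> K \<Longrightarrow> norm (f z) \<le> C * \<parallel>f\<parallel>"
      using A2_pointwise_bound[OF K] by blast
    have "e / C > 0" using e C by simp
    from cau[OF this] obtain N where N: "\<And>m n. m \<ge> N \<Longrightarrow> n \<ge> N \<Longrightarrow> \<parallel>\<lambda>z. f m z - f n z\<parallel> \<le> e / C" by blast
    show ?thesis
    proof (intro exI allI impI ballI)
      fix m n z assume "m \<ge> N" "n \<ge> N" "z \<in> K"
      have "norm (f m z - f n z) \<le> C * \<parallel>\<lambda>z. f m z - f n z\<parallel>"
        using C(2)[OF A2_diff[OF f f] \<open>z \<in> K\<close>] .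
      also have "\<dots> \<le> C * (e / C)"
        using N[OF \<open>m \<ge> N\<close> \<open>n \<ge> N\<close>] C by (intro mult_left_mono) auto
      finally show "norm (f m z - f n z) \<le> e" using C by simp
    qed
  qed
  define g where "g z = lim (\<lambda>n. f n z)" for z
  have conv: "(\<lambda>n. f n z) \<longlonglongrightarrow> g z" if z: "z \<in> \<Omega>" for z
  proof -
    have "Cauchy (\<lambda>n. f n z)"
    proof (rule metric_CauchyI)
      fix e :: real assume "e > 0"
      hence "e / 2 > 0" by simp
      from ucau[OF _ _ this, of "{z}"] obtain N where
        "\<forall>m\<ge>N. \<forall>n\<ge>N. norm (f m z - f n z) \<le> e / 2" using z by auto
      moreover have "e / 2 < e" using \<open>e > 0\<close> by simp
      ultimately show "\<exists>N. \<forall>m\<ge>N. \<forall>n\<ge>N. dist (f m z) (f n z) < e"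
        unfolding dist_norm by (intro exI[of _ N]) (blast intro: order_le_less_trans)
    qed
    thus ?thesis unfolding g_def by (simp add: Cauchy_convergent_iff convergent_LIMSEQ_iff)
  qed
  have unif: "\<exists>r>0. ball z r \<subseteq> \<Omega> \<and> uniform_limit (ball z r) f g sequentially" if z: "z \<in> \<Omega>" for z
  proof -
    obtain r where r: "r > 0" "cball z r \<subseteq> \<Omega>"
      using z open_dom open_contains_cball by blast
    have bs: "ball z r \<subseteq> cball z r" by (rule ball_subset_cball)
    have "uniform_limit (ball z r) f g sequentially"
      unfolding uniform_limit_sequentially_iff
    proof (intro allI impI)
      fix e :: real assume e: "e > 0"
      hence "e / 2 > 0" by simp
      from ucau[OF compact_cball r(2) this] obtain N where
        N: "\<And>m n x. m \<ge> N \<Longrightarrow> n \<ge> N \<Longrightarrow> x \<in> cball z r \<Longrightarrow> norm (f m x - f n x) \<le> e / 2" by blast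
      show "\<exists>N. \<forall>n\<ge>N. \<forall>x\<in>ball z r. dist (f n x) (g x) < e"
      proof (intro exI[of _ N] allI impI ballI)
        fix n x assume n: "n \<ge> N" and x: "x \<in> ball z r"
        have xc: "x \<in> cball z r" using x bs by blast
        have "(\<lambda>m. norm (f n x - f m x)) \<longlonglongrightarrow> norm (f n x - g x)"
          using xc r by (intro tendsto_intros conv) blast
        hence "norm (f n x - g x) \<le> e / 2"
          by (rule LIMSEQ_le_const2) (use N n xc in blast)
        thus "dist (f n x) (g x) < e" using e unfolding dist_norm by linarith
      qed
    qed
    thus ?thesis using r bs by blast
  qed
  have hol: "holo_on g \<Omega>"
    by (rule holo_on_uniform_limit[OF A2D(2)[OF f] unif])
  have bd: "(\<lambda>z. f n z - g z) \<in> L2 \<Omega> \<and> \<parallel>\<lambda>z. f n z - g z\<parallel> \<le> e"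
    if e: "e > 0" and N: "\<And>m. m \<ge> N \<Longrightarrow> \<parallel>\<lambda>z. f n z - f m z\<parallel> \<le> e" for n N e
  proof -
    have mg: "(\<lambda>z. f n z - g z) \<in> borel_measurable dM"
      by (intro measurable_of_holo holo_on_diff A2D(2)[OF f] hol)
    have ev: "\<forall>\<^sub>F m in sequentially. \<parallel>\<lambda>z. f n z - f m z\<parallel> \<le> e"
      using N by (rule eventually_sequentiallyI)
    have cv: "(\<lambda>m. f n z - f m z) \<longlonglongrightarrow> f n z - g z" if "z \<in> \<Omega>" for z
      by (intro tendsto_intros conv that)
    have fm: "(\<lambda>z. f n z - f m z) \<in> L2 \<Omega>" for m
      by (intro L2_diff A2D(1)[OF f])
    show ?thesis
      using L2_fatou[OF fm mg cv ev] e by simp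
  qed
  have gL2: "g \<in> L2 \<Omega>"
  proof -
    obtain N where N: "\<And>m n. m \<ge> N \<Longrightarrow> n \<ge> N \<Longrightarrow> \<parallel>\<lambda>z. f m z - f n z\<parallel> \<le> 1"
      using cau[OF zero_less_one] by blast
    have "(\<lambda>z. f N z - g z) \<in> L2 \<Omega>"
      using bd[of 1 N N] N by auto
    from L2_diff[OF A2D(1)[OF f] this, of N] show ?thesis by simp
  qed
  show thesis
  proof (rule that[of "ext0 g"])
    show "ext0 g \<in> A2" by (rule ext0_A2[OF hol gL2])
    have "\<parallel>\<lambda>z. f n z - ext0 g z\<parallel> = \<parallel>\<lambda>z. f n z - g z\<parallel>" for n
      by (rule L2_norm_cong) simp
    moreover have "(\<lambda>n. \<parallel>\<lambda>z. f n z - g z\<parallel>) \<longlonglongrightarrow> 0"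
    proof (rule LIMSEQ_I)
      fix e :: real assume e: "e > 0"
      hence "e / 2 > 0" by simp
      from cau[OF this] obtain N where
        N: "\<And>m n. m \<ge> N \<Longrightarrow> n \<ge> N \<Longrightarrow> \<parallel>\<lambda>z. f m z - f n z\<parallel> \<le> e / 2" by blast
      show "\<exists>N. \<forall>n\<ge>N. norm (\<parallel>\<lambda>z. f n z - g z\<parallel> - 0) < e"
      proof (intro exI[of _ N] allI impI)
        fix n assume n: "n \<ge> N"
        have "\<parallel>\<lambda>z. f n z - g z\<parallel> \<le> e / 2"
          using bd[OF \<open>e / 2 > 0\<close> N[OF n]] by blast
        thus "norm (\<parallel>\<lambda>z. f n z - g z\<parallel> - 0) < e" using e by simp
      qed
    qed
    ultimately show "(\<lambda>n. \<parallel>\<lambda>z. f n z - ext0 g z\<parallel>) \<longlonglongrightarrow> 0" by simp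
  qed
qed

lemma A2_norm_tendsto:
  assumes "\<And>n. f n \<in> L2 \<Omega>" "g \<in> L2 \<Omega>" "(\<lambda>n. \<parallel>\<lambda>z. f n z - g z\<parallel>) \<longlonglongrightarrow> 0"
  shows "(\<lambda>n. \<parallel>f n\<parallel>) \<longlonglongrightarrow> \<parallel>g\<parallel>"
proof -
  have "(\<lambda>n. \<parallel>f n\<parallel> - \<parallel>g\<parallel>) \<longlonglongrightarrow> 0"
  proof (rule Lim_null_comparison[OF always_eventually assms(3)], rule allI)
    fix n
    have "\<parallel>f n\<parallel> \<le> \<parallel>g\<parallel> + \<parallel>\<lambda>z. f n z - g z\<parallel>" "\<parallel>g\<parallel> \<le> \<parallel>f n\<parallel> + \<parallel>\<lambda>z. g z - f n z\<parallel>"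
      by (intro norm_le_add_diff_L2 assms)+
    thus "norm (\<parallel>f n\<parallel> - \<parallel>g\<parallel>) \<le> \<parallel>\<lambda>z. f n z - g z\<parallel>"
      using norm_minus_commute_L2[of g "f n"] by (simp add: abs_le_iff)
  qed
  thus ?thesis by (simp add: LIM_zero_iff)
qed

lemma A2_inner_tendsto:
  assumes "\<And>n. f n \<in> L2 \<Omega>" "g \<in> L2 \<Omega>" "(\<lambda>n. \<parallel>\<lambda>z. f n z - g z\<parallel>) \<longlonglongrightarrow> 0" "h \<in> L2 \<Omega>"
  shows "(\<lambda>n. \<langle>f n, h\<rangle>) \<longlonglongrightarrow> \<langle>g, h\<rangle>"
proof -
  have "(\<lambda>n. \<langle>f n, h\<rangle> - \<langle>g, h\<rangle>) \<longlonglongrightarrow> 0"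
  proof (rule Lim_null_comparison[OF always_eventually], rule allI)
    show "norm (\<langle>f n, h\<rangle> - \<langle>g, h\<rangle>) \<le> \<parallel>\<lambda>z. f n z - g z\<parallel> * \<parallel>h\<parallel>" for n
      unfolding inner_diff_left[OF assms(1,2,4), symmetric]
      by (intro cauchy_schwarz L2_diff assms)
    show "(\<lambda>n. \<parallel>\<lambda>z. f n z - g z\<parallel> * \<parallel>h\<parallel>) \<longlonglongrightarrow> 0"
      using tendsto_mult_right[OF assms(3), of "\<parallel>h\<parallel>"] by simp
  qed
  thus ?thesis by (simp add: LIM_zero_iff)
qed

text \<open>
  The representing vector minimizes \<open>\<parallel>f\<parallel>\<^sup>2 - 2 Re (L f)\<close>:
  the parallelogram law makes minimizing sequences Cauchy, and the first variation at the
  minimum is the asserted identity. Projection, reproducing kernel and adjoint are all obtained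
  from this one fact.
\<close>

theorem A2_riesz:
  assumes add: "\<And>f g. f \<in> A2 \<Longrightarrow> g \<in> A2 \<Longrightarrow> L (\<lambda>z. f z + g z) = L f + L g"
    and scale: "\<And>c f. f \<in> A2 \<Longrightarrow> L (\<lambda>z. c * f z) = c * L f"
    and bdd: "\<And>f. f \<in> A2 \<Longrightarrow> norm (L f) \<le> C * \<parallel>f\<parallel>"
  obtains k where "k \<in> A2" "\<And>f. f \<in> A2 \<Longrightarrow> L f = \<langle>f, k\<rangle>"
proof -
  define J where "J f = \<parallel>f\<parallel>\<^sup>2 - 2 * Re (L f)" for f
  \<comment> \<open>finite, since \<open>J f \<ge> (\<parallel>f\<parallel> - C)\<^sup>2 - C\<^sup>2\<close>\<close>
  define m where "m = (INF f\<in>A2. J f)"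
  have Jge: "J f \<ge> - C\<^sup>2" if "f \<in> A2" for f
  proof -
    have "Re (L f) \<le> C * \<parallel>f\<parallel>"
      using bdd[OF that] complex_Re_le_cmod[of "L f"] by linarith
    hence "J f \<ge> \<parallel>f\<parallel>\<^sup>2 - 2 * (C * \<parallel>f\<parallel>)" by (simp add: J_def)
    also have "\<parallel>f\<parallel>\<^sup>2 - 2 * (C * \<parallel>f\<parallel>) = (\<parallel>f\<parallel> - C)\<^sup>2 - C\<^sup>2"
      by (simp add: power2_eq_square algebra_simps)
    finally show ?thesis using zero_le_power2[of "\<parallel>f\<parallel> - C"] by linarith
  qed
  have bb: "bdd_below (J ` A2)"
    using Jge by (auto intro!: bdd_belowI)
  have m: "m \<le> J f" if "f \<in> A2" for f
    unfolding m_def using bb that by (rule cINF_lower)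
  have par: "\<parallel>\<lambda>z. f z - g z\<parallel>\<^sup>2 \<le> 2 * (J f - m) + 2 * (J g - m)" if fg: "f \<in> A2" "g \<in> A2" for f g
  proof -
    define h where "h = (\<lambda>z. (1/2) * (f z + g z))"
    have h: "h \<in> A2" unfolding h_def by (intro A2_scale A2_add fg)
    have "L h = (1/2) * L (\<lambda>z. f z + g z)"
      unfolding h_def by (rule scale[OF A2_add[OF fg]])
    hence "2 * L h = L f + L g"
      unfolding add[OF fg] by (simp add: mult.commute)
    from arg_cong[where f = Re, OF this] have "Re (L h) = (Re (L f) + Re (L g)) / 2"
      by simp
    moreover have "4 * \<parallel>h\<parallel>\<^sup>2 = \<parallel>\<lambda>z. f z + g z\<parallel>\<^sup>2"
      unfolding h_def norm_scale by (simp add: power2_eq_square)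
    moreover have "\<parallel>\<lambda>z. f z + g z\<parallel>\<^sup>2 + \<parallel>\<lambda>z. f z - g z\<parallel>\<^sup>2 = 2 * \<parallel>f\<parallel>\<^sup>2 + 2 * \<parallel>g\<parallel>\<^sup>2"
      using fg A2D(1) by (simp add: norm_add_sq norm_diff_sq)
    ultimately have "\<parallel>\<lambda>z. f z - g z\<parallel>\<^sup>2 = 2 * J f + 2 * J g - 4 * J h"
      unfolding J_def by simp
    thus ?thesis using m[OF h] by simp
  qed
  have "\<exists>f\<in>A2. J f < m + 1 / (real n + 1)" for n
  proof -
    have "(INF f\<in>A2. J f) < m + 1 / (real n + 1)" unfolding m_def by simp
    thus ?thesis using bb A2_zero by (subst (asm) cINF_less_iff) auto
  qed
  then obtain f where f: "\<And>n. f n \<in> A2" "\<And>n. J (f n) < m + 1 / (real n + 1)"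
    by metis
  have fJ: "J (f n) - m \<le> 1 / (real n + 1)" for n
    using less_imp_le[OF f(2)[of n]] by (simp only: diff_le_eq add.commute)
  have "\<exists>N. \<forall>i\<ge>N. \<forall>j\<ge>N. \<parallel>\<lambda>z. f i z - f j z\<parallel> \<le> e" if e: "e > 0" for e
  proof -
    obtain N where N: "4 / e\<^sup>2 < real N" using reals_Archimedean2 by blast
    have Npos: "0 < real N" using N e by (meson divide_pos_pos less_trans zero_less_numeral zero_less_power)
    have key: "1 / (real i + 1) \<le> e\<^sup>2 / 4" if "i \<ge> N" for i
    proof -
      have "4 / e\<^sup>2 < real i + 1" using N that by linarith
      thus ?thesis using e by (simp add: field_simps)
    qed
    show ?thesis
    proof (intro exI[of _ N] allI impI)
      fix i j assume ij: "i \<ge> N" "j \<ge> N"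
      have "\<parallel>\<lambda>z. f i z - f j z\<parallel>\<^sup>2 \<le> 2 * (1 / (real i + 1)) + 2 * (1 / (real j + 1))"
        using par[OF f(1) f(1)]
        by (rule order_trans) (intro add_mono mult_left_mono fJ; simp)
      also have "\<dots> \<le> e\<^sup>2" using key[OF ij(1)] key[OF ij(2)] by linarith
      finally show "\<parallel>\<lambda>z. f i z - f j z\<parallel> \<le> e" using e by (simp add: power2_le_iff_abs_le)
    qed
  qed
  from A2_complete[OF f(1) this] obtain k where
    k: "k \<in> A2" "(\<lambda>n. \<parallel>\<lambda>z. f n z - k z\<parallel>) \<longlonglongrightarrow> 0" by blast
  have Ldiff: "L (\<lambda>z. f z - g z) = L f - L g" if "f \<in> A2" "g \<in> A2" for f g
    using add[OF that(1) A2_scale[OF that(2)], of "-1"] scale[OF that(2), of "-1"] by simp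
  have "(\<lambda>n. L (f n) - L k) \<longlonglongrightarrow> 0"
  proof (rule Lim_null_comparison[OF always_eventually], rule allI)
    show "norm (L (f n) - L k) \<le> C * \<parallel>\<lambda>z. f n z - k z\<parallel>" for n
      unfolding Ldiff[OF f(1) k(1), symmetric] by (intro bdd A2_diff f k)
    show "(\<lambda>n. C * \<parallel>\<lambda>z. f n z - k z\<parallel>) \<longlonglongrightarrow> 0"
      using tendsto_mult_left[OF k(2), of C] by simp
  qed
  hence Lk: "(\<lambda>n. L (f n)) \<longlonglongrightarrow> L k" by (simp add: LIM_zero_iff)
  have "(\<lambda>n. J (f n)) \<longlonglongrightarrow> J k"
    unfolding J_def
    by (intro tendsto_intros Lk A2_norm_tendsto A2D(1) f k)
  moreover have "(\<lambda>n. J (f n)) \<longlonglongrightarrow> m"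
  proof (rule tendsto_sandwich[of "\<lambda>n. m" _ _ "\<lambda>n. m + 1 / (real n + 1)"])
    show "(\<lambda>n. m + 1 / (real n + 1)) \<longlonglongrightarrow> m"
      using tendsto_add[OF tendsto_const[of m] LIMSEQ_inverse_real_of_nat] by (simp add: field_simps)
  qed (use m f in \<open>auto intro!: always_eventually less_imp_le\<close>)
  ultimately have Jk: "J k = m" by (rule LIMSEQ_unique)
  \<comment> \<open>first variation of \<open>J\<close> at its minimum\<close>
  have ReL: "Re (L h) = Re \<langle>h, k\<rangle>" if h: "h \<in> A2" for h
  proof -
    define d where "d = Re \<langle>h, k\<rangle> - Re (L h)"
    have q: "0 \<le> 2 * t * d + t\<^sup>2 * \<parallel>h\<parallel>\<^sup>2" for t :: real
    proof -
      have th: "(\<lambda>z. of_real t * h z) \<in> A2" by (rule A2_scale[OF h])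
      have "J k \<le> J (\<lambda>z. k z + of_real t * h z)"
        unfolding Jk by (intro m A2_add k th)
      also have "\<dots> = J k + 2 * t * (Re \<langle>k, h\<rangle> - Re (L h)) + t\<^sup>2 * \<parallel>h\<parallel>\<^sup>2"
        unfolding J_def norm_add_sq[OF A2D(1)[OF k(1)] A2D(1)[OF th]] norm_scale inner_scale_right
          add[OF k(1) th] scale[OF h]
        by (simp add: algebra_simps power_mult_distrib)
      also have "Re \<langle>k, h\<rangle> = Re \<langle>h, k\<rangle>" by (subst inner_cnj) simp
      finally show ?thesis by (simp add: d_def)
    qed
    have "d = 0"
    proof (cases "\<parallel>h\<parallel>\<^sup>2 = 0")
      case True
      thus ?thesis using q[of "-d"] q[of d] by (simp add: power2_eq_square) (smt (verit) mult_eq_0_iff zero_le_square)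
    next
      case False
      hence pos: "\<parallel>h\<parallel>\<^sup>2 > 0" by (simp add: zero_less_power2)
      have "2 * (- d / \<parallel>h\<parallel>\<^sup>2) * d + (- d / \<parallel>h\<parallel>\<^sup>2)\<^sup>2 * \<parallel>h\<parallel>\<^sup>2 = - (d\<^sup>2 / \<parallel>h\<parallel>\<^sup>2)"
        using pos by (simp add: field_simps power2_eq_square)
      with q[of "- d / \<parallel>h\<parallel>\<^sup>2"] have "d\<^sup>2 / \<parallel>h\<parallel>\<^sup>2 \<le> 0" by linarith
      thus ?thesis using pos by (simp add: divide_le_0_iff)
    qed
    thus ?thesis by (simp add: d_def)
  qed
  show thesis
  proof (rule that[OF k(1)])
    fix h assume h: "h \<in> A2"
    have "Re (L (\<lambda>z. - \<i> * h z)) = Re \<langle>\<lambda>z. - \<i> * h z, k\<rangle>"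
      by (rule ReL[OF A2_scale[OF h]])
    hence "Im (L h) = Im \<langle>h, k\<rangle>"
      unfolding scale[OF h] inner_scale_left by simp
    with ReL[OF h] show "L h = \<langle>h, k\<rangle>" by (simp add: complex_eq_iff)
  qed
qed

lemma A2_eqI:
  assumes "f \<in> A2" "g \<in> A2" "\<And>h. h \<in> A2 \<Longrightarrow> \<langle>h, f\<rangle> = \<langle>h, g\<rangle>"
  shows "f = g"
proof -
  have d: "(\<lambda>z. f z - g z) \<in> A2" by (intro A2_diff assms)
  have "\<langle>\<lambda>z. f z - g z, \<lambda>z. f z - g z\<rangle> = 0"
    using assms(3)[OF d] assms A2D(1) d by (simp add: inner_diff_right)
  hence "\<parallel>\<lambda>z. f z - g z\<parallel> = 0" by (simp add: inner_self)
  from A2_norm_zero[OF d this] show ?thesis by (simp add: fun_eq_iff)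
qed

text \<open>
  Norm bounded sequences are locally bounded, and the limit is square integrable by Fatou's
  lemma.
\<close>

lemma A2_montel:
  assumes f: "\<And>n. f n \<in> A2" and M: "\<And>n. \<parallel>f n\<parallel> \<le> M"
  obtains g r where "g \<in> A2" "strict_mono (r :: nat \<Rightarrow> nat)"
    "\<And>z. z \<in> \<Omega> \<Longrightarrow> (\<lambda>n. f (r n) z) \<longlonglongrightarrow> g z"
proof -
  have M0: "M \<ge> 0" by (rule order_trans[OF L2_norm_nonneg M])
  obtain g r where g: "holo_on g \<Omega>" "strict_mono (r :: nat \<Rightarrow> nat)"
    "\<And>z. z \<in> \<Omega> \<Longrightarrow> (\<lambda>n. f (r n) z) \<longlonglongrightarrow> g z"
  proof (rule montel_several[where F = f and U = \<Omega>])
    show "holo_on (f n) \<Omega>" for n by (rule A2D(2)[OF f])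
  next
    fix K assume "compact K" "K \<subseteq> \<Omega>"
    from A2_pointwise_bound[OF this]
    obtain C where C: "C > 0" "\<And>f z. f \<in> A2 \<Longrightarrow> z \<in> K \<Longrightarrow> norm (f z) \<le> C * \<parallel>f\<parallel>"
      by blast
    have "norm (f n z) \<le> C * M" if "z \<in> K" for n z
    proof -
      have "norm (f n z) \<le> C * \<parallel>f n\<parallel>" by (rule C(2)[OF f that])
      also have "\<dots> \<le> C * M" using M C(1) by (intro mult_left_mono) auto
      finally show ?thesis .
    qed
    thus "\<exists>B. \<forall>n. \<forall>z\<in>K. norm (f n z) \<le> B" by blast
  qed (use open_dom in blast)+
  have "g \<in> L2 \<Omega>"
    by (rule L2_fatou[of "\<lambda>n. f (r n)" g M])
       (use M M0 A2D(1)[OF f] measurable_of_holo[OF g(1)] g(3) in auto)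
  thus thesis
    using g by (intro that[of "ext0 g" r] ext0_A2) auto
qed

text \<open>
  The projection of \<open>g\<close> represents the functional \<open>\<lambda>f. \<langle>f,
  g\<rangle>\<close>.
\<close>

lemma projection_ex1:
  assumes g: "g \<in> L2 \<Omega>"
  shows "\<exists>!f. f \<in> A2 \<and> (\<forall>h\<in>A2. L2_inner \<Omega> (\<lambda>z. g z - f z) h = 0)"
proof -
  obtain k where k: "k \<in> A2" "\<And>f. f \<in> A2 \<Longrightarrow> \<langle>f, g\<rangle> = \<langle>f, k\<rangle>"
  proof (rule A2_riesz[of "\<lambda>f. \<langle>f, g\<rangle>" "\<parallel>g\<parallel>"])
    show "norm \<langle>f, g\<rangle> \<le> \<parallel>g\<parallel> * \<parallel>f\<parallel>" if "f \<in> A2" for f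
      using cauchy_schwarz[OF A2D(1)[OF that] g] by (simp add: mult.commute)
  qed (use g A2D(1) in \<open>auto simp: inner_add_left inner_scale_left\<close>)
  have "\<langle>\<lambda>z. g z - k z, h\<rangle> = 0" if h: "h \<in> A2" for h
    using k(2)[OF h] g k(1) h A2D(1) inner_cnj[of g h] inner_cnj[of k h] by (simp add: inner_diff_left)
  moreover have "f = k" if "f \<in> A2" "\<forall>h\<in>A2. \<langle>\<lambda>z. g z - f z, h\<rangle> = 0" for f
  proof (rule A2_eqI[OF that(1) k(1)])
    fix h assume h: "h \<in> A2"
    have "\<langle>g, h\<rangle> = \<langle>f, h\<rangle>"
      using that h g A2D(1) by (simp add: inner_diff_left)
    hence "\<langle>h, g\<rangle> = \<langle>h, f\<rangle>" using inner_cnj[of h g] inner_cnj[of h f] by simp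
    thus "\<langle>h, f\<rangle> = \<langle>h, k\<rangle>" using k(2)[OF h] by simp
  qed
  ultimately show ?thesis using k(1) by blast
qed

abbreviation "P \<equiv> bergman_projection \<Omega>"

lemma projection:
  assumes g: "g \<in> L2 \<Omega>"
  shows projection_A2: "P g \<in> A2"
    and projection_inner: "h \<in> A2 \<Longrightarrow> \<langle>P g, h\<rangle> = \<langle>g, h\<rangle>"
proof -
  have *: "P g \<in> A2 \<and> (\<forall>h\<in>A2. \<langle>\<lambda>z. g z - P g z, h\<rangle> = 0)"
    unfolding bergman_projection_def by (rule theI'[OF projection_ex1[OF g]])
  thus "P g \<in> A2" by blast
  show "\<langle>P g, h\<rangle> = \<langle>g, h\<rangle>" if h: "h \<in> A2"
  proof -
    have "\<langle>\<lambda>z. g z - P g z, h\<rangle> = \<langle>g, h\<rangle> - \<langle>P g, h\<rangle>"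
      by (rule inner_diff_left[OF g A2D(1) A2D(1)[OF h]]) (use * in blast)
    thus ?thesis using * h by simp
  qed
qed

lemma projection_norm:
  assumes g: "g \<in> L2 \<Omega>"
  shows "\<parallel>P g\<parallel> \<le> \<parallel>g\<parallel>"
proof -
  have "\<parallel>P g\<parallel>\<^sup>2 = Re \<langle>P g, P g\<rangle>" by (simp add: inner_self)
  also have "\<dots> = Re \<langle>g, P g\<rangle>" using projection_inner[OF g projection_A2[OF g]] by simp
  also have "\<dots> \<le> \<parallel>g\<parallel> * \<parallel>P g\<parallel>" by (intro Re_inner_le g A2D(1) projection_A2)
  finally show ?thesis
    using L2_norm_nonneg[of "P g"] by (cases "\<parallel>P g\<parallel> = 0") (auto simp: power2_eq_square)
qed

lemma kernel_ex1:
  assumes z: "z \<in> \<Omega>"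
  shows "\<exists>!k. k \<in> A2 \<and> (\<forall>f\<in>A2. f z = L2_inner \<Omega> f k)"
proof -
  obtain C where "\<And>f. f \<in> A2 \<Longrightarrow> norm (f z) \<le> C * \<parallel>f\<parallel>"
    using A2_pointwise_bound[of "{z}"] z by auto
  then obtain k where "k \<in> A2" "\<And>f. f \<in> A2 \<Longrightarrow> f z = \<langle>f, k\<rangle>"
    using A2_riesz[of "\<lambda>f. f z" C] by auto
  thus ?thesis using A2_eqI by (intro ex1I[of _ k]) auto
qed

definition ker :: "complex ^ 2 \<Rightarrow> complex ^ 2 \<Rightarrow> complex" where
  "ker z = (\<lambda>w. bergman_kernel \<Omega> w z)"

lemma ker:
  assumes z: "z \<in> \<Omega>"
  shows ker_A2: "ker z \<in> A2" and ker_reproducing: "f \<in> A2 \<Longrightarrow> \<langle>f, ker z\<rangle> = f z"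
proof -
  have "ker z \<in> A2 \<and> (\<forall>f\<in>A2. f z = \<langle>f, ker z\<rangle>)"
    unfolding ker_def bergman_kernel_def by (rule theI'[OF kernel_ex1[OF z]])
  thus "ker z \<in> A2" "f \<in> A2 \<Longrightarrow> \<langle>f, ker z\<rangle> = f z" by auto
qed

lemma ker_diag: "z \<in> \<Omega> \<Longrightarrow> ker z z = of_real (\<parallel>ker z\<parallel>\<^sup>2)"
  using ker_reproducing[OF _ ker_A2, of z z] by (simp add: inner_self)

text \<open>
  The constant \<open>1\<close> belongs to the Bergman space of a bounded domain, so evaluation
  is not the zero functional.
\<close>

lemma ker_norm_pos:
  assumes z: "z \<in> \<Omega>"
  shows "\<parallel>ker z\<parallel> > 0"
proof -
  have one: "ext0 (\<lambda>z. 1) \<in> A2"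
    by (rule ext0_bounded_A2[OF holo_on_const, of _ 1]) auto
  have "\<parallel>ker z\<parallel> \<noteq> 0"
  proof
    assume "\<parallel>ker z\<parallel> = 0"
    hence "ext0 (\<lambda>z. 1) z = 0"
      using cauchy_schwarz[OF A2D(1)[OF one] A2D(1)[OF ker_A2[OF z]]] ker_reproducing[OF z one] by simp
    thus False using z by simp
  qed
  thus ?thesis by (simp add: order_less_le)
qed

abbreviation nk :: "complex ^ 2 \<Rightarrow> complex ^ 2 \<Rightarrow> complex" where
  "nk \<equiv> normalized_kernel \<Omega>"

lemma nk_eq:
  assumes z: "z \<in> \<Omega>"
  shows "nk z = (\<lambda>w. of_real (1 / \<parallel>ker z\<parallel>) * ker z w)"
proof -
  have k: "bergman_kernel \<Omega> w z = ker z w" for w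
    by (simp add: ker_def)
  have "csqrt (ker z z) = of_real \<parallel>ker z\<parallel>"
    unfolding ker_diag[OF z] by (simp add: csqrt_of_real_nonneg del: of_real_power)
  thus ?thesis by (simp add: normalized_kernel_def k fun_eq_iff)
qed

lemma nk:
  assumes z: "z \<in> \<Omega>"
  shows nk_A2: "nk z \<in> A2" and nk_norm: "\<parallel>nk z\<parallel> = 1"
    and nk_inner: "f \<in> A2 \<Longrightarrow> \<langle>f, nk z\<rangle> = f z / of_real \<parallel>ker z\<parallel>"
proof -
  have pos: "\<parallel>ker z\<parallel> > 0" by (rule ker_norm_pos[OF z])
  show "nk z \<in> A2" unfolding nk_eq[OF z] by (intro A2_scale ker_A2 z)
  show "\<parallel>nk z\<parallel> = 1"
    unfolding nk_eq[OF z] norm_scale using pos by (simp add: norm_divide)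
  show "\<langle>f, nk z\<rangle> = f z / of_real \<parallel>ker z\<parallel>" if "f \<in> A2"
    unfolding nk_eq[OF z] inner_scale_right ker_reproducing[OF z that] by simp
qed

text \<open>
  The reproducing property for \<open>h k\<^sub>z\<close>: under the probability measure
  \<open>|k\<^sub>z|\<^sup>2 dV\<close> every bounded holomorphic function has its value at
  \<open>z\<close> as expectation.
\<close>

lemma nk_self_inner:
  assumes z: "z \<in> \<Omega>" and h: "holo_on h \<Omega>" "\<And>w. w \<in> \<Omega> \<Longrightarrow> norm (h w) \<le> B"
  shows "\<langle>\<lambda>w. h w * nk z w, nk z\<rangle> = h z"
proof -
  have n: "\<parallel>ker z\<parallel> > 0" by (rule ker_norm_pos[OF z])
  have "\<langle>\<lambda>w. h w * nk z w, nk z\<rangle> = h z * nk z z / of_real \<parallel>ker z\<parallel>"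
    by (rule nk_inner[OF z A2_mult_bounded[OF nk_A2[OF z] h]])
  also have "nk z z = of_real \<parallel>ker z\<parallel>"
    using n by (simp add: nk_eq[OF z] ker_diag[OF z] power2_eq_square)
  finally show ?thesis using n by simp
qed

end

section \<open>Toeplitz operators and Berezin transforms\<close>

context bergman_domain
begin

text \<open>
  The closure is compact, so points whose distance to the boundary tends to zero accumulate at
  boundary points, and it is enough to treat subsequences of convergent sequences.
\<close>

lemma tendsto_to_boundaryI:
  fixes F :: "complex ^ 2 \<Rightarrow> complex"
  assumes "\<And>z p. (\<And>n. z n \<in> \<Omega>) \<Longrightarrow> z \<longlonglongrightarrow> p \<Longrightarrow> p \<in> frontier \<Omega> \<Longrightarrow>
             \<exists>r. strict_mono (r :: nat \<Rightarrow> nat) \<and> (\<lambda>n. F (z (r n))) \<longlonglongrightarrow> 0"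
  shows "(F \<longlongrightarrow> 0) (to_boundary \<Omega>)"
proof (rule ccontr)
  assume "\<not> (F \<longlongrightarrow> 0) (to_boundary \<Omega>)"
  then obtain e where e: "e > 0" "\<not> (\<forall>\<^sub>F z in to_boundary \<Omega>. dist (F z) 0 < e)"
    unfolding tendsto_iff by blast
  have "\<exists>z\<in>\<Omega>. infdist z (frontier \<Omega>) < 1 / (real n + 1) \<and> norm (F z) \<ge> e" for n
  proof (rule ccontr)
    assume neg: "\<not> ?thesis"
    have "\<forall>\<^sub>F x in nhds (0::real). x < 1 / (real n + 1)"
      by (rule order_tendstoD(2)[OF filterlim_ident]) simp
    hence "\<forall>\<^sub>F z in filtercomap (\<lambda>z. infdist z (frontier \<Omega>)) (nhds 0).
             infdist z (frontier \<Omega>) < 1 / (real n + 1)"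
      by (rule eventually_filtercomapI)
    hence "\<forall>\<^sub>F z in to_boundary \<Omega>. dist (F z) 0 < e"
      unfolding to_boundary_def eventually_inf_principal
      by (rule eventually_mono) (use neg in force)
    with e(2) show False by blast
  qed
  then obtain z where z: "\<And>n. z n \<in> \<Omega>" "\<And>n. infdist (z n) (frontier \<Omega>) < 1 / (real n + 1)"
      "\<And>n. norm (F (z n)) \<ge> e"
    by metis
  have ne: "frontier \<Omega> \<noteq> {}"
    using z(1) bounded_dom by (metis empty_iff frontier_eq_empty not_bounded_UNIV)
  have "compact (closure \<Omega>)" using bounded_dom by simp
  moreover have "\<forall>n. z n \<in> closure \<Omega>" using z(1) closure_subset by blast
  ultimately obtain p s where p: "strict_mono (s :: nat \<Rightarrow> nat)" "(z \<circ> s) \<longlonglongrightarrow> p"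
    unfolding compact_def by blast
  have "(\<lambda>n. infdist (z n) (frontier \<Omega>)) \<longlonglongrightarrow> 0"
  proof (rule Lim_null_comparison[OF always_eventually], rule allI)
    show "norm (infdist (z n) (frontier \<Omega>)) \<le> 1 / (real n + 1)" for n
      using z(2)[of n] by (simp add: infdist_nonneg)
    show "(\<lambda>n. 1 / (real n + 1)) \<longlonglongrightarrow> 0"
      using LIMSEQ_inverse_real_of_nat by (simp add: inverse_eq_divide add.commute)
  qed
  hence "(\<lambda>n. infdist ((z \<circ> s) n) (frontier \<Omega>)) \<longlonglongrightarrow> 0"
    using LIMSEQ_subseq_LIMSEQ[OF _ p(1)] by (fastforce simp: o_def)
  moreover have "(\<lambda>n. infdist ((z \<circ> s) n) (frontier \<Omega>)) \<longlonglongrightarrow> infdist p (frontier \<Omega>)"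
    by (intro tendsto_infdist p)
  ultimately have "infdist p (frontier \<Omega>) = 0" by (metis LIMSEQ_unique)
  hence "p \<in> frontier \<Omega>"
    using in_closed_iff_infdist_zero[OF frontier_closed ne] by simp
  from assms[OF _ p(2) this] obtain r where
    "strict_mono (r :: nat \<Rightarrow> nat)" "(\<lambda>n. F ((z \<circ> s) (r n))) \<longlonglongrightarrow> 0"
    using z(1) by auto
  hence "(\<lambda>n. norm (F ((z \<circ> s) (r n)))) \<longlonglongrightarrow> 0" by (simp add: tendsto_norm_zero)
  hence "e \<le> 0" by (rule LIMSEQ_le_const) (use z(3) in auto)
  with e(1) show False by simp
qed

lemma tendsto_to_boundaryD:
  assumes F: "(F \<longlongrightarrow> l) (to_boundary \<Omega>)" and z: "\<And>n. z n \<in> \<Omega>" "(z \<longlongrightarrow> p) sequentially"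
    and p: "p \<in> frontier \<Omega>"
  shows "(\<lambda>n. F (z n)) \<longlonglongrightarrow> l"
proof (rule filterlim_compose[OF F])
  have "(\<lambda>n. infdist (z n) (frontier \<Omega>)) \<longlonglongrightarrow> infdist p (frontier \<Omega>)"
    by (intro tendsto_infdist z)
  hence "(\<lambda>n. infdist (z n) (frontier \<Omega>)) \<longlonglongrightarrow> 0" using p by simp
  thus "filterlim z (to_boundary \<Omega>) sequentially"
    unfolding to_boundary_def filterlim_inf filterlim_principal filterlim_filtercomap_iff
    using z(1) by (simp add: o_def)
qed

text \<open>
  The Cauchy-Schwarz inequality divided by \<open>\<parallel>d\<parallel>\<close>.
\<close>

lemma norm_le_of_weak_eq:
  assumes "d \<in> A2" "u \<in> L2 \<Omega>" "\<langle>d, d\<rangle> = \<langle>u, d\<rangle>"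
  shows "\<parallel>d\<parallel> \<le> \<parallel>u\<parallel>"
proof -
  have "complex_of_real (\<parallel>d\<parallel>\<^sup>2) = \<langle>u, d\<rangle>" using assms(3) by (simp only: inner_self)
  hence "\<parallel>d\<parallel>\<^sup>2 = Re \<langle>u, d\<rangle>" by (metis Re_complex_of_real)
  also have "\<dots> \<le> \<parallel>u\<parallel> * \<parallel>d\<parallel>" by (intro Re_inner_le assms A2D(1))
  finally show ?thesis
    using L2_norm_nonneg[of d] by (cases "\<parallel>d\<parallel> = 0") (auto simp: power2_eq_square)
qed

text \<open>
  On the set where \<open>w\<close> is at least \<open>1 / (m + 1)\<close> the mass of
  \<open>k\<^sub>n\<close> tends to zero; on the complement, \<open>f\<close> itself has small
  norm once \<open>m\<close> is large, because \<open>w\<close> is positive.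
\<close>

lemma weakly_null_of_escaping_mass:
  assumes k: "\<And>n. k n \<in> L2 \<Omega>" "\<And>n. \<parallel>k n\<parallel> \<le> 1" and f: "f \<in> L2 \<Omega>"
    and w [measurable]: "w \<in> borel_measurable dM" and wpos: "\<And>z. z \<in> \<Omega> \<Longrightarrow> w z > 0"
    and wint: "\<And>n. integrable dM (\<lambda>z. w z * (norm (k n z))\<^sup>2)"
    and lim: "(\<lambda>n. LINT z|dM. w z * (norm (k n z))\<^sup>2) \<longlonglongrightarrow> 0"
  shows "(\<lambda>n. \<langle>k n, f\<rangle>) \<longlonglongrightarrow> 0"
proof (rule LIMSEQ_I)
  fix e :: real assume e: "e > 0"
  have [measurable]: "f \<in> borel_measurable dM" "k n \<in> borel_measurable dM" for n
    using f k by (simp_all add: L2_iff)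
  define E where "E m z = (if w z < 1 / (real m + 1) then 1 else 0 :: complex)" for m :: nat and z
  have [measurable]: "E m \<in> borel_measurable dM" for m unfolding E_def by measurable
  have Eb: "norm (E m z) \<le> 1" "norm (1 - E m z) \<le> 1" for m z by (auto simp: E_def)
  have fE: "(\<lambda>z. E m z * f z) \<in> L2 \<Omega>" for m
    by (rule L2_mult_bounded[OF f _ Eb(1)]) measurable
  have "(\<lambda>m. LINT z|dM. (norm (E m z * f z))\<^sup>2) \<longlonglongrightarrow> (LINT z|dM. (0::real))"
  proof (rule integral_dominated_convergence[where w = "\<lambda>z. (norm (f z))\<^sup>2"])
    show "integrable dM (\<lambda>z. (norm (f z))\<^sup>2)" using f by (simp add: L2_iff)
    show "AE z in dM. (\<lambda>m. (norm (E m z * f z))\<^sup>2) \<longlonglongrightarrow> 0"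
    proof (rule AE_I2)
      fix z assume "z \<in> space dM"
      hence wz: "w z > 0" using wpos by simp
      obtain N where N: "1 / w z < real N" using reals_Archimedean2 by blast
      have "(norm (E m z * f z))\<^sup>2 = 0" if "m \<ge> N" for m
      proof -
        have "1 / w z < real m + 1" using N that by linarith
        hence "1 / (real m + 1) < w z" using wz by (simp add: field_simps)
        thus ?thesis by (simp add: E_def)
      qed
      thus "(\<lambda>m. (norm (E m z * f z))\<^sup>2) \<longlonglongrightarrow> 0"
        by (intro tendsto_eventually eventually_sequentiallyI[of N])
    qed
    show "AE z in dM. norm ((norm (E m z * f z))\<^sup>2) \<le> (norm (f z))\<^sup>2" for m
      by (rule AE_I2) (auto simp: E_def)
  qed measurable
  hence "(\<lambda>m. \<parallel>\<lambda>z. E m z * f z\<parallel>\<^sup>2) \<longlonglongrightarrow> 0" by (simp add: L2_norm_sq)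
  hence "\<forall>\<^sub>F m in sequentially. \<parallel>\<lambda>z. E m z * f z\<parallel>\<^sup>2 < (e / 2)\<^sup>2"
    by (rule order_tendstoD) (use e in simp)
  then obtain m where "\<parallel>\<lambda>z. E m z * f z\<parallel>\<^sup>2 < (e / 2)\<^sup>2"
    by (auto simp: eventually_sequentially)
  hence fm: "\<parallel>\<lambda>z. E m z * f z\<parallel> < e / 2"
    using e by (intro power2_less_imp_less[of _ "e / 2"]) auto
  \<comment> \<open>so that \<open>(m + 1) c\<close> bounds the squared norm of \<open>k n\<close> where \<open>w\<close> is at least \<open>1 / (m + 1)\<close>\<close>
  define c where "c = (e / (2 * (\<parallel>f\<parallel> + 1)))\<^sup>2 / (real m + 1)"
  have f1: "\<parallel>f\<parallel> + 1 > 0" using L2_norm_nonneg[of f] by linarith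
  have c: "c > 0" using e f1 by (simp add: c_def)
  have "\<forall>\<^sub>F n in sequentially. (LINT z|dM. w z * (norm (k n z))\<^sup>2) < c"
    using lim c by (rule order_tendstoD)
  then obtain N where N: "\<And>n. n \<ge> N \<Longrightarrow> (LINT z|dM. w z * (norm (k n z))\<^sup>2) < c"
    by (auto simp: eventually_sequentially)
  show "\<exists>N. \<forall>n\<ge>N. norm (\<langle>k n, f\<rangle> - 0) < e"
  proof (intro exI[of _ N] allI impI)
    fix n assume n: "n \<ge> N"
    have kE: "(\<lambda>z. (1 - E m z) * k n z) \<in> L2 \<Omega>"
      by (rule L2_mult_bounded[OF k(1) _ Eb(2)]) measurable
    have "\<parallel>\<lambda>z. (1 - E m z) * k n z\<parallel>\<^sup>2 \<le> (LINT z|dM. (real m + 1) * (w z * (norm (k n z))\<^sup>2))"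
      unfolding L2_norm_sq
    proof (rule integral_mono)
      show "integrable dM (\<lambda>z. (norm ((1 - E m z) * k n z))\<^sup>2)" using kE by (simp add: L2_iff)
      show "(norm ((1 - E m z) * k n z))\<^sup>2 \<le> (real m + 1) * (w z * (norm (k n z))\<^sup>2)"
        if z: "z \<in> space dM" for z
      proof (cases "w z < 1 / (real m + 1)")
        case True
        thus ?thesis using wpos z by (simp add: E_def less_imp_le)
      next
        case False
        hence "1 \<le> (real m + 1) * w z" by (simp add: field_simps)
        from mult_right_mono[OF this, of "(norm (k n z))\<^sup>2"] False
        show ?thesis by (simp add: E_def mult.assoc)
      qed
    qed (use wint in simp)
    also have "\<dots> = (real m + 1) * (LINT z|dM. w z * (norm (k n z))\<^sup>2)" by simp
    also have "\<dots> \<le> (real m + 1) * c"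
      using N[OF n] by (intro mult_left_mono) auto
    also have "\<dots> = (e / (2 * (\<parallel>f\<parallel> + 1)))\<^sup>2" by (simp add: c_def)
    finally have kn: "\<parallel>\<lambda>z. (1 - E m z) * k n z\<parallel> \<le> e / (2 * (\<parallel>f\<parallel> + 1))"
      using e f1 by (simp add: power2_le_iff_abs_le)
    have Ec: "cnj (E m z) = E m z" for z by (simp add: E_def)
    have "\<langle>k n, f\<rangle> = \<langle>\<lambda>z. (1 - E m z) * k n z + E m z * k n z, f\<rangle>"
      by (rule L2_inner_cong) (auto simp: algebra_simps)
    also have "\<dots> = \<langle>\<lambda>z. (1 - E m z) * k n z, f\<rangle> + \<langle>\<lambda>z. E m z * k n z, f\<rangle>"
      by (rule inner_add_left[OF kE L2_mult_bounded[OF k(1) _ Eb(1)] f]) measurable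
    also have "\<langle>\<lambda>z. E m z * k n z, f\<rangle> = \<langle>k n, \<lambda>z. E m z * f z\<rangle>"
      by (simp add: inner_mult_move Ec)
    finally have "norm \<langle>k n, f\<rangle> \<le> norm \<langle>\<lambda>z. (1 - E m z) * k n z, f\<rangle> + norm \<langle>k n, \<lambda>z. E m z * f z\<rangle>"
      by (simp add: norm_triangle_ineq)
    also have "\<dots> \<le> \<parallel>\<lambda>z. (1 - E m z) * k n z\<parallel> * \<parallel>f\<parallel> + \<parallel>k n\<parallel> * \<parallel>\<lambda>z. E m z * f z\<parallel>"
      by (intro add_mono cauchy_schwarz kE f k fE)
    also have "\<dots> < e"
    proof -
      have "\<parallel>\<lambda>z. (1 - E m z) * k n z\<parallel> * \<parallel>f\<parallel> \<le> e / (2 * (\<parallel>f\<parallel> + 1)) * (\<parallel>f\<parallel> + 1)"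
        using e f1 by (intro mult_mono kn) auto
      also have "\<dots> = e / 2" using f1 by (simp add: field_simps)
      finally have 1: "\<parallel>\<lambda>z. (1 - E m z) * k n z\<parallel> * \<parallel>f\<parallel> \<le> e / 2" .
      have "\<parallel>k n\<parallel> * \<parallel>\<lambda>z. E m z * f z\<parallel> \<le> 1 * \<parallel>\<lambda>z. E m z * f z\<parallel>"
        by (intro mult_right_mono k) auto
      with 1 fm show ?thesis by linarith
    qed
    finally show "norm (\<langle>k n, f\<rangle> - 0) < e" by simp
  qed
qed

text \<open>
  The real part of \<open>nk_self_inner\<close>. For \<open>Re q \<ge> 0\<close> it measures how
  far the mass of \<open>k\<^sub>z\<close> is from the zero set of \<open>Re q\<close>.
\<close>

lemma nk_weight:
  assumes z: "z \<in> \<Omega>" and q: "holo_on q \<Omega>" "\<And>w. w \<in> \<Omega> \<Longrightarrow> norm (q w) \<le> B"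
  shows "integrable dM (\<lambda>w. Re (q w) * (norm (nk z w))\<^sup>2)"
    and "(LINT w|dM. Re (q w) * (norm (nk z w))\<^sup>2) = Re (q z)"
proof -
  have int: "integrable dM (\<lambda>w. (q w * nk z w) * cnj (nk z w))"
    by (intro L2_prod_integrable A2D(1) A2_mult_bounded[OF nk_A2[OF z] q] nk_A2 z)
  have eq: "Re ((q w * nk z w) * cnj (nk z w)) = Re (q w) * (norm (nk z w))\<^sup>2" for w
  proof -
    have "(q w * nk z w) * cnj (nk z w) = q w * of_real ((norm (nk z w))\<^sup>2)"
      by (simp only: mult.assoc complex_norm_square)
    thus ?thesis by (simp only:) (simp del: of_real_power)
  qed
  show "integrable dM (\<lambda>w. Re (q w) * (norm (nk z w))\<^sup>2)"
    using integrable_Re[OF int] by (simp only: eq)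
  have "(LINT w|dM. Re (q w) * (norm (nk z w))\<^sup>2) = Re \<langle>\<lambda>w. q w * nk z w, nk z\<rangle>"
    unfolding L2_inner_eq by (subst integral_Re[OF int, symmetric]) (simp only: eq)
  also have "\<dots> = Re (q z)" by (simp add: nk_self_inner[OF z q])
  finally show "(LINT w|dM. Re (q w) * (norm (nk z w))\<^sup>2) = Re (q z)" .
qed

end

locale toeplitz_symbol = bergman_domain +
  fixes \<phi> :: "complex ^ 2 \<Rightarrow> complex"
  assumes cont: "continuous_on (closure \<Omega>) \<phi>"
begin

abbreviation "T \<equiv> toeplitz \<Omega> \<phi>"
abbreviation "Ts \<equiv> bergman_adjoint \<Omega> T"

lemma symbol_bound: "\<exists>B>0. \<forall>z\<in>closure \<Omega>. norm (\<phi> z) \<le> B"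
proof -
  have "compact (closure \<Omega>)" using bounded_dom by simp
  hence "bounded (\<phi> ` closure \<Omega>)" using cont by (intro compact_imp_bounded compact_continuous_image)
  thus ?thesis by (force simp: bounded_pos)
qed

definition B\<phi> where "B\<phi> = (SOME B. B > 0 \<and> (\<forall>z\<in>closure \<Omega>. norm (\<phi> z) \<le> B))"

lemma B\<phi>: "B\<phi> > 0" "z \<in> closure \<Omega> \<Longrightarrow> norm (\<phi> z) \<le> B\<phi>"
proof -
  have "B\<phi> > 0 \<and> (\<forall>z\<in>closure \<Omega>. norm (\<phi> z) \<le> B\<phi>)"
    unfolding B\<phi>_def by (rule someI_ex) (use symbol_bound in blast)
  thus "B\<phi> > 0" "z \<in> closure \<Omega> \<Longrightarrow> norm (\<phi> z) \<le> B\<phi>" by auto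
qed

lemma B\<phi>_dom: "z \<in> \<Omega> \<Longrightarrow> norm (\<phi> z) \<le> B\<phi>"
  using B\<phi>(2) closure_subset by blast

lemma symbol_measurable [measurable]: "\<phi> \<in> borel_measurable dM"
  by (intro measurable_of_continuous continuous_on_subset[OF cont] closure_subset)

lemma symbol_mult_L2: "f \<in> L2 \<Omega> \<Longrightarrow> (\<lambda>z. \<phi> z * f z) \<in> L2 \<Omega>"
  by (rule L2_mult_bounded[OF _ symbol_measurable B\<phi>_dom])

lemma symbol_cnj_mult_L2: "f \<in> L2 \<Omega> \<Longrightarrow> (\<lambda>z. cnj (\<phi> z) * f z) \<in> L2 \<Omega>"
  by (rule L2_mult_bounded[where B = B\<phi>])
     (use B\<phi>_dom in \<open>auto intro!: borel_measurable_cnj\<close>)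

lemma T_A2: "f \<in> A2 \<Longrightarrow> T f \<in> A2"
  unfolding toeplitz_def by (intro projection_A2 symbol_mult_L2 A2D(1))

lemma T_inner: "f \<in> A2 \<Longrightarrow> h \<in> A2 \<Longrightarrow> \<langle>T f, h\<rangle> = \<langle>\<lambda>z. \<phi> z * f z, h\<rangle>"
  unfolding toeplitz_def by (intro projection_inner symbol_mult_L2 A2D(1))

lemma T_diff:
  assumes f: "f \<in> A2" and g: "g \<in> A2"
  shows "T (\<lambda>z. f z - g z) = (\<lambda>z. T f z - T g z)"
proof (rule A2_eqI)
  show "T (\<lambda>z. f z - g z) \<in> A2" "(\<lambda>z. T f z - T g z) \<in> A2"
    by (intro T_A2 A2_diff f g)+
  fix h assume h: "h \<in> A2"
  have "\<langle>T (\<lambda>z. f z - g z), h\<rangle> = \<langle>\<lambda>z. \<phi> z * (f z - g z), h\<rangle>"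
    by (rule T_inner[OF A2_diff[OF f g] h])
  also have "\<dots> = \<langle>\<lambda>z. \<phi> z * f z - \<phi> z * g z, h\<rangle>" by (simp add: right_diff_distrib)
  also have "\<dots> = \<langle>T f, h\<rangle> - \<langle>T g, h\<rangle>"
    unfolding T_inner[OF f h] T_inner[OF g h]
    by (intro inner_diff_left symbol_mult_L2 A2D(1) f g h)
  also have "\<dots> = \<langle>\<lambda>z. T f z - T g z, h\<rangle>"
    by (intro inner_diff_left[symmetric] A2D(1) T_A2 f g h)
  finally have "cnj \<langle>T (\<lambda>z. f z - g z), h\<rangle> = cnj \<langle>\<lambda>z. T f z - T g z, h\<rangle>" by simp
  thus "\<langle>h, T (\<lambda>z. f z - g z)\<rangle> = \<langle>h, \<lambda>z. T f z - T g z\<rangle>"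
    by (simp only: inner_cnj[symmetric])
qed

lemma T_norm_le: "f \<in> A2 \<Longrightarrow> \<parallel>T f\<parallel> \<le> \<parallel>\<lambda>z. \<phi> z * f z\<parallel>"
  unfolding toeplitz_def by (intro projection_norm symbol_mult_L2 A2D(1))

text \<open>
  The adjoint is the Toeplitz operator of the conjugate symbol.
\<close>

lemma adjoint:
  assumes g: "g \<in> A2"
  shows Ts_A2: "Ts g \<in> A2" and Ts_inner: "f \<in> A2 \<Longrightarrow> \<langle>T f, g\<rangle> = \<langle>f, Ts g\<rangle>"
    and Ts_eq: "Ts g = P (\<lambda>z. cnj (\<phi> z) * g z)"
proof -
  let ?h = "P (\<lambda>z. cnj (\<phi> z) * g z)"
  have hA: "?h \<in> A2" by (intro projection_A2 symbol_cnj_mult_L2 A2D(1) g)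
  have h: "\<langle>T f, g\<rangle> = \<langle>f, ?h\<rangle>" if f: "f \<in> A2" for f
  proof -
    have "\<langle>?h, f\<rangle> = \<langle>\<lambda>z. cnj (\<phi> z) * g z, f\<rangle>"
      by (intro projection_inner symbol_cnj_mult_L2 A2D(1) g f)
    hence "\<langle>f, ?h\<rangle> = \<langle>f, \<lambda>z. cnj (\<phi> z) * g z\<rangle>"
      unfolding inner_cnj[of f ?h] inner_cnj[of f "\<lambda>z. cnj (\<phi> z) * g z"] by simp
    thus ?thesis by (simp add: T_inner[OF f g] inner_mult_move)
  qed
  have "Ts g = ?h"
    unfolding bergman_adjoint_def
  proof (rule the_equality)
    show "?h \<in> A2 \<and> (\<forall>f\<in>A2. \<langle>T f, g\<rangle> = \<langle>f, ?h\<rangle>)" using hA h by blast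
    fix h' assume "h' \<in> A2 \<and> (\<forall>f\<in>A2. \<langle>T f, g\<rangle> = \<langle>f, h'\<rangle>)"
    thus "h' = ?h" using h hA by (intro A2_eqI) auto
  qed
  thus "Ts g = ?h" "Ts g \<in> A2" "f \<in> A2 \<Longrightarrow> \<langle>T f, g\<rangle> = \<langle>f, Ts g\<rangle>"
    using hA h by simp_all
qed

lemma Ts_diff_norm:
  assumes f: "f \<in> A2" and g: "g \<in> A2"
  shows "\<parallel>\<lambda>z. Ts f z - Ts g z\<parallel> \<le> B\<phi> * \<parallel>\<lambda>z. f z - g z\<parallel>"
proof -
  have d: "(\<lambda>z. Ts f z - Ts g z) \<in> A2" by (intro A2_diff Ts_A2 f g)
  have u: "(\<lambda>z. cnj (\<phi> z) * (f z - g z)) \<in> L2 \<Omega>"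
    by (intro symbol_cnj_mult_L2 A2D(1) A2_diff f g)
  have "\<parallel>\<lambda>z. Ts f z - Ts g z\<parallel> \<le> \<parallel>\<lambda>z. cnj (\<phi> z) * (f z - g z)\<parallel>"
  proof (rule norm_le_of_weak_eq[OF d u])
    let ?d = "\<lambda>z. Ts f z - Ts g z"
    have "\<langle>?d, ?d\<rangle> = \<langle>Ts f, ?d\<rangle> - \<langle>Ts g, ?d\<rangle>"
      by (intro inner_diff_left A2D(1) Ts_A2 f g d)
    also have "\<dots> = \<langle>\<lambda>z. cnj (\<phi> z) * f z, ?d\<rangle> - \<langle>\<lambda>z. cnj (\<phi> z) * g z, ?d\<rangle>"
      using projection_inner[OF symbol_cnj_mult_L2[OF A2D(1)[OF f]] d]
        projection_inner[OF symbol_cnj_mult_L2[OF A2D(1)[OF g]] d]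
      by (simp add: Ts_eq[OF f, symmetric] Ts_eq[OF g, symmetric])
    also have "\<dots> = \<langle>\<lambda>z. cnj (\<phi> z) * f z - cnj (\<phi> z) * g z, ?d\<rangle>"
      by (intro inner_diff_left[symmetric] symbol_cnj_mult_L2 A2D(1) f g d)
    finally show "\<langle>?d, ?d\<rangle> = \<langle>\<lambda>z. cnj (\<phi> z) * (f z - g z), ?d\<rangle>"
      by (simp add: right_diff_distrib)
  qed
  also have "\<dots> \<le> B\<phi> * \<parallel>\<lambda>z. f z - g z\<parallel>"
    by (rule L2_norm_mult_bounded)
       (use B\<phi>_dom B\<phi>(1) f g A2D(1) L2_diff in \<open>auto intro!: borel_measurable_cnj\<close>)
  finally show ?thesis .
qed

lemma compact_imp_compact_TsT:
  assumes T: "compact_operator \<Omega> T"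
  shows "compact_operator \<Omega> (Ts \<circ> T)"
  unfolding compact_operator_def
proof (intro allI impI)
  fix f :: "nat \<Rightarrow> complex ^ 2 \<Rightarrow> complex"
  assume f: "(\<forall>n. f n \<in> A2) \<and> (\<exists>M. \<forall>n. \<parallel>f n\<parallel> \<le> M)"
  then obtain g r where g: "g \<in> A2" "strict_mono (r :: nat \<Rightarrow> nat)"
      "(\<lambda>n. \<parallel>\<lambda>z. T (f (r n)) z - g z\<parallel>) \<longlonglongrightarrow> 0"
    using T unfolding compact_operator_def by blast
  have "(\<lambda>n. \<parallel>\<lambda>z. (Ts \<circ> T) (f (r n)) z - Ts g z\<parallel>) \<longlonglongrightarrow> 0"
  proof (rule Lim_null_comparison[OF always_eventually], rule allI)
    show "norm \<parallel>\<lambda>z. (Ts \<circ> T) (f (r n)) z - Ts g z\<parallel> \<le> B\<phi> * \<parallel>\<lambda>z. T (f (r n)) z - g z\<parallel>" for n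
      using Ts_diff_norm[OF T_A2 g(1), of "f (r n)"] f by simp
    show "(\<lambda>n. B\<phi> * \<parallel>\<lambda>z. T (f (r n)) z - g z\<parallel>) \<longlonglongrightarrow> 0"
      using tendsto_mult_left[OF g(3), of B\<phi>] by simp
  qed
  thus "\<exists>g\<in>A2. \<exists>r. strict_mono r \<and> (\<lambda>n. \<parallel>\<lambda>z. (Ts \<circ> T) (f (r n)) z - g z\<parallel>) \<longlonglongrightarrow> 0"
    using g Ts_A2[OF g(1)] by blast
qed

text \<open>
  The identity \<open>\<parallel>T d\<parallel>\<^sup>2 = \<langle>d, T\<^sup>*T
  d\<rangle>\<close> for \<open>d = f - g\<close>.
\<close>

lemma TsT_norm:
  assumes "f \<in> A2" "g \<in> A2"
  shows "\<parallel>\<lambda>z. T f z - T g z\<parallel>\<^sup>2 \<le> \<parallel>\<lambda>z. f z - g z\<parallel> * \<parallel>\<lambda>z. Ts (T f) z - Ts (T g) z\<parallel>"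
proof -
  let ?d = "\<lambda>z. f z - g z"
  have d: "?d \<in> A2" by (intro A2_diff assms)
  have Td: "T ?d = (\<lambda>z. T f z - T g z)" by (rule T_diff[OF assms])
  have TA: "T f \<in> A2" "T g \<in> A2" "T ?d \<in> A2" using assms d by (auto intro: T_A2)
  have TsA: "Ts (T f) \<in> A2" "Ts (T g) \<in> A2" using TA by (auto intro: Ts_A2)
  have "\<langle>T ?d, T ?d\<rangle> = \<langle>T ?d, T f\<rangle> - \<langle>T ?d, T g\<rangle>"
    unfolding Td using TA by (intro inner_diff_right A2D(1) A2_diff) auto
  also have "\<dots> = \<langle>?d, Ts (T f)\<rangle> - \<langle>?d, Ts (T g)\<rangle>"
    by (simp only: Ts_inner[OF TA(1) d] Ts_inner[OF TA(2) d])
  also have "\<dots> = \<langle>?d, \<lambda>z. Ts (T f) z - Ts (T g) z\<rangle>"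
    by (intro inner_diff_right[symmetric] A2D(1) TsA d)
  finally have "complex_of_real (\<parallel>T ?d\<parallel>\<^sup>2) = \<langle>?d, \<lambda>z. Ts (T f) z - Ts (T g) z\<rangle>"
    by (simp only: inner_self)
  hence "\<parallel>T ?d\<parallel>\<^sup>2 = Re \<langle>?d, \<lambda>z. Ts (T f) z - Ts (T g) z\<rangle>"
    by (metis Re_complex_of_real)
  also have "\<dots> \<le> \<parallel>?d\<parallel> * \<parallel>\<lambda>z. Ts (T f) z - Ts (T g) z\<parallel>"
    by (intro Re_inner_le A2D(1) d A2_diff TsA)
  finally show ?thesis unfolding Td .
qed

text \<open>
  By \<open>TsT_norm\<close>, convergence of \<open>T\<^sup>*T f\<^sub>n\<close> makes \<open>T
  f\<^sub>n\<close> a Cauchy sequence when \<open>f\<^sub>n\<close> is bounded.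
\<close>

lemma compact_TsT_imp_compact:
  assumes TsT: "compact_operator \<Omega> (Ts \<circ> T)"
  shows "compact_operator \<Omega> T"
  unfolding compact_operator_def
proof (intro allI impI)
  fix f :: "nat \<Rightarrow> complex ^ 2 \<Rightarrow> complex"
  assume f': "(\<forall>n. f n \<in> A2) \<and> (\<exists>M. \<forall>n. \<parallel>f n\<parallel> \<le> M)"
  then obtain M where f: "\<And>n. f n \<in> A2" and M: "\<And>n. \<parallel>f n\<parallel> \<le> M" by blast
  have M0: "M \<ge> 0" by (rule order_trans[OF L2_norm_nonneg M])
  obtain g r where g: "g \<in> A2" "strict_mono (r :: nat \<Rightarrow> nat)"
      "(\<lambda>n. \<parallel>\<lambda>z. (Ts \<circ> T) (f (r n)) z - g z\<parallel>) \<longlonglongrightarrow> 0"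
    using TsT f' unfolding compact_operator_def by blast
  define a where "a n = \<parallel>\<lambda>z. Ts (T (f (r n))) z - g z\<parallel>" for n
  have a: "a \<longlonglongrightarrow> 0" using g(3) unfolding a_def by simp
  have key: "\<parallel>\<lambda>z. T (f (r m)) z - T (f (r n)) z\<parallel>\<^sup>2 \<le> 2 * M * (a m + a n)" for m n
  proof -
    have TsA: "Ts (T (f (r k))) \<in> A2" for k by (intro Ts_A2 T_A2 f)
    have "\<parallel>\<lambda>z. f (r m) z - f (r n) z\<parallel> \<le> \<parallel>f (r m)\<parallel> + \<parallel>f (r n)\<parallel>"
      using norm_triangle_L2[OF A2D(1)[OF f] L2_scale[OF A2D(1)[OF f]], of "r m" "-1" "r n"]
        norm_scale[of "-1" "f (r n)"] by simp
    also have "\<dots> \<le> 2 * M" using M[of "r m"] M[of "r n"] by simp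
    finally have 1: "\<parallel>\<lambda>z. f (r m) z - f (r n) z\<parallel> \<le> 2 * M" .
    have "\<parallel>\<lambda>z. Ts (T (f (r m))) z - Ts (T (f (r n))) z\<parallel>
        \<le> a m + \<parallel>\<lambda>z. g z - Ts (T (f (r n))) z\<parallel>"
      unfolding a_def by (intro norm_diff_triangle_L2 A2D(1) TsA g)
    also have "\<parallel>\<lambda>z. g z - Ts (T (f (r n))) z\<parallel> = a n"
      unfolding a_def by (rule norm_minus_commute_L2)
    finally have 2: "\<parallel>\<lambda>z. Ts (T (f (r m))) z - Ts (T (f (r n))) z\<parallel> \<le> a m + a n" .
    show ?thesis
      by (rule order_trans[OF TsT_norm[OF f f] mult_mono[OF 1 2]]) (use M0 in auto)
  qed
  obtain h where h: "h \<in> A2" "(\<lambda>n. \<parallel>\<lambda>z. T (f (r n)) z - h z\<parallel>) \<longlonglongrightarrow> 0"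
  proof (rule A2_complete[of "\<lambda>n. T (f (r n))"])
    show "T (f (r n)) \<in> A2" for n by (intro T_A2 f)
    fix e :: real assume e: "e > 0"
    define c where "c = e\<^sup>2 / (4 * M + 1)"
    have c: "c > 0" using e M0 by (simp add: c_def)
    have "\<forall>\<^sub>F n in sequentially. a n < c" using a c by (rule order_tendstoD)
    then obtain N where N: "\<And>n. n \<ge> N \<Longrightarrow> a n < c" by (auto simp: eventually_sequentially)
    show "\<exists>N. \<forall>m\<ge>N. \<forall>n\<ge>N. \<parallel>\<lambda>z. T (f (r m)) z - T (f (r n)) z\<parallel> \<le> e"
    proof (intro exI[of _ N] allI impI)
      fix m n assume mn: "m \<ge> N" "n \<ge> N"
      have "2 * M * (a m + a n) \<le> 2 * M * (c + c)"
        using N[OF mn(1)] N[OF mn(2)] M0 by (intro mult_left_mono) auto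
      also have "\<dots> = 4 * M * c" by simp
      also have "\<dots> \<le> (4 * M + 1) * c" using c by (simp add: algebra_simps)
      also have "\<dots> = e\<^sup>2" using M0 by (simp add: c_def)
      finally have "\<parallel>\<lambda>z. T (f (r m)) z - T (f (r n)) z\<parallel>\<^sup>2 \<le> e\<^sup>2"
        using key[of m n] by simp
      thus "\<parallel>\<lambda>z. T (f (r m)) z - T (f (r n)) z\<parallel> \<le> e" using e by (simp add: power2_le_iff_abs_le)
    qed
  qed blast
  thus "\<exists>g\<in>A2. \<exists>r. strict_mono r \<and> (\<lambda>n. \<parallel>\<lambda>z. T (f (r n)) z - g z\<parallel>) \<longlonglongrightarrow> 0"
    using g(2) by blast
qed

text \<open>
  The set where \<open>|\<phi>| \<ge> \<epsilon>\<close> is a compact subset of the domain. On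
  it a pointwise convergent subsequence converges in \<open>L\<^sup>2\<close> by dominated
  convergence; off it multiplication by \<open>\<phi>\<close> has norm at most
  \<open>\<epsilon>\<close>.
\<close>

lemma compact_of_vanishing_boundary:
  assumes zero: "\<And>z. z \<in> frontier \<Omega> \<Longrightarrow> \<phi> z = 0"
  shows "compact_operator \<Omega> T"
  unfolding compact_operator_def
proof (intro allI impI)
  fix f :: "nat \<Rightarrow> complex ^ 2 \<Rightarrow> complex"
  assume "(\<forall>n. f n \<in> A2) \<and> (\<exists>M. \<forall>n. \<parallel>f n\<parallel> \<le> M)"
  then obtain M where f: "\<And>n. f n \<in> A2" and M: "\<And>n. \<parallel>f n\<parallel> \<le> M" by blast
  obtain g r where g: "g \<in> A2" "strict_mono (r :: nat \<Rightarrow> nat)"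
      "\<And>z. z \<in> \<Omega> \<Longrightarrow> (\<lambda>n. f (r n) z) \<longlonglongrightarrow> g z"
    using A2_montel[of f M] f M by blast
  define d where "d n z = f (r n) z - g z" for n z
  have dA: "d n \<in> A2" for n unfolding d_def by (intro A2_diff f g)
  define L where "L = M + \<parallel>g\<parallel>"
  have dn: "\<parallel>d n\<parallel> \<le> L" for n
  proof -
    have "\<parallel>\<lambda>z. f (r n) z - g z\<parallel> \<le> \<parallel>f (r n)\<parallel> + \<parallel>g\<parallel>"
      using norm_triangle_L2[OF A2D(1)[OF f] L2_scale[OF A2D(1)[OF g(1)]], of "r n" "-1"]
        norm_scale[of "-1" g] by simp
    thus ?thesis using M[of "r n"] unfolding L_def d_def[abs_def] by simp
  qed
  have L0: "L \<ge> 0" by (rule order_trans[OF L2_norm_nonneg dn])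
  have "(\<lambda>n. \<parallel>\<lambda>z. \<phi> z * d n z\<parallel>\<^sup>2) \<longlonglongrightarrow> 0"
  proof (rule LIMSEQ_I)
    fix e :: real assume e: "e > 0"
    define \<epsilon> where "\<epsilon> = sqrt (e / (2 * (L\<^sup>2 + 1)))"
    have L1: "L\<^sup>2 + 1 > 0" by (simp add: add_nonneg_pos)
    have \<epsilon>: "\<epsilon> > 0" "\<epsilon>\<^sup>2 = e / (2 * (L\<^sup>2 + 1))" using e L1 by (auto simp: \<epsilon>_def)
    define K where "K = {z \<in> closure \<Omega>. norm (\<phi> z) \<ge> \<epsilon>}"
    have "closed {z \<in> closure \<Omega>. norm (\<phi> z) \<in> {\<epsilon>..}}"
      by (rule continuous_closed_preimage[OF continuous_on_norm[OF cont], unfolded vimage_def Int_def mem_Collect_eq]) auto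
    hence "compact K"
      unfolding K_def using bounded_dom
      by (auto simp: compact_eq_bounded_closed intro: bounded_subset[OF bounded_closure])
    moreover have KO: "K \<subseteq> \<Omega>"
    proof
      fix z assume z: "z \<in> K"
      show "z \<in> \<Omega>"
      proof (rule ccontr)
        assume "z \<notin> \<Omega>"
        hence "z \<in> frontier \<Omega>"
          using z open_dom by (simp add: K_def frontier_def interior_open)
        thus False using zero[of z] z \<epsilon>(1) by (simp add: K_def)
      qed
    qed
    ultimately obtain C where C: "C > 0" "\<And>f z. f \<in> A2 \<Longrightarrow> z \<in> K \<Longrightarrow> norm (f z) \<le> C * \<parallel>f\<parallel>"
      using A2_pointwise_bound[of K] by blast
    have Km: "K \<in> sets dM"
      using \<open>compact K\<close> KO by (auto simp: sets_restrict_space_iff dest!: borel_compact)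
    have [measurable]: "d n \<in> borel_measurable dM" for n
      using A2D(1)[OF dA] by (simp add: L2_iff)
    have indm [measurable]: "(indicator K :: _ \<Rightarrow> real) \<in> borel_measurable dM"
      using Km by simp
    have intd: "integrable dM (\<lambda>z. (norm (d n z))\<^sup>2)" for n
      using A2D(1)[OF dA] by (simp add: L2_iff)
    have mK: "(\<lambda>z. indicator K z * (norm (d n z))\<^sup>2) \<in> borel_measurable dM" for n
      by measurable
    have intK: "integrable dM (\<lambda>z. indicator K z * (norm (d n z))\<^sup>2)" for n
      by (rule Bochner_Integration.integrable_bound[OF intd[of n] mK])
         (auto simp: indicator_def intro!: AE_I2)
    interpret finite_measure dM by (rule finite_dM)
    have "(\<lambda>n. LINT z|dM. indicator K z * (norm (d n z))\<^sup>2) \<longlonglongrightarrow> (LINT z|dM. (0::real))"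
    proof (rule integral_dominated_convergence[where w = "\<lambda>z. (C * L)\<^sup>2"])
      show "AE z in dM. (\<lambda>n. indicator K z * (norm (d n z))\<^sup>2) \<longlonglongrightarrow> 0"
      proof (rule AE_I2)
        fix z assume "z \<in> space dM"
        hence "(\<lambda>n. d n z) \<longlonglongrightarrow> 0"
          unfolding d_def using g(3)[of z] by (simp add: LIM_zero)
        from tendsto_mult_left[OF tendsto_power[OF tendsto_norm[OF this], of 2]]
        show "(\<lambda>n. indicator K z * (norm (d n z))\<^sup>2) \<longlonglongrightarrow> 0" by simp
      qed
      show "AE z in dM. norm (indicator K z * (norm (d n z))\<^sup>2) \<le> (C * L)\<^sup>2" for n
      proof (rule AE_I2)
        fix z
        show "norm (indicator K z * (norm (d n z))\<^sup>2) \<le> (C * L)\<^sup>2"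
        proof (cases "z \<in> K")
          case True
          have "norm (d n z) \<le> C * \<parallel>d n\<parallel>" by (rule C(2)[OF dA True])
          also have "\<dots> \<le> C * L" using C(1) dn by (intro mult_left_mono) auto
          finally show ?thesis using True by (simp add: power_mono)
        qed simp
      qed
    qed (simp_all, measurable)
    hence "(\<lambda>n. LINT z|dM. indicator K z * (norm (d n z))\<^sup>2) \<longlonglongrightarrow> 0" by simp
    from order_tendstoD(2)[OF this, of "e / (2 * B\<phi>\<^sup>2)"] e B\<phi>(1)
    obtain N where N: "\<And>n. n \<ge> N \<Longrightarrow> (LINT z|dM. indicator K z * (norm (d n z))\<^sup>2) < e / (2 * B\<phi>\<^sup>2)"
      by (auto simp: eventually_sequentially)
    show "\<exists>N. \<forall>n\<ge>N. norm (\<parallel>\<lambda>z. \<phi> z * d n z\<parallel>\<^sup>2 - 0) < e"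
    proof (intro exI[of _ N] allI impI)
      fix n assume n: "n \<ge> N"
      have "\<parallel>\<lambda>z. \<phi> z * d n z\<parallel>\<^sup>2
          \<le> (LINT z|dM. \<epsilon>\<^sup>2 * (norm (d n z))\<^sup>2 + B\<phi>\<^sup>2 * (indicator K z * (norm (d n z))\<^sup>2))"
        unfolding L2_norm_sq
      proof (rule integral_mono)
        show "integrable dM (\<lambda>z. (norm (\<phi> z * d n z))\<^sup>2)"
          using symbol_mult_L2[OF A2D(1)[OF dA]] by (simp add: L2_iff)
        show "integrable dM (\<lambda>z. \<epsilon>\<^sup>2 * (norm (d n z))\<^sup>2 + B\<phi>\<^sup>2 * (indicator K z * (norm (d n z))\<^sup>2))"
          using intd intK by simp
        fix z assume "z \<in> space dM"
        hence z: "z \<in> \<Omega>" by simp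
        show "(norm (\<phi> z * d n z))\<^sup>2 \<le> \<epsilon>\<^sup>2 * (norm (d n z))\<^sup>2 + B\<phi>\<^sup>2 * (indicator K z * (norm (d n z))\<^sup>2)"
        proof (cases "z \<in> K")
          case True
          have "(norm (\<phi> z))\<^sup>2 \<le> B\<phi>\<^sup>2" using B\<phi>_dom[OF z] by (intro power_mono) auto
          hence "(norm (\<phi> z))\<^sup>2 * (norm (d n z))\<^sup>2 \<le> B\<phi>\<^sup>2 * (norm (d n z))\<^sup>2"
            by (intro mult_right_mono) auto
          thus ?thesis using True by (simp add: norm_mult power_mult_distrib add_increasing)
        next
          case False
          hence "norm (\<phi> z) \<le> \<epsilon>" using z closure_subset unfolding K_def by auto
          hence "(norm (\<phi> z))\<^sup>2 \<le> \<epsilon>\<^sup>2" by (intro power_mono) auto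
          hence "(norm (\<phi> z))\<^sup>2 * (norm (d n z))\<^sup>2 \<le> \<epsilon>\<^sup>2 * (norm (d n z))\<^sup>2"
            by (intro mult_right_mono) auto
          thus ?thesis using False by (simp add: norm_mult power_mult_distrib)
        qed
      qed
      also have "\<dots> = \<epsilon>\<^sup>2 * \<parallel>d n\<parallel>\<^sup>2 + B\<phi>\<^sup>2 * (LINT z|dM. indicator K z * (norm (d n z))\<^sup>2)"
        unfolding L2_norm_sq using intd intK by simp
      also have "\<dots> < e / 2 + e / 2"
      proof (rule add_le_less_mono)
        have "\<epsilon>\<^sup>2 * \<parallel>d n\<parallel>\<^sup>2 \<le> \<epsilon>\<^sup>2 * (L\<^sup>2 + 1)"
          using power_mono[OF dn[of n], of 2] by (intro mult_left_mono) auto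
        also have "\<dots> = e / 2" using L1 \<epsilon>(2) by (simp add: field_simps)
        finally show "\<epsilon>\<^sup>2 * \<parallel>d n\<parallel>\<^sup>2 \<le> e / 2" .
        have "B\<phi>\<^sup>2 * (LINT z|dM. indicator K z * (norm (d n z))\<^sup>2) < B\<phi>\<^sup>2 * (e / (2 * B\<phi>\<^sup>2))"
          using N[OF n] B\<phi>(1) by (intro mult_strict_left_mono) auto
        thus "B\<phi>\<^sup>2 * (LINT z|dM. indicator K z * (norm (d n z))\<^sup>2) < e / 2"
          using B\<phi>(1) by simp
      qed
      finally show "norm (\<parallel>\<lambda>z. \<phi> z * d n z\<parallel>\<^sup>2 - 0) < e" by simp
    qed
  qed
  from tendsto_real_sqrt[OF this] have lim: "(\<lambda>n. \<parallel>\<lambda>z. \<phi> z * d n z\<parallel>) \<longlonglongrightarrow> 0" by simp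
  have "(\<lambda>n. \<parallel>\<lambda>z. T (f (r n)) z - T g z\<parallel>) \<longlonglongrightarrow> 0"
  proof (rule Lim_null_comparison[OF always_eventually lim], rule allI)
    fix n
    have "T (d n) = (\<lambda>z. T (f (r n)) z - T g z)"
      unfolding d_def[abs_def] by (rule T_diff[OF f g(1)])
    thus "norm \<parallel>\<lambda>z. T (f (r n)) z - T g z\<parallel> \<le> \<parallel>\<lambda>z. \<phi> z * d n z\<parallel>"
      using T_norm_le[OF dA[of n]] by simp
  qed
  thus "\<exists>g\<in>A2. \<exists>r. strict_mono r \<and> (\<lambda>n. \<parallel>\<lambda>z. T (f (r n)) z - g z\<parallel>) \<longlonglongrightarrow> 0"
    using g(2) T_A2[OF g(1)] by blast
qed

text \<open>
  A norm limit \<open>g\<close> of \<open>T k\<^sub>n\<close> satisfies \<open>\<langle>g,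
  g\<rangle> = lim \<langle>k\<^sub>n, T\<^sup>* g\<rangle> = 0\<close>.
\<close>

lemma compact_weakly_null:
  assumes T: "compact_operator \<Omega> T" and k: "\<And>n. k n \<in> A2" "\<And>n. \<parallel>k n\<parallel> \<le> 1"
    and weak: "\<And>f. f \<in> A2 \<Longrightarrow> (\<lambda>n. \<langle>k n, f\<rangle>) \<longlonglongrightarrow> 0"
  shows "\<exists>r. strict_mono (r :: nat \<Rightarrow> nat) \<and> (\<lambda>n. \<parallel>T (k (r n))\<parallel>) \<longlonglongrightarrow> 0"
proof -
  have "(\<forall>n. k n \<in> A2) \<and> (\<exists>M. \<forall>n. \<parallel>k n\<parallel> \<le> M)" using k by blast
  then obtain g r where g: "g \<in> A2" "strict_mono (r :: nat \<Rightarrow> nat)"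
      "(\<lambda>n. \<parallel>\<lambda>z. T (k (r n)) z - g z\<parallel>) \<longlonglongrightarrow> 0"
    using T unfolding compact_operator_def by blast
  have TA: "T (k (r n)) \<in> L2 \<Omega>" for n by (intro A2D(1) T_A2 k)
  have "(\<lambda>n. \<langle>T (k (r n)), g\<rangle>) \<longlonglongrightarrow> \<langle>g, g\<rangle>"
    by (rule A2_inner_tendsto[OF TA A2D(1)[OF g(1)] g(3) A2D(1)[OF g(1)]])
  moreover have "(\<lambda>n. \<langle>T (k (r n)), g\<rangle>) \<longlonglongrightarrow> 0"
    unfolding Ts_inner[OF g(1) k(1)]
    using LIMSEQ_subseq_LIMSEQ[OF weak[OF Ts_A2[OF g(1)]] g(2)] by (simp add: o_def)
  ultimately have "\<langle>g, g\<rangle> = 0" by (rule LIMSEQ_unique)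
  hence "\<parallel>g\<parallel> = 0" by (simp add: inner_self)
  thus ?thesis
    using A2_norm_tendsto[OF TA A2D(1)[OF g(1)] g(3)] g(2) by auto
qed

lemma berezin_TsT:
  assumes z: "z \<in> \<Omega>"
  shows "berezin \<Omega> (Ts \<circ> T) z = of_real (\<parallel>T (nk z)\<parallel>\<^sup>2)"
proof -
  have TA: "T (nk z) \<in> A2" by (intro T_A2 nk_A2 z)
  have "\<langle>Ts (T (nk z)), nk z\<rangle> = cnj \<langle>T (nk z), T (nk z)\<rangle>"
    unfolding Ts_inner[OF TA nk_A2[OF z]] by (rule inner_cnj)
  thus ?thesis by (simp add: berezin_def inner_self)
qed

lemma berezin_T: "z \<in> \<Omega> \<Longrightarrow> berezin \<Omega> T z = \<langle>\<lambda>w. \<phi> w * nk z w, nk z\<rangle>"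
  unfolding berezin_def by (intro T_inner nk_A2)

lemma berezin_T_le: "z \<in> \<Omega> \<Longrightarrow> norm (berezin \<Omega> T z) \<le> \<parallel>T (nk z)\<parallel>"
  unfolding berezin_def
  using cauchy_schwarz[OF A2D(1)[OF T_A2[OF nk_A2]] A2D(1)[OF nk_A2], of z z] by (simp add: nk_norm)

text \<open>
  Since \<open>Re q\<close> is bounded below away from \<open>p\<close>, \<open>|\<phi> - \<phi>
  p| \<le> \<epsilon> + D Re q\<close> for a suitable \<open>D\<close>; integrate this against
  \<open>|k\<^sub>z|\<^sup>2\<close> and use \<open>nk_weight\<close>.
\<close>

lemma berezin_tendsto_at_peak_point:
  assumes z: "\<And>n. z n \<in> \<Omega>" and p: "p \<in> closure \<Omega>"
    and q: "holo_on q \<Omega>" "continuous_on (closure \<Omega>) q"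
    and peak: "\<And>w. w \<in> closure \<Omega> \<Longrightarrow> w \<noteq> p \<Longrightarrow> Re (q w) > 0" "q p = 0"
    and lim: "(\<lambda>n. q (z n)) \<longlonglongrightarrow> 0"
  shows "(\<lambda>n. berezin \<Omega> T (z n)) \<longlonglongrightarrow> \<phi> p"
proof (rule LIMSEQ_I)
  fix e :: real assume e: "e > 0"
  have com: "compact (closure \<Omega>)" using bounded_dom by simp
  have "bounded (q ` closure \<Omega>)"
    using com q(2) by (intro compact_imp_bounded compact_continuous_image)
  then obtain Q where Q: "\<And>w. w \<in> \<Omega> \<Longrightarrow> norm (q w) \<le> Q"
    using closure_subset by (force simp: bounded_iff)
  have Re0: "Re (q w) \<ge> 0" if "w \<in> closure \<Omega>" for w
    using peak(1)[OF that] peak(2) by (cases "w = p") auto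
  define K where "K = {w \<in> closure \<Omega>. norm (\<phi> w - \<phi> p) \<ge> e / 2}"
  have "\<exists>C>0. \<forall>w\<in>K. 1 \<le> C * Re (q w)"
  proof (cases "K = {}")
    case False
    have "closed {w \<in> closure \<Omega>. norm (\<phi> w - \<phi> p) \<in> {e / 2..}}"
      by (rule continuous_closed_preimage[of "closure \<Omega>" "\<lambda>w. norm (\<phi> w - \<phi> p)",
            unfolded vimage_def Int_def mem_Collect_eq])
         (auto intro!: continuous_intros cont)
    hence "compact K"
      unfolding K_def using bounded_dom
      by (auto simp: compact_eq_bounded_closed intro: bounded_subset[OF bounded_closure])
    moreover have "continuous_on K (\<lambda>w. Re (q w))"
      by (intro continuous_intros continuous_on_subset[OF q(2)]) (auto simp: K_def)
    ultimately obtain w0 where w0: "w0 \<in> K" "\<And>w. w \<in> K \<Longrightarrow> Re (q w0) \<le> Re (q w)"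
      using continuous_attains_inf[of K "\<lambda>w. Re (q w)"] False by blast
    have pos: "Re (q w0) > 0"
      using w0(1) e unfolding K_def by (intro peak(1)) auto
    show ?thesis
      using w0(2) pos by (intro exI[of _ "1 / Re (q w0)"]) (auto simp: field_simps)
  qed (auto intro: exI[of _ 1])
  then obtain C where C: "C > 0" "\<And>w. w \<in> K \<Longrightarrow> 1 \<le> C * Re (q w)" by blast
  \<comment> \<open>\<open>|\<phi> - \<phi> p|\<close> never exceeds \<open>2 B\<phi>\<close>, and \<open>1 \<le> C Re q\<close> where it is large\<close>
  define D where "D = 2 * B\<phi> * C"
  have D: "D > 0" using C B\<phi> by (simp add: D_def)
  have pt: "norm (\<phi> w - \<phi> p) \<le> e / 2 + D * Re (q w)" if w: "w \<in> \<Omega>" for w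
  proof (cases "w \<in> K")
    case True
    have wc: "w \<in> closure \<Omega>" using w closure_subset by blast
    have "norm (\<phi> w - \<phi> p) \<le> norm (\<phi> w) + norm (\<phi> p)" by (rule norm_triangle_ineq4)
    also have "\<dots> \<le> 2 * B\<phi> * 1" using B\<phi>(2)[OF wc] B\<phi>(2)[OF p] by simp
    also have "\<dots> \<le> 2 * B\<phi> * (C * Re (q w))"
      using B\<phi>(1) C(2)[OF True] by (intro mult_left_mono) auto
    finally show ?thesis using e by (simp add: D_def mult.assoc)
  next
    case False
    hence "norm (\<phi> w - \<phi> p) < e / 2" using w closure_subset unfolding K_def by auto
    moreover have "0 \<le> D * Re (q w)"
      using D Re0[of w] w closure_subset by (intro mult_nonneg_nonneg) auto
    ultimately show ?thesis by linarith
  qed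
  have "(\<lambda>n. Re (q (z n))) \<longlonglongrightarrow> 0" using tendsto_Re[OF lim] by simp
  from order_tendstoD(2)[OF this, of "e / (2 * D)"] e D
  obtain N where N: "\<And>n. n \<ge> N \<Longrightarrow> Re (q (z n)) < e / (2 * D)"
    by (auto simp: eventually_sequentially)
  show "\<exists>N. \<forall>n\<ge>N. norm (berezin \<Omega> T (z n) - \<phi> p) < e"
  proof (intro exI[of _ N] allI impI)
    fix n assume n: "n \<ge> N"
    let ?k = "nk (z n)"
    have k: "?k \<in> L2 \<Omega>" by (intro A2D(1) nk_A2 z)
    have kn: "(LINT w|dM. (norm (?k w))\<^sup>2) = 1" using nk_norm[OF z[of n]] by (simp flip: L2_norm_sq)
    have ik: "integrable dM (\<lambda>w. (norm (?k w))\<^sup>2)" using k by (simp add: L2_iff)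
    have "berezin \<Omega> T (z n) - \<phi> p = \<langle>\<lambda>w. \<phi> w * ?k w, ?k\<rangle> - \<phi> p * \<langle>?k, ?k\<rangle>"
      by (simp add: berezin_T[OF z] inner_self nk_norm[OF z])
    also have "\<dots> = \<langle>\<lambda>w. \<phi> w * ?k w - \<phi> p * ?k w, ?k\<rangle>"
      by (simp add: inner_diff_left symbol_mult_L2 L2_scale k inner_scale_left)
    also have "\<dots> = (LINT w|dM. (\<phi> w - \<phi> p) * of_real ((norm (?k w))\<^sup>2))"
      unfolding L2_inner_eq
      by (intro Bochner_Integration.integral_cong refl)
         (simp only: complex_norm_square, simp add: algebra_simps)
    also have "norm \<dots> \<le> (LINT w|dM. norm ((\<phi> w - \<phi> p) * of_real ((norm (?k w))\<^sup>2)))"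
      by (rule integral_norm_bound)
    also have "\<dots> \<le> (LINT w|dM. e / 2 * (norm (?k w))\<^sup>2 + D * (Re (q w) * (norm (?k w))\<^sup>2))"
    proof (rule integral_mono_AE')
      show "integrable dM (\<lambda>w. e / 2 * (norm (?k w))\<^sup>2 + D * (Re (q w) * (norm (?k w))\<^sup>2))"
        using ik nk_weight(1)[OF z q(1) Q] by simp
      show "AE w in dM. norm ((\<phi> w - \<phi> p) * of_real ((norm (?k w))\<^sup>2))
          \<le> e / 2 * (norm (?k w))\<^sup>2 + D * (Re (q w) * (norm (?k w))\<^sup>2)"
      proof (rule AE_I2)
        fix w assume "w \<in> space dM"
        hence "norm (\<phi> w - \<phi> p) * (norm (?k w))\<^sup>2 \<le> (e / 2 + D * Re (q w)) * (norm (?k w))\<^sup>2"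
          by (intro mult_right_mono pt) auto
        thus "norm ((\<phi> w - \<phi> p) * of_real ((norm (?k w))\<^sup>2))
          \<le> e / 2 * (norm (?k w))\<^sup>2 + D * (Re (q w) * (norm (?k w))\<^sup>2)"
          unfolding norm_mult norm_of_real by (simp add: algebra_simps)
      qed
      show "AE w in dM. 0 \<le> e / 2 * (norm (?k w))\<^sup>2 + D * (Re (q w) * (norm (?k w))\<^sup>2)"
      proof (rule AE_I2)
        fix w assume "w \<in> space dM"
        hence "Re (q w) \<ge> 0" using Re0 closure_subset by auto
        thus "0 \<le> e / 2 * (norm (?k w))\<^sup>2 + D * (Re (q w) * (norm (?k w))\<^sup>2)"
          using e D by simp
      qed
    qed
    also have "\<dots> = e / 2 + D * Re (q (z n))"
      using ik nk_weight[OF z q(1) Q] kn by simp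
    also have "\<dots> < e / 2 + D * (e / (2 * D))"
      using N[OF n] D by (intro add_strict_left_mono mult_strict_left_mono) auto
    also have "\<dots> = e" using D by simp
    finally show "norm (berezin \<Omega> T (z n) - \<phi> p) < e" .
  qed
qed

end

section \<open>Supporting functionals of a convex Reinhardt domain\<close>

locale reinhardt_symbol = toeplitz_symbol +
  assumes reinh: "reinhardt_domain \<Omega>" and conv: "convex \<Omega>"
begin

lemma dom_nonempty: "\<Omega> \<noteq> {}"
  using reinh by (simp add: reinhardt_domain_def)

lemma dom_rot: "z \<in> \<Omega> \<Longrightarrow> (\<And>j. norm (\<xi> $ j) = 1) \<Longrightarrow> (\<chi> j. \<xi> $ j * z $ j) \<in> \<Omega>"
  using reinh by (simp add: reinhardt_domain_def)

lemma closure_rot: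
  assumes z: "z \<in> closure \<Omega>" and \<xi>: "\<And>j. norm (\<xi> $ j) = 1"
  shows "(\<chi> j. \<xi> $ j * z $ j) \<in> closure \<Omega>"
proof -
  obtain x where x: "\<And>n. x n \<in> \<Omega>" "x \<longlonglongrightarrow> z"
    using z unfolding closure_sequential by blast
  have "(\<lambda>n. \<chi> j. \<xi> $ j * x n $ j) \<longlonglongrightarrow> (\<chi> j. \<xi> $ j * z $ j)"
    by (intro vec_tendstoI) (simp, intro tendsto_intros tendsto_vec_nth x)
  thus ?thesis
    unfolding closure_sequential using dom_rot[OF x(1) \<xi>]
    by (intro exI[of _ "\<lambda>n. \<chi> j. \<xi> $ j * x n $ j"]) auto
qed

text \<open>
  A point of the closed disc is the midpoint of a chord of the unit circle.
\<close>

lemma disc_average: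
  assumes "norm c \<le> 1"
  obtains a b where "norm a = 1" "norm b = 1" "c = (a + b) / (2 :: complex)"
proof -
  define r where "r = norm c"
  define \<alpha> where "\<alpha> = arccos r"
  have r: "0 \<le> r" "r \<le> 1" using assms by (auto simp: r_def)
  have ca: "cos \<alpha> = r" unfolding \<alpha>_def using r by (intro cos_arccos) auto
  have "cis (Arg c + \<alpha>) + cis (Arg c - \<alpha>) = 2 * of_real (cos \<alpha>) * cis (Arg c)"
    by (simp add: complex_eq_iff cos_add cos_diff sin_add sin_diff algebra_simps)
  also have "\<dots> = 2 * c"
    unfolding ca r_def using rcis_cmod_Arg[of c] by (simp add: rcis_def)
  finally show thesis by (intro that[of "cis (Arg c + \<alpha>)" "cis (Arg c - \<alpha>)"]) auto
qed

text \<open>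
  Averaging two rotations multiplies one coordinate by an arbitrary factor from the closed disc.
  Convex Reinhardt domains are therefore complete Reinhardt domains.
\<close>

lemma shrink_coordinate:
  assumes ij: "i \<noteq> j" and S: "convex S"
    and rot: "\<And>z \<xi>. z \<in> S \<Longrightarrow> (\<And>k. norm (\<xi> $ k) = 1) \<Longrightarrow> (\<chi> k. \<xi> $ k * z $ k) \<in> S"
    and u: "u \<in> S" and c: "norm c \<le> 1"
  shows "vec2 i (u $ i) (c * u $ j) \<in> S"
proof -
  obtain a b where ab: "norm a = 1" "norm b = 1" "c = (a + b) / 2"
    using disc_average[OF c] .
  have m: "vec2 i (u $ i) (x * u $ j) \<in> S" if "norm x = 1" for x
  proof -
    have "norm (vec2 i 1 x $ k) = 1" for k
      using two_indices[OF ij, of k] that ij by auto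
    from rot[OF u this] show ?thesis
      by (rule back_subst[of "\<lambda>w. w \<in> S"]) (intro vec2_eqI[OF ij]; simp add: ij)
  qed
  have "(1/2) *\<^sub>R vec2 i (u $ i) (a * u $ j) + (1/2) *\<^sub>R vec2 i (u $ i) (b * u $ j) \<in> S"
    using m[OF ab(1)] m[OF ab(2)] by (intro convexD[OF S]) auto
  also have "(1/2) *\<^sub>R vec2 i (u $ i) (a * u $ j) + (1/2) *\<^sub>R vec2 i (u $ i) (b * u $ j)
      = vec2 i (u $ i) (c * u $ j)"
    by (intro vec2_eqI[OF ij]) (simp_all add: ij ab(3) scaleR_conv_of_real[where 'a = complex] algebra_simps)
  finally show ?thesis .
qed

lemma dom_shrink: "i \<noteq> j \<Longrightarrow> u \<in> \<Omega> \<Longrightarrow> norm c \<le> 1 \<Longrightarrow> vec2 i (u $ i) (c * u $ j) \<in> \<Omega>"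
  by (rule shrink_coordinate[OF _ conv]) (auto intro: dom_rot)

lemma closure_shrink:
  "i \<noteq> j \<Longrightarrow> u \<in> closure \<Omega> \<Longrightarrow> norm c \<le> 1 \<Longrightarrow> vec2 i (u $ i) (c * u $ j) \<in> closure \<Omega>"
  by (rule shrink_coordinate[OF _ convex_closure[OF conv]]) (auto intro: closure_rot)

lemma zero_in_dom: "0 \<in> \<Omega>"
proof -
  obtain u where u: "u \<in> \<Omega>" using dom_nonempty by blast
  have ij: "(1::2) \<noteq> 2" by simp
  have "vec2 1 (u $ 1) (0 * u $ 2) \<in> \<Omega>" by (rule dom_shrink[OF ij u]) simp
  from dom_shrink[OF ij[symmetric] this, of 0]
  have "vec2 2 0 (0 * u $ 1) \<in> \<Omega>" by (simp add: vec2_nth')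
  moreover have "vec2 2 0 (0 * u $ 1) = 0" by (intro vec2_eqI[OF ij]) (simp_all add: vec2_nth')
  ultimately show ?thesis by simp
qed

lemma closure_scale_in_dom:
  assumes "p \<in> closure \<Omega>" "0 \<le> t" "t < 1"
  shows "t *\<^sub>R p \<in> \<Omega>"
  using mem_interior_closure_convex_shrink[OF conv _ assms(1), of 0 "1 - t"] assms open_dom zero_in_dom
  by (simp add: interior_open algebra_simps)

lemma inner_2:
  fixes a b :: "complex ^ 2"
  assumes "i \<noteq> j"
  shows "a \<bullet> b = a $ i \<bullet> b $ i + a $ j \<bullet> b $ j"
  unfolding inner_vec_def UNIV_2_eq[OF assms] using assms by simp

text \<open>
  A real supporting hyperplane is the real part of a complex functional. Rotating the two
  coordinates of \<open>y\<close> independently makes both terms nonnegative, which upgrades the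
  bound on the real part to one on the sum of the moduli; equality at \<open>p\<close> then
  fixes the arguments there.
\<close>

lemma supporting_functional:
  assumes p: "p \<in> frontier \<Omega>" and ij: "i \<noteq> j"
  obtains \<alpha> :: "complex ^ 2" and c :: real where "c > 0" "\<alpha> \<noteq> 0"
    "\<And>y. y \<in> closure \<Omega> \<Longrightarrow> norm (\<alpha> $ i * y $ i) + norm (\<alpha> $ j * y $ j) \<le> c"
    "\<And>y. y \<in> \<Omega> \<Longrightarrow> Re (\<alpha> $ i * y $ i + \<alpha> $ j * y $ j) < c"
    "\<alpha> $ i * p $ i = of_real (norm (\<alpha> $ i * p $ i))"
    "\<alpha> $ j * p $ j = of_real (norm (\<alpha> $ j * p $ j))"
    "\<alpha> $ i * p $ i + \<alpha> $ j * p $ j = of_real c"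
proof -
  have pc: "p \<in> closure \<Omega>" "p \<notin> \<Omega>"
    using p open_dom by (auto simp: frontier_def interior_open)
  obtain a where a: "a \<noteq> 0" "\<And>y. y \<in> closure \<Omega> \<Longrightarrow> a \<bullet> p \<le> a \<bullet> y"
      "\<And>y. y \<in> \<Omega> \<Longrightarrow> a \<bullet> p < a \<bullet> y"
    using supporting_hyperplane_relative_frontier[OF conv pc(1)] pc(2) open_dom
    by (metis rel_interior_open)
  define \<alpha> :: "complex ^ 2" where "\<alpha> = (\<chi> k. - cnj (a $ k))"
  define ell where "ell y = \<alpha> $ i * y $ i + \<alpha> $ j * y $ j" for y :: "complex ^ 2"
  have Reell: "Re (ell y) = - (a \<bullet> y)" for y
    by (simp add: ell_def \<alpha>_def inner_2[OF ij] inner_complex_def)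
  define c where "c = Re (ell p)"
  have c: "c > 0" using a(3)[OF zero_in_dom] by (simp add: c_def Reell)
  have le: "norm (\<alpha> $ i * y $ i) + norm (\<alpha> $ j * y $ j) \<le> c" if y: "y \<in> closure \<Omega>" for y
  proof -
    \<comment> \<open>the rotation that makes both terms of the functional nonnegative\<close>
    define \<xi> :: "complex ^ 2" where
      "\<xi> = (\<chi> k. if \<alpha> $ k * y $ k = 0 then 1 else cnj (sgn (\<alpha> $ k * y $ k)))"
    have sg: "cnj (sgn w) * w = of_real (norm w)" for w :: complex
      using complex_norm_square[of w]
      by (cases "w = 0") (simp_all add: sgn_eq divide_simps power2_eq_square mult.commute)
    have \<xi>1: "norm (\<xi> $ k) = 1" for k by (simp add: \<xi>_def norm_sgn)
    have \<xi>2: "\<alpha> $ k * (\<xi> $ k * y $ k) = of_real (norm (\<alpha> $ k * y $ k))" for k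
    proof (cases "\<alpha> $ k * y $ k = 0")
      case False
      have "\<alpha> $ k * (\<xi> $ k * y $ k) = cnj (sgn (\<alpha> $ k * y $ k)) * (\<alpha> $ k * y $ k)"
        using False by (simp add: \<xi>_def)
      thus ?thesis by (simp only: sg)
    qed auto
    have "(\<chi> k. \<xi> $ k * y $ k) \<in> closure \<Omega>" by (rule closure_rot[OF y \<xi>1])
    from a(2)[OF this] have "Re (ell (\<chi> k. \<xi> $ k * y $ k)) \<le> c"
      by (simp add: c_def Reell)
    moreover have "ell (\<chi> k. \<xi> $ k * y $ k)
        = of_real (norm (\<alpha> $ i * y $ i)) + of_real (norm (\<alpha> $ j * y $ j))"
      unfolding ell_def vec_lambda_beta \<xi>2 ..
    ultimately show ?thesis by simp
  qed
  have real: "w = of_real (norm w)" if "Re w \<ge> norm w" for w :: complex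
  proof -
    have "Re w = norm w" using that complex_Re_le_cmod[of w] by linarith
    hence "Im w = 0" using cmod_power2[of w] by simp
    thus ?thesis using \<open>Re w = norm w\<close> by (simp add: complex_eq_iff)
  qed
  have sum: "Re (\<alpha> $ i * p $ i) + Re (\<alpha> $ j * p $ j) = c" by (simp add: c_def ell_def)
  have bi: "Re (\<alpha> $ i * p $ i) \<le> norm (\<alpha> $ i * p $ i)"
    and bj: "Re (\<alpha> $ j * p $ j) \<le> norm (\<alpha> $ j * p $ j)" by (rule complex_Re_le_cmod)+
  have ri: "\<alpha> $ i * p $ i = of_real (norm (\<alpha> $ i * p $ i))"
    using le[OF pc(1)] sum bi bj by (intro real) linarith
  have rj: "\<alpha> $ j * p $ j = of_real (norm (\<alpha> $ j * p $ j))"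
    using le[OF pc(1)] sum bi bj by (intro real) linarith
  show thesis
  proof (rule that[of c \<alpha>])
    show "\<alpha> \<noteq> 0" using a(1) by (auto simp: \<alpha>_def vec_eq_iff)
    show "Re (\<alpha> $ i * y $ i + \<alpha> $ j * y $ j) < c" if "y \<in> \<Omega>" for y
      using a(3)[OF that] Reell[of y] Reell[of p] by (simp add: c_def ell_def)
    have "Im (\<alpha> $ i * p $ i) = 0" "Im (\<alpha> $ j * p $ j) = 0"
      by (subst ri, simp) (subst rj, simp)
    thus "\<alpha> $ i * p $ i + \<alpha> $ j * p $ j = of_real c"
      using sum by (simp add: complex_eq_iff)
  qed (use c le ri rj in auto)
qed

lemma dom_norm_bound: obtains R where "R > 0" "\<And>z. z \<in> closure \<Omega> \<Longrightarrow> norm z \<le> R"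
  using bounded_closure[OF bounded_dom] unfolding bounded_pos by blast

lemma holo_bounded_on_dom:
  fixes q :: "complex ^ 2 \<Rightarrow> complex"
  assumes "continuous_on (closure \<Omega>) q"
  obtains Q where "Q > 0" "\<And>z. z \<in> \<Omega> \<Longrightarrow> norm (q z) \<le> Q"
proof -
  have "compact (closure \<Omega>)" using bounded_dom by simp
  hence "bounded (q ` closure \<Omega>)" using assms by (intro compact_imp_bounded compact_continuous_image)
  then obtain Q where "Q > 0" "\<forall>x\<in>q ` closure \<Omega>. norm x \<le> Q" unfolding bounded_pos by blast
  thus thesis using closure_subset[of \<Omega>] by (intro that[of Q]) auto
qed

text \<open>
  The affine function of a supporting hyperplane is positive on the domain and vanishes at
  \<open>p\<close>, so it serves as the weight along which the mass of the kernels escapes.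
\<close>

lemma nk_weakly_null:
  assumes z: "\<And>n. z n \<in> \<Omega>" "z \<longlonglongrightarrow> p" and p: "p \<in> frontier \<Omega>" and f: "f \<in> L2 \<Omega>"
  shows "(\<lambda>n. \<langle>nk (z n), f\<rangle>) \<longlonglongrightarrow> 0"
proof -
  have ij: "(1::2) \<noteq> 2" by simp
  obtain \<alpha> :: "complex ^ 2" and c :: real where sf: "c > 0" "\<alpha> \<noteq> 0"
    "\<And>y. y \<in> closure \<Omega> \<Longrightarrow> norm (\<alpha> $ 1 * y $ 1) + norm (\<alpha> $ 2 * y $ 2) \<le> c"
    "\<And>y. y \<in> \<Omega> \<Longrightarrow> Re (\<alpha> $ 1 * y $ 1 + \<alpha> $ 2 * y $ 2) < c"
    "\<alpha> $ 1 * p $ 1 = of_real (norm (\<alpha> $ 1 * p $ 1))"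
    "\<alpha> $ 2 * p $ 2 = of_real (norm (\<alpha> $ 2 * p $ 2))"
    "\<alpha> $ 1 * p $ 1 + \<alpha> $ 2 * p $ 2 = of_real c"
    by (rule supporting_functional[OF p ij], rule that)
  define q where "q y = of_real c - (\<alpha> $ 1 * y $ 1 + \<alpha> $ 2 * y $ 2)" for y :: "complex ^ 2"
  have q: "holo_on q \<Omega>" unfolding q_def
    by (intro holo_on_diff holo_on_add holo_on_scale holo_on_const holo_on_coord)
  have qc: "continuous_on S q" for S unfolding q_def by (intro continuous_intros)
  obtain Q where Q: "Q > 0" "\<And>z. z \<in> \<Omega> \<Longrightarrow> norm (q z) \<le> Q"
    by (rule holo_bounded_on_dom[OF qc], rule that)
  have "(\<lambda>n. Re (q (z n))) \<longlonglongrightarrow> Re (q p)"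
    unfolding q_def by (intro tendsto_intros tendsto_vec_nth z)
  hence lim: "(\<lambda>n. Re (q (z n))) \<longlonglongrightarrow> 0" by (simp add: q_def sf(7))
  show ?thesis
  proof (rule weakly_null_of_escaping_mass[OF _ _ f, where w = "\<lambda>w. Re (q w)"])
    show "nk (z n) \<in> L2 \<Omega>" "\<parallel>nk (z n)\<parallel> \<le> 1" for n
      using A2D(1)[OF nk_A2[OF z(1)]] by (simp_all add: nk_norm[OF z(1)])
    show "(\<lambda>w. Re (q w)) \<in> borel_measurable dM"
      by (intro measurable_of_continuous continuous_intros qc)
    show "Re (q w) > 0" if "w \<in> \<Omega>" for w using sf(4)[OF that] by (simp add: q_def)
    show "integrable dM (\<lambda>w. Re (q w) * (norm (nk (z n) w))\<^sup>2)" for n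
      by (rule nk_weight(1)[OF z(1) q Q(2)])
    show "(\<lambda>n. LINT w|dM. Re (q w) * (norm (nk (z n) w))\<^sup>2) \<longlonglongrightarrow> 0"
      using lim by (simp add: nk_weight(2)[OF z(1) q Q(2)])
  qed
qed

lemma compact_imp_berezin_TsT:
  assumes T: "compact_operator \<Omega> T"
  shows "(berezin \<Omega> (Ts \<circ> T) \<longlongrightarrow> 0) (to_boundary \<Omega>)"
proof (rule tendsto_to_boundaryI)
  fix z :: "nat \<Rightarrow> complex ^ 2" and p
  assume z: "\<And>n. z n \<in> \<Omega>" "z \<longlonglongrightarrow> p" and p: "p \<in> frontier \<Omega>"
  have "\<exists>r. strict_mono (r :: nat \<Rightarrow> nat) \<and> (\<lambda>n. \<parallel>T (nk (z (r n)))\<parallel>) \<longlonglongrightarrow> 0"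
  proof (rule compact_weakly_null[OF T])
    show "nk (z n) \<in> A2" "\<parallel>nk (z n)\<parallel> \<le> 1" for n
      using nk_A2[OF z(1)] by (simp_all add: nk_norm[OF z(1)])
    show "(\<lambda>n. \<langle>nk (z n), f\<rangle>) \<longlonglongrightarrow> 0" if "f \<in> A2" for f
      by (rule nk_weakly_null[OF z p A2D(1)[OF that]])
  qed
  then obtain r where r: "strict_mono (r :: nat \<Rightarrow> nat)" "(\<lambda>n. \<parallel>T (nk (z (r n)))\<parallel>) \<longlonglongrightarrow> 0" by blast
  have "(\<lambda>n. complex_of_real (\<parallel>T (nk (z (r n)))\<parallel>\<^sup>2)) \<longlonglongrightarrow> of_real (0\<^sup>2)"
    by (intro tendsto_intros r)
  hence "(\<lambda>n. berezin \<Omega> (Ts \<circ> T) (z (r n))) \<longlonglongrightarrow> 0"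
    by (simp add: berezin_TsT[OF z(1)])
  thus "\<exists>r. strict_mono (r :: nat \<Rightarrow> nat) \<and> (\<lambda>n. berezin \<Omega> (Ts \<circ> T) (z (r n))) \<longlonglongrightarrow> 0"
    using r(1) by blast
qed

lemma berezin_TsT_imp_berezin:
  assumes "(berezin \<Omega> (Ts \<circ> T) \<longlongrightarrow> 0) (to_boundary \<Omega>)"
  shows "(berezin \<Omega> T \<longlongrightarrow> 0) (to_boundary \<Omega>)"
proof (rule Lim_null_comparison)
  show "((\<lambda>z. sqrt (norm (berezin \<Omega> (Ts \<circ> T) z))) \<longlongrightarrow> 0) (to_boundary \<Omega>)"
    using tendsto_real_sqrt[OF tendsto_norm[OF assms]] by simp
  show "\<forall>\<^sub>F z in to_boundary \<Omega>. norm (berezin \<Omega> T z) \<le> sqrt (norm (berezin \<Omega> (Ts \<circ> T) z))"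
    unfolding to_boundary_def eventually_inf_principal
  proof (intro always_eventually allI impI)
    fix z assume z: "z \<in> \<Omega>"
    have "sqrt (norm (berezin \<Omega> (Ts \<circ> T) z)) = \<parallel>T (nk z)\<parallel>"
      unfolding berezin_TsT[OF z] by (simp del: of_real_power)
    thus "norm (berezin \<Omega> T z) \<le> sqrt (norm (berezin \<Omega> (Ts \<circ> T) z))"
      using berezin_T_le[OF z] by simp
  qed
qed

lemma symbol_zero_of_peak:
  assumes bz: "(berezin \<Omega> T \<longlongrightarrow> 0) (to_boundary \<Omega>)" and p: "p \<in> frontier \<Omega>"
    and q: "holo_on q \<Omega>" "continuous_on UNIV q"
    and peak: "\<And>w. w \<in> closure \<Omega> \<Longrightarrow> w \<noteq> p \<Longrightarrow> Re (q w) > 0" "q p = 0"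
  shows "\<phi> p = 0"
proof -
  have pc: "p \<in> closure \<Omega>" using p by (simp add: frontier_def)
  obtain z where z: "\<And>n. z n \<in> \<Omega>" "z \<longlonglongrightarrow> p" using pc unfolding closure_sequential by blast
  have "(\<lambda>n. q (z n)) \<longlonglongrightarrow> q p"
    by (rule continuous_on_tendsto_compose[OF q(2) z(2)]) auto
  hence "(\<lambda>n. berezin \<Omega> T (z n)) \<longlonglongrightarrow> \<phi> p"
    using q peak by (intro berezin_tendsto_at_peak_point[OF z(1) pc]) (auto intro: continuous_on_subset)
  moreover have "(\<lambda>n. berezin \<Omega> T (z n)) \<longlonglongrightarrow> 0"
    by (rule tendsto_to_boundaryD[OF bz z p])
  ultimately show ?thesis by (rule LIMSEQ_unique)
qed

text \<open>
  The functional exposes the segment where \<open>\<alpha>\<^sub>i w\<^sub>i\<close> and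
  \<open>\<alpha>\<^sub>j w\<^sub>j\<close> are nonnegative with sum \<open>c\<close>. Adding
  \<open>(\<alpha>\<^sub>i w\<^sub>i - a0)\<^sup>2\<close>, which is real and nonnegative on the
  segment, leaves \<open>p\<close> as the only zero. Off the segment the square may have
  negative real part, but at most \<open>(Im (\<alpha>\<^sub>i w\<^sub>i))\<^sup>2 \<le> 2 c (c
  - Re (\<alpha>\<^sub>i w\<^sub>i + \<alpha>\<^sub>j w\<^sub>j))\<close>, and the factor
  \<open>3 c\<close> compensates for it.
\<close>

lemma symbol_zero_of_generic_support:
  assumes bz: "(berezin \<Omega> T \<longlongrightarrow> 0) (to_boundary \<Omega>)" and p: "p \<in> frontier \<Omega>" and ij: "i \<noteq> j"
    and \<alpha>: "c > 0" "\<alpha> $ i \<noteq> 0" "\<alpha> $ j \<noteq> 0"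
      "\<And>y. y \<in> closure \<Omega> \<Longrightarrow> norm (\<alpha> $ i * y $ i) + norm (\<alpha> $ j * y $ j) \<le> c"
      "\<alpha> $ i * p $ i = of_real (norm (\<alpha> $ i * p $ i))"
      "\<alpha> $ i * p $ i + \<alpha> $ j * p $ j = of_real c"
  shows "\<phi> p = 0"
proof -
  define a0 where "a0 = norm (\<alpha> $ i * p $ i)"
  have pa: "\<alpha> $ i * p $ i = of_real a0" using \<alpha>(5) by (simp only: a0_def)
  define q where "q w = of_real (3 * c) * (of_real c - (\<alpha> $ i * w $ i + \<alpha> $ j * w $ j))
      + (\<alpha> $ i * w $ i - of_real a0)\<^sup>2" for w :: "complex ^ 2"
  show ?thesis
  proof (rule symbol_zero_of_peak[OF bz p, of q])
    show "holo_on q \<Omega>"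
      unfolding q_def
      by (intro holo_on_add holo_on_scale holo_on_diff holo_on_power holo_on_const holo_on_coord)
    show "continuous_on UNIV q" unfolding q_def by (intro continuous_intros)
    show "q p = 0" unfolding q_def \<alpha>(6) by (simp add: pa)
    fix w assume w: "w \<in> closure \<Omega>" "w \<noteq> p"
    define A B where "A = \<alpha> $ i * w $ i" and "B = \<alpha> $ j * w $ j"
    have AB: "norm A + norm B \<le> c" using \<alpha>(4)[OF w(1)] by (simp add: A_def B_def)
    have RA: "\<bar>Re A\<bar> \<le> norm A" and RB: "\<bar>Re B\<bar> \<le> norm B" by (rule abs_Re_le_cmod)+
    have "(Im A)\<^sup>2 = (norm A - Re A) * (norm A + Re A)"
      using cmod_power2[of A] by (simp add: power2_eq_square algebra_simps)
    also have "\<dots> \<le> (c - Re A - Re B) * (2 * c)"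
      using AB RA RB \<alpha>(1) norm_ge_zero[of B] by (intro mult_mono) auto
    finally have Im: "(Im A)\<^sup>2 \<le> 2 * c * (c - Re A - Re B)" by (simp add: mult_ac)
    have Req: "Re (q w) = 3 * c * (c - Re A - Re B) + ((Re A - a0)\<^sup>2 - (Im A)\<^sup>2)"
      unfolding q_def A_def[symmetric] B_def[symmetric]
      by (simp add: power2_eq_square algebra_simps)
    have nn: "c - Re A - Re B \<ge> 0" using AB RA RB by linarith
    have ge: "Re (q w) \<ge> c * (c - Re A - Re B) + (Re A - a0)\<^sup>2"
      unfolding Req using Im by (simp add: algebra_simps)
    show "Re (q w) > 0"
    proof (rule ccontr)
      assume "\<not> Re (q w) > 0"
      hence le0: "c * (c - Re A - Re B) + (Re A - a0)\<^sup>2 \<le> 0" using ge by linarith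
      have n1: "c * (c - Re A - Re B) \<ge> 0" using \<alpha>(1) nn by simp
      have z1: "c * (c - Re A - Re B) = 0" and z2: "(Re A - a0)\<^sup>2 = 0"
        using le0 n1 zero_le_power2[of "Re A - a0"] by linarith+
      have e1: "Re A + Re B = c" using z1 \<alpha>(1) by simp
      have e2: "Re A = a0" using z2 by simp
      have "norm A = Re A" "norm B = Re B" using AB RA RB e1 by linarith+
      hence "Im A = 0" "Im B = 0" using cmod_power2[of A] cmod_power2[of B] by simp_all
      hence "A = \<alpha> $ i * p $ i" "A + B = of_real c"
        using e1 e2 unfolding pa by (simp_all add: complex_eq_iff)
      hence "\<alpha> $ i * w $ i = \<alpha> $ i * p $ i" "\<alpha> $ j * w $ j = \<alpha> $ j * p $ j"
        using \<alpha>(6) unfolding A_def B_def by (simp, metis add_left_cancel)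
      hence "w = p" using \<alpha>(2,3) by (intro vec2_eqI[OF ij]) auto
      with w(2) show False by simp
    qed
  qed
qed

end

section \<open>Polarization and moments\<close>

lemma taylor_coeff_limit:
  assumes "g holomorphic_on ball 0 R" "R > 1"
  shows "(\<lambda>N. (\<Sum>m<N. cnj (unit_root N m) ^ k * g (unit_root N m)) / of_nat N) \<longlonglongrightarrow> taylor_coeff g k"
  using discrete_cauchy_tendsto[OF assms(1), of 1 k] assms(2) by simp

lemma taylor_coeff_monomial:
  "taylor_coeff (\<lambda>b. c * b ^ k) l = (if l = k then c else 0)"
proof (rule LIMSEQ_unique)
  show "(\<lambda>N. (\<Sum>m<N. cnj (unit_root N m) ^ l * (c * unit_root N m ^ k)) / of_nat N)
      \<longlonglongrightarrow> taylor_coeff (\<lambda>b. c * b ^ k) l"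
    by (rule taylor_coeff_limit[of _ 2]) (auto intro!: holomorphic_intros)
  have "(\<Sum>m<N. cnj (unit_root N m) ^ l * (c * unit_root N m ^ k)) / of_nat N = (if l = k then c else 0)"
    if "N \<ge> Suc (max k l)" for N
  proof -
    have "(\<Sum>m<N. cnj (unit_root N m) ^ l * (c * unit_root N m ^ k))
        = c * (\<Sum>m<N. cnj (unit_root N m) ^ l * unit_root N m ^ k)"
      by (simp add: sum_distrib_left mult_ac)
    also have "\<dots> = c * (if k = l then of_nat N else 0)"
      using that by (subst unit_root_orthogonality) auto
    finally show ?thesis using that by auto
  qed
  thus "(\<lambda>N. (\<Sum>m<N. cnj (unit_root N m) ^ l * (c * unit_root N m ^ k)) / of_nat N)
      \<longlonglongrightarrow> (if l = k then c else 0)"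
    by (intro tendsto_eventually eventually_sequentiallyI)
qed

lemma taylor_coeff_scale:
  assumes "g holomorphic_on ball 0 R" "norm c < R"
  shows "taylor_coeff (\<lambda>z. g (c * z)) k = taylor_coeff g k * c ^ k"
proof -
  have R: "R > 0" using assms(2) norm_ge_zero[of c] by linarith
  have "(deriv ^^ k) (\<lambda>w. g (c * w)) 0 = c ^ k * (deriv ^^ k) g (c * 0)"
  proof (rule higher_deriv_compose_linear[OF assms(1), of "ball 0 1"])
    fix w :: complex assume "w \<in> ball 0 1"
    hence "norm c * norm w \<le> norm c * 1" by (intro mult_left_mono) auto
    thus "c * w \<in> ball 0 R" using assms(2) by (simp add: norm_mult)
  qed auto
  thus ?thesis by (simp add: taylor_coeff_def)
qed

lemma taylor_coeff_cong:
  assumes "r > 0" "\<And>z. norm z < r \<Longrightarrow> f z = g z"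
  shows "taylor_coeff f k = taylor_coeff g k"
proof -
  have "\<forall>\<^sub>F z in nhds 0. f z = g z"
    using assms by (intro eventually_nhds_in_open[of "ball 0 r", THEN eventually_mono]) auto
  thus ?thesis unfolding taylor_coeff_def by (simp add: higher_deriv_cong_ev)
qed

lemma double_sum_split_degree:
  fixes a :: "nat \<Rightarrow> nat \<Rightarrow> complex"
  shows "(\<Sum>k<Suc d. \<Sum>l<Suc d. a k l) = (\<Sum>k<Suc d. \<Sum>l<Suc d. if k + l < d then a k l else 0)
     + (\<Sum>k<Suc d. a k (d - k)) + (\<Sum>k<Suc d. \<Sum>l<Suc d. if k + l > d then a k l else 0)"
proof -
  have diag: "(\<Sum>k<Suc d. a k (d - k)) = (\<Sum>k<Suc d. \<Sum>l<Suc d. if k + l = d then a k l else 0)"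
  proof (rule sum.cong[OF refl])
    fix k assume k: "k \<in> {..<Suc d}"
    have "(\<Sum>l<Suc d. if k + l = d then a k l else 0) = (\<Sum>l<Suc d. if l = d - k then a k l else 0)"
      using k by (intro sum.cong) auto
    thus "a k (d - k) = (\<Sum>l<Suc d. if k + l = d then a k l else 0)" by (simp add: sum.delta)
  qed
  show ?thesis
    unfolding diag sum.distrib[symmetric]
    by (intro sum.cong refl) auto
qed

text \<open>
  On the unit circle \<open>(cnj u)\<^sup>k u\<^sup>d\<^sup>-\<^sup>k = u\<^sup>d (cnj
  (u\<^sup>2))\<^sup>k\<close>. Taking for \<open>u\<close> square roots of the
  \<open>(d+1)\<close>-st roots of unity, the coefficients are recovered by a discrete Fourier
  transform.
\<close>

lemma homogeneous_coefficients_null: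
  fixes A :: "nat \<Rightarrow> nat \<Rightarrow> complex"
  assumes lim: "\<And>u. norm u = 1 \<Longrightarrow> (\<lambda>n. \<Sum>k<Suc d. cnj u ^ k * u ^ (d - k) * A n k) \<longlonglongrightarrow> 0"
    and k0: "k0 < Suc d"
  shows "(\<lambda>n. A n k0) \<longlonglongrightarrow> 0"
proof -
  define N where "N = Suc d"
  \<comment> \<open>half the angle of a root of unity, so that \<open>u m * u m\<close> is one\<close>
  define u where "u m = cis (pi * real m / real N)" for m
  have nu: "norm (u m) = 1" for m by (simp add: u_def)
  have cu: "cnj (u m) * u m = 1" for m
    using complex_norm_square[of "u m"] nu[of m] by (simp add: mult.commute)
  have u2: "u m * u m = unit_root N m" for m
    by (simp add: u_def unit_root_def cis_mult mult_ac)
  have uk: "cnj (u m) ^ k * u m ^ (d - k) = u m ^ d * cnj (unit_root N m) ^ k" if k: "k < N" for m k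
  proof -
    have "cnj (unit_root N m) = cnj (u m) * cnj (u m)" by (simp flip: u2)
    moreover have "u m ^ d = u m ^ (d - k) * u m ^ k" using k by (simp add: N_def flip: power_add)
    ultimately have "u m ^ d * cnj (unit_root N m) ^ k = u m ^ (d - k) * u m ^ k * (cnj (u m) * cnj (u m)) ^ k"
      by simp
    also have "\<dots> = (cnj (u m) * u m) ^ k * (cnj (u m) ^ k * u m ^ (d - k))"
      by (simp add: power_mult_distrib mult_ac)
    finally show ?thesis by (simp add: cu)
  qed
  have "(\<lambda>n. \<Sum>k<N. cnj (unit_root N m) ^ k * A n k) \<longlonglongrightarrow> 0" for m
  proof -
    have "(\<lambda>n. cnj (u m) ^ d * (\<Sum>k<N. cnj (u m) ^ k * u m ^ (d - k) * A n k)) \<longlonglongrightarrow> cnj (u m) ^ d * 0"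
      using lim[OF nu[of m]] unfolding N_def by (intro tendsto_intros)
    moreover have "cnj (u m) ^ d * (\<Sum>k<N. cnj (u m) ^ k * u m ^ (d - k) * A n k)
        = (\<Sum>k<N. cnj (unit_root N m) ^ k * A n k)" for n
    proof -
      have "(\<Sum>k<N. cnj (u m) ^ k * u m ^ (d - k) * A n k) = (\<Sum>k<N. u m ^ d * cnj (unit_root N m) ^ k * A n k)"
        by (intro sum.cong refl) (simp add: uk)
      also have "\<dots> = u m ^ d * (\<Sum>k<N. cnj (unit_root N m) ^ k * A n k)"
        by (simp add: sum_distrib_left mult.assoc)
      finally have "cnj (u m) ^ d * (\<Sum>k<N. cnj (u m) ^ k * u m ^ (d - k) * A n k)
          = (cnj (u m) * u m) ^ d * (\<Sum>k<N. cnj (unit_root N m) ^ k * A n k)"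
        by (simp add: power_mult_distrib mult.assoc)
      thus ?thesis by (simp add: cu)
    qed
    ultimately show ?thesis by simp
  qed
  hence "(\<lambda>n. (\<Sum>m<N. unit_root N m ^ k0 * (\<Sum>k<N. cnj (unit_root N m) ^ k * A n k)) / of_nat N)
      \<longlonglongrightarrow> (\<Sum>m<N. unit_root N m ^ k0 * 0) / of_nat N"
    by (intro tendsto_intros) (simp_all add: N_def del: of_nat_Suc)
  moreover have "(\<Sum>m<N. unit_root N m ^ k0 * (\<Sum>k<N. cnj (unit_root N m) ^ k * A n k)) / of_nat N = A n k0" for n
  proof -
    have "(\<Sum>m<N. unit_root N m ^ k0 * (\<Sum>k<N. cnj (unit_root N m) ^ k * A n k))
        = (\<Sum>k<N. A n k * (\<Sum>m<N. cnj (unit_root N m) ^ k * unit_root N m ^ k0))"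
      unfolding sum_distrib_left by (subst sum.swap) (simp add: mult_ac)
    also have "\<dots> = (\<Sum>k<N. if k = k0 then A n k * of_nat N else 0)"
      using k0 by (intro sum.cong refl, subst unit_root_orthogonality) (auto simp: N_def)
    also have "\<dots> = A n k0 * of_nat N" using k0 by (simp add: N_def)
    finally show ?thesis by (simp add: N_def del: of_nat_Suc)
  qed
  ultimately show ?thesis by simp
qed

text \<open>
  Polarization in the limit. By induction on the degree \<open>d = k + l\<close>, the part of
  degree below \<open>d\<close> tends to zero, and the rest beyond degree \<open>d\<close> is
  \<open>O(|z|\<^sup>d\<^sup>+\<^sup>1)\<close> uniformly in \<open>n\<close>; dividing by
  \<open>|z|\<^sup>d\<close> and letting \<open>z\<close> shrink isolates the homogeneous part
  of degree \<open>d\<close>.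
\<close>

proposition sesqui_coefficients_null:
  fixes F :: "nat \<Rightarrow> complex \<Rightarrow> complex" and A :: "nat \<Rightarrow> nat \<Rightarrow> nat \<Rightarrow> complex"
  assumes \<delta>: "\<delta> > 0"
    and expn: "\<And>N. \<exists>C. \<forall>n z. norm z \<le> \<delta> \<longrightarrow>
        norm (F n z - (\<Sum>k<N. \<Sum>l<N. cnj z ^ k * z ^ l * A n k l)) \<le> C * norm z ^ N"
    and bdd: "\<And>k l. \<exists>M. \<forall>n. norm (A n k l) \<le> M"
    and lim: "\<And>z. norm z \<le> \<delta> \<Longrightarrow> (\<lambda>n. F n z) \<longlonglongrightarrow> 0"
  shows "(\<lambda>n. A n k l) \<longlonglongrightarrow> 0"
proof (induction "k + l" arbitrary: k l rule: less_induct)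
  case less
  note sum.lessThan_Suc [simp del]
  define d where "d = k + l"
  obtain M where M: "\<And>n k l. norm (A n k l) \<le> M k l" using bdd by metis
  obtain C where C: "\<And>n z. norm z \<le> \<delta> \<Longrightarrow>
      norm (F n z - (\<Sum>k<Suc d. \<Sum>l<Suc d. cnj z ^ k * z ^ l * A n k l)) \<le> C * norm z ^ Suc d"
    using expn[of "Suc d"] by blast
  define H where "H = (\<Sum>k<Suc d. \<Sum>l<Suc d. M k l)"
  have Mn: "M k l \<ge> 0" for k l by (rule order_trans[OF norm_ge_zero M[of 0]])
  define low where "low n z = (\<Sum>k<Suc d. \<Sum>l<Suc d. if k + l < d then cnj z ^ k * z ^ l * A n k l else 0)"
    for n z
  define S where "S n u = (\<Sum>k<Suc d. cnj u ^ k * u ^ (d - k) * A n k (d - k))" for n u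
  have low: "(\<lambda>n. low n z) \<longlonglongrightarrow> 0" for z
  proof -
    have "(\<lambda>n. low n z) \<longlonglongrightarrow> (\<Sum>k<Suc d. \<Sum>l<Suc d. if k + l < d then cnj z ^ k * z ^ l * 0 else 0)"
      unfolding low_def
    proof (intro tendsto_sum)
      fix k l
      show "(\<lambda>n. if k + l < d then cnj z ^ k * z ^ l * A n k l else 0)
          \<longlonglongrightarrow> (if k + l < d then cnj z ^ k * z ^ l * 0 else 0)"
      proof (cases "k + l < d")
        case True
        have "(\<lambda>n. A n k l) \<longlonglongrightarrow> 0" by (rule less) (use True in \<open>simp add: d_def\<close>)
        from tendsto_mult[OF tendsto_const[of "cnj z ^ k * z ^ l"] this] True show ?thesis by simp
      qed simp
    qed
    thus ?thesis by (simp only: mult_zero_right if_cancel sum.neutral_const)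
  qed
  have key: "norm (S n u) \<le> (norm (F n (of_real \<rho> * u)) + norm (low n (of_real \<rho> * u))) / \<rho> ^ d + (C + H) * \<rho>"
    if u: "norm u = 1" and \<rho>: "0 < \<rho>" "\<rho> \<le> \<delta>" "\<rho> \<le> 1" for n u \<rho>
  proof -
    define z where "z = of_real \<rho> * u"
    have nz: "norm z = \<rho>" using u \<rho> by (simp add: z_def norm_mult)
    define hi where "hi = (\<Sum>k<Suc d. \<Sum>l<Suc d. if k + l > d then cnj z ^ k * z ^ l * A n k l else 0)"
    have "norm hi \<le> (\<Sum>k<Suc d. \<Sum>l<Suc d. M k l * \<rho> ^ Suc d)"
      unfolding hi_def
    proof (intro order_trans[OF norm_sum] sum_mono)
      fix k l
      show "norm (if k + l > d then cnj z ^ k * z ^ l * A n k l else 0) \<le> M k l * \<rho> ^ Suc d"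
      proof (cases "k + l > d")
        case True
        have "norm (cnj z ^ k * z ^ l * A n k l) = \<rho> ^ (k + l) * norm (A n k l)"
          by (simp add: norm_mult norm_power nz power_add)
        also have "\<dots> \<le> \<rho> ^ Suc d * M k l"
          using True \<rho> M[of n k l] by (intro mult_mono power_decreasing) auto
        finally show ?thesis using True by (simp add: mult.commute)
      qed (use Mn \<rho> in auto)
    qed
    also have "\<dots> = H * \<rho> ^ Suc d" by (simp add: H_def sum_distrib_right)
    finally have hi: "norm hi \<le> H * \<rho> ^ Suc d" .
    have Sz: "(\<Sum>k<Suc d. cnj z ^ k * z ^ (d - k) * A n k (d - k)) = of_real \<rho> ^ d * S n u"
      unfolding S_def sum_distrib_left
    proof (rule sum.cong[OF refl])
      fix k assume "k \<in> {..<Suc d}"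
      hence "complex_of_real \<rho> ^ d = of_real \<rho> ^ k * of_real \<rho> ^ (d - k)"
        by (simp flip: power_add)
      thus "cnj z ^ k * z ^ (d - k) * A n k (d - k) = of_real \<rho> ^ d * (cnj u ^ k * u ^ (d - k) * A n k (d - k))"
        by (simp add: z_def power_mult_distrib mult_ac)
    qed
    define E where "E = F n z - (\<Sum>k<Suc d. \<Sum>l<Suc d. cnj z ^ k * z ^ l * A n k l)"
    have E: "norm E \<le> C * \<rho> ^ Suc d" unfolding E_def using C[of z n] nz \<rho> by simp
    have "of_real \<rho> ^ d * S n u = F n z - E - low n z - hi"
      unfolding E_def Sz[symmetric] low_def hi_def
      by (subst double_sum_split_degree) simp
    hence "\<rho> ^ d * norm (S n u) = norm (F n z - E - low n z - hi)"
      using \<rho> by (metis norm_mult norm_power norm_of_real abs_of_pos)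
    also have "\<dots> \<le> norm (F n z) + norm E + norm (low n z) + norm hi"
      by (intro order_trans[OF norm_triangle_ineq4] add_mono) auto
    also have "\<dots> \<le> norm (F n z) + norm (low n z) + (C + H) * \<rho> ^ Suc d"
      using E hi by (simp add: algebra_simps)
    finally have "norm (S n u) * \<rho> ^ d \<le> (norm (F n z) + norm (low n z)) + ((C + H) * \<rho>) * \<rho> ^ d"
      by (simp add: mult_ac)
    hence "norm (S n u) \<le> ((norm (F n z) + norm (low n z)) + ((C + H) * \<rho>) * \<rho> ^ d) / \<rho> ^ d"
      using \<rho> by (simp add: pos_le_divide_eq)
    also have "\<dots> = (norm (F n z) + norm (low n z)) / \<rho> ^ d + (C + H) * \<rho>"
      using \<rho> by (simp add: add_divide_distrib)
    finally show ?thesis unfolding z_def .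
  qed
  have S: "(\<lambda>n. S n u) \<longlonglongrightarrow> 0" if u: "norm u = 1" for u
  proof (rule LIMSEQ_I)
    fix e :: real assume e: "e > 0"
    \<comment> \<open>a radius at which the error term \<open>(C + H) \<rho>\<close> is below \<open>e / 2\<close>\<close>
    define \<rho> where "\<rho> = min (min \<delta> 1) (e / (2 * (\<bar>C + H\<bar> + 1)))"
    have pos: "\<bar>C + H\<bar> + 1 > 0" using abs_ge_zero[of "C + H"] by linarith
    hence "e / (2 * (\<bar>C + H\<bar> + 1)) > 0" using e by (intro divide_pos_pos mult_pos_pos) auto
    hence \<rho>: "0 < \<rho>" "\<rho> \<le> \<delta>" "\<rho> \<le> 1" using \<delta> by (simp_all add: \<rho>_def)
    have "(C + H) * \<rho> \<le> (\<bar>C + H\<bar> + 1) * \<rho>" using \<rho> by (intro mult_right_mono) auto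
    also have "\<dots> \<le> (\<bar>C + H\<bar> + 1) * (e / (2 * (\<bar>C + H\<bar> + 1)))"
      using pos by (intro mult_left_mono) (auto simp: \<rho>_def)
    also have "\<dots> = e / 2" using pos by (simp add: divide_simps)
    finally have r: "(C + H) * \<rho> \<le> e / 2" .
    have "(\<lambda>n. (norm (F n (of_real \<rho> * u)) + norm (low n (of_real \<rho> * u))) / \<rho> ^ d) \<longlonglongrightarrow> (norm (0::complex) + norm (0::complex)) / \<rho> ^ d"
      using \<rho> u by (intro tendsto_intros lim low) (auto simp: norm_mult)
    hence "(\<lambda>n. (norm (F n (of_real \<rho> * u)) + norm (low n (of_real \<rho> * u))) / \<rho> ^ d) \<longlonglongrightarrow> 0" by simp
    from order_tendstoD(2)[OF this, of "e / 2"] e obtain N where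
      N: "\<And>n. n \<ge> N \<Longrightarrow> (norm (F n (of_real \<rho> * u)) + norm (low n (of_real \<rho> * u))) / \<rho> ^ d < e / 2"
      by (auto simp: eventually_sequentially)
    show "\<exists>N. \<forall>n\<ge>N. norm (S n u - 0) < e"
    proof (intro exI[of _ N] allI impI)
      fix n assume "n \<ge> N"
      have "norm (S n u) < e / 2 + e / 2"
        by (rule order_le_less_trans[OF key[OF u \<rho>] add_less_le_mono[OF N[OF \<open>n \<ge> N\<close>] r]])
      thus "norm (S n u - 0) < e" by simp
    qed
  qed
  have "(\<lambda>n. A n k (d - k)) \<longlonglongrightarrow> 0"
    by (rule homogeneous_coefficients_null[where A = "\<lambda>n k. A n k (d - k)" and d = d])
       (use S in \<open>auto simp: S_def d_def\<close>)
  thus ?case by (simp add: d_def)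
qed

lemma continuous_zero_of_null_integral:
  fixes h :: "complex \<Rightarrow> real"
  assumes h: "continuous_on (ball 0 s) h" "\<And>b. b \<in> ball 0 s \<Longrightarrow> h b \<ge> 0"
    and int: "integrable (restrict_space lborel (ball 0 s)) h"
    and z: "(LINT b|restrict_space lborel (ball 0 s). h b) = 0" and b: "b \<in> ball 0 s"
  shows "h b = 0"
proof (rule ccontr)
  assume "h b \<noteq> 0"
  define V where "V = {b \<in> ball 0 s. h b \<noteq> 0}"
  have "open V"
  proof -
    have "open (ball 0 s \<inter> h -` (- {0}))"
      by (rule continuous_open_preimage[OF h(1)]) auto
    thus ?thesis by (simp add: V_def vimage_def Int_def)
  qed
  have "AE b in restrict_space lborel (ball 0 s). h b = 0"
  proof -
    have "AE b in restrict_space lborel (ball 0 s). 0 \<le> h b"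
      by (rule AE_I2) (use h(2) in \<open>simp add: space_restrict_space\<close>)
    from integral_nonneg_eq_0_iff_AE[OF int this] z show ?thesis by simp
  qed
  hence "AE b in lborel. b \<in> ball 0 s \<longrightarrow> h b = 0"
    by (subst (asm) AE_restrict_space_iff) auto
  hence "AE b in lborel. b \<notin> V" by (rule eventually_mono) (auto simp: V_def)
  hence "V \<in> null_sets lborel"
    using \<open>open V\<close> by (subst (asm) AE_iff_null_sets[symmetric]) auto
  hence "negligible V" by (simp add: negligible_iff_null_sets null_sets_completionI)
  moreover have "V \<noteq> {}" using b \<open>h b \<noteq> 0\<close> by (auto simp: V_def)
  ultimately show False using open_not_negligible[OF \<open>open V\<close>] by blast
qed

lemma integrable_on_disc:
  fixes f :: "complex \<Rightarrow> 'b :: {banach, second_countable_topology}"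
  assumes f: "continuous_on (cball 0 s) f"
  shows "integrable (restrict_space lborel (ball 0 s)) f"
proof -
  let ?M = "restrict_space lborel (ball (0 :: complex) s)"
  interpret finite_measure ?M
  proof
    show "emeasure ?M (space ?M) \<noteq> \<infinity>"
      using emeasure_lborel_ball_finite[of "0 :: complex" s]
      by (simp add: emeasure_restrict_space space_restrict_space)
  qed
  have "bounded (f ` cball 0 s)"
    using f by (intro compact_imp_bounded compact_continuous_image) auto
  then obtain B where B: "\<And>b. b \<in> cball 0 s \<Longrightarrow> norm (f b) \<le> B" by (force simp: bounded_iff)
  have "f \<in> borel_measurable (restrict_space borel (ball 0 s))"
    by (rule borel_measurable_continuous_on_restrict) (rule continuous_on_subset[OF f], auto)
  hence "f \<in> borel_measurable ?M"
    by (simp cong: measurable_cong_sets sets_restrict_space_cong)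
  thus ?thesis
    by (rule integrable_const_bound[rotated, where B = B])
       (auto simp: space_restrict_space intro!: AE_I2 B)
qed

text \<open>
  Real linear forms are combinations of \<open>b\<close> and \<open>cnj b\<close>, so
  \<open>g\<close> is orthogonal to all real polynomials. Approximating the real and imaginary
  parts of \<open>g\<close> uniformly by such polynomials gives \<open>\<integral> |g|\<^sup>2 =
  0\<close>.
\<close>

proposition vanishing_moments_imp_zero:
  fixes g :: "complex \<Rightarrow> complex"
  assumes g: "continuous_on (cball 0 s) g"
    and mom: "\<And>k l. (LINT b|restrict_space lborel (ball 0 s). g b * (b ^ k * cnj b ^ l)) = 0"
    and b: "b \<in> ball 0 s"
  shows "g b = 0"
proof -
  let ?M = "restrict_space lborel (ball (0::complex) s)"
  note int = integrable_on_disc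
  have poly: "\<forall>h. continuous_on (cball 0 s) h \<longrightarrow>
      (\<forall>k l. (LINT b|?M. g b * h b * (b ^ k * cnj b ^ l)) = 0) \<longrightarrow>
      (\<forall>k l. (LINT b|?M. g b * (h b * of_real (p b)) * (b ^ k * cnj b ^ l)) = 0)"
    if "real_polynomial_function p" for p :: "complex \<Rightarrow> real"
    using that
  proof induction
    case (linear f)
    show ?case
    proof (intro allI impI)
      fix h k l
      assume h: "continuous_on (cball 0 s) h"
        and z: "\<forall>k l. (LINT b|?M. g b * h b * (b ^ k * cnj b ^ l)) = 0"
      define c1 c2 where "c1 = (of_real (f 1) - \<i> * of_real (f \<i>)) / (2 :: complex)"
        and "c2 = (of_real (f 1) + \<i> * of_real (f \<i>)) / (2 :: complex)"
      have f: "complex_of_real (f b) = c1 * b + c2 * cnj b" for b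
      proof -
        interpret f: bounded_linear f by (rule linear)
        have "f b = f (Re b *\<^sub>R 1 + Im b *\<^sub>R \<i>)" by (rule arg_cong[where f = f]) (simp add: complex_eq_iff)
        also have "\<dots> = Re b * f 1 + Im b * f \<i>" by (simp only: f.add f.scaleR real_scaleR_def)
        finally show ?thesis by (simp add: c1_def c2_def complex_eq_iff field_simps)
      qed
      have "(LINT b|?M. g b * (h b * of_real (f b)) * (b ^ k * cnj b ^ l))
          = (LINT b|?M. c1 * (g b * h b * (b ^ Suc k * cnj b ^ l))
              + c2 * (g b * h b * (b ^ k * cnj b ^ Suc l)))"
        by (intro Bochner_Integration.integral_cong refl)
           (simp add: f algebra_simps)
      also have "\<dots> = c1 * (LINT b|?M. g b * h b * (b ^ Suc k * cnj b ^ l))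
              + c2 * (LINT b|?M. g b * h b * (b ^ k * cnj b ^ Suc l))"
        using g h by (subst Bochner_Integration.integral_add)
          (auto intro!: int integrable_mult_right continuous_intros simp del: power_Suc)
      also have "\<dots> = 0" using z by (simp del: power_Suc)
      finally show "(LINT b|?M. g b * (h b * of_real (f b)) * (b ^ k * cnj b ^ l)) = 0" .
    qed
  next
    case (const c)
    show ?case
    proof (intro allI impI)
      fix h k l
      assume z: "\<forall>k l. (LINT b|?M. g b * h b * (b ^ k * cnj b ^ l)) = 0"
      have "(LINT b|?M. g b * (h b * of_real c) * (b ^ k * cnj b ^ l))
          = (LINT b|?M. of_real c * (g b * h b * (b ^ k * cnj b ^ l)))"
        by (intro Bochner_Integration.integral_cong refl) (simp add: mult_ac)
      also have "\<dots> = of_real c * (LINT b|?M. g b * h b * (b ^ k * cnj b ^ l))"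
        by (rule integral_mult_right_zero)
      also have "\<dots> = 0" using z by simp
      finally show "(LINT b|?M. g b * (h b * of_real c) * (b ^ k * cnj b ^ l)) = 0" .
    qed
  next
    case (add f1 f2)
    show ?case
    proof (intro allI impI)
      fix h k l
      assume h: "continuous_on (cball 0 s) h"
        and z: "\<forall>k l. (LINT b|?M. g b * h b * (b ^ k * cnj b ^ l)) = 0"
      have c: "continuous_on (cball 0 s) f1" "continuous_on (cball 0 s) f2"
        using add.hyps by (auto intro: continuous_real_polymonial_function continuous_at_imp_continuous_on)
      have "(LINT b|?M. g b * (h b * of_real (f1 b + f2 b)) * (b ^ k * cnj b ^ l))
          = (LINT b|?M. g b * (h b * of_real (f1 b)) * (b ^ k * cnj b ^ l)
              + g b * (h b * of_real (f2 b)) * (b ^ k * cnj b ^ l))"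
        by (intro Bochner_Integration.integral_cong refl) (simp add: algebra_simps)
      also have "\<dots> = 0"
        using g h c add.IH z by (subst Bochner_Integration.integral_add)
          (auto intro!: int continuous_intros)
      finally show "(LINT b|?M. g b * (h b * of_real (f1 b + f2 b)) * (b ^ k * cnj b ^ l)) = 0" .
    qed
  next
    case (mult f1 f2)
    show ?case
    proof (intro allI impI)
      fix h k l
      assume h: "continuous_on (cball 0 s) h"
        and z: "\<forall>k l. (LINT b|?M. g b * h b * (b ^ k * cnj b ^ l)) = 0"
      have c: "continuous_on (cball 0 s) f1"
        using mult.hyps by (auto intro: continuous_real_polymonial_function continuous_at_imp_continuous_on)
      have "continuous_on (cball 0 s) (\<lambda>b. h b * of_real (f1 b))"
        by (intro continuous_intros h c)
      with mult.IH z h have "(LINT b|?M. g b * ((h b * of_real (f1 b)) * of_real (f2 b)) * (b ^ k * cnj b ^ l)) = 0"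
        by blast
      thus "(LINT b|?M. g b * (h b * of_real (f1 b * f2 b)) * (b ^ k * cnj b ^ l)) = 0"
        by (simp add: mult.assoc)
    qed
  qed
  have poly0: "(LINT b|?M. g b * of_real (p b)) = 0" if "real_polynomial_function p" for p
    using poly[OF that, rule_format, of "\<lambda>b. 1" 0 0] mom by simp
  have g1: "continuous_on (cball 0 s) (\<lambda>b. norm (g b))" by (intro continuous_intros g)
  define I where "I = (LINT b|?M. norm (g b))"
  have I: "I \<ge> 0" unfolding I_def by (simp add: integral_nonneg_AE)
  have small: "(LINT b|?M. (norm (g b))\<^sup>2) \<le> 2 * e * I" if e: "e > 0" for e
  proof -
    obtain p where p: "real_polynomial_function p" "\<And>x. x \<in> cball 0 s \<Longrightarrow> \<bar>Re (g x) - p x\<bar> < e"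
      using Stone_Weierstrass_real_polynomial_function[of "cball 0 s" "\<lambda>x. Re (g x)" e] g e
      by (auto intro!: continuous_intros)
    obtain q where q: "real_polynomial_function q" "\<And>x. x \<in> cball 0 s \<Longrightarrow> \<bar>Im (g x) - q x\<bar> < e"
      using Stone_Weierstrass_real_polynomial_function[of "cball 0 s" "\<lambda>x. Im (g x)" e] g e
      by (auto intro!: continuous_intros)
    have c: "continuous_on (cball 0 s) p" "continuous_on (cball 0 s) q"
      using p(1) q(1) by (auto intro: continuous_real_polymonial_function continuous_at_imp_continuous_on)
    have ip: "integrable ?M (\<lambda>b. g b * of_real (p b))" "integrable ?M (\<lambda>b. \<i> * (g b * of_real (q b)))"
      and ir: "integrable ?M (\<lambda>b. g b * (cnj (g b) - (of_real (p b) - \<i> * of_real (q b))))"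
      by (intro int continuous_intros g c)+
    have "complex_of_real (LINT b|?M. (norm (g b))\<^sup>2) = (LINT b|?M. g b * cnj (g b))"
      by (subst integral_complex_of_real[symmetric]) (simp only: complex_norm_square)
    also have "\<dots> = (LINT b|?M. g b * (cnj (g b) - (of_real (p b) - \<i> * of_real (q b)))
          + (g b * of_real (p b) - \<i> * (g b * of_real (q b))))"
      by (intro Bochner_Integration.integral_cong refl) (simp add: algebra_simps)
    also have "\<dots> = (LINT b|?M. g b * (cnj (g b) - (of_real (p b) - \<i> * of_real (q b))))
          + ((LINT b|?M. g b * of_real (p b)) - \<i> * (LINT b|?M. g b * of_real (q b)))"
      by (subst Bochner_Integration.integral_add[OF ir Bochner_Integration.integrable_diff[OF ip]],
          subst Bochner_Integration.integral_diff[OF ip]) simp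
    also have "\<dots> = (LINT b|?M. g b * (cnj (g b) - (of_real (p b) - \<i> * of_real (q b))))"
      by (simp add: poly0 p q)
    finally have "norm (complex_of_real (LINT b|?M. (norm (g b))\<^sup>2))
        \<le> (LINT b|?M. norm (g b * (cnj (g b) - (of_real (p b) - \<i> * of_real (q b)))))"
      by (simp only: integral_norm_bound)
    also have "\<dots> \<le> (LINT b|?M. 2 * e * norm (g b))"
    proof (rule integral_mono)
      show "norm (g b * (cnj (g b) - (of_real (p b) - \<i> * of_real (q b)))) \<le> 2 * e * norm (g b)"
        if "b \<in> space ?M" for b
      proof -
        have bc: "b \<in> cball 0 s" using that by (simp add: space_restrict_space)
        let ?d = "cnj (g b) - (of_real (p b) - \<i> * of_real (q b))"
        have "norm ?d \<le> \<bar>Re ?d\<bar> + \<bar>Im ?d\<bar>" by (rule cmod_le)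
        also have "\<dots> \<le> 2 * e" using p(2)[OF bc] q(2)[OF bc] by (simp add: abs_minus_commute)
        finally have "norm (g b) * norm ?d \<le> norm (g b) * (2 * e)"
          by (intro mult_left_mono) auto
        thus ?thesis by (simp add: norm_mult mult_ac)
      qed
    qed (use g c in \<open>auto intro!: int continuous_intros integrable_mult_right\<close>)
    also have "\<dots> = 2 * e * I" by (simp add: I_def)
    finally show ?thesis by simp
  qed
  have nn: "(LINT b|?M. (norm (g b))\<^sup>2) \<ge> 0" by (simp add: integral_nonneg_AE)
  have "(LINT b|?M. (norm (g b))\<^sup>2) \<le> 0"
  proof (rule field_le_epsilon)
    fix e :: real assume e: "e > 0"
    have "2 * (e / (2 * (I + 1))) * I \<le> e" using e I by (simp add: field_simps)
    thus "(LINT b|?M. (norm (g b))\<^sup>2) \<le> 0 + e"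
      using small[of "e / (2 * (I + 1))"] e I by simp
  qed
  hence z: "(LINT b|?M. (norm (g b))\<^sup>2) = 0" using nn by simp
  have "(norm (g b))\<^sup>2 = 0"
  proof (rule continuous_zero_of_null_integral[OF _ _ _ z b])
    show "continuous_on (ball 0 s) (\<lambda>b. (norm (g b))\<^sup>2)"
      by (intro continuous_intros continuous_on_subset[OF g]) auto
    show "integrable ?M (\<lambda>b. (norm (g b))\<^sup>2)" by (intro int continuous_intros g)
  qed auto
  thus ?thesis by simp
qed

section \<open>Taylor coefficients in the direction of a disc face\<close>

lemma norm_axis_complex: "norm (axis k (1::complex)) = 1"
  by (simp add: norm_eq_sqrt_inner inner_axis_axis)

locale disc_face = reinhardt_symbol +
  fixes i j :: 2 and p0 :: complex and s S :: real
  assumes ij: "i \<noteq> j" and p0: "p0 \<noteq> 0" and s: "s > 0"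
    and first_bound: "\<And>y. y \<in> closure \<Omega> \<Longrightarrow> norm (y $ i) \<le> norm p0"
    and slice: "\<And>b. vec2 i p0 b \<in> closure \<Omega> \<longleftrightarrow> norm b \<le> s"
    and second_bound: "\<And>y. y \<in> closure \<Omega> \<Longrightarrow> norm (y $ j) \<le> S"
begin

lemma vec2_j [simp]: "vec2 i a b $ j = b"
  using ij by (simp add: vec2_nth')

lemma S_pos: "S > 0"
  using second_bound[of "vec2 i p0 (of_real s)"] slice[of "of_real s"] s by simp

text \<open>
  The closure is complete Reinhardt and contains \<open>(p0, s)\<close>, hence the closed
  bidisc; scaling towards the interior point \<open>0\<close> reaches the domain itself.
\<close>

lemma bidisc:
  assumes a: "norm a < norm p0" and b: "norm b < s"
  shows "vec2 i a b \<in> \<Omega>"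
proof -
  define m where "m = max (norm a / norm p0) (norm b / s)"
  have "m < 1" using a b p0 s by (simp add: m_def)
  then obtain t where t: "m < t" "t < 1" using dense by blast
  have m0: "m \<ge> 0" using s by (simp add: m_def le_max_iff_disj)
  have t0: "t > 0" using t m0 by linarith
  have "norm a / norm p0 \<le> t" "norm b / s \<le> t" using t by (auto simp: m_def)
  hence c: "norm (a / (of_real t * p0)) \<le> 1" "norm (b / (of_real t * of_real s)) \<le> 1"
    using t0 p0 s by (auto simp: norm_divide norm_mult field_simps)
  have v: "vec2 i p0 (of_real s) \<in> closure \<Omega>" using slice s by simp
  have "vec2 i p0 (b / of_real t) \<in> closure \<Omega>"
    using closure_shrink[OF ij v c(2)] s by simp
  from closure_shrink[OF ij[symmetric] this c(1)]
  have "vec2 j (b / of_real t) (a / of_real t) \<in> closure \<Omega>" using p0 by simp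
  also have "vec2 j (b / of_real t) (a / of_real t) = vec2 i (a / of_real t) (b / of_real t)"
    using ij by (intro vec2_eqI[OF ij]) (simp_all add: vec2_nth')
  finally have "t *\<^sub>R vec2 i (a / of_real t) (b / of_real t) \<in> \<Omega>"
    using t t0 by (intro closure_scale_in_dom) auto
  also have "t *\<^sub>R vec2 i (a / of_real t) (b / of_real t) = vec2 i a b"
    using t0 by (intro vec2_eqI[OF ij]) (simp_all add: scaleR_conv_of_real[where 'a = complex])
  finally show ?thesis .
qed

text \<open>
  An interior point could be scaled up slightly, so it cannot attain the maximum of the first
  modulus.
\<close>

lemma first_strict:
  assumes u: "u \<in> \<Omega>"
  shows "norm (u $ i) < norm p0"
proof -
  have le: "norm (u $ i) \<le> norm p0" using first_bound u closure_subset by blast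
  have "norm (u $ i) \<noteq> norm p0"
  proof
    assume eq: "norm (u $ i) = norm p0"
    obtain e where e: "e > 0" "ball u e \<subseteq> \<Omega>" using open_dom u open_contains_ball by blast
    define d where "d = e / (2 * (norm u + 1))"
    have nu: "norm u + 1 > 0" by (simp add: add_nonneg_pos)
    have d: "d > 0" using e nu by (simp add: d_def)
    have "d * norm u \<le> d * (norm u + 1)" using d by simp
    also have "\<dots> = e / 2" using nu by (simp add: d_def field_simps)
    also have "\<dots> < e" using e by simp
    finally have "norm (d *\<^sub>R u) < e" using d by simp
    hence "u + d *\<^sub>R u \<in> ball u e" by (simp add: dist_norm)
    hence "u + d *\<^sub>R u \<in> closure \<Omega>" using e(2) closure_subset by blast
    from first_bound[OF this] have "norm (u $ i + d *\<^sub>R u $ i) \<le> norm p0" by simp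
    moreover have "u $ i + d *\<^sub>R u $ i = (1 + d) *\<^sub>R (u $ i)" by (simp add: scaleR_add_left)
    ultimately have "(1 + d) * norm p0 \<le> norm p0" using d eq by simp
    thus False using d p0 by (simp add: algebra_simps mult_le_0_iff)
  qed
  with le show ?thesis by simp
qed

lemma second_bound_dom: "u \<in> \<Omega> \<Longrightarrow> norm (u $ j) \<le> S"
  using second_bound closure_subset by blast

lemma slice_disc:
  assumes "vec2 i a b \<in> \<Omega>" "norm b' \<le> norm b"
  shows "vec2 i a b' \<in> \<Omega>"
proof (cases "b = 0")
  case False
  have "norm (b' / b) \<le> 1" using False assms(2) by (simp add: norm_divide)
  from dom_shrink[OF ij assms(1) this] show ?thesis using False by simp
qed (use assms in simp)

lemma slice_open:
  assumes "vec2 i a b \<in> \<Omega>"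
  obtains R where "R > norm b" "\<And>b'. norm b' < R \<Longrightarrow> vec2 i a b' \<in> \<Omega>"
proof -
  obtain e where e: "e > 0" "ball (vec2 i a b) e \<subseteq> \<Omega>" using open_dom assms open_contains_ball by blast
  define c where "c = (if b = 0 then 1 else sgn b)"
  have c: "norm c = 1" by (auto simp: c_def norm_sgn)
  have c2: "b = of_real (norm b) * c" by (simp add: c_def sgn_eq)
  define b2 where "b2 = of_real (norm b + e / 2) * c"
  have diff: "vec2 i a b2 - vec2 i a b = (of_real (e / 2) * c) *s axis j 1"
  proof (rule vec2_eqI[OF ij])
    have "b2 - b = of_real (e / 2) * c" unfolding b2_def by (subst (2) c2) (simp add: algebra_simps)
    thus "(vec2 i a b2 - vec2 i a b) $ j = ((of_real (e / 2) * c) *s axis j 1) $ j" by simp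
    show "(vec2 i a b2 - vec2 i a b) $ i = ((of_real (e / 2) * c) *s axis j 1) $ i"
      using ij by (simp add: axis_def)
  qed
  have "norm (vec2 i a b2 - vec2 i a b) = e / 2"
    unfolding diff norm_smult_complex norm_mult norm_of_real norm_axis_complex c using e by simp
  hence "dist (vec2 i a b) (vec2 i a b2) = e / 2"
    by (simp add: dist_norm norm_minus_commute)
  hence "vec2 i a b2 \<in> \<Omega>" using e by (intro subsetD[OF e(2)]) simp
  moreover have "norm b2 = norm b + e / 2" using c e unfolding b2_def norm_mult norm_of_real by simp
  ultimately show thesis
    using slice_disc[of a b2] e by (intro that[of "norm b + e / 2"]) auto
qed

lemma vec2_line: "vec2 i a b = vec2 i a 0 + b *s axis j 1"
  using ij by (intro vec2_eqI[OF ij]) (auto simp: axis_def)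

lemma slice_holomorphic:
  assumes "holo_on f \<Omega>" "\<And>b. norm b < R \<Longrightarrow> vec2 i a b \<in> \<Omega>"
  shows "(\<lambda>b. f (vec2 i a b)) holomorphic_on ball 0 R"
proof -
  have "(\<lambda>b. f (vec2 i a 0 + b *s axis j 1)) holomorphic_on ball 0 R"
    using assms(2) by (intro holo_on_line[OF assms(1)]) (simp flip: vec2_line)
  thus ?thesis by (simp flip: vec2_line)
qed

text \<open>
  The \<open>k\<close>-th Taylor coefficient of \<open>f\<close> along the slice over
  \<open>a\<close>, as a function of \<open>a\<close>.
\<close>

definition slice_cf :: "nat \<Rightarrow> (complex ^ 2 \<Rightarrow> complex) \<Rightarrow> complex \<Rightarrow> complex" where
  "slice_cf k f a = taylor_coeff (\<lambda>b. f (vec2 i a b)) k"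

lemma bounded_linear_first: "bounded_linear (\<lambda>u :: complex ^ 2. vec2 i (u $ i) 0)"
proof (rule bounded_linear_intro[where K = 1])
  show "vec2 i ((x + y) $ i) 0 = vec2 i (x $ i) 0 + vec2 i (y $ i) 0" for x y :: "complex ^ 2"
    by (intro vec2_eqI[OF ij]) auto
  show "vec2 i ((r *\<^sub>R x) $ i) 0 = r *\<^sub>R vec2 i (x $ i) 0" for r and x :: "complex ^ 2"
    by (intro vec2_eqI[OF ij]) auto
  show "norm (vec2 i (x $ i) 0) \<le> norm x * 1" for x :: "complex ^ 2"
  proof -
    have "vec2 i (x $ i) 0 = x $ i *s axis i 1"
      using ij by (intro vec2_eqI[OF ij]) (auto simp: axis_def)
    hence "norm (vec2 i (x $ i) 0) = norm (x $ i)" by (simp add: norm_smult_complex norm_axis_complex)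
    thus ?thesis using Finite_Cartesian_Product.norm_nth_le[of x i] by simp
  qed
qed

text \<open>
  The coefficient is a locally uniform limit of the finite sums of
  \<open>discrete_cauchy\<close>, each of which is holomorphic in the base point. Any circle
  inside the disc of radius \<open>s\<close> would do; \<open>s / 2\<close> and \<open>3 s /
  4\<close> leave room for the error term.
\<close>

lemma slice_cf_holo:
  assumes f: "holo_on f \<Omega>"
  shows "holo_on (\<lambda>u. slice_cf k f (u $ i)) \<Omega>"
proof -
  define t where "t = s / 2"
  define r where "r = 3 * s / 4"
  have tr: "0 < t" "t < r" "r < s" "t / r = 2 / 3" using s by (auto simp: t_def r_def)
  define F where "F N u = (\<Sum>m<N. cnj (unit_root N m) ^ k * f (vec2 i (u $ i) (of_real t * unit_root N m)))
      / of_nat N" for N and u :: "complex ^ 2"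
  have F: "holo_on (F N) \<Omega>" for N
  proof -
    have "holo_on (\<lambda>u. f (vec2 i (u $ i) (of_real t * unit_root N m))) \<Omega>" for m
    proof -
      have eq: "vec2 i a b = vec2 i 0 b + vec2 i a 0" for a b
        by (intro vec2_eqI[OF ij]) auto
      have "holo_on (\<lambda>u. f (vec2 i 0 (of_real t * unit_root N m) + vec2 i (u $ i) 0)) \<Omega>"
      proof (rule holo_on_compose_affine[OF f bounded_linear_first])
        show "vec2 i ((c *s v) $ i) 0 = c *s vec2 i (v $ i) 0" for c and v :: "complex ^ 2"
          by (intro vec2_eqI[OF ij]) auto
        show "vec2 i 0 (of_real t * unit_root N m) + vec2 i (u $ i) 0 \<in> \<Omega>" if "u \<in> \<Omega>" for u
          unfolding eq[symmetric] using first_strict[OF that] tr by (intro bidisc) (auto simp: norm_mult)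
      qed
      thus ?thesis by (simp flip: eq)
    qed
    hence "holo_on (\<lambda>u. inverse (of_nat N) *
        (\<Sum>m<N. cnj (unit_root N m) ^ k * f (vec2 i (u $ i) (of_real t * unit_root N m)))) \<Omega>"
      by (intro holo_on_scale holo_on_sum)
    thus ?thesis unfolding F_def by (simp add: field_class.field_divide_inverse mult.commute)
  qed
  have "holo_on (\<lambda>u. slice_cf k f (u $ i) * of_real t ^ k) \<Omega>"
  proof (rule holo_on_uniform_limit[OF F])
    fix u0 assume u0: "u0 \<in> \<Omega>"
    obtain d where d: "d > 0" "cball u0 d \<subseteq> \<Omega>" using u0 open_dom open_contains_cball by blast
    define K where "K = (\<lambda>(u :: complex ^ 2, b). vec2 i (u $ i) b) ` (cball u0 d \<times> cball 0 r)"
    have "compact K"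
      unfolding K_def by (intro compact_continuous_image compact_Times compact_cball)
        (auto simp: split_beta intro!: continuous_intros)
    moreover have KO: "K \<subseteq> \<Omega>"
      unfolding K_def using d first_strict tr by (auto intro!: bidisc)
    ultimately have "bounded (f ` K)"
      using holo_on_continuous[OF f] by (intro compact_imp_bounded compact_continuous_image)
        (auto intro: continuous_on_subset)
    then obtain B where B: "\<And>v. v \<in> K \<Longrightarrow> norm (f v) \<le> B" by (force simp: bounded_iff)
    have err: "norm (F N u - slice_cf k f (u $ i) * of_real t ^ k) \<le> B * (2 / 3) ^ N * 3"
      if u: "u \<in> cball u0 d" and N: "k < N" for u N
    proof -
      have hol: "(\<lambda>b. f (vec2 i (u $ i) b)) holomorphic_on ball 0 s"
        using u d first_strict by (intro slice_holomorphic[OF f] bidisc) auto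
      have "norm (F N u - slice_cf k f (u $ i) * of_real t ^ k) \<le> B * (t / r) ^ N / (1 - t / r)"
        unfolding F_def slice_cf_def
      proof (rule discrete_cauchy[OF hol tr(3) tr(1) tr(2) _ N])
        show "norm (f (vec2 i (u $ i) z)) \<le> B" if "norm z \<le> r" for z
          using u that by (intro B) (force simp: K_def)
      qed
      thus ?thesis unfolding tr(4) by simp
    qed
    have "uniform_limit (ball u0 d) F (\<lambda>u. slice_cf k f (u $ i) * of_real t ^ k) sequentially"
      unfolding uniform_limit_iff
    proof (intro allI impI)
      fix e :: real assume e: "e > 0"
      have "(\<lambda>N. B * (2 / 3) ^ N * 3) \<longlonglongrightarrow> B * 0 * 3"
        by (intro tendsto_intros LIMSEQ_realpow_zero) auto
      hence "\<forall>\<^sub>F N in sequentially. B * (2 / 3) ^ N * 3 < e"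
        by (rule order_tendstoD) (use e in simp)
      thus "\<forall>\<^sub>F N in sequentially. \<forall>u\<in>ball u0 d. dist (F N u) (slice_cf k f (u $ i) * of_real t ^ k) < e"
        using eventually_gt_at_top[of k]
      proof eventually_elim
        case (elim N)
        show ?case
        proof
          fix u assume "u \<in> ball u0 d"
          hence "u \<in> cball u0 d" by simp
          from err[OF this elim(2)] elim(1)
          show "dist (F N u) (slice_cf k f (u $ i) * of_real t ^ k) < e" by (simp add: dist_norm)
        qed
      qed
    qed
    thus "\<exists>r>0. ball u0 r \<subseteq> \<Omega> \<and> uniform_limit (ball u0 r) F (\<lambda>u. slice_cf k f (u $ i) * of_real t ^ k) sequentially"
      using d ball_subset_cball by blast
  qed
  from holo_on_scale[OF this, of "inverse (of_real t ^ k)"]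
  show ?thesis using tr(1) by (simp add: field_simps)
qed

definition hom_part :: "nat \<Rightarrow> (complex ^ 2 \<Rightarrow> complex) \<Rightarrow> complex ^ 2 \<Rightarrow> complex" where
  "hom_part k f = ext0 (\<lambda>u. slice_cf k f (u $ i) * (u $ j) ^ k)"

lemma A2_borel: "f \<in> A2 \<Longrightarrow> f \<in> borel_measurable borel"
proof -
  assume f: "f \<in> A2"
  have "(\<lambda>u. indicator \<Omega> u *\<^sub>R f u) \<in> borel_measurable borel"
    by (intro borel_measurable_continuous_on_indicator holo_on_continuous A2D(2)[OF f] dom_sets)
  moreover have "(\<lambda>u. indicator \<Omega> u *\<^sub>R f u) = f"
    using A2D(3)[OF f] by (auto simp: indicator_def)
  ultimately show ?thesis by simp
qed

lemma A2_nn_integral: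
  assumes f: "f \<in> A2"
  shows "(\<integral>\<^sup>+u. ennreal ((norm (f u))\<^sup>2) \<partial>dM) = (\<integral>\<^sup>+u. ennreal ((norm (f u))\<^sup>2) \<partial>lborel)"
proof -
  have [measurable]: "f \<in> borel_measurable borel" by (rule A2_borel[OF f])
  have "(\<integral>\<^sup>+u. ennreal ((norm (f u))\<^sup>2) \<partial>dM) = (\<integral>\<^sup>+u. ennreal ((norm (f u))\<^sup>2) * indicator \<Omega> u \<partial>lborel)"
    by (rule nn_integral_dM) measurable
  also have "\<dots> = (\<integral>\<^sup>+u. ennreal ((norm (f u))\<^sup>2) \<partial>lborel)"
    using A2D(3)[OF f] by (intro nn_integral_cong) (auto simp: indicator_def)
  finally show ?thesis .
qed

text \<open>
  The \<open>k\<close>-homogeneous part in the variable \<open>u\<^sub>j\<close> is a limit of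
  averages over rotations in that variable, and these preserve the domain and its measure.
\<close>

lemma hom_part_contraction:
  assumes f: "f \<in> A2"
  shows hom_part_A2: "hom_part k f \<in> A2" and hom_part_norm: "\<parallel>hom_part k f\<parallel> \<le> \<parallel>f\<parallel>"
proof -
  let ?h = "\<lambda>u. slice_cf k f (u $ i) * (u $ j) ^ k"
  have hol: "holo_on ?h \<Omega>"
    by (intro holo_on_mult slice_cf_holo A2D(2)[OF f] holo_on_power holo_on_coord)
  have "(\<integral>\<^sup>+u. ennreal ((norm (hom_part k f u))\<^sup>2) \<partial>lborel) \<le> (\<integral>\<^sup>+u. ennreal ((norm (f u))\<^sup>2) \<partial>lborel)"
  proof (rule nn_integral_circle_average[OF A2_borel[OF f],
      where \<xi> = "\<lambda>N m. vec2 i 1 (unit_root N m)" and c = "\<lambda>N m. cnj (unit_root N m) ^ k"])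
    show un: "norm (vec2 i 1 (unit_root N m) $ n) = 1" for N m n
      using two_indices[OF ij, of n] by auto
    show "norm (cnj (unit_root N m) ^ k) = 1" for N m by (simp add: norm_power)
    fix u :: "complex ^ 2"
    have rot: "(\<chi> n. vec2 i 1 (unit_root N m) $ n * u $ n) = vec2 i (u $ i) (unit_root N m * u $ j)" for N m
      by (intro vec2_eqI[OF ij]) auto
    show "(\<lambda>N. (\<Sum>m<N. cnj (unit_root N m) ^ k * f (\<chi> n. vec2 i 1 (unit_root N m) $ n * u $ n)) / of_nat N)
        \<longlonglongrightarrow> hom_part k f u"
      unfolding rot
    proof (cases "u \<in> \<Omega>")
      case False
      have "vec2 i (u $ i) (unit_root N m * u $ j) \<notin> \<Omega>" for N m
      proof
        assume "vec2 i (u $ i) (unit_root N m * u $ j) \<in> \<Omega>"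
        from slice_disc[OF this, of "u $ j"] have "u \<in> \<Omega>" by (simp add: norm_mult vec2_eta[OF ij])
        with False show False ..
      qed
      thus "(\<lambda>N. (\<Sum>m<N. cnj (unit_root N m) ^ k * f (vec2 i (u $ i) (unit_root N m * u $ j))) / of_nat N)
        \<longlonglongrightarrow> hom_part k f u"
        using A2D(3)[OF f] False by (simp add: hom_part_def ext0_def)
    next
      case True
      hence "vec2 i (u $ i) (u $ j) \<in> \<Omega>" by (simp add: vec2_eta[OF ij])
      then obtain R where R: "R > norm (u $ j)" "\<And>b. norm b < R \<Longrightarrow> vec2 i (u $ i) b \<in> \<Omega>"
        by (rule slice_open) (rule that)
      have R0: "R > 0" using R(1) norm_ge_zero[of "u $ j"] by linarith
      have hol: "(\<lambda>b. f (vec2 i (u $ i) b)) holomorphic_on ball 0 R"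
        by (rule slice_holomorphic[OF A2D(2)[OF f] R(2)])
      define Q where "Q = (if u $ j = 0 then 2 else R / norm (u $ j))"
      have Q: "Q > 1" using R by (auto simp: Q_def field_simps)
      have "(\<lambda>z. f (vec2 i (u $ i) (u $ j * z))) holomorphic_on ball 0 Q"
      proof (rule holomorphic_on_compose_gen[OF _ hol, unfolded o_def])
        show "(*) (u $ j) holomorphic_on ball 0 Q" by (intro holomorphic_intros)
        show "(*) (u $ j) ` ball 0 Q \<subseteq> ball 0 R"
          using R0 R by (auto simp: Q_def norm_mult field_simps split: if_splits)
      qed
      from taylor_coeff_limit[OF this Q, of k]
      show "(\<lambda>N. (\<Sum>m<N. cnj (unit_root N m) ^ k * f (vec2 i (u $ i) (unit_root N m * u $ j))) / of_nat N)
        \<longlonglongrightarrow> hom_part k f u"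
        using True taylor_coeff_scale[OF hol R(1), of k]
        by (simp add: hom_part_def slice_cf_def mult.commute)
    qed
  qed
  hence bd: "(\<integral>\<^sup>+u. ennreal ((norm (hom_part k f u))\<^sup>2) \<partial>lborel) \<le> ennreal (\<parallel>f\<parallel>\<^sup>2)"
    by (simp add: norm_sq_nn[OF A2D(1)[OF f]] A2_nn_integral[OF f])
  have "(\<integral>\<^sup>+u. ennreal ((norm (?h u))\<^sup>2) \<partial>dM) = (\<integral>\<^sup>+u. ennreal ((norm (indicator \<Omega> u *\<^sub>R ?h u))\<^sup>2) \<partial>dM)"
    by (intro nn_integral_cong) auto
  also have "\<dots> = (\<integral>\<^sup>+u. ennreal ((norm (indicator \<Omega> u *\<^sub>R ?h u))\<^sup>2) * indicator \<Omega> u \<partial>lborel)"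
  proof (rule nn_integral_dM)
    have "(\<lambda>u. indicator \<Omega> u *\<^sub>R ?h u) \<in> borel_measurable borel"
      by (intro borel_measurable_continuous_on_indicator holo_on_continuous hol dom_sets)
    thus "(\<lambda>u. ennreal ((norm (indicator \<Omega> u *\<^sub>R ?h u))\<^sup>2)) \<in> borel_measurable borel" by measurable
  qed
  also have "\<dots> = (\<integral>\<^sup>+u. ennreal ((norm (hom_part k f u))\<^sup>2) \<partial>lborel)"
    by (intro nn_integral_cong) (auto simp: hom_part_def ext0_def indicator_def)
  finally have "(\<integral>\<^sup>+u. ennreal ((norm (?h u))\<^sup>2) \<partial>dM) \<le> ennreal (\<parallel>f\<parallel>\<^sup>2)" using bd by simp
  from L2_of_nn_bound[OF measurable_of_holo[OF hol] this]
  have h: "?h \<in> L2 \<Omega>" "\<parallel>?h\<parallel> \<le> \<parallel>f\<parallel>" by auto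
  show "hom_part k f \<in> A2" unfolding hom_part_def by (rule ext0_A2[OF hol h(1)])
  have "\<parallel>hom_part k f\<parallel> = \<parallel>?h\<parallel>" by (rule L2_norm_cong) (simp add: hom_part_def)
  thus "\<parallel>hom_part k f\<parallel> \<le> \<parallel>f\<parallel>" using h(2) by simp
qed

text \<open>
  At least half of the area of a slice lies where \<open>|b| \<ge> s/2\<close>, and there
  \<open>(2/s)\<^sup>2\<^sup>k |b|\<^sup>2\<^sup>k \<ge> 1\<close>.
\<close>

definition area_const :: "nat \<Rightarrow> real" where "area_const k = 2 * (2 / s) ^ (2 * k)"

lemma area_const_pos: "area_const k > 0"
  using s by (simp add: area_const_def)

lemma half_disc_le_annulus:
  "emeasure lborel (ball (0 :: complex) (s / 2)) \<le> emeasure lborel (ball (0 :: complex) s - ball 0 (s / 2))"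
proof -
  have m: "measure lborel (ball (0 :: complex) r) = r\<^sup>2 * measure lborel (ball (0 :: complex) 1)" if "r > 0" for r
    using content_ball_conv_unit_ball[of r "0 :: complex"] that by simp
  have fin: "emeasure lborel (ball (0 :: complex) r) \<noteq> \<infinity>" for r
    using emeasure_lborel_ball_finite[of "0 :: complex" r] by auto
  have "measure lborel (ball (0 :: complex) s - ball 0 (s / 2))
      = measure lborel (ball (0 :: complex) s) - measure lborel (ball (0 :: complex) (s / 2))"
    using s fin[of s] by (intro measure_Diff) (auto intro: subset_ball)
  also have "\<dots> = 3 / 4 * s\<^sup>2 * measure lborel (ball (0 :: complex) 1)"
    using s m[of s] m[of "s / 2"] by (simp add: power_divide)
  finally have A: "measure lborel (ball (0 :: complex) s - ball 0 (s / 2))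
      = 3 / 4 * s\<^sup>2 * measure lborel (ball (0 :: complex) 1)" .
  have B: "measure lborel (ball (0 :: complex) (s / 2)) = 1 / 4 * s\<^sup>2 * measure lborel (ball (0 :: complex) 1)"
    using s m[of "s / 2"] by (simp add: power_divide)
  have "measure lborel (ball (0 :: complex) (s / 2)) \<le> measure lborel (ball (0 :: complex) s - ball 0 (s / 2))"
    unfolding A B by (intro mult_right_mono) auto
  moreover have "emeasure lborel (ball (0 :: complex) s - ball 0 (s / 2)) \<noteq> \<infinity>"
    using emeasure_mono[of "ball (0 :: complex) s - ball 0 (s / 2)" "ball 0 s" lborel] fin[of s]
    by (auto simp: top_unique)
  ultimately show ?thesis
    using fin[of "s / 2"] by (simp add: emeasure_eq_ennreal_measure)
qed

lemma indicator_slice_measurable [measurable]: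
  "(\<lambda>b. indicator \<Omega> (vec2 i a b) :: ennreal) \<in> borel_measurable borel"
proof -
  have "open ((\<lambda>b. vec2 i a b) -` \<Omega>)"
    by (rule open_vimage[OF open_dom]) (intro continuous_intros)
  moreover have "(\<lambda>b. indicator \<Omega> (vec2 i a b) :: ennreal) = indicator ((\<lambda>b. vec2 i a b) -` \<Omega>)"
    by (auto simp: indicator_def)
  ultimately show ?thesis by simp
qed

text \<open>
  Every nonempty slice contains the disc of radius \<open>s\<close>, in which the inner
  half-disc is no larger than the annulus around it.
\<close>

lemma slice_moment:
  "(\<integral>\<^sup>+b. indicator \<Omega> (vec2 i a b) \<partial>lborel)
     \<le> ennreal (area_const k) * (\<integral>\<^sup>+b. ennreal (norm b ^ (2 * k)) * indicator \<Omega> (vec2 i a b) \<partial>lborel)"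
proof (cases "norm a < norm p0")
  case False
  hence "vec2 i a b \<notin> \<Omega>" for b using first_strict[of "vec2 i a b"] by auto
  thus ?thesis by simp
next
  case True
  define Y where "Y = (\<integral>\<^sup>+b. ennreal (norm b ^ (2 * k)) * indicator \<Omega> (vec2 i a b) \<partial>lborel)"
  define c where "c = (2 / s) ^ (2 * k)"
  have c0: "c \<ge> 0" using s by (simp add: c_def)
  have ge1: "1 \<le> c * norm b ^ (2 * k)" if "norm b \<ge> s / 2" for b :: complex
  proof -
    have "1 \<le> (2 / s * norm b) ^ (2 * k)" using that s by (intro one_le_power) (simp add: field_simps)
    thus ?thesis unfolding c_def power_mult_distrib[symmetric] .
  qed
  have cY: "(\<integral>\<^sup>+b. ennreal c * (ennreal (norm b ^ (2 * k)) * indicator \<Omega> (vec2 i a b)) \<partial>lborel) = ennreal c * Y"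
    unfolding Y_def by (rule nn_integral_cmult) measurable
  have an: "emeasure lborel (ball (0 :: complex) s - ball 0 (s / 2)) \<le> ennreal c * Y"
  proof -
    have "emeasure lborel (ball (0 :: complex) s - ball 0 (s / 2))
        = (\<integral>\<^sup>+b. indicator (ball (0 :: complex) s - ball 0 (s / 2)) b \<partial>lborel)" by simp
    also have "\<dots> \<le> (\<integral>\<^sup>+b. ennreal c * (ennreal (norm b ^ (2 * k)) * indicator \<Omega> (vec2 i a b)) \<partial>lborel)"
    proof (rule nn_integral_mono)
      fix b :: complex
      show "indicator (ball 0 s - ball 0 (s / 2)) b
          \<le> ennreal c * (ennreal (norm b ^ (2 * k)) * indicator \<Omega> (vec2 i a b))"
      proof (cases "b \<in> ball 0 s - ball 0 (s / 2)")
        case b: True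
        hence "vec2 i a b \<in> \<Omega>" using True by (intro bidisc) auto
        moreover have "(1::ennreal) \<le> ennreal (c * norm b ^ (2 * k))"
          using ge1[of b] b by (metis DiffD2 ennreal_1 ennreal_leI linorder_not_le mem_ball_0)
        ultimately show ?thesis using b c0 by (simp add: ennreal_mult)
      qed simp
    qed
    finally show ?thesis unfolding cY .
  qed
  have "(\<integral>\<^sup>+b. indicator \<Omega> (vec2 i a b) \<partial>lborel)
      \<le> (\<integral>\<^sup>+b. indicator (ball (0 :: complex) (s / 2)) b
            + ennreal c * (ennreal (norm b ^ (2 * k)) * indicator \<Omega> (vec2 i a b)) \<partial>lborel)"
  proof (rule nn_integral_mono)
    fix b :: complex
    show "indicator \<Omega> (vec2 i a b) \<le> indicator (ball (0 :: complex) (s / 2)) b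
            + ennreal c * (ennreal (norm b ^ (2 * k)) * indicator \<Omega> (vec2 i a b))"
    proof (cases "b \<in> ball 0 (s / 2)")
      case False
      hence "(1::ennreal) \<le> ennreal (c * norm b ^ (2 * k))"
        using ge1[of b] by (metis ennreal_1 ennreal_leI linorder_not_le mem_ball_0)
      thus ?thesis using False c0 by (auto simp: indicator_def ennreal_mult)
    qed (auto simp: indicator_def)
  qed
  also have "\<dots> = emeasure lborel (ball (0 :: complex) (s / 2)) + ennreal c * Y"
    by (subst nn_integral_add) (auto simp: cY intro!: borel_measurable_indicator)
  also have "\<dots> \<le> ennreal c * Y + ennreal c * Y"
    by (rule add_right_mono[OF order_trans[OF half_disc_le_annulus an]])
  also have "\<dots> = ennreal (area_const k) * Y"
  proof -
    have "ennreal (area_const k) = ennreal c + ennreal c"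
      using c0 by (simp add: area_const_def c_def flip: ennreal_plus)
    thus ?thesis by (simp add: distrib_right)
  qed
  finally show ?thesis unfolding Y_def .
qed

lemma slice_compare:
  assumes [measurable]: "h \<in> borel_measurable (borel :: complex measure)"
  shows "(\<integral>\<^sup>+u. h (u $ i) * indicator \<Omega> u \<partial>lborel)
     \<le> ennreal (area_const k) * (\<integral>\<^sup>+u. h (u $ i) * (ennreal (norm (u $ j) ^ (2 * k)) * indicator \<Omega> u) \<partial>lborel)"
proof -
  have m1 [measurable]: "(\<lambda>u :: complex ^ 2. u $ n) \<in> borel_measurable borel" for n
    by (rule borel_measurable_continuous_onI) (intro continuous_intros)
  have m2: "(\<lambda>u :: complex ^ 2. h (u $ i) * indicator \<Omega> u) \<in> borel_measurable borel" by measurable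
  have m3: "(\<lambda>u :: complex ^ 2. h (u $ i) * (ennreal (norm (u $ j) ^ (2 * k)) * indicator \<Omega> u)) \<in> borel_measurable borel"
    by measurable
  have "(\<integral>\<^sup>+u. h (u $ i) * indicator \<Omega> u \<partial>lborel)
      = (\<integral>\<^sup>+a. h a * (\<integral>\<^sup>+b. indicator \<Omega> (vec2 i a b) \<partial>lborel) \<partial>lborel)"
    unfolding nn_integral_slices[OF ij m2] by (simp add: nn_integral_cmult)
  also have "\<dots> \<le> (\<integral>\<^sup>+a. ennreal (area_const k) * (h a *
      (\<integral>\<^sup>+b. ennreal (norm b ^ (2 * k)) * indicator \<Omega> (vec2 i a b) \<partial>lborel)) \<partial>lborel)"
  proof (rule nn_integral_mono)
    fix a
    show "h a * (\<integral>\<^sup>+b. indicator \<Omega> (vec2 i a b) \<partial>lborel)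
      \<le> ennreal (area_const k) * (h a * (\<integral>\<^sup>+b. ennreal (norm b ^ (2 * k)) * indicator \<Omega> (vec2 i a b) \<partial>lborel))"
      using mult_left_mono[OF slice_moment[of a k], of "h a"] by (simp add: mult_ac)
  qed
  also have "\<dots> = (\<integral>\<^sup>+a. ennreal (area_const k) *
      (\<integral>\<^sup>+b. h a * (ennreal (norm b ^ (2 * k)) * indicator \<Omega> (vec2 i a b)) \<partial>lborel) \<partial>lborel)"
    by (simp add: nn_integral_cmult)
  also have "\<dots> = (\<integral>\<^sup>+a. (\<integral>\<^sup>+b. ennreal (area_const k) *
      (h a * (ennreal (norm b ^ (2 * k)) * indicator \<Omega> (vec2 i a b))) \<partial>lborel) \<partial>lborel)"
    by (intro nn_integral_cong, subst nn_integral_cmult[symmetric]) measurable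
  also have "\<dots> = (\<integral>\<^sup>+u. ennreal (area_const k) * (h (u $ i) * (ennreal (norm (u $ j) ^ (2 * k)) * indicator \<Omega> u)) \<partial>lborel)"
    by (subst nn_integral_slices[OF ij]) (use m3 in \<open>simp_all\<close>)
  also have "\<dots> = ennreal (area_const k) * (\<integral>\<^sup>+u. h (u $ i) * (ennreal (norm (u $ j) ^ (2 * k)) * indicator \<Omega> u) \<partial>lborel)"
    by (rule nn_integral_cmult) (use m3 in simp)
  finally show ?thesis .
qed

lemma slice_cf_continuous:
  assumes "holo_on f \<Omega>"
  shows "continuous_on (ball 0 (norm p0)) (slice_cf k f)"
proof -
  have "continuous_on (ball 0 (norm p0)) (\<lambda>a. slice_cf k f (vec2 i a 0 $ i))"
    by (rule continuous_on_compose2[OF holo_on_continuous[OF slice_cf_holo[OF assms, of k]]])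
       (use s in \<open>auto intro!: continuous_intros bidisc\<close>)
  thus ?thesis by simp
qed

text \<open>
  Removing the factor \<open>u\<^sub>j\<^sup>k\<close> from the homogeneous part costs a
  constant only, uniformly over the slices, hence also under any weight depending on
  \<open>u\<^sub>i\<close>.
\<close>

lemma slice_cf_weighted:
  assumes f: "f \<in> A2" and [measurable]: "w \<in> borel_measurable (borel :: complex measure)"
  shows "(\<integral>\<^sup>+u. ennreal (w (u $ i) * (norm (slice_cf k f (u $ i)))\<^sup>2) \<partial>dM)
     \<le> ennreal (area_const k) * (\<integral>\<^sup>+u. ennreal (w (u $ i) * (norm (hom_part k f u))\<^sup>2) \<partial>dM)"
proof -
  define g where "g a = indicator (ball 0 (norm p0)) a *\<^sub>R slice_cf k f a" for a
  have [measurable]: "g \<in> borel_measurable borel"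
    unfolding g_def by (intro borel_measurable_continuous_on_indicator slice_cf_continuous A2D(2)[OF f]) auto
  have m1 [measurable]: "(\<lambda>u :: complex ^ 2. u $ n) \<in> borel_measurable borel" for n
    by (rule borel_measurable_continuous_onI) (intro continuous_intros)
  have [measurable]: "hom_part k f \<in> borel_measurable borel" by (rule A2_borel[OF hom_part_A2[OF f]])
  define h where "h a = ennreal (w a * (norm (g a))\<^sup>2)" for a
  have hm [measurable]: "h \<in> borel_measurable borel" unfolding h_def by measurable
  have g: "g (u $ i) = slice_cf k f (u $ i)" if "u \<in> \<Omega>" for u
    using first_strict[OF that] by (simp add: g_def)
  have "(\<integral>\<^sup>+u. ennreal (w (u $ i) * (norm (slice_cf k f (u $ i)))\<^sup>2) \<partial>dM) = (\<integral>\<^sup>+u. h (u $ i) \<partial>dM)"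
    by (intro nn_integral_cong) (simp add: h_def g)
  also have "\<dots> = (\<integral>\<^sup>+u. h (u $ i) * indicator \<Omega> u \<partial>lborel)"
    by (rule nn_integral_dM) measurable
  also have "\<dots> \<le> ennreal (area_const k) * (\<integral>\<^sup>+u. h (u $ i) * (ennreal (norm (u $ j) ^ (2 * k)) * indicator \<Omega> u) \<partial>lborel)"
    by (rule slice_compare[OF hm])
  also have "(\<integral>\<^sup>+u. h (u $ i) * (ennreal (norm (u $ j) ^ (2 * k)) * indicator \<Omega> u) \<partial>lborel)
      = (\<integral>\<^sup>+u. ennreal (w (u $ i) * (norm (hom_part k f u))\<^sup>2) * indicator \<Omega> u \<partial>lborel)"
  proof (rule nn_integral_cong)
    fix u
    show "h (u $ i) * (ennreal (norm (u $ j) ^ (2 * k)) * indicator \<Omega> u)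
        = ennreal (w (u $ i) * (norm (hom_part k f u))\<^sup>2) * indicator \<Omega> u"
    proof (cases "u \<in> \<Omega>")
      case True
      have "(norm (hom_part k f u))\<^sup>2 = (norm (slice_cf k f (u $ i)))\<^sup>2 * norm (u $ j) ^ (2 * k)"
        using True by (simp add: hom_part_def norm_mult norm_power power_mult_distrib power_mult[symmetric] mult.commute)
      thus ?thesis using True by (simp add: h_def g ennreal_mult''[symmetric] mult.assoc)
    qed simp
  qed
  also have "\<dots> = (\<integral>\<^sup>+u. ennreal (w (u $ i) * (norm (hom_part k f u))\<^sup>2) \<partial>dM)"
    by (rule nn_integral_dM[symmetric]) measurable
  finally show ?thesis .
qed

text \<open>
  The square of this number dominates \<open>area_const\<close>; its growth rate \<open>2 / s\<close> is
  what limits the expansion of the kernel to small \<open>z\<close>.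
\<close>

definition norm_const :: "nat \<Rightarrow> real" where "norm_const k = 2 * (2 / s) ^ k"

lemma norm_const_pos: "norm_const k > 0"
  using s by (simp add: norm_const_def)

lemma area_const_le: "area_const k \<le> (norm_const k)\<^sup>2"
  using s by (simp add: area_const_def norm_const_def power_mult_distrib power_mult[symmetric] mult.commute)

lemma slice_cf_L2:
  assumes f: "f \<in> A2"
  shows "(\<lambda>u. slice_cf k f (u $ i)) \<in> L2 \<Omega>" "\<parallel>\<lambda>u. slice_cf k f (u $ i)\<parallel> \<le> norm_const k * \<parallel>hom_part k f\<parallel>"
proof -
  have "(\<integral>\<^sup>+u. ennreal ((norm (slice_cf k f (u $ i)))\<^sup>2) \<partial>dM)
      \<le> ennreal (area_const k) * (\<integral>\<^sup>+u. ennreal ((norm (hom_part k f u))\<^sup>2) \<partial>dM)"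
    using slice_cf_weighted[OF f, of "\<lambda>a. 1" k] by simp
  also have "\<dots> = ennreal (area_const k * \<parallel>hom_part k f\<parallel>\<^sup>2)"
    using area_const_pos[of k] by (simp add: norm_sq_nn[OF A2D(1)[OF hom_part_A2[OF f]], symmetric] ennreal_mult)
  also have "\<dots> \<le> ennreal ((norm_const k * \<parallel>hom_part k f\<parallel>)\<^sup>2)"
    using area_const_le[of k] by (intro ennreal_leI) (simp add: power_mult_distrib mult_right_mono)
  finally have b: "(\<integral>\<^sup>+u. ennreal ((norm (slice_cf k f (u $ i)))\<^sup>2) \<partial>dM) \<le> ennreal ((norm_const k * \<parallel>hom_part k f\<parallel>)\<^sup>2)" .
  show "(\<lambda>u. slice_cf k f (u $ i)) \<in> L2 \<Omega>" "\<parallel>\<lambda>u. slice_cf k f (u $ i)\<parallel> \<le> norm_const k * \<parallel>hom_part k f\<parallel>"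
    using L2_of_nn_bound[OF measurable_of_holo[OF slice_cf_holo[OF A2D(2)[OF f]]] b] norm_const_pos[of k] by auto
qed

lemma slice_cf_ext0_A2: "f \<in> A2 \<Longrightarrow> ext0 (\<lambda>u. slice_cf k f (u $ i)) \<in> A2"
  by (intro ext0_A2 slice_cf_holo slice_cf_L2 A2D(2))

lemma slice_cf_of_monomial:
  assumes a: "norm a < norm p0"
  shows "slice_cf l (ext0 (\<lambda>u. G (u $ i) * (u $ j) ^ k)) a = (if l = k then G a else 0)"
proof -
  have "slice_cf l (ext0 (\<lambda>u. G (u $ i) * (u $ j) ^ k)) a = taylor_coeff (\<lambda>b. G a * b ^ k) l"
    unfolding slice_cf_def by (rule taylor_coeff_cong[OF s]) (simp add: bidisc a)
  thus ?thesis by (simp add: taylor_coeff_monomial)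
qed

lemma slice_cf_add_scale:
  assumes f: "holo_on f \<Omega>" and g: "holo_on g \<Omega>" and a: "norm a < norm p0"
  shows "slice_cf k (\<lambda>z. f z + g z) a = slice_cf k f a + slice_cf k g a" and "slice_cf k (\<lambda>z. c * f z) a = c * slice_cf k f a"
proof -
  have hf: "(\<lambda>b. f (vec2 i a b)) holomorphic_on ball 0 s" and hg: "(\<lambda>b. g (vec2 i a b)) holomorphic_on ball 0 s"
    using f g a by (auto intro!: slice_holomorphic bidisc)
  show "slice_cf k (\<lambda>z. f z + g z) a = slice_cf k f a + slice_cf k g a"
    unfolding slice_cf_def taylor_coeff_def
    by (subst higher_deriv_add[OF hf hg]) (use s in \<open>auto simp: add_divide_distrib\<close>)
  show "slice_cf k (\<lambda>z. c * f z) a = c * slice_cf k f a"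
    unfolding slice_cf_def taylor_coeff_def
    by (subst higher_deriv_cmult[OF hf]) (use s in auto)
qed

lemma slice_cf_sums:
  assumes f: "holo_on f \<Omega>" and a: "norm a < norm p0" and z: "norm z < s"
  shows "(\<lambda>k. slice_cf k f a * z ^ k) sums f (vec2 i a z)"
  unfolding slice_cf_def
  by (rule taylor_coeff_sums[OF _ z]) (use f a in \<open>auto intro!: slice_holomorphic bidisc\<close>)

end

section \<open>The kernels of the coefficient functionals\<close>

context disc_face
begin

abbreviation base_pt :: "real \<Rightarrow> complex ^ 2" where "base_pt t \<equiv> vec2 i (of_real t * p0) 0"
abbreviation base_norm :: "real \<Rightarrow> real" where "base_norm t \<equiv> \<parallel>ker (base_pt t)\<parallel>"

lemma tp0: "0 \<le> t \<Longrightarrow> t < 1 \<Longrightarrow> norm (of_real t * p0) < norm p0"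
  using p0 by (simp add: norm_mult)

lemma base_pt_dom: "0 \<le> t \<Longrightarrow> t < 1 \<Longrightarrow> base_pt t \<in> \<Omega>"
  using s tp0 by (intro bidisc) auto

lemma base_norm_pos: "0 \<le> t \<Longrightarrow> t < 1 \<Longrightarrow> base_norm t > 0"
  by (intro ker_norm_pos base_pt_dom)

text \<open>
  As a function of \<open>u\<^sub>i\<close> alone, the coefficient is an element of the Bergman
  space of controlled norm; evaluate it at the base point. In this way the coefficient
  functionals are bounded by the evaluation functional at one point, with constants independent
  of \<open>t\<close>.
\<close>

lemma slice_cf_bound:
  assumes f: "f \<in> A2" and t: "0 \<le> t" "t < 1"
  shows "norm (slice_cf k f (of_real t * p0)) \<le> norm_const k * base_norm t * \<parallel>f\<parallel>"
proof -
  let ?g = "ext0 (\<lambda>u. slice_cf k f (u $ i))"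
  have b: "base_pt t \<in> \<Omega>" by (rule base_pt_dom[OF t])
  have g: "?g \<in> A2" by (rule slice_cf_ext0_A2[OF f])
  have "slice_cf k f (of_real t * p0) = ?g (base_pt t)" using b by simp
  also have "\<dots> = \<langle>?g, ker (base_pt t)\<rangle>" by (rule ker_reproducing[OF b g, symmetric])
  finally have "norm (slice_cf k f (of_real t * p0)) \<le> \<parallel>?g\<parallel> * base_norm t"
    using cauchy_schwarz[OF A2D(1)[OF g] A2D(1)[OF ker_A2[OF b]]] by simp
  also have "\<parallel>?g\<parallel> = \<parallel>\<lambda>u. slice_cf k f (u $ i)\<parallel>" by (rule L2_norm_cong) simp
  also have "\<dots> * base_norm t \<le> (norm_const k * \<parallel>f\<parallel>) * base_norm t"
  proof (rule mult_right_mono)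
    have "\<parallel>\<lambda>u. slice_cf k f (u $ i)\<parallel> \<le> norm_const k * \<parallel>hom_part k f\<parallel>" by (rule slice_cf_L2(2)[OF f])
    also have "\<dots> \<le> norm_const k * \<parallel>f\<parallel>" using norm_const_pos[of k] hom_part_norm[OF f, of k] by simp
    finally show "\<parallel>\<lambda>u. slice_cf k f (u $ i)\<parallel> \<le> norm_const k * \<parallel>f\<parallel>" .
  qed simp
  finally show ?thesis by (simp add: mult_ac)
qed

lemma coeff_kernel_exists:
  assumes t: "0 \<le> t" "t < 1"
  shows "\<exists>p. p \<in> A2 \<and> (\<forall>f\<in>A2. \<langle>f, p\<rangle> = slice_cf k f (of_real t * p0))"
proof -
  obtain p where "p \<in> A2" "\<And>f. f \<in> A2 \<Longrightarrow> slice_cf k f (of_real t * p0) = \<langle>f, p\<rangle>"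
  proof (rule A2_riesz[of "\<lambda>f. slice_cf k f (of_real t * p0)" "norm_const k * base_norm t"])
    fix f g c assume "f \<in> A2"
    show "slice_cf k (\<lambda>z. c * f z) (of_real t * p0) = c * slice_cf k f (of_real t * p0)"
      by (rule slice_cf_add_scale(2)[OF A2D(2) A2D(2) tp0[OF t]]) (rule \<open>f \<in> A2\<close>)+
    show "norm (slice_cf k f (of_real t * p0)) \<le> norm_const k * base_norm t * \<parallel>f\<parallel>"
      by (rule slice_cf_bound[OF \<open>f \<in> A2\<close> t])
    assume "g \<in> A2"
    show "slice_cf k (\<lambda>z. f z + g z) (of_real t * p0) = slice_cf k f (of_real t * p0) + slice_cf k g (of_real t * p0)"
      by (rule slice_cf_add_scale(1)[OF A2D(2)[OF \<open>f \<in> A2\<close>] A2D(2)[OF \<open>g \<in> A2\<close>] tp0[OF t]])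
  qed blast
  thus ?thesis by (intro exI[of _ p]) simp
qed

definition coeff_ker :: "nat \<Rightarrow> real \<Rightarrow> complex ^ 2 \<Rightarrow> complex" where
  "coeff_ker k t = (SOME p. p \<in> A2 \<and> (\<forall>f\<in>A2. \<langle>f, p\<rangle> = slice_cf k f (of_real t * p0)))"

lemma coeff_ker:
  assumes t: "0 \<le> t" "t < 1"
  shows coeff_ker_A2: "coeff_ker k t \<in> A2" and coeff_ker_inner: "f \<in> A2 \<Longrightarrow> \<langle>f, coeff_ker k t\<rangle> = slice_cf k f (of_real t * p0)"
  using someI_ex[OF coeff_kernel_exists[OF t, of k]] unfolding coeff_ker_def by auto

lemma coeff_ker_self:
  assumes t: "0 \<le> t" "t < 1"
  shows "slice_cf k (coeff_ker k t) (of_real t * p0) = of_real (\<parallel>coeff_ker k t\<parallel>\<^sup>2)"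
  using coeff_ker_inner[OF t coeff_ker_A2[OF t]] by (simp only: inner_self[symmetric])

lemma coeff_ker_norm_le:
  assumes t: "0 \<le> t" "t < 1"
  shows "\<parallel>coeff_ker k t\<parallel> \<le> norm_const k * base_norm t"
proof -
  have "norm (complex_of_real (\<parallel>coeff_ker k t\<parallel>\<^sup>2)) \<le> norm_const k * base_norm t * \<parallel>coeff_ker k t\<parallel>"
    unfolding coeff_ker_self[OF t, symmetric] by (rule slice_cf_bound[OF coeff_ker_A2[OF t] t])
  hence "\<parallel>coeff_ker k t\<parallel> * \<parallel>coeff_ker k t\<parallel> \<le> norm_const k * base_norm t * \<parallel>coeff_ker k t\<parallel>" by (simp add: power2_eq_square norm_mult)
  moreover have "0 \<le> norm_const k * base_norm t" using norm_const_pos[of k] by simp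
  ultimately show ?thesis
    using L2_norm_nonneg[of "coeff_ker k t"] by (cases "\<parallel>coeff_ker k t\<parallel> = 0") auto
qed

text \<open>
  Taking the homogeneous part \<open>E P\<close> does not change the value of the coefficient
  functional, so \<open>\<langle>E P, P\<rangle> = \<parallel>P\<parallel>\<^sup>2\<close>. As
  \<open>E\<close> is a contraction, expanding \<open>\<parallel>E P -
  P\<parallel>\<^sup>2\<close> leaves nothing positive.
\<close>

lemma hom_part_coeff_ker:
  assumes t: "0 \<le> t" "t < 1"
  shows "hom_part k (coeff_ker k t) = coeff_ker k t"
proof -
  let ?P = "coeff_ker k t" and ?E = "hom_part k (coeff_ker k t)"
  have PA: "?P \<in> A2" by (rule coeff_ker_A2[OF t])
  have EA: "?E \<in> A2" by (rule hom_part_A2[OF PA])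
  have "\<langle>?E, ?P\<rangle> = slice_cf k ?E (of_real t * p0)" by (rule coeff_ker_inner[OF t EA])
  also have "\<dots> = slice_cf k ?P (of_real t * p0)"
    unfolding hom_part_def by (simp add: slice_cf_of_monomial[OF tp0[OF t]])
  also have "\<dots> = of_real (\<parallel>?P\<parallel>\<^sup>2)" by (rule coeff_ker_self[OF t])
  finally have "\<parallel>\<lambda>z. ?E z - ?P z\<parallel>\<^sup>2 = \<parallel>?E\<parallel>\<^sup>2 - \<parallel>?P\<parallel>\<^sup>2"
    by (simp add: norm_diff_sq[OF A2D(1)[OF EA] A2D(1)[OF PA]])
  also have "\<dots> \<le> 0" using hom_part_norm[OF PA, of k] by (simp add: power_mono)
  finally have "\<parallel>\<lambda>z. ?E z - ?P z\<parallel> = 0" by simp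
  from A2_norm_zero[OF A2_diff[OF EA PA] this] show ?thesis by (simp add: fun_eq_iff)
qed

lemma coeff_ker_monomial:
  assumes t: "0 \<le> t" "t < 1" and u: "u \<in> \<Omega>"
  shows "coeff_ker k t u = slice_cf k (coeff_ker k t) (u $ i) * (u $ j) ^ k"
proof -
  have "coeff_ker k t u = hom_part k (coeff_ker k t) u" by (simp only: hom_part_coeff_ker[OF t])
  thus ?thesis using u by (simp add: hom_part_def)
qed

lemma monomial_mult_A2:
  assumes f: "f \<in> A2"
  shows "(\<lambda>u. (u $ j) ^ l * f u) \<in> A2" "\<parallel>\<lambda>u. (u $ j) ^ l * f u\<parallel> \<le> S ^ l * \<parallel>f\<parallel>"
proof -
  have h: "holo_on (\<lambda>u. (u $ j) ^ l) \<Omega>" by (intro holo_on_power holo_on_coord)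
  have b: "norm ((u $ j) ^ l) \<le> S ^ l" if "u \<in> \<Omega>" for u
    unfolding norm_power using second_bound_dom[OF that] by (intro power_mono) auto
  show "(\<lambda>u. (u $ j) ^ l * f u) \<in> A2" by (rule A2_mult_bounded[OF f h b])
  show "\<parallel>\<lambda>u. (u $ j) ^ l * f u\<parallel> \<le> S ^ l * \<parallel>f\<parallel>"
    using S_pos by (intro L2_norm_mult_bounded[OF A2D(1)[OF f] measurable_of_holo[OF h] b]) auto
qed

lemma ext0_monomial: "ext0 (\<lambda>u. G (u $ i) * (u $ j) ^ l) = (\<lambda>u. (u $ j) ^ l * ext0 (\<lambda>u. G (u $ i)) u)"
  by (auto simp: ext0_def fun_eq_iff)

text \<open>
  Test the coefficient functional on \<open>u\<^sub>j\<^sup>k\<close> times the restriction of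
  the kernel to \<open>u\<^sub>j = 0\<close>.
\<close>

lemma base_norm_le_coeff_ker:
  assumes t: "0 \<le> t" "t < 1"
  shows "base_norm t \<le> S ^ k * \<parallel>coeff_ker k t\<parallel>"
proof -
  let ?K = "ker (base_pt t)"
  let ?g = "ext0 (\<lambda>u. slice_cf 0 ?K (u $ i))"
  let ?f = "ext0 (\<lambda>u. slice_cf 0 ?K (u $ i) * (u $ j) ^ k)"
  have b: "base_pt t \<in> \<Omega>" by (rule base_pt_dom[OF t])
  have KA: "?K \<in> A2" by (rule ker_A2[OF b])
  have gA: "?g \<in> A2" by (rule slice_cf_ext0_A2[OF KA])
  have gE: "?g = hom_part 0 ?K" by (simp add: hom_part_def)
  have gn: "\<parallel>?g\<parallel> \<le> base_norm t" unfolding gE by (rule hom_part_norm[OF KA])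
  have fA: "?f \<in> A2" and fn: "\<parallel>?f\<parallel> \<le> S ^ k * \<parallel>?g\<parallel>"
    unfolding ext0_monomial by (rule monomial_mult_A2[OF gA])+
  have "\<langle>?f, coeff_ker k t\<rangle> = slice_cf 0 ?K (of_real t * p0)"
    by (simp add: coeff_ker_inner[OF t fA] slice_cf_of_monomial[OF tp0[OF t]])
  also have "\<dots> = ?K (base_pt t)" by (simp add: slice_cf_def taylor_coeff_def)
  also have "\<dots> = of_real ((base_norm t)\<^sup>2)" by (rule ker_diag[OF b])
  finally have "(base_norm t)\<^sup>2 = norm \<langle>?f, coeff_ker k t\<rangle>" by (simp only: norm_of_real abs_power2)
  also have "\<dots> \<le> \<parallel>?f\<parallel> * \<parallel>coeff_ker k t\<parallel>" by (intro cauchy_schwarz A2D(1) fA coeff_ker_A2 t)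
  also have "\<dots> \<le> (S ^ k * base_norm t) * \<parallel>coeff_ker k t\<parallel>"
  proof (rule mult_right_mono)
    show "\<parallel>?f\<parallel> \<le> S ^ k * base_norm t"
      by (rule order_trans[OF fn mult_left_mono[OF gn]]) (use S_pos in auto)
  qed simp
  finally show ?thesis using base_norm_pos[OF t] by (simp add: power2_eq_square)
qed

abbreviation ker_at :: "real \<Rightarrow> complex \<Rightarrow> complex ^ 2 \<Rightarrow> complex" where
  "ker_at t z \<equiv> ker (vec2 i (of_real t * p0) z)"

definition ker_sum :: "nat \<Rightarrow> real \<Rightarrow> complex \<Rightarrow> complex ^ 2 \<Rightarrow> complex" where
  "ker_sum N t z = (\<lambda>u. \<Sum>k<N. cnj z ^ k * coeff_ker k t u)"

lemma ker_sum_A2: "0 \<le> t \<Longrightarrow> t < 1 \<Longrightarrow> ker_sum N t z \<in> A2"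
  unfolding ker_sum_def by (intro A2_sum A2_scale coeff_ker_A2)

lemma ker_at_dom: "0 \<le> t \<Longrightarrow> t < 1 \<Longrightarrow> norm z \<le> s / 4 \<Longrightarrow> vec2 i (of_real t * p0) z \<in> \<Omega>"
  using s tp0 by (intro bidisc) auto

text \<open>
  By duality: against \<open>f\<close> the difference is the tail of the Taylor series of
  \<open>f\<close> along the slice, which \<open>slice_cf_bound\<close> dominates by a geometric
  series with ratio at most \<open>1/2\<close>.
\<close>

lemma kernel_expansion:
  assumes t: "0 \<le> t" "t < 1" and z: "norm z \<le> s / 4"
  shows "\<parallel>\<lambda>u. ker_at t z u - ker_sum N t z u\<parallel> \<le> 4 * (2 / s) ^ N * norm z ^ N * base_norm t"
proof -
  let ?R = "\<lambda>u. ker_at t z u - ker_sum N t z u"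
  have VA: "ker_at t z \<in> A2" by (intro ker_A2 ker_at_dom t z)
  have WA: "ker_sum N t z \<in> A2" by (rule ker_sum_A2[OF t])
  have RA: "?R \<in> A2" by (intro A2_diff VA WA)
  define q where "q = 2 * norm z / s"
  have q: "0 \<le> q" "q \<le> 1 / 2" using z s by (auto simp: q_def field_simps)
  have bd: "norm \<langle>f, ?R\<rangle> \<le> 4 * q ^ N * base_norm t * \<parallel>f\<parallel>" if f: "f \<in> A2" for f
  proof -
    have PL: "(\<lambda>u. cnj z ^ k * coeff_ker k t u) \<in> L2 \<Omega>" for k
      by (intro L2_scale A2D(1) coeff_ker_A2 t)
    have "\<langle>f, ker_sum N t z\<rangle> = (\<Sum>k<N. z ^ k * slice_cf k f (of_real t * p0))"
      unfolding ker_sum_def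
      by (subst inner_sum_right)
         (auto simp: inner_scale_right coeff_ker_inner[OF t f] A2D(1)[OF f] PL)
    hence eq: "\<langle>f, ?R\<rangle> = f (vec2 i (of_real t * p0) z) - (\<Sum>k<N. slice_cf k f (of_real t * p0) * z ^ k)"
      using inner_diff_right[OF A2D(1)[OF VA] A2D(1)[OF WA] A2D(1)[OF f]]
        ker_reproducing[OF ker_at_dom[OF t z] f] by (simp add: mult.commute)
    have "(\<lambda>k. slice_cf k f (of_real t * p0) * z ^ k) sums f (vec2 i (of_real t * p0) z)"
      by (rule slice_cf_sums[OF A2D(2)[OF f] tp0[OF t]]) (use z s in auto)
    from sums_split_initial_segment[OF this, of N]
    have sm: "(\<lambda>k. slice_cf (k + N) f (of_real t * p0) * z ^ (k + N)) sums \<langle>f, ?R\<rangle>" unfolding eq .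
    have gs: "(\<lambda>k. 2 * q ^ N * base_norm t * \<parallel>f\<parallel> * q ^ k) sums (2 * q ^ N * base_norm t * \<parallel>f\<parallel> * (1 / (1 - q)))"
      using q by (intro sums_mult geometric_sums) auto
    have tb: "norm (slice_cf (k + N) f (of_real t * p0) * z ^ (k + N)) \<le> 2 * q ^ N * base_norm t * \<parallel>f\<parallel> * q ^ k" for k
    proof -
      have "norm (slice_cf (k + N) f (of_real t * p0) * z ^ (k + N))
          \<le> (norm_const (k + N) * base_norm t * \<parallel>f\<parallel>) * norm z ^ (k + N)"
        unfolding norm_mult norm_power by (intro mult_right_mono slice_cf_bound f t) auto
      also have "\<dots> = 2 * q ^ N * base_norm t * \<parallel>f\<parallel> * q ^ k"
        by (simp add: norm_const_def q_def power_divide power_mult_distrib power_add mult_ac)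
      finally show ?thesis .
    qed
    have "norm \<langle>f, ?R\<rangle> \<le> (\<Sum>k. norm (slice_cf (k + N) f (of_real t * p0) * z ^ (k + N)))"
      unfolding sums_unique[OF sm]
      by (intro summable_norm summable_comparison_test'[OF sums_summable[OF gs], of 0])
         (use tb in auto)
    also have "\<dots> \<le> (\<Sum>k. 2 * q ^ N * base_norm t * \<parallel>f\<parallel> * q ^ k)"
      using tb by (intro suminf_le sums_summable[OF gs]
          summable_comparison_test'[OF sums_summable[OF gs], of 0]) auto
    also have "\<dots> = 2 * q ^ N * base_norm t * \<parallel>f\<parallel> * (1 / (1 - q))" by (rule sums_unique[OF gs, symmetric])
    also have "\<dots> \<le> 2 * q ^ N * base_norm t * \<parallel>f\<parallel> * 2"
      using q by (intro mult_left_mono) (auto simp: field_simps)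
    finally show ?thesis by (simp add: mult_ac)
  qed
  have "norm (complex_of_real (\<parallel>?R\<parallel>\<^sup>2)) \<le> 4 * q ^ N * base_norm t * \<parallel>?R\<parallel>"
    unfolding inner_self[symmetric] by (rule bd[OF RA])
  hence "\<parallel>?R\<parallel> * \<parallel>?R\<parallel> \<le> 4 * q ^ N * base_norm t * \<parallel>?R\<parallel>" by (simp add: power2_eq_square norm_mult)
  moreover have "0 \<le> 4 * q ^ N * base_norm t" using q by simp
  ultimately have "\<parallel>?R\<parallel> \<le> 4 * q ^ N * base_norm t"
    using L2_norm_nonneg[of ?R] by (cases "\<parallel>?R\<parallel> = 0") auto
  thus ?thesis by (simp add: q_def power_divide power_mult_distrib mult_ac)
qed

lemma ker_at_norm:
  assumes t: "0 \<le> t" "t < 1" and z: "norm z \<le> s / 4"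
  shows "\<parallel>ker_at t z\<parallel> \<le> 4 * base_norm t"
  using kernel_expansion[OF t z, of 0] by (simp add: ker_sum_def)

text \<open>
  A fixed approach to the face; the denominator \<open>n + 1\<close> keeps the values in
  \<open>[0, 1)\<close>.
\<close>

definition \<tau> :: "nat \<Rightarrow> real" where "\<tau> n = 1 - 1 / (real n + 1)"

lemma \<tau>: "0 \<le> \<tau> n" "\<tau> n < 1" "\<tau> \<longlonglongrightarrow> 1"
proof -
  show "0 \<le> \<tau> n" "\<tau> n < 1" by (auto simp: \<tau>_def field_simps)
  have "(\<lambda>n. 1 - inverse (real (Suc n))) \<longlonglongrightarrow> 1 - 0"
    by (intro tendsto_intros LIMSEQ_inverse_real_of_nat)
  thus "\<tau> \<longlonglongrightarrow> 1" unfolding \<tau>_def[abs_def] by (simp add: inverse_eq_divide add.commute)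
qed

lemma face_frontier:
  assumes "norm b \<le> s"
  shows "vec2 i p0 b \<in> frontier \<Omega>"
proof -
  have "vec2 i p0 b \<notin> \<Omega>" using first_strict[of "vec2 i p0 b"] by auto
  thus ?thesis using slice assms open_dom by (simp add: frontier_def interior_open)
qed

text \<open>
  The Berezin transform at \<open>(t p0, z)\<close>, multiplied by the bounded ratio of squared
  kernel norms, expands into these coefficients by \<open>kernel_expansion\<close>. It tends to
  zero for every small \<open>z\<close>, so \<open>sesqui_coefficients_null\<close> applies.
\<close>

proposition toeplitz_coefficients_null:
  assumes bz: "(berezin \<Omega> T \<longlongrightarrow> 0) (to_boundary \<Omega>)"
  shows "(\<lambda>n. \<langle>\<lambda>u. \<phi> u * coeff_ker k (\<tau> n) u, coeff_ker l (\<tau> n)\<rangle> / of_real ((base_norm (\<tau> n))\<^sup>2)) \<longlonglongrightarrow> 0"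
proof (rule sesqui_coefficients_null[where \<delta> = "s / 4" and
    F = "\<lambda>n z. \<langle>\<lambda>u. \<phi> u * ker_at (\<tau> n) z u, ker_at (\<tau> n) z\<rangle> / of_real ((base_norm (\<tau> n))\<^sup>2)" and
    A = "\<lambda>n k l. \<langle>\<lambda>u. \<phi> u * coeff_ker k (\<tau> n) u, coeff_ker l (\<tau> n)\<rangle> / of_real ((base_norm (\<tau> n))\<^sup>2)"])
  show "s / 4 > 0" using s by simp
next
  fix N
  define C where "C = B\<phi> * (4 * (2 / s) ^ N) * 12"
  show "\<exists>C. \<forall>n z. norm z \<le> s / 4 \<longrightarrow>
      norm (\<langle>\<lambda>u. \<phi> u * ker_at (\<tau> n) z u, ker_at (\<tau> n) z\<rangle> / of_real ((base_norm (\<tau> n))\<^sup>2)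
        - (\<Sum>k<N. \<Sum>l<N. cnj z ^ k * z ^ l *
            (\<langle>\<lambda>u. \<phi> u * coeff_ker k (\<tau> n) u, coeff_ker l (\<tau> n)\<rangle> / of_real ((base_norm (\<tau> n))\<^sup>2)))) \<le> C * norm z ^ N"
  proof (intro exI[of _ C] allI impI)
    fix n and z :: complex assume z: "norm z \<le> s / 4"
    let ?t = "\<tau> n"
    note t = \<tau>(1,2)[of n]
    let ?V = "ker_at ?t z" and ?W = "ker_sum N ?t z"
    let ?R = "\<lambda>u. ?V u - ?W u"
    have VL: "?V \<in> L2 \<Omega>" by (intro A2D(1) ker_A2 ker_at_dom t z)
    have WL: "?W \<in> L2 \<Omega>" by (intro A2D(1) ker_sum_A2 t)
    have RL: "?R \<in> L2 \<Omega>" by (intro L2_diff VL WL)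
    have PL: "coeff_ker k ?t \<in> L2 \<Omega>" for k by (intro A2D(1) coeff_ker_A2 t)
    have n: "base_norm ?t > 0" by (rule base_norm_pos[OF t])
    have WW: "\<langle>\<lambda>u. \<phi> u * ?W u, ?W\<rangle> = (\<Sum>k<N. \<Sum>l<N. cnj z ^ k * z ^ l * \<langle>\<lambda>u. \<phi> u * coeff_ker k ?t u, coeff_ker l ?t\<rangle>)"
    proof -
      have "(\<lambda>u. \<phi> u * ?W u) = (\<lambda>u. \<Sum>k<N. cnj z ^ k * (\<phi> u * coeff_ker k ?t u))"
        by (simp add: ker_sum_def sum_distrib_left mult_ac)
      hence "\<langle>\<lambda>u. \<phi> u * ?W u, ?W\<rangle> = (\<Sum>k<N. cnj z ^ k * \<langle>\<lambda>u. \<phi> u * coeff_ker k ?t u, ?W\<rangle>)"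
        by (simp add: inner_sum_left L2_scale symbol_mult_L2 PL WL inner_scale_left)
      also have "\<dots> = (\<Sum>k<N. cnj z ^ k * (\<Sum>l<N. z ^ l * \<langle>\<lambda>u. \<phi> u * coeff_ker k ?t u, coeff_ker l ?t\<rangle>))"
        unfolding ker_sum_def
        by (simp add: inner_sum_right L2_scale symbol_mult_L2 PL inner_scale_right)
      finally show ?thesis by (simp add: sum_distrib_left mult.assoc)
    qed
    have "(\<Sum>k<N. \<Sum>l<N. cnj z ^ k * z ^ l *
            (\<langle>\<lambda>u. \<phi> u * coeff_ker k ?t u, coeff_ker l ?t\<rangle> / of_real ((base_norm ?t)\<^sup>2)))
        = \<langle>\<lambda>u. \<phi> u * ?W u, ?W\<rangle> / of_real ((base_norm ?t)\<^sup>2)"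
      unfolding WW by (simp add: sum_divide_distrib)
    hence eq: "\<langle>\<lambda>u. \<phi> u * ?V u, ?V\<rangle> / of_real ((base_norm ?t)\<^sup>2)
        - (\<Sum>k<N. \<Sum>l<N. cnj z ^ k * z ^ l *
            (\<langle>\<lambda>u. \<phi> u * coeff_ker k ?t u, coeff_ker l ?t\<rangle> / of_real ((base_norm ?t)\<^sup>2)))
        = (\<langle>\<lambda>u. \<phi> u * ?V u, ?V\<rangle> - \<langle>\<lambda>u. \<phi> u * ?W u, ?W\<rangle>) / of_real ((base_norm ?t)\<^sup>2)"
      by (simp only: diff_divide_distrib)
    have split: "\<langle>\<lambda>u. \<phi> u * ?V u, ?V\<rangle> - \<langle>\<lambda>u. \<phi> u * ?W u, ?W\<rangle>
        = \<langle>\<lambda>u. \<phi> u * ?R u, ?V\<rangle> + \<langle>\<lambda>u. \<phi> u * ?W u, ?R\<rangle>"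
    proof -
      have "\<langle>\<lambda>u. \<phi> u * ?R u, ?V\<rangle> = \<langle>\<lambda>u. \<phi> u * ?V u, ?V\<rangle> - \<langle>\<lambda>u. \<phi> u * ?W u, ?V\<rangle>"
        unfolding right_diff_distrib by (intro inner_diff_left symbol_mult_L2 VL WL)
      moreover have "\<langle>\<lambda>u. \<phi> u * ?W u, ?R\<rangle> = \<langle>\<lambda>u. \<phi> u * ?W u, ?V\<rangle> - \<langle>\<lambda>u. \<phi> u * ?W u, ?W\<rangle>"
        by (intro inner_diff_right symbol_mult_L2 VL WL)
      ultimately show ?thesis by simp
    qed
    have phi: "\<parallel>\<lambda>u. \<phi> u * f u\<parallel> \<le> B\<phi> * \<parallel>f\<parallel>" if "f \<in> L2 \<Omega>" for f
      by (rule L2_norm_mult_bounded[OF that symbol_measurable B\<phi>_dom]) (use B\<phi>(1) in auto)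
    define \<rho> where "\<rho> = 4 * (2 / s) ^ N * norm z ^ N"
    have \<rho>0: "\<rho> \<ge> 0" using s by (simp add: \<rho>_def)
    have R: "\<parallel>?R\<parallel> \<le> \<rho> * base_norm ?t" unfolding \<rho>_def by (rule kernel_expansion[OF t z])
    have R4: "\<parallel>?R\<parallel> \<le> 4 * base_norm ?t"
    proof -
      have "(2 / s * norm z) ^ N \<le> 1" using z s by (intro power_le_one) (auto simp: field_simps)
      hence "\<rho> \<le> 4" unfolding \<rho>_def power_mult_distrib mult.assoc by linarith
      thus ?thesis using R n by (meson mult_right_mono less_imp_le order_trans)
    qed
    have V: "\<parallel>?V\<parallel> \<le> 4 * base_norm ?t" by (rule ker_at_norm[OF t z])
    have W: "\<parallel>?W\<parallel> \<le> 8 * base_norm ?t"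
      using norm_le_add_diff_L2[OF WL VL] norm_minus_commute_L2[of ?W ?V] V R4 by linarith
    have "norm (\<langle>\<lambda>u. \<phi> u * ?V u, ?V\<rangle> - \<langle>\<lambda>u. \<phi> u * ?W u, ?W\<rangle>)
        \<le> norm \<langle>\<lambda>u. \<phi> u * ?R u, ?V\<rangle> + norm \<langle>\<lambda>u. \<phi> u * ?W u, ?R\<rangle>"
      unfolding split by (rule norm_triangle_ineq)
    also have "\<dots> \<le> (B\<phi> * \<parallel>?R\<parallel>) * \<parallel>?V\<parallel> + (B\<phi> * \<parallel>?W\<parallel>) * \<parallel>?R\<parallel>"
      by (intro add_mono order_trans[OF cauchy_schwarz] mult_right_mono phi symbol_mult_L2 RL VL WL) auto
    also have "\<dots> \<le> (B\<phi> * (\<rho> * base_norm ?t)) * (4 * base_norm ?t) + (B\<phi> * (8 * base_norm ?t)) * (\<rho> * base_norm ?t)"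
      using B\<phi>(1) n \<rho>0 by (intro add_mono mult_mono R V W order_refl) (auto intro!: mult_nonneg_nonneg)
    also have "\<dots> = C * norm z ^ N * (base_norm ?t)\<^sup>2"
      by (simp add: C_def \<rho>_def power2_eq_square algebra_simps)
    finally have "norm (\<langle>\<lambda>u. \<phi> u * ?V u, ?V\<rangle> - \<langle>\<lambda>u. \<phi> u * ?W u, ?W\<rangle>) / (base_norm ?t)\<^sup>2 \<le> C * norm z ^ N"
      using n by (simp add: pos_divide_le_eq)
    thus "norm (\<langle>\<lambda>u. \<phi> u * ?V u, ?V\<rangle> / of_real ((base_norm ?t)\<^sup>2)
        - (\<Sum>k<N. \<Sum>l<N. cnj z ^ k * z ^ l *
            (\<langle>\<lambda>u. \<phi> u * coeff_ker k ?t u, coeff_ker l ?t\<rangle> / of_real ((base_norm ?t)\<^sup>2)))) \<le> C * norm z ^ N"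
      unfolding eq norm_divide norm_of_real by simp
  qed
next
  fix k l :: nat
  show "\<exists>M. \<forall>n. norm (\<langle>\<lambda>u. \<phi> u * coeff_ker k (\<tau> n) u, coeff_ker l (\<tau> n)\<rangle> / of_real ((base_norm (\<tau> n))\<^sup>2)) \<le> M"
  proof (intro exI[of _ "B\<phi> * norm_const k * norm_const l"] allI)
    fix n
    note t = \<tau>(1,2)[of n]
    have n: "base_norm (\<tau> n) > 0" by (rule base_norm_pos[OF t])
    have PL: "coeff_ker k (\<tau> n) \<in> L2 \<Omega>" for k by (intro A2D(1) coeff_ker_A2 t)
    have "norm \<langle>\<lambda>u. \<phi> u * coeff_ker k (\<tau> n) u, coeff_ker l (\<tau> n)\<rangle> \<le> \<parallel>\<lambda>u. \<phi> u * coeff_ker k (\<tau> n) u\<parallel> * \<parallel>coeff_ker l (\<tau> n)\<parallel>"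
      by (intro cauchy_schwarz symbol_mult_L2 PL)
    also have "\<dots> \<le> (B\<phi> * (norm_const k * base_norm (\<tau> n))) * (norm_const l * base_norm (\<tau> n))"
    proof (rule mult_mono)
      have "\<parallel>\<lambda>u. \<phi> u * coeff_ker k (\<tau> n) u\<parallel> \<le> B\<phi> * \<parallel>coeff_ker k (\<tau> n)\<parallel>"
        by (rule L2_norm_mult_bounded[OF PL symbol_measurable B\<phi>_dom]) (use B\<phi>(1) in auto)
      also have "\<dots> \<le> B\<phi> * (norm_const k * base_norm (\<tau> n))" using B\<phi>(1) coeff_ker_norm_le[OF t] by simp
      finally show "\<parallel>\<lambda>u. \<phi> u * coeff_ker k (\<tau> n) u\<parallel> \<le> B\<phi> * (norm_const k * base_norm (\<tau> n))" .
    qed (use coeff_ker_norm_le[OF t] B\<phi>(1) norm_const_pos[of k] n in auto)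
    also have "\<dots> = B\<phi> * norm_const k * norm_const l * (base_norm (\<tau> n))\<^sup>2" by (simp add: power2_eq_square mult_ac)
    finally show "norm (\<langle>\<lambda>u. \<phi> u * coeff_ker k (\<tau> n) u, coeff_ker l (\<tau> n)\<rangle> / of_real ((base_norm (\<tau> n))\<^sup>2)) \<le> B\<phi> * norm_const k * norm_const l"
      unfolding norm_divide norm_of_real using n by (simp add: pos_divide_le_eq)
  qed
next
  fix z :: complex assume z: "norm z \<le> s / 4"
  define x where "x n = vec2 i (of_real (\<tau> n) * p0) z" for n
  have x: "x n \<in> \<Omega>" for n unfolding x_def by (intro ker_at_dom \<tau> z)
  have "x \<longlonglongrightarrow> vec2 i (of_real 1 * p0) z"
    unfolding x_def by (intro tendsto_intros \<tau>)
  hence xl: "x \<longlonglongrightarrow> vec2 i p0 z" by simp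
  have "vec2 i p0 z \<in> frontier \<Omega>" using z s by (intro face_frontier) auto
  from tendsto_to_boundaryD[OF bz x xl this] have b: "(\<lambda>n. berezin \<Omega> T (x n)) \<longlonglongrightarrow> 0" .
  show "(\<lambda>n. \<langle>\<lambda>u. \<phi> u * ker_at (\<tau> n) z u, ker_at (\<tau> n) z\<rangle> / of_real ((base_norm (\<tau> n))\<^sup>2)) \<longlonglongrightarrow> 0"
  proof (rule Lim_null_comparison[OF always_eventually], rule allI)
    show "(\<lambda>n. 16 * norm (berezin \<Omega> T (x n))) \<longlonglongrightarrow> 0"
      using tendsto_mult_left[OF tendsto_norm[OF b], of 16] by simp
    fix n
    note t = \<tau>(1,2)[of n]
    let ?V = "ker_at (\<tau> n) z"
    have n: "base_norm (\<tau> n) > 0" by (rule base_norm_pos[OF t])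
    have vp: "\<parallel>?V\<parallel> > 0" by (intro ker_norm_pos ker_at_dom t z)
    have nk: "nk (x n) = (\<lambda>w. of_real (1 / \<parallel>?V\<parallel>) * ?V w)" using nk_eq[OF x[of n]] by (simp add: x_def)
    have "(\<lambda>w. \<phi> w * nk (x n) w) = (\<lambda>w. of_real (1 / \<parallel>?V\<parallel>) * (\<phi> w * ?V w))"
      by (simp add: nk mult_ac)
    hence "berezin \<Omega> T (x n) = of_real (1 / \<parallel>?V\<parallel>) * (of_real (1 / \<parallel>?V\<parallel>) * \<langle>\<lambda>w. \<phi> w * ?V w, ?V\<rangle>)"
      unfolding berezin_T[OF x] by (simp only: nk inner_scale_left inner_scale_right complex_cnj_complex_of_real) 
    hence "\<langle>\<lambda>w. \<phi> w * ?V w, ?V\<rangle> = berezin \<Omega> T (x n) * of_real (\<parallel>?V\<parallel>\<^sup>2)"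
      using vp by (simp add: power2_eq_square)
    hence "norm \<langle>\<lambda>w. \<phi> w * ?V w, ?V\<rangle> = norm (berezin \<Omega> T (x n)) * \<parallel>?V\<parallel>\<^sup>2"
      by (simp add: norm_mult norm_power)
    also have "\<dots> \<le> norm (berezin \<Omega> T (x n)) * (4 * base_norm (\<tau> n))\<^sup>2"
      using ker_at_norm[OF t z] by (intro mult_left_mono power_mono) auto
    also have "\<dots> = 16 * norm (berezin \<Omega> T (x n)) * (base_norm (\<tau> n))\<^sup>2" by (simp add: power_mult_distrib)
    finally show "norm (\<langle>\<lambda>u. \<phi> u * ?V u, ?V\<rangle> / of_real ((base_norm (\<tau> n))\<^sup>2)) \<le> 16 * norm (berezin \<Omega> T (x n))"
      unfolding norm_divide norm_of_real using n by (simp add: pos_divide_le_eq)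
  qed
qed

end

section \<open>The symbol on a disc face\<close>

context disc_face
begin

text \<open>
  A nonnegative weight on the disc of first coordinates that vanishes on its closure at
  \<open>p0\<close> only.
\<close>

definition face_wt :: "complex \<Rightarrow> real" where "face_wt a = Re (1 - a / p0)"

lemma face_wt_nonneg: "norm a < norm p0 \<Longrightarrow> face_wt a \<ge> 0"
proof -
  assume "norm a < norm p0"
  hence "norm (a / p0) \<le> 1" using p0 by (simp add: norm_divide)
  hence "Re (a / p0) \<le> 1" using complex_Re_le_cmod[of "a / p0"] by linarith
  thus ?thesis by (simp add: face_wt_def)
qed

lemma face_wt_borel [measurable]: "face_wt \<in> borel_measurable borel"
  unfolding face_wt_def by (rule borel_measurable_continuous_onI) (use p0 in \<open>auto intro!: continuous_intros\<close>)

lemma slice_cf_mult_first: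
  assumes f: "holo_on f \<Omega>" and a: "norm a < norm p0"
  shows "slice_cf k (\<lambda>u. g (u $ i) * f u) a = g a * slice_cf k f a"
proof -
  have "slice_cf k (\<lambda>u. g (u $ i) * f u) a = slice_cf k (\<lambda>u. g a * f u) a" by (simp add: slice_cf_def)
  also have "\<dots> = g a * slice_cf k f a" by (rule slice_cf_add_scale(2)[OF f f a])
  finally show ?thesis .
qed

text \<open>
  Multiplication by a function of the first coordinate multiplies the coefficient at the base
  point by its value there; for \<open>1 - u\<^sub>i / p0\<close> this value is \<open>1 -
  t\<close>. So the mass of \<open>P\<^sub>k\<close> concentrates over \<open>p0\<close>.
\<close>

lemma coeff_ker_concentration:
  assumes t: "0 \<le> t" "t < 1"
  shows "integrable dM (\<lambda>u. face_wt (u $ i) * (norm (coeff_ker k t u))\<^sup>2)"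
    and "(LINT u|dM. face_wt (u $ i) * (norm (coeff_ker k t u))\<^sup>2) = (1 - t) * \<parallel>coeff_ker k t\<parallel>\<^sup>2"
proof -
  let ?P = "coeff_ker k t" and ?q = "\<lambda>u :: complex ^ 2. 1 - u $ i * (1 / p0)"
  have PA: "?P \<in> A2" by (rule coeff_ker_A2[OF t])
  have hq: "holo_on ?q \<Omega>"
    by (intro holo_on_diff holo_on_mult holo_on_const holo_on_coord)
  have bq: "norm (?q u) \<le> 2" if "u \<in> \<Omega>" for u
  proof -
    have "norm (u $ i * (1 / p0)) \<le> 1" using first_strict[OF that] p0 by (simp add: norm_divide)
    thus ?thesis using norm_triangle_ineq4[of 1 "u $ i * (1 / p0)"] by simp
  qed
  have qP: "(\<lambda>u. ?q u * ?P u) \<in> A2" by (rule A2_mult_bounded[OF PA hq bq])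
  have int: "integrable dM (\<lambda>u. (?q u * ?P u) * cnj (?P u))"
    by (intro L2_prod_integrable A2D(1) qP PA)
  have eq: "Re ((?q u * ?P u) * cnj (?P u)) = face_wt (u $ i) * (norm (?P u))\<^sup>2" for u
  proof -
    have "(?q u * ?P u) * cnj (?P u) = ?q u * of_real ((norm (?P u))\<^sup>2)"
      by (simp only: mult.assoc complex_norm_square)
    thus ?thesis by (simp only:) (simp add: face_wt_def del: of_real_power)
  qed
  show "integrable dM (\<lambda>u. face_wt (u $ i) * (norm (?P u))\<^sup>2)"
    using integrable_Re[OF int] by (simp only: eq)
  have "(LINT u|dM. face_wt (u $ i) * (norm (?P u))\<^sup>2) = Re \<langle>\<lambda>u. ?q u * ?P u, ?P\<rangle>"
    unfolding L2_inner_eq by (subst integral_Re[OF int, symmetric]) (simp only: eq)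
  also have "\<langle>\<lambda>u. ?q u * ?P u, ?P\<rangle> = slice_cf k (\<lambda>u. ?q u * ?P u) (of_real t * p0)" by (rule coeff_ker_inner[OF t qP])
  also have "\<dots> = (1 - of_real t) * of_real (\<parallel>?P\<parallel>\<^sup>2)"
    using p0 slice_cf_mult_first[OF A2D(2)[OF PA] tp0[OF t], of k "\<lambda>a. 1 - a * (1 / p0)"]
    by (simp add: coeff_ker_self[OF t] del: of_real_power)
  finally show "(LINT u|dM. face_wt (u $ i) * (norm (?P u))\<^sup>2) = (1 - t) * \<parallel>?P\<parallel>\<^sup>2"
    by (simp del: of_real_power)
qed

abbreviation slice_area :: "complex \<Rightarrow> ennreal" where
  "slice_area a \<equiv> (\<integral>\<^sup>+b. indicator \<Omega> (vec2 i a b) \<partial>lborel)"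

lemma slice_area_ge:
  assumes "norm a < norm p0"
  shows "emeasure lborel (ball (0 :: complex) s) \<le> slice_area a"
proof -
  have "emeasure lborel (ball (0 :: complex) s) = (\<integral>\<^sup>+b. indicator (ball (0 :: complex) s) b \<partial>lborel)" by simp
  also have "\<dots> \<le> slice_area a"
    using assms by (intro nn_integral_mono) (auto simp: indicator_def intro!: bidisc)
  finally show ?thesis .
qed

text \<open>
  The integrals of \<open>\<Phi>\<close> over the slices tend to the integral over the face as
  the base point tends to \<open>p0\<close>, by dominated convergence: the slices converge to
  the disc off its bounding circle, which is a null set. Away from \<open>p0\<close> the weight
  is bounded below. A sequence violating the bound for \<open>C = n\<close> would have to
  converge to \<open>p0\<close>.
\<close>

proposition slice_integral_estimate:
  fixes \<Phi> :: "complex ^ 2 \<Rightarrow> complex"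
  assumes \<Phi>: "continuous_on (closure \<Omega>) \<Phi>"
    and zero: "(LINT b|restrict_space lborel (ball 0 s). \<Phi> (vec2 i p0 b)) = 0" and \<epsilon>: "\<epsilon> > 0"
  shows "\<exists>C\<ge>0. \<forall>a. ennreal (norm (LINT b|lborel. indicator \<Omega> (vec2 i a b) *\<^sub>R \<Phi> (vec2 i a b)))
            \<le> ennreal (\<epsilon> + C * face_wt a) * slice_area a"
proof (rule ccontr)
  define \<psi> where "\<psi> a = (LINT b|lborel. indicator \<Omega> (vec2 i a b) *\<^sub>R \<Phi> (vec2 i a b))" for a
  assume neg: "\<not> ?thesis"
  have "\<exists>a. ennreal (\<epsilon> + real n * face_wt a) * slice_area a < ennreal (norm (\<psi> a))" for n :: nat
    using neg unfolding \<psi>_def not_le[symmetric] by (meson of_nat_0_le_iff)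
  then obtain a where a: "\<And>n. ennreal (\<epsilon> + real n * face_wt (a n)) * slice_area (a n) < ennreal (norm (\<psi> (a n)))"
    by metis
  obtain Q where Q: "Q > 0" "\<And>u. u \<in> \<Omega> \<Longrightarrow> norm (\<Phi> u) \<le> Q"
    by (rule holo_bounded_on_dom[OF \<Phi>], rule that)
  have \<Phi>m: "(\<lambda>u. indicator \<Omega> u *\<^sub>R \<Phi> u) \<in> borel_measurable borel"
    by (intro borel_measurable_continuous_on_indicator continuous_on_subset[OF \<Phi>] closure_subset dom_sets)
  have sm: "(\<lambda>b. indicator \<Omega> (vec2 i a b) *\<^sub>R \<Phi> (vec2 i a b)) \<in> borel_measurable borel" for a
    by (rule measurable_compose[OF vec2_measurable_snd \<Phi>m])
  have lt: "norm (a n) < norm p0" for n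
  proof (rule ccontr)
    assume "\<not> norm (a n) < norm p0"
    hence "vec2 i (a n) b \<notin> \<Omega>" for b using first_strict[of "vec2 i (a n) b"] by auto
    hence "\<psi> (a n) = 0" by (simp add: \<psi>_def)
    thus False using a[of n] by simp
  qed
  have le: "ennreal (norm (\<psi> a)) \<le> ennreal Q * slice_area a" for a
  proof (cases "integrable lborel (\<lambda>b. indicator \<Omega> (vec2 i a b) *\<^sub>R \<Phi> (vec2 i a b))")
    case True
    have "ennreal (norm (\<psi> a)) \<le> (\<integral>\<^sup>+b. norm (indicator \<Omega> (vec2 i a b) *\<^sub>R \<Phi> (vec2 i a b)) \<partial>lborel)"
      unfolding \<psi>_def by (rule integral_norm_bound_ennreal[OF True])
    also have "\<dots> \<le> (\<integral>\<^sup>+b. ennreal Q * indicator \<Omega> (vec2 i a b) \<partial>lborel)"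
      by (intro nn_integral_mono) (auto simp: indicator_def intro!: ennreal_leI Q)
    also have "\<dots> = ennreal Q * slice_area a" by (rule nn_integral_cmult) measurable
    finally show ?thesis .
  qed (simp add: \<psi>_def not_integrable_integral_eq)
  have wn: "real n * face_wt (a n) \<le> Q" for n
  proof (rule ccontr)
    assume "\<not> real n * face_wt (a n) \<le> Q"
    hence "ennreal Q \<le> ennreal (\<epsilon> + real n * face_wt (a n))" using \<epsilon> by (intro ennreal_leI) simp
    hence "ennreal Q * slice_area (a n) \<le> ennreal (\<epsilon> + real n * face_wt (a n)) * slice_area (a n)"
      by (rule mult_right_mono) simp
    with le[of "a n"] a[of n] show False by (meson leD order_trans)
  qed
  have wl: "(\<lambda>n. face_wt (a n)) \<longlonglongrightarrow> 0"
  proof (rule Lim_null_comparison)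
    show "\<forall>\<^sub>F n in sequentially. norm (face_wt (a n)) \<le> Q / real n"
      using eventually_gt_at_top[of 0]
    proof eventually_elim
      case (elim n)
      thus ?case using wn[of n] face_wt_nonneg[OF lt[of n]] by (simp add: field_simps)
    qed
    show "(\<lambda>n. Q / real n) \<longlonglongrightarrow> 0" by (rule lim_const_over_n)
  qed
  have al: "a \<longlonglongrightarrow> p0"
  proof -
    have "(\<lambda>n. (norm (a n / p0 - 1))\<^sup>2) \<longlonglongrightarrow> 0"
    proof (rule Lim_null_comparison[OF always_eventually], rule allI)
      show "(\<lambda>n. 2 * face_wt (a n)) \<longlonglongrightarrow> 0" using tendsto_mult_left[OF wl, of 2] by simp
      fix n
      define c where "c = a n / p0"
      have "norm c \<le> 1" using lt[of n] p0 by (simp add: c_def norm_divide)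
      hence "(norm c)\<^sup>2 \<le> 1" by (simp add: power_le_one)
      hence "(norm (c - 1))\<^sup>2 \<le> 2 * (1 - Re c)" unfolding cmod_power2 by (simp add: power2_eq_square algebra_simps)
      thus "norm ((norm (a n / p0 - 1))\<^sup>2) \<le> 2 * face_wt (a n)" by (simp add: c_def face_wt_def)
    qed
    from tendsto_real_sqrt[OF this] have "(\<lambda>n. norm (a n / p0 - 1)) \<longlonglongrightarrow> 0" by simp
    hence "(\<lambda>n. a n / p0 - 1) \<longlonglongrightarrow> 0" by (simp add: tendsto_norm_zero_iff)
    hence "(\<lambda>n. a n / p0) \<longlonglongrightarrow> 1" by (simp add: LIM_zero_iff)
    from tendsto_mult_right[OF this, of p0] show ?thesis using p0 by simp
  qed
  have \<psi>l: "(\<lambda>n. \<psi> (a n)) \<longlonglongrightarrow> (LINT b|lborel. indicator (ball 0 s) b *\<^sub>R \<Phi> (vec2 i p0 b))"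
    unfolding \<psi>_def
  proof (rule integral_dominated_convergence[where w = "\<lambda>b. Q * indicator (cball 0 S) b"])
    show "(\<lambda>b. indicator (ball 0 s) b *\<^sub>R \<Phi> (vec2 i p0 b)) \<in> borel_measurable lborel"
    proof -
      have "continuous_on (ball 0 s) (\<lambda>b. \<Phi> (vec2 i p0 b))"
        by (rule continuous_on_compose2[OF \<Phi>]) (auto intro!: continuous_intros simp: slice)
      thus ?thesis by (simp add: borel_measurable_continuous_on_indicator)
    qed
    show "(\<lambda>b. indicator \<Omega> (vec2 i (a n) b) *\<^sub>R \<Phi> (vec2 i (a n) b)) \<in> borel_measurable lborel" for n
      using sm by simp
    show "integrable lborel (\<lambda>b. Q * indicator (cball (0 :: complex) S) b)"
      using emeasure_lborel_cball_finite[of "0 :: complex" S]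
      by (intro integrable_mult_right integrable_real_indicator) auto
    show "AE b in lborel. norm (indicator \<Omega> (vec2 i (a n) b) *\<^sub>R \<Phi> (vec2 i (a n) b)) \<le> Q * indicator (cball 0 S) b" for n
    proof (rule AE_I2)
      fix b
      show "norm (indicator \<Omega> (vec2 i (a n) b) *\<^sub>R \<Phi> (vec2 i (a n) b)) \<le> Q * indicator (cball 0 S) b"
        using Q second_bound_dom[of "vec2 i (a n) b"]
        by (cases "vec2 i (a n) b \<in> \<Omega>") (auto simp: indicator_def)
    qed
    have "negligible (sphere (0 :: complex) s)"
      using negligible_convex_frontier[of "ball (0 :: complex) s"] s by (simp add: frontier_ball)
    hence "sphere (0 :: complex) s \<in> null_sets lborel"
      by (simp add: negligible_iff_null_sets null_sets_completion_iff)
    hence "AE b in lborel. b \<notin> sphere (0 :: complex) s" by (rule AE_not_in)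
    thus "AE b in lborel. (\<lambda>n. indicator \<Omega> (vec2 i (a n) b) *\<^sub>R \<Phi> (vec2 i (a n) b))
        \<longlonglongrightarrow> indicator (ball 0 s) b *\<^sub>R \<Phi> (vec2 i p0 b)"
    proof (rule eventually_mono)
      fix b :: complex assume "b \<notin> sphere 0 s"
      hence nb: "norm b \<noteq> s" by simp
      have vl: "(\<lambda>n. vec2 i (a n) b) \<longlonglongrightarrow> vec2 i p0 b" by (intro tendsto_intros al)
      show "(\<lambda>n. indicator \<Omega> (vec2 i (a n) b) *\<^sub>R \<Phi> (vec2 i (a n) b))
        \<longlonglongrightarrow> indicator (ball 0 s) b *\<^sub>R \<Phi> (vec2 i p0 b)"
      proof (cases "norm b < s")
        case True
        have vo: "vec2 i (a n) b \<in> \<Omega>" for n by (rule bidisc[OF lt True])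
        have "(\<lambda>n. \<Phi> (vec2 i (a n) b)) \<longlonglongrightarrow> \<Phi> (vec2 i p0 b)"
          by (rule continuous_on_tendsto_compose[OF \<Phi> vl])
             (use True vo closure_subset in \<open>auto simp: slice intro!: always_eventually\<close>)
        thus ?thesis using True vo by simp
      next
        case False
        hence "vec2 i p0 b \<in> - closure \<Omega>" using nb slice[of b] by simp
        hence "\<forall>\<^sub>F n in sequentially. vec2 i (a n) b \<in> - closure \<Omega>"
          by (rule topological_tendstoD[OF vl open_Compl[OF closed_closure]])
        hence "\<forall>\<^sub>F n in sequentially. indicator \<Omega> (vec2 i (a n) b) *\<^sub>R \<Phi> (vec2 i (a n) b) = 0"
          by (rule eventually_mono) (use closure_subset in \<open>auto simp: indicator_def\<close>)
        thus ?thesis using False by (simp add: tendsto_eventually)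
      qed
    qed
  qed
  also have "(LINT b|lborel. indicator (ball 0 s) b *\<^sub>R \<Phi> (vec2 i p0 b)) = 0"
    using zero by (subst (asm) integral_restrict_space) auto
  finally have "(\<lambda>n. norm (\<psi> (a n))) \<longlonglongrightarrow> 0" by (simp add: tendsto_norm_zero)
  define \<sigma> where "\<sigma> = measure lborel (ball (0 :: complex) s)"
  have \<sigma>: "emeasure lborel (ball (0 :: complex) s) = ennreal \<sigma>" "\<sigma> > 0"
  proof -
    show "emeasure lborel (ball (0 :: complex) s) = ennreal \<sigma>"
      unfolding \<sigma>_def by (rule emeasure_eq_ennreal_measure)
        (use emeasure_lborel_ball_finite[of "0 :: complex" s] in auto)
    show "\<sigma> > 0" using s content_ball_pos[of s "0 :: complex"] by (simp add: \<sigma>_def)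
  qed
  have "\<epsilon> * \<sigma> \<le> norm (\<psi> (a n))" for n
  proof -
    have "ennreal (\<epsilon> * \<sigma>) = ennreal \<epsilon> * emeasure lborel (ball (0 :: complex) s)"
      using \<epsilon> \<sigma> by (simp add: ennreal_mult)
    also have "\<dots> \<le> ennreal (\<epsilon> + real n * face_wt (a n)) * slice_area (a n)"
      using face_wt_nonneg[OF lt[of n]] by (intro mult_mono slice_area_ge[OF lt] ennreal_leI) auto
    also have "\<dots> \<le> ennreal (norm (\<psi> (a n)))" using a[of n] by simp
    finally show ?thesis by (subst (asm) ennreal_le_iff) auto
  qed
  hence "\<epsilon> * \<sigma> \<le> 0"
    using \<open>(\<lambda>n. norm (\<psi> (a n))) \<longlonglongrightarrow> 0\<close> by (intro LIMSEQ_le_const) auto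
  thus False using \<epsilon> \<sigma> by (simp add: mult_le_0_iff)
qed

definition pair_const :: "nat \<Rightarrow> nat \<Rightarrow> real" where
  "pair_const k l = area_const k * (norm_const k)\<^sup>2 + area_const l * (norm_const l)\<^sup>2"

lemma weighted_coefficient_bound:
  assumes t: "0 \<le> t" "t < 1" and \<epsilon>: "\<epsilon> > 0" and C: "C \<ge> 0"
  shows "(\<integral>\<^sup>+u. ennreal ((\<epsilon> + C * face_wt (u $ i)) * (norm (slice_cf k (coeff_ker k t) (u $ i)))\<^sup>2) \<partial>dM)
     \<le> ennreal (area_const k * (norm_const k)\<^sup>2 * ((\<epsilon> + C * (1 - t)) * (base_norm t)\<^sup>2))"
proof -
  have PA: "coeff_ker k t \<in> A2" by (rule coeff_ker_A2[OF t])
  have iP: "integrable dM (\<lambda>u. (norm (coeff_ker k t u))\<^sup>2)" using A2D(1)[OF PA] by (simp add: L2_iff)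
  have "(\<integral>\<^sup>+u. ennreal ((\<epsilon> + C * face_wt (u $ i)) * (norm (slice_cf k (coeff_ker k t) (u $ i)))\<^sup>2) \<partial>dM)
      \<le> ennreal (area_const k) * (\<integral>\<^sup>+u. ennreal ((\<epsilon> + C * face_wt (u $ i)) * (norm (hom_part k (coeff_ker k t) u))\<^sup>2) \<partial>dM)"
    by (rule slice_cf_weighted[OF PA, where w = "\<lambda>a. \<epsilon> + C * face_wt a"]) measurable
  also have "(\<integral>\<^sup>+u. ennreal ((\<epsilon> + C * face_wt (u $ i)) * (norm (hom_part k (coeff_ker k t) u))\<^sup>2) \<partial>dM)
      = (\<integral>\<^sup>+u. ennreal (\<epsilon> * (norm (coeff_ker k t u))\<^sup>2 + C * (face_wt (u $ i) * (norm (coeff_ker k t u))\<^sup>2)) \<partial>dM)"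
    unfolding hom_part_coeff_ker[OF t] by (intro nn_integral_cong arg_cong[where f = ennreal]) (simp add: algebra_simps)
  also have "\<dots> = ennreal (LINT u|dM. \<epsilon> * (norm (coeff_ker k t u))\<^sup>2 + C * (face_wt (u $ i) * (norm (coeff_ker k t u))\<^sup>2))"
    using iP coeff_ker_concentration(1)[OF t] \<epsilon> C
    by (intro nn_integral_eq_integral) (auto intro!: AE_I2 add_nonneg_nonneg mult_nonneg_nonneg face_wt_nonneg first_strict)
  also have "(LINT u|dM. \<epsilon> * (norm (coeff_ker k t u))\<^sup>2 + C * (face_wt (u $ i) * (norm (coeff_ker k t u))\<^sup>2))
      = (\<epsilon> + C * (1 - t)) * \<parallel>coeff_ker k t\<parallel>\<^sup>2"
    using iP coeff_ker_concentration(1)[OF t]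
    by (simp add: coeff_ker_concentration(2)[OF t] L2_norm_sq[symmetric] algebra_simps)
  also have "ennreal (area_const k) * ennreal ((\<epsilon> + C * (1 - t)) * \<parallel>coeff_ker k t\<parallel>\<^sup>2)
      = ennreal (area_const k * ((\<epsilon> + C * (1 - t)) * \<parallel>coeff_ker k t\<parallel>\<^sup>2))"
    using area_const_pos[of k] \<epsilon> C t by (simp add: ennreal_mult)
  also have "\<dots> \<le> ennreal (area_const k * ((\<epsilon> + C * (1 - t)) * (norm_const k * base_norm t)\<^sup>2))"
    using area_const_pos[of k] \<epsilon> C t coeff_ker_norm_le[OF t]
    by (intro ennreal_leI mult_left_mono power_mono) auto
  also have "area_const k * ((\<epsilon> + C * (1 - t)) * (norm_const k * base_norm t)\<^sup>2) = area_const k * (norm_const k)\<^sup>2 * ((\<epsilon> + C * (1 - t)) * (base_norm t)\<^sup>2)"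
    by (simp add: power_mult_distrib mult_ac)
  finally show ?thesis .
qed

text \<open>
  Integrate over the slices first. The slice integrals of \<open>\<Phi>\<close> are controlled
  by \<open>slice_integral_estimate\<close>, and the functions of the first coordinate that
  remain by \<open>weighted_coefficient_bound\<close>, where the weight contributes the factor
  \<open>1 - t\<close>.
\<close>

proposition face_form_estimate:
  fixes \<Phi> :: "complex ^ 2 \<Rightarrow> complex"
  assumes \<Phi>: "continuous_on (closure \<Omega>) \<Phi>"
    and zero: "(LINT b|restrict_space lborel (ball 0 s). \<Phi> (vec2 i p0 b)) = 0" and \<epsilon>: "\<epsilon> > 0"
  shows "\<exists>C\<ge>0. \<forall>t. 0 \<le> t \<longrightarrow> t < 1 \<longrightarrow>
     norm (LINT u|dM. \<Phi> u * (slice_cf k (coeff_ker k t) (u $ i) * cnj (slice_cf l (coeff_ker l t) (u $ i))))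
       \<le> pair_const k l * ((\<epsilon> + C * (1 - t)) * (base_norm t)\<^sup>2)"
proof -
  obtain C where C: "C \<ge> 0" "\<And>a. ennreal (norm (LINT b|lborel. indicator \<Omega> (vec2 i a b) *\<^sub>R \<Phi> (vec2 i a b)))
            \<le> ennreal (\<epsilon> + C * face_wt a) * slice_area a"
    using slice_integral_estimate[OF \<Phi> zero \<epsilon>] by blast
  obtain Q where Q: "Q > 0" "\<And>u. u \<in> \<Omega> \<Longrightarrow> norm (\<Phi> u) \<le> Q"
    by (rule holo_bounded_on_dom[OF \<Phi>], rule that)
  have bound: "norm (LINT u|dM. \<Phi> u * (slice_cf k (coeff_ker k t) (u $ i) * cnj (slice_cf l (coeff_ker l t) (u $ i))))
       \<le> pair_const k l * ((\<epsilon> + C * (1 - t)) * (base_norm t)\<^sup>2)" if t: "0 \<le> t" "t < 1" for t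
  proof -
    let ?G = "slice_cf k (coeff_ker k t)" and ?L = "slice_cf l (coeff_ker l t)"
    define g h where "g a = indicator (ball 0 (norm p0)) a *\<^sub>R ?G a"
      and "h a = indicator (ball 0 (norm p0)) a *\<^sub>R ?L a" for a
    have gm [measurable]: "g \<in> borel_measurable borel" "h \<in> borel_measurable borel"
      unfolding g_def h_def
      by (intro borel_measurable_continuous_on_indicator slice_cf_continuous A2D(2) coeff_ker_A2 t; simp)+
    have g: "g (u $ i) = ?G (u $ i)" "h (u $ i) = ?L (u $ i)" if "u \<in> \<Omega>" for u
      using first_strict[OF that] by (simp_all add: g_def h_def)
    have m1 [measurable]: "(\<lambda>u :: complex ^ 2. u $ n) \<in> borel_measurable borel" for n
      by (rule borel_measurable_continuous_onI) (intro continuous_intros)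
    have \<Phi>m [measurable]: "(\<lambda>u. indicator \<Omega> u *\<^sub>R \<Phi> u) \<in> borel_measurable borel"
      by (intro borel_measurable_continuous_on_indicator continuous_on_subset[OF \<Phi>] closure_subset dom_sets)
    define H where "H u = (indicator \<Omega> u *\<^sub>R \<Phi> u) * (g (u $ i) * cnj (h (u $ i)))" for u
    have Hm [measurable]: "H \<in> borel_measurable borel" unfolding H_def by measurable
    let ?F = "\<lambda>u. \<Phi> u * (?G (u $ i) * cnj (?L (u $ i)))"
    have HF: "indicator \<Omega> u *\<^sub>R ?F u = H u" for u
      by (cases "u \<in> \<Omega>") (simp_all add: H_def g)
    have GL: "(\<lambda>u. ?G (u $ i)) \<in> L2 \<Omega>" "(\<lambda>u. ?L (u $ i)) \<in> L2 \<Omega>"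
      by (intro slice_cf_L2 coeff_ker_A2 t)+
    have "(\<lambda>u. \<Phi> u * ?G (u $ i)) \<in> L2 \<Omega>"
      by (rule L2_mult_bounded[OF GL(1) _ Q(2)])
         (intro measurable_of_continuous continuous_on_subset[OF \<Phi>] closure_subset)
    from L2_prod_integrable[OF this GL(2)] have "integrable dM ?F" by (simp add: mult.assoc)
    hence "integrable lebesgue (\<lambda>u. indicator \<Omega> u *\<^sub>R ?F u)"
      by (subst (asm) integrable_restrict_space) auto
    hence Hi: "integrable lborel H" unfolding HF by (simp add: integrable_completion)
    have "(LINT u|dM. ?F u) = (LINT u|lebesgue. indicator \<Omega> u *\<^sub>R ?F u)"
      by (subst integral_restrict_space) auto
    also have "\<dots> = (LINT u|lborel. H u)" unfolding HF by (rule integral_completion) simp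
    finally have FH: "(LINT u|dM. ?F u) = (LINT u|lborel. H u)" .
    define \<psi> where "\<psi> a = (LINT b|lborel. indicator \<Omega> (vec2 i a b) *\<^sub>R \<Phi> (vec2 i a b))" for a
    have inner: "(LINT b|lborel. H (vec2 i a b)) = \<psi> a * (g a * cnj (h a))" for a
      by (simp only: H_def \<psi>_def vec2_nth(1) integral_mult_left_zero)
    have "ennreal (norm (LINT u|dM. ?F u)) \<le> (\<integral>\<^sup>+a. norm (LINT b|lborel. H (vec2 i a b)) \<partial>lborel)"
      unfolding FH integral_slices[OF ij Hm Hi]
      by (rule integral_norm_bound_ennreal[OF integrable_slices[OF ij Hm Hi]])
    also have "\<dots> \<le> (\<integral>\<^sup>+a. (\<integral>\<^sup>+b. ennreal ((\<epsilon> + C * face_wt a) * ((norm (g a))\<^sup>2 + (norm (h a))\<^sup>2))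
        * indicator \<Omega> (vec2 i a b) \<partial>lborel) \<partial>lborel)"
    proof (rule nn_integral_mono)
      fix a
      define x where "x = norm (g a) * norm (h a)"
      define y where "y = (norm (g a))\<^sup>2 + (norm (h a))\<^sup>2"
      define v where "v = \<epsilon> + C * face_wt a"
      have x0: "x \<ge> 0" by (simp add: x_def)
      have "0 \<le> (norm (g a) - norm (h a))\<^sup>2 + (norm (g a))\<^sup>2 + (norm (h a))\<^sup>2" by simp
      hence xy: "x \<le> y" by (simp add: x_def y_def power2_eq_square algebra_simps)
      have vxy: "ennreal v * ennreal x \<le> ennreal (v * y)"
      proof (cases "v \<ge> 0")
        case True
        have "ennreal v * ennreal x = ennreal (v * x)" using True x0 by (simp add: ennreal_mult)
        also have "\<dots> \<le> ennreal (v * y)" using True xy by (intro ennreal_leI mult_left_mono)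
        finally show ?thesis .
      qed (simp add: ennreal_neg)
      have "ennreal (norm (LINT b|lborel. H (vec2 i a b))) = ennreal (norm (\<psi> a)) * ennreal x"
        unfolding inner by (simp add: norm_mult x_def ennreal_mult mult_ac)
      also have "\<dots> \<le> (ennreal v * slice_area a) * ennreal x"
        using C(2)[of a] unfolding \<psi>_def[symmetric] v_def by (rule mult_right_mono) simp
      also have "\<dots> = (ennreal v * ennreal x) * slice_area a" by (simp add: mult_ac)
      also have "\<dots> \<le> ennreal (v * y) * slice_area a" by (rule mult_right_mono[OF vxy]) simp
      also have "\<dots> = (\<integral>\<^sup>+b. ennreal (v * y) * indicator \<Omega> (vec2 i a b) \<partial>lborel)"
        by (rule nn_integral_cmult[symmetric]) measurable
      finally show "ennreal (norm (LINT b|lborel. H (vec2 i a b))) \<le> (\<integral>\<^sup>+b. ennreal ((\<epsilon> + C * face_wt a) * ((norm (g a))\<^sup>2 + (norm (h a))\<^sup>2))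
        * indicator \<Omega> (vec2 i a b) \<partial>lborel)" unfolding v_def y_def .
    qed
    also have "\<dots> = (\<integral>\<^sup>+u. ennreal ((\<epsilon> + C * face_wt (u $ i)) * ((norm (g (u $ i)))\<^sup>2 + (norm (h (u $ i)))\<^sup>2))
        * indicator \<Omega> u \<partial>lborel)"
    proof -
      have "(\<lambda>u. ennreal ((\<epsilon> + C * face_wt (u $ i)) * ((norm (g (u $ i)))\<^sup>2 + (norm (h (u $ i)))\<^sup>2))
        * indicator \<Omega> u) \<in> borel_measurable borel" by measurable
      from nn_integral_slices[OF ij this] show ?thesis by simp
    qed
    also have "\<dots> = (\<integral>\<^sup>+u. ennreal ((\<epsilon> + C * face_wt (u $ i)) * ((norm (g (u $ i)))\<^sup>2 + (norm (h (u $ i)))\<^sup>2)) \<partial>dM)"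
      by (rule nn_integral_dM[symmetric]) measurable
    also have "\<dots> = (\<integral>\<^sup>+u. ennreal ((\<epsilon> + C * face_wt (u $ i)) * (norm (?G (u $ i)))\<^sup>2)
        + ennreal ((\<epsilon> + C * face_wt (u $ i)) * (norm (?L (u $ i)))\<^sup>2) \<partial>dM)"
    proof (rule nn_integral_cong)
      fix u assume "u \<in> space dM"
      hence u: "u \<in> \<Omega>" by simp
      have "\<epsilon> + C * face_wt (u $ i) \<ge> 0"
        using \<epsilon> C(1) face_wt_nonneg[OF first_strict[OF u]] by simp
      thus "ennreal ((\<epsilon> + C * face_wt (u $ i)) * ((norm (g (u $ i)))\<^sup>2 + (norm (h (u $ i)))\<^sup>2))
        = ennreal ((\<epsilon> + C * face_wt (u $ i)) * (norm (?G (u $ i)))\<^sup>2)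
        + ennreal ((\<epsilon> + C * face_wt (u $ i)) * (norm (?L (u $ i)))\<^sup>2)"
        by (simp add: g[OF u] distrib_left ennreal_plus)
    qed
    also have "\<dots> = (\<integral>\<^sup>+u. ennreal ((\<epsilon> + C * face_wt (u $ i)) * (norm (?G (u $ i)))\<^sup>2) \<partial>dM)
        + (\<integral>\<^sup>+u. ennreal ((\<epsilon> + C * face_wt (u $ i)) * (norm (?L (u $ i)))\<^sup>2) \<partial>dM)"
    proof (rule nn_integral_add)
      have [measurable]: "(\<lambda>u. ?G (u $ i)) \<in> borel_measurable dM" "(\<lambda>u. ?L (u $ i)) \<in> borel_measurable dM"
        using GL by (simp_all add: L2_iff)
      have [measurable]: "(\<lambda>u. face_wt (u $ i)) \<in> borel_measurable dM"
        unfolding face_wt_def using p0 by (intro measurable_of_continuous continuous_intros) auto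
      show "(\<lambda>u. ennreal ((\<epsilon> + C * face_wt (u $ i)) * (norm (?G (u $ i)))\<^sup>2)) \<in> borel_measurable dM" by measurable
      show "(\<lambda>u. ennreal ((\<epsilon> + C * face_wt (u $ i)) * (norm (?L (u $ i)))\<^sup>2)) \<in> borel_measurable dM" by measurable
    qed
    also have "\<dots> \<le> ennreal (area_const k * (norm_const k)\<^sup>2 * ((\<epsilon> + C * (1 - t)) * (base_norm t)\<^sup>2))
        + ennreal (area_const l * (norm_const l)\<^sup>2 * ((\<epsilon> + C * (1 - t)) * (base_norm t)\<^sup>2))"
      by (intro add_mono weighted_coefficient_bound t \<epsilon> C(1))
    also have "\<dots> = ennreal (pair_const k l * ((\<epsilon> + C * (1 - t)) * (base_norm t)\<^sup>2))"
      using area_const_pos[of k] area_const_pos[of l] \<epsilon> C(1) t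
      by (subst ennreal_plus[symmetric]) (auto simp: pair_const_def distrib_right intro!: mult_nonneg_nonneg)
    finally show ?thesis
      using area_const_pos[of k] area_const_pos[of l] \<epsilon> C(1) t
      by (subst (asm) ennreal_le_iff) (auto simp: pair_const_def intro!: mult_nonneg_nonneg add_nonneg_nonneg)
  qed
  show ?thesis using C(1) bound by blast
qed

text \<open>
  Let \<open>\<kappa>\<close> be the quotient of the moment of \<open>\<phi>\<close> in question
  by the moment of \<open>|b|\<^sup>2\<^sup>l\<close>. Subtracting \<open>\<kappa>
  |u\<^sub>j|\<^sup>2\<^sup>l\<close> makes the integral over the face vanish, and its
  contribution to the form is exactly \<open>\<kappa>
  \<parallel>P\<^sub>k\<parallel>\<^sup>2\<close> by the coefficient functional. The estimate
  and the vanishing of the coefficients force \<open>\<kappa> = 0\<close>, because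
  \<open>\<parallel>P\<^sub>k\<parallel>\<close> is comparable with the norm of the kernel at
  the base point.
\<close>

theorem symbol_zero_on_open_face:
  assumes bz: "(berezin \<Omega> T \<longlongrightarrow> 0) (to_boundary \<Omega>)" and b: "norm b < s"
  shows "\<phi> (vec2 i p0 b) = 0"
proof (rule vanishing_moments_imp_zero[where g = "\<lambda>b. \<phi> (vec2 i p0 b)" and s = s])
  show "continuous_on (cball 0 s) (\<lambda>b. \<phi> (vec2 i p0 b))"
    by (rule continuous_on_compose2[OF cont]) (auto intro!: continuous_intros simp: slice)
  show "b \<in> ball 0 s" using b by simp
  fix k l
  let ?M = "restrict_space lborel (ball (0 :: complex) s)"
  define \<psi>0 where "\<psi>0 = (LINT b|?M. \<phi> (vec2 i p0 b) * (b ^ k * cnj b ^ l))"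
  define \<omega>0 where "\<omega>0 = (LINT b|?M. norm b ^ (2 * l))"
  note int = integrable_on_disc
  have \<omega>0: "\<omega>0 \<noteq> 0"
  proof
    assume "\<omega>0 = 0"
    hence z: "(LINT b|?M. norm b ^ (2 * l)) = 0" by (simp add: \<omega>0_def)
    have "norm (of_real (s / 2) :: complex) ^ (2 * l) = 0"
      by (rule continuous_zero_of_null_integral[OF _ _ _ z])
         (use s in \<open>auto intro!: int continuous_intros simp del: of_real_divide\<close>)
    thus False using s by (simp del: of_real_divide)
  qed
  \<comment> \<open>chosen so that the integral of \<open>\<Phi>\<close> over the face vanishes\<close>
  define \<kappa> where "\<kappa> = \<psi>0 / of_real \<omega>0"
  define \<Phi> where "\<Phi> u = \<phi> u * ((u $ j) ^ k * cnj (u $ j) ^ l) - \<kappa> * ((u $ j) ^ l * cnj (u $ j) ^ l)" for u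
  have \<Phi>c: "continuous_on (closure \<Omega>) \<Phi>" unfolding \<Phi>_def by (intro continuous_intros cont)
  have \<phi>c: "continuous_on (cball 0 s) (\<lambda>b. \<phi> (vec2 i p0 b))"
    by (rule continuous_on_compose2[OF cont]) (auto intro!: continuous_intros simp: slice)
  have zero: "(LINT b|?M. \<Phi> (vec2 i p0 b)) = 0"
  proof -
    have i1: "integrable ?M (\<lambda>b. \<phi> (vec2 i p0 b) * (b ^ k * cnj b ^ l))"
      by (intro int continuous_intros \<phi>c)
    have i2: "integrable ?M (\<lambda>b. \<kappa> * complex_of_real (norm b ^ (2 * l)))"
      by (intro int continuous_intros)
    have nl: "b ^ l * cnj b ^ l = complex_of_real (norm b ^ (2 * l))" for b :: complex
    proof -
      have "b ^ l * cnj b ^ l = (b * cnj b) ^ l" by (simp add: power_mult_distrib)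
      also have "\<dots> = of_real ((norm b)\<^sup>2) ^ l" by (simp only: complex_norm_square)
      finally show ?thesis by (simp add: power_mult)
    qed
    have "(LINT b|?M. \<Phi> (vec2 i p0 b))
        = (LINT b|?M. \<phi> (vec2 i p0 b) * (b ^ k * cnj b ^ l) - \<kappa> * complex_of_real (norm b ^ (2 * l)))"
      by (simp add: \<Phi>_def nl del: of_real_power)
    also have "\<dots> = \<psi>0 - \<kappa> * (LINT b|?M. complex_of_real (norm b ^ (2 * l)))"
      unfolding \<psi>0_def using i1 i2 by (simp del: of_real_power)
    also have "(LINT b|?M. complex_of_real (norm b ^ (2 * l))) = of_real \<omega>0"
      unfolding \<omega>0_def by (rule integral_complex_of_real)
    finally show ?thesis using \<omega>0 by (simp add: \<kappa>_def)
  qed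
  have key: "\<langle>\<lambda>u. \<phi> u * coeff_ker k t u, coeff_ker l t\<rangle> - \<kappa> * of_real (\<parallel>coeff_ker k t\<parallel>\<^sup>2)
      = (LINT u|dM. \<Phi> u * (slice_cf k (coeff_ker k t) (u $ i) * cnj (slice_cf l (coeff_ker l t) (u $ i))))"
    if t: "0 \<le> t" "t < 1" for t
  proof -
    let ?P = "coeff_ker k t" and ?Q = "coeff_ker l t"
    let ?f = "ext0 (\<lambda>u. slice_cf k ?P (u $ i) * (u $ j) ^ l)"
    have PL: "?P \<in> A2" "?Q \<in> A2" by (intro coeff_ker_A2 t)+
    have fA: "?f \<in> A2"
      unfolding ext0_monomial by (intro monomial_mult_A2 slice_cf_ext0_A2 PL)
    have "\<langle>?f, ?Q\<rangle> = slice_cf l ?f (of_real t * p0)" by (rule coeff_ker_inner[OF t fA])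
    also have "\<dots> = of_real (\<parallel>?P\<parallel>\<^sup>2)"
      by (simp add: slice_cf_of_monomial[OF tp0[OF t]] coeff_ker_self[OF t] del: of_real_power)
    finally have e1: "\<kappa> * of_real (\<parallel>?P\<parallel>\<^sup>2) = \<langle>\<lambda>u. \<kappa> * ?f u, ?Q\<rangle>" by (simp only: inner_scale_left)
    have i1: "integrable dM (\<lambda>u. (\<phi> u * ?P u) * cnj (?Q u))"
      by (intro L2_prod_integrable symbol_mult_L2 A2D(1) PL)
    have i2: "integrable dM (\<lambda>u. (\<kappa> * ?f u) * cnj (?Q u))"
      by (intro L2_prod_integrable L2_scale A2D(1) PL fA)
    have "\<langle>\<lambda>u. \<phi> u * ?P u, ?Q\<rangle> - \<kappa> * of_real (\<parallel>?P\<parallel>\<^sup>2)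
        = (LINT u|dM. (\<phi> u * ?P u) * cnj (?Q u) - (\<kappa> * ?f u) * cnj (?Q u))"
      unfolding e1 L2_inner_eq by (rule Bochner_Integration.integral_diff[OF i1 i2, symmetric])
    also have "\<dots> = (LINT u|dM. \<Phi> u * (slice_cf k ?P (u $ i) * cnj (slice_cf l ?Q (u $ i))))"
    proof (rule Bochner_Integration.integral_cong[OF refl])
      fix u assume "u \<in> space dM"
      hence u: "u \<in> \<Omega>" by simp
      show "(\<phi> u * ?P u) * cnj (?Q u) - (\<kappa> * ?f u) * cnj (?Q u)
          = \<Phi> u * (slice_cf k ?P (u $ i) * cnj (slice_cf l ?Q (u $ i)))"
        unfolding coeff_ker_monomial[OF t u, of k] coeff_ker_monomial[OF t u, of l] ext0_in[OF u] \<Phi>_def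
        by (simp add: algebra_simps)
    qed
    finally show ?thesis .
  qed
  define A where "A n = \<langle>\<lambda>u. \<phi> u * coeff_ker k (\<tau> n) u, coeff_ker l (\<tau> n)\<rangle> / of_real ((base_norm (\<tau> n))\<^sup>2)" for n
  have A: "A \<longlonglongrightarrow> 0" unfolding A_def by (rule toeplitz_coefficients_null[OF bz])
  have "norm \<kappa> \<le> 0"
  proof (rule field_le_epsilon)
    fix e :: real assume e: "e > 0"
    define K where "K = S ^ (2 * k) * pair_const k l + 1"
    have M0: "pair_const k l \<ge> 0" using area_const_pos[of k] area_const_pos[of l] by (simp add: pair_const_def)
    have K: "K > 0" using M0 S_pos by (simp add: K_def add_nonneg_pos)
    define \<epsilon> where "\<epsilon> = e / K"
    have \<epsilon>: "\<epsilon> > 0" using e K by (simp add: \<epsilon>_def)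
    obtain C where C: "C \<ge> 0" "\<And>t. 0 \<le> t \<Longrightarrow> t < 1 \<Longrightarrow>
       norm (LINT u|dM. \<Phi> u * (slice_cf k (coeff_ker k t) (u $ i) * cnj (slice_cf l (coeff_ker l t) (u $ i))))
       \<le> pair_const k l * ((\<epsilon> + C * (1 - t)) * (base_norm t)\<^sup>2)"
      using face_form_estimate[OF \<Phi>c zero \<epsilon>, of k l] by blast
    have le: "norm \<kappa> \<le> S ^ (2 * k) * (norm (A n) + pair_const k l * (\<epsilon> + C * (1 - \<tau> n)))" for n
    proof -
      note t = \<tau>(1,2)[of n]
      let ?n = "base_norm (\<tau> n)" and ?P = "\<parallel>coeff_ker k (\<tau> n)\<parallel>"
      have n: "?n > 0" by (rule base_norm_pos[OF t])
      let ?I = "LINT u|dM. \<Phi> u * (slice_cf k (coeff_ker k (\<tau> n)) (u $ i) * cnj (slice_cf l (coeff_ker l (\<tau> n)) (u $ i)))"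
      have Aeq: "\<langle>\<lambda>u. \<phi> u * coeff_ker k (\<tau> n) u, coeff_ker l (\<tau> n)\<rangle> = A n * of_real (?n\<^sup>2)"
        using n by (simp add: A_def)
      have "\<kappa> * of_real (?P\<^sup>2) = A n * of_real (?n\<^sup>2) - ?I"
        using key[OF t] unfolding Aeq by (simp add: algebra_simps del: of_real_power)
      hence "norm (\<kappa> * of_real (?P\<^sup>2)) = norm (A n * of_real (?n\<^sup>2) - ?I)" by simp
      also have "\<dots> \<le> norm (A n * of_real (?n\<^sup>2)) + norm ?I" by (rule norm_triangle_ineq4)
      finally have "norm \<kappa> * ?P\<^sup>2 \<le> norm (A n) * ?n\<^sup>2 + norm ?I"
        unfolding norm_mult norm_of_real by simp
      also have "\<dots> \<le> norm (A n) * ?n\<^sup>2 + pair_const k l * ((\<epsilon> + C * (1 - \<tau> n)) * ?n\<^sup>2)"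
        using C(2)[OF t] by simp
      also have "\<dots> = (norm (A n) + pair_const k l * (\<epsilon> + C * (1 - \<tau> n))) * ?n\<^sup>2" by (simp add: algebra_simps)
      finally have 1: "norm \<kappa> * ?P\<^sup>2 \<le> (norm (A n) + pair_const k l * (\<epsilon> + C * (1 - \<tau> n))) * ?n\<^sup>2" .
      have "?n\<^sup>2 \<le> (S ^ k * ?P)\<^sup>2" using base_norm_le_coeff_ker[OF t, of k] n by (intro power_mono) auto
      hence 2: "?n\<^sup>2 \<le> S ^ (2 * k) * ?P\<^sup>2" by (simp add: power_mult_distrib power_mult[symmetric] mult.commute)
      have "norm \<kappa> * ?n\<^sup>2 \<le> norm \<kappa> * (S ^ (2 * k) * ?P\<^sup>2)" by (rule mult_left_mono[OF 2]) simp
      also have "\<dots> = S ^ (2 * k) * (norm \<kappa> * ?P\<^sup>2)" by simp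
      also have "\<dots> \<le> S ^ (2 * k) * ((norm (A n) + pair_const k l * (\<epsilon> + C * (1 - \<tau> n))) * ?n\<^sup>2)"
        by (rule mult_left_mono[OF 1]) (use S_pos in simp)
      finally have "norm \<kappa> * ?n\<^sup>2 \<le> (S ^ (2 * k) * (norm (A n) + pair_const k l * (\<epsilon> + C * (1 - \<tau> n)))) * ?n\<^sup>2"
        by (simp only: mult.assoc)
      thus ?thesis using n by (simp only: mult_le_cancel_right_pos zero_less_power)
    qed
    have "(\<lambda>n. S ^ (2 * k) * (norm (A n) + pair_const k l * (\<epsilon> + C * (1 - \<tau> n))))
        \<longlonglongrightarrow> S ^ (2 * k) * (norm (0 :: complex) + pair_const k l * (\<epsilon> + C * (1 - 1)))"
      by (intro tendsto_intros A \<tau>)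
    hence "norm \<kappa> \<le> S ^ (2 * k) * (norm (0 :: complex) + pair_const k l * (\<epsilon> + C * (1 - 1)))"
      by (rule LIMSEQ_le_const) (use le in auto)
    also have "\<dots> = S ^ (2 * k) * pair_const k l * \<epsilon>" by simp
    also have "\<dots> \<le> K * \<epsilon>" using \<epsilon> by (intro mult_right_mono) (auto simp: K_def)
    also have "\<dots> = e" using K by (simp add: \<epsilon>_def)
    finally show "norm \<kappa> \<le> 0 + e" by simp
  qed
  hence "\<psi>0 = 0" using \<omega>0 by (simp add: \<kappa>_def)
  thus "(LINT b|?M. \<phi> (vec2 i p0 b) * (b ^ k * cnj b ^ l)) = 0" by (simp only: \<psi>0_def)
qed

end

section \<open>Boundary values of the symbol\<close>

context reinhardt_symbol
begin

text \<open>
  The points of the closure over \<open>p\<^sub>i\<close> form a disc of some radius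
  \<open>s\<close>. For \<open>s = 0\<close> the function \<open>1 - u\<^sub>i /
  p\<^sub>i\<close> peaks at \<open>p\<close>; for \<open>s > 0\<close> the face is a genuine
  disc and \<open>p\<close> is a limit of points of the open disc.
\<close>

lemma symbol_zero_of_flat_support:
  assumes bz: "(berezin \<Omega> T \<longlongrightarrow> 0) (to_boundary \<Omega>)" and p: "p \<in> frontier \<Omega>" and ij: "i \<noteq> j"
    and pi: "p $ i \<noteq> 0" and flat: "\<And>y. y \<in> closure \<Omega> \<Longrightarrow> norm (y $ i) \<le> norm (p $ i)"
  shows "\<phi> p = 0"
proof -
  have pc: "p \<in> closure \<Omega>" using p by (simp add: frontier_def)
  have eta: "vec2 i (p $ i) (p $ j) = p" by (rule vec2_eta[OF ij])
  obtain R where R: "R > 0" "\<And>z. z \<in> closure \<Omega> \<Longrightarrow> norm z \<le> R"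
    by (rule dom_norm_bound, rule that)
  have Rj: "norm (y $ j) \<le> R" if "y \<in> closure \<Omega>" for y
    using Finite_Cartesian_Product.norm_nth_le[of y j] R(2)[OF that] by linarith
  define D where "D = {b. vec2 i (p $ i) b \<in> closure \<Omega>}"
  have "closed D"
  proof -
    have "closed ((\<lambda>b. vec2 i (p $ i) b) -` closure \<Omega>)"
      by (rule closed_vimage[OF closed_closure]) (intro continuous_intros)
    thus ?thesis by (simp add: D_def vimage_def)
  qed
  moreover have "bounded D"
    unfolding bounded_iff D_def using Rj ij by (intro exI[of _ R]) (fastforce simp: vec2_nth')
  ultimately have "compact D" by (simp add: compact_eq_bounded_closed)
  moreover have pj: "p $ j \<in> D" using pc by (simp add: D_def eta)
  ultimately obtain b0 where b0: "b0 \<in> D" "\<And>b. b \<in> D \<Longrightarrow> norm b \<le> norm b0"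
    using continuous_attains_sup[of D norm] by (auto intro: continuous_intros)
  define s where "s = norm b0"
  have slice: "vec2 i (p $ i) b \<in> closure \<Omega> \<longleftrightarrow> norm b \<le> s" for b
  proof
    assume "vec2 i (p $ i) b \<in> closure \<Omega>"
    thus "norm b \<le> s" using b0(2)[of b] by (simp add: D_def s_def)
  next
    assume b: "norm b \<le> s"
    have v: "vec2 i (p $ i) b0 \<in> closure \<Omega>" using b0(1) by (simp add: D_def)
    show "vec2 i (p $ i) b \<in> closure \<Omega>"
    proof (cases "b0 = 0")
      case True
      thus ?thesis using b v by (simp add: s_def)
    next
      case False
      hence "norm (b / b0) \<le> 1" using b by (simp add: s_def norm_divide)
      from closure_shrink[OF ij v this] show ?thesis using False ij by (simp add: vec2_nth')
    qed
  qed
  show ?thesis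
  proof (cases "s = 0")
    case True
    show ?thesis
    proof (rule symbol_zero_of_peak[OF bz p, of "\<lambda>u. 1 - u $ i * (1 / p $ i)"])
      show "holo_on (\<lambda>u. 1 - u $ i * (1 / p $ i)) \<Omega>"
        by (intro holo_on_diff holo_on_mult holo_on_const holo_on_coord)
      show "continuous_on UNIV (\<lambda>u. 1 - u $ i * (1 / p $ i))"
        by (intro continuous_intros)
      show "1 - p $ i * (1 / p $ i) = 0" using pi by simp
      fix w assume w: "w \<in> closure \<Omega>" "w \<noteq> p"
      define c where "c = w $ i / p $ i"
      have nc: "norm c \<le> 1" using flat[OF w(1)] pi by (simp add: c_def norm_divide)
      have "c \<noteq> 1"
      proof
        assume "c = 1"
        hence wi: "w $ i = p $ i" using pi by (simp add: c_def)
        have "vec2 i (p $ i) (w $ j) \<in> closure \<Omega>" using w(1) vec2_eta[OF ij, of w] wi by simp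
        hence "w $ j = 0" using slice True by simp
        moreover have "p $ j = 0" using pj slice True by (simp add: D_def)
        ultimately have "w = p" using wi by (intro vec2_eqI[OF ij]) auto
        with w(2) show False ..
      qed
      have "Re c < 1"
      proof (rule ccontr)
        assume "\<not> Re c < 1"
        hence "Re c = 1" using complex_Re_le_cmod[of c] nc by linarith
        hence "(Im c)\<^sup>2 \<le> 0" using cmod_power2[of c] power_le_one[OF norm_ge_zero nc, of 2] by simp
        hence "Im c = 0" by simp
        with \<open>Re c = 1\<close> \<open>c \<noteq> 1\<close> show False by (simp add: complex_eq_iff)
      qed
      thus "Re (1 - w $ i * (1 / p $ i)) > 0" by (simp add: c_def)
    qed
  next
    case False
    interpret disc_face \<Omega> \<phi> i j "p $ i" s R
      by unfold_locales (use False ij pi flat slice Rj in \<open>auto simp: s_def\<close>)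
    have jn: "norm (p $ j) \<le> s" using pj slice by (simp add: D_def)
    define x where "x n = vec2 i (p $ i) (of_real (\<tau> n) * p $ j)" for n
    have lt: "norm (of_real (\<tau> n) * p $ j) < s" for n
    proof -
      have "\<tau> n * norm (p $ j) \<le> \<tau> n * s" using jn \<tau>(1)[of n] by (rule mult_left_mono)
      also have "\<dots> < s" using \<tau>(2)[of n] s by simp
      finally show ?thesis using \<tau>(1)[of n] by (simp add: norm_mult)
    qed
    have "x \<longlonglongrightarrow> vec2 i (p $ i) (of_real 1 * p $ j)"
      unfolding x_def by (intro tendsto_intros \<tau>)
    hence xl: "x \<longlonglongrightarrow> p" by (simp add: eta)
    have "(\<lambda>n. \<phi> (x n)) \<longlonglongrightarrow> \<phi> p"
    proof (rule continuous_on_tendsto_compose[OF cont xl pc])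
      show "\<forall>\<^sub>F n in sequentially. x n \<in> closure \<Omega>"
        unfolding x_def using lt by (intro always_eventually allI) (simp add: slice less_imp_le)
    qed
    moreover have "\<phi> (x n) = 0" for n
      unfolding x_def by (rule symbol_zero_on_open_face[OF bz lt])
    ultimately show ?thesis using LIMSEQ_unique[of "\<lambda>n. 0" "\<phi> p" 0] by simp
  qed
qed

theorem symbol_zero_on_boundary:
  assumes bz: "(berezin \<Omega> T \<longlongrightarrow> 0) (to_boundary \<Omega>)" and p: "p \<in> frontier \<Omega>"
  shows "\<phi> p = 0"
proof -
  have ij: "(1 :: 2) \<noteq> 2" by simp
  obtain \<alpha> :: "complex ^ 2" and c :: real where sf: "c > 0" "\<alpha> \<noteq> 0"
    "\<And>y. y \<in> closure \<Omega> \<Longrightarrow> norm (\<alpha> $ 1 * y $ 1) + norm (\<alpha> $ 2 * y $ 2) \<le> c"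
    "\<And>y. y \<in> \<Omega> \<Longrightarrow> Re (\<alpha> $ 1 * y $ 1 + \<alpha> $ 2 * y $ 2) < c"
    "\<alpha> $ 1 * p $ 1 = of_real (norm (\<alpha> $ 1 * p $ 1))"
    "\<alpha> $ 2 * p $ 2 = of_real (norm (\<alpha> $ 2 * p $ 2))"
    "\<alpha> $ 1 * p $ 1 + \<alpha> $ 2 * p $ 2 = of_real c"
    by (rule supporting_functional[OF p ij], rule that)
  have flat: "\<phi> p = 0"
    if kl: "k \<noteq> l" and a: "\<alpha> $ l = 0"
      and sup: "\<And>y. y \<in> closure \<Omega> \<Longrightarrow> norm (\<alpha> $ k * y $ k) + norm (\<alpha> $ l * y $ l) \<le> c"
      and eq: "\<alpha> $ k * p $ k + \<alpha> $ l * p $ l = of_real c" for k l :: 2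
  proof (rule symbol_zero_of_flat_support[OF bz p kl])
    have e: "\<alpha> $ k * p $ k = of_real c" using eq a by simp
    hence nz: "\<alpha> $ k \<noteq> 0" "p $ k \<noteq> 0" using sf(1) by auto
    show "p $ k \<noteq> 0" by (rule nz)
    fix y assume "y \<in> closure \<Omega>"
    from sup[OF this] a have "norm (\<alpha> $ k) * norm (y $ k) \<le> c" by (simp add: norm_mult)
    moreover have "norm (\<alpha> $ k) * norm (p $ k) = c"
      unfolding norm_mult[symmetric] e using sf(1) by simp
    ultimately have "norm (\<alpha> $ k) * norm (y $ k) \<le> norm (\<alpha> $ k) * norm (p $ k)" by simp
    thus "norm (y $ k) \<le> norm (p $ k)" using nz by (simp add: mult_le_cancel_left)
  qed
  show ?thesis
  proof (cases "\<alpha> $ 1 = 0 \<or> \<alpha> $ 2 = 0")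
    case False
    show ?thesis
      by (rule symbol_zero_of_generic_support[OF bz p ij sf(1) _ _ sf(3) sf(5) sf(7)]) (use False in auto)
  next
    case True
    thus ?thesis
    proof
      assume "\<alpha> $ 2 = 0"
      thus ?thesis by (rule flat[OF ij _ sf(3) sf(7)])
    next
      assume "\<alpha> $ 1 = 0"
      thus ?thesis
        by (rule flat[OF ij[symmetric]]) (use sf(3,7) in \<open>auto simp: add.commute\<close>)
    qed
  qed
qed

end

theorem corollary1p1:
  fixes \<Omega> :: "(complex ^ 2) set" and \<phi> :: "complex ^ 2 \<Rightarrow> complex"
  assumes "reinhardt_domain \<Omega>" and "bounded \<Omega>" and "convex \<Omega>"
    and "continuous_on (closure \<Omega>) \<phi>"
  shows "(\<forall>z\<in>\<Omega>. berezin \<Omega> (bergman_adjoint \<Omega> (toeplitz \<Omega> \<phi>) \<circ> toeplitz \<Omega> \<phi>) z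
            = of_real ((L2_norm \<Omega> (toeplitz \<Omega> \<phi> (normalized_kernel \<Omega> z)))\<^sup>2)) \<and>
         (compact_operator \<Omega> (toeplitz \<Omega> \<phi>) \<longleftrightarrow>
          compact_operator \<Omega> (bergman_adjoint \<Omega> (toeplitz \<Omega> \<phi>) \<circ> toeplitz \<Omega> \<phi>)) \<and>
         (compact_operator \<Omega> (toeplitz \<Omega> \<phi>) \<longleftrightarrow>
          (berezin \<Omega> (bergman_adjoint \<Omega> (toeplitz \<Omega> \<phi>) \<circ> toeplitz \<Omega> \<phi>) \<longlongrightarrow> 0) (to_boundary \<Omega>)) \<and>
         (compact_operator \<Omega> (toeplitz \<Omega> \<phi>) \<longleftrightarrow>
          (berezin \<Omega> (toeplitz \<Omega> \<phi>) \<longlongrightarrow> 0) (to_boundary \<Omega>)) \<and>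
         (compact_operator \<Omega> (toeplitz \<Omega> \<phi>) \<longleftrightarrow> (\<forall>z\<in>frontier \<Omega>. \<phi> z = 0))"
proof -
  interpret reinhardt_symbol \<Omega> \<phi>
    using assms by unfold_locales (auto simp: reinhardt_domain_def)
  have "compact_operator \<Omega> T \<longleftrightarrow> compact_operator \<Omega> (Ts \<circ> T)"
    using compact_imp_compact_TsT compact_TsT_imp_compact by blast
  moreover have "compact_operator \<Omega> T \<Longrightarrow> (berezin \<Omega> (Ts \<circ> T) \<longlongrightarrow> 0) (to_boundary \<Omega>)"
    by (rule compact_imp_berezin_TsT)
  moreover have "(berezin \<Omega> (Ts \<circ> T) \<longlongrightarrow> 0) (to_boundary \<Omega>) \<Longrightarrow> (berezin \<Omega> T \<longlongrightarrow> 0) (to_boundary \<Omega>)"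
    by (rule berezin_TsT_imp_berezin)
  moreover have "(berezin \<Omega> T \<longlongrightarrow> 0) (to_boundary \<Omega>) \<Longrightarrow> \<forall>z\<in>frontier \<Omega>. \<phi> z = 0"
    using symbol_zero_on_boundary by blast
  moreover have "\<forall>z\<in>frontier \<Omega>. \<phi> z = 0 \<Longrightarrow> compact_operator \<Omega> T"
    by (rule compact_of_vanishing_boundary) blast
  ultimately show ?thesis
    using berezin_TsT by blast
qed

end
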